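(* Let $d\geq 2$, let $f(z)=g(z)=z^d+A_1(t)z^{d-1}+\ldots+A_d(t)\in\overline{\mathbb{Q}}[t][z]$, and let $a,b\in\overline{\mathbb{Q}}$. Assume the following: (A) $d$ is a prime power. (B) There is a prime $p$ and an embedding $\overline{\mathbb{Q}}\to\mathbb{C}_p$ satisfying the following conditions, where $\overline{\mathbb{Z}}_p$ denotes the set of elements of $\overline{\mathbb{Q}}_p$ that are integral over $\mathbb{Z}_p$: (i) for every $i\in\{1,\ldots,d\}$, $A_i(t)\in\overline{\mathbb{Z}}_p[t]$ and $\deg(A_i)<i$; (ii) $a\in\overline{\mathbb{Z}}_p$ while $b\notin\overline{\mathbb{Z}}_p$; (iii) for some $m\in\mathbb{N}$, the polynomial $f^m(a)\in\overline{\mathbb{Z}}_p[t]$ is non-constant and its leading coefficient is a unit of $\overline{\mathbb{Z}}_p$. Let $S=\{t_0\in\overline{\mathbb{Q}} : f_{t_0}^m(a)=g_{t_0}^n(b)\ \text{for some integers } m,n\geq 0\}$. Then at least one of the following statements holds: (1) either $(f,a)$ or $(g,b)$ is isotrivial; (2) there exist integers $m,n\geq 0$ such that $f^m(a)=g^n(b)$ in $\overline{\mathbb{Q}}[t]$; (3) $S$ has bounded height.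
   Context: $\mathbb{N}$ is the set of positive integers. Let $\mathcal{F}=\overline{\mathbb{Q}}(t)$. $f^m$ is the $m$-th iterate of $f$ as a polynomial in $z$ over $\overline{\mathbb{Q}}[t]$ ($f^0=\mathrm{id}$), so $f^m(a)\in\overline{\mathbb{Q}}[t]$; $f_{t_0}\in\overline{\mathbb{Q}}[z]$ is the specialization of $f$ at $t=t_0$. $\mathbb{C}_p$ is the completion of an algebraic closure $\overline{\mathbb{Q}}_p$ of $\mathbb{Q}_p$, and elements of $\overline{\mathbb{Q}}$ are viewed in $\overline{\mathbb{Q}}_p\subset\mathbb{C}_p$ via the embedding. A pair $(f,c)$ with $f(z)\in\mathcal{F}(z)$ and $c\in\mathbb{P}^1(\mathcal{F})$ is isotrivial if there is a fractional linear transformation $\mu\in\overline{\mathcal{F}}(z)$ such that $\mu\circ f\circ\mu^{-1}\in\overline{\mathbb{Q}}(z)$ and $\mu(c)\in\mathbb{P}^1(\overline{\mathbb{Q}})$. A subset of $\overline{\mathbb{Q}}$ has bounded height if the absolute logarithmic Weil height $h$ is bounded on it. *)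

theory Defs
  imports
    "HOL-Algebra.Algebraic_Closure_Type"
    "HOL-Analysis.Infinite_Sum"
    "HOL-Number_Theory.Prime_Powers"
begin

type_synonym qbar = "rat alg_closure"

text \<open>The field \<open>\<F>\<close> of rational functions in \<open>t\<close>, and its algebraic closure.\<close>

type_synonym ratfun_t = "qbar poly fract"
type_synonym ratfun_t_bar = "ratfun_t alg_closure"

fun poly_iterate :: "'a::comm_ring_1 poly \<Rightarrow> nat \<Rightarrow> 'a poly" where
  "poly_iterate f 0 = [:0, 1:]"
| "poly_iterate f (Suc n) = pcompose f (poly_iterate f n)"

text \<open>An element of \<open>K[t][z]\<close> has type \<open>K poly poly\<close>: the outer variable is \<open>z\<close>, the inner
  one \<open>t\<close>. For \<open>a \<in> K\<close> the value \<open>f\<^sup>m(a) \<in> K[t]\<close> is taken at the constant polynomial \<open>a\<close>.\<close>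

definition iterate_at :: "'a::comm_ring_1 poly poly \<Rightarrow> nat \<Rightarrow> 'a \<Rightarrow> 'a poly" where
  "iterate_at f m a = poly (poly_iterate f m) [:a:]"

definition specialize :: "'a::comm_ring_1 poly poly \<Rightarrow> 'a \<Rightarrow> 'a poly" where
  "specialize f t\<^sub>0 = map_poly (\<lambda>q. poly q t\<^sub>0) f"

text \<open>For a field \<open>K\<close>, the elements of \<open>K(z)\<close> have type \<open>K poly fract\<close>.\<close>

definition poly_at_ratfun :: "'a::field poly \<Rightarrow> 'a poly fract \<Rightarrow> 'a poly fract" where
  "poly_at_ratfun q s = poly (map_poly (\<lambda>c. to_fract [:c:]) q) s"

text \<open>Reduced fractions are unique up to a common constant factor, which cancels wherever this
  choice is used.\<close>

definition num_denom :: "'a::field poly fract \<Rightarrow> 'a poly \<times> 'a poly" where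
  "num_denom r = (SOME (p, q). q \<noteq> 0 \<and> coprime p q \<and> r = to_fract p / to_fract q)"

text \<open>If \<open>s\<close> is a constant at which \<open>r\<close> has a pole, the composition \<open>r \<circ> s\<close> is not an element of
  \<open>K(z)\<close> and the value below is meaningless. This does not occur for nonconstant \<open>s\<close>.\<close>

definition ratfun_comp :: "'a::field poly fract \<Rightarrow> 'a poly fract \<Rightarrow> 'a poly fract" where
  "ratfun_comp r s =
     poly_at_ratfun (fst (num_denom r)) s / poly_at_ratfun (snd (num_denom r)) s"

definition map_ratfun ::
    "('a::field \<Rightarrow> 'b::field) \<Rightarrow> 'a poly fract \<Rightarrow> 'b poly fract" where
  "map_ratfun h r =
     to_fract (map_poly h (fst (num_denom r))) / to_fract (map_poly h (snd (num_denom r)))"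

datatype 'a proj_line = Affine 'a | Infinity

text \<open>The fractional linear transformation \<open>(\<alpha>z + \<beta>) / (\<gamma>z + \<delta>)\<close>, as an element of \<open>K(z)\<close> and as a
  map of the projective line. If \<open>\<alpha>\<delta> - \<beta>\<gamma> \<noteq> 0\<close>, its inverse has coefficients \<open>\<delta>, -\<beta>, -\<gamma>, \<alpha>\<close>.\<close>

definition moebius :: "'a::field \<Rightarrow> 'a \<Rightarrow> 'a \<Rightarrow> 'a \<Rightarrow> 'a poly fract" where
  "moebius \<alpha> \<beta> \<gamma> \<delta> = to_fract [:\<beta>, \<alpha>:] / to_fract [:\<delta>, \<gamma>:]"

fun moebius_point :: "'a::field \<Rightarrow> 'a \<Rightarrow> 'a \<Rightarrow> 'a \<Rightarrow> 'a proj_line \<Rightarrow> 'a proj_line" where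
  "moebius_point \<alpha> \<beta> \<gamma> \<delta> (Affine x) =
     (if \<gamma> * x + \<delta> = 0 then Infinity else Affine ((\<alpha> * x + \<beta>) / (\<gamma> * x + \<delta>)))"
| "moebius_point \<alpha> \<beta> \<gamma> \<delta> Infinity = (if \<gamma> = 0 then Infinity else Affine (\<alpha> / \<gamma>))"

definition const_t :: "qbar \<Rightarrow> ratfun_t" where
  "const_t x = to_fract [:x:]"

definition isotrivial :: "ratfun_t poly fract \<Rightarrow> ratfun_t proj_line \<Rightarrow> bool" where
  "isotrivial f c \<longleftrightarrow>
     (\<exists>\<alpha> \<beta> \<gamma> \<delta> :: ratfun_t_bar. \<alpha> * \<delta> - \<beta> * \<gamma> \<noteq> 0 \<and>
        ratfun_comp (ratfun_comp (moebius \<alpha> \<beta> \<gamma> \<delta>) (map_ratfun to_ac f)) (moebius \<delta> (-\<beta>) (-\<gamma>) \<alpha>)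
          \<in> range (map_ratfun (to_ac \<circ> const_t)) \<and>
        moebius_point \<alpha> \<beta> \<gamma> \<delta> (map_proj_line to_ac c)
          \<in> range (map_proj_line (to_ac \<circ> const_t)))"

definition ratfun_of_poly :: "qbar poly poly \<Rightarrow> ratfun_t poly fract" where
  "ratfun_of_poly f = to_fract (map_poly to_fract f)"

definition is_subfield :: "'a::field set \<Rightarrow> bool" where
  "is_subfield K \<longleftrightarrow> 0 \<in> K \<and> 1 \<in> K \<and>
     (\<forall>x\<in>K. \<forall>y\<in>K. x - y \<in> K \<and> x * y \<in> K) \<and> (\<forall>x\<in>K. inverse x \<in> K)"

definition field_embedding_on :: "'a::field set \<Rightarrow> ('a \<Rightarrow> 'b::field) \<Rightarrow> bool" where
  "field_embedding_on K \<sigma> \<longleftrightarrow> \<sigma> 1 = 1 \<and>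
     (\<forall>x\<in>K. \<forall>y\<in>K. \<sigma> (x + y) = \<sigma> x + \<sigma> y \<and> \<sigma> (x * y) = \<sigma> x * \<sigma> y)"

definition nonarch_abs_on :: "'a::field set \<Rightarrow> ('a \<Rightarrow> real) \<Rightarrow> bool" where
  "nonarch_abs_on K v \<longleftrightarrow>
     (\<forall>x\<in>K. 0 \<le> v x \<and> (v x = 0 \<longleftrightarrow> x = 0)) \<and>
     (\<forall>x\<in>K. \<forall>y\<in>K. v (x * y) = v x * v y \<and> v (x + y) \<le> max (v x) (v y))"

definition field_gen :: "qbar \<Rightarrow> qbar set" where
  "field_gen x = \<Inter>{K. is_subfield K \<and> x \<in> K}"

definition field_degree :: "qbar set \<Rightarrow> nat" where
  "field_degree K = vector_space.dim (\<lambda>(r::rat) x. of_rat r * x) K"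

definition residue_card :: "'a::field set \<Rightarrow> ('a \<Rightarrow> real) \<Rightarrow> nat" where
  "residue_card K v =
     card ({x \<in> K. v x \<le> 1} // {(x, y). x \<in> K \<and> y \<in> K \<and> v x \<le> 1 \<and> v y \<le> 1 \<and> v (x - y) < 1})"

text \<open>Each finite place of a number field \<open>K\<close> contains exactly one absolute value that maps a
  uniformizer to \<open>1/N\<close>, where \<open>N\<close> is the size of the residue field; it equals
  \<open>\<bar>\<cdot>\<bar>\<^sub>v\<close> to the power \<open>[K\<^sub>v:\<rat>\<^sub>v]\<close> for the absolute value \<open>\<bar>\<cdot>\<bar>\<^sub>v\<close> of that place that extends a
  standard one on \<open>\<rat>\<close>. The value \<open>0\<close> outside \<open>K\<close> makes the representing function unique. The
  trivial absolute value is excluded: its residue field is \<open>K\<close>, which is infinite.\<close>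

definition finite_places :: "qbar set \<Rightarrow> (qbar \<Rightarrow> real) set" where
  "finite_places K = {v. nonarch_abs_on K v \<and> (\<forall>x. x \<notin> K \<longrightarrow> v x = 0) \<and> residue_card K v > 1 \<and>
     v ` (K - {0}) = range (\<lambda>k::int. real (residue_card K v) powi k)}"

text \<open>A real place corresponds to one of these embeddings, a complex place to two.\<close>

definition complex_embeddings :: "qbar set \<Rightarrow> (qbar \<Rightarrow> complex) set" where
  "complex_embeddings K = {\<sigma>. field_embedding_on K \<sigma> \<and> (\<forall>x. x \<notin> K \<longrightarrow> \<sigma> x = 0)}"

text \<open>Both sums below have only finitely many nonzero terms.\<close>

definition weil_height :: "qbar \<Rightarrow> real" where
  "weil_height x =
     (let K = field_gen x in
       ((\<Sum>\<^sub>\<infinity>v\<in>finite_places K. ln (max 1 (v x))) +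
        (\<Sum>\<sigma>\<in>complex_embeddings K. ln (max 1 (norm (\<sigma> x))))) / real (field_degree K))"

definition bounded_height :: "qbar set \<Rightarrow> bool" where
  "bounded_height S \<longleftrightarrow> (\<exists>B. \<forall>x\<in>S. weil_height x \<le> B)"

definition coeffs_in :: "'a::zero set \<Rightarrow> 'a poly \<Rightarrow> bool" where
  "coeffs_in R q \<longleftrightarrow> (\<forall>i. coeff q i \<in> R)"

text \<open>Let \<open>v\<close> be an absolute value on a field \<open>C\<close> of characteristic 0 that is complete for it,
  and let \<open>v\<close> restrict to the \<open>p\<close>-adic absolute value on \<open>\<rat>\<close>. Then \<open>\<rat>\<^sub>p\<close> is the topological
  closure of \<open>\<rat>\<close> in \<open>C\<close>.\<close>

definition Qp :: "('c::field_char_0 \<Rightarrow> real) \<Rightarrow> 'c set" where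
  "Qp v = {x. \<forall>e>0. \<exists>r::rat. v (x - of_rat r) < e}"

definition Zp :: "('c::field_char_0 \<Rightarrow> real) \<Rightarrow> 'c set" where
  "Zp v = {x \<in> Qp v. v x \<le> 1}"

definition Qp_bar :: "('c::field_char_0 \<Rightarrow> real) \<Rightarrow> 'c set" where
  "Qp_bar v = {x. \<exists>q. q \<noteq> 0 \<and> coeffs_in (Qp v) q \<and> poly q x = 0}"

definition Zp_bar :: "('c::field_char_0 \<Rightarrow> real) \<Rightarrow> 'c set" where
  "Zp_bar v = {x \<in> Qp_bar v. \<exists>q. lead_coeff q = 1 \<and> coeffs_in (Zp v) q \<and> poly q x = 0}"

definition complete_wrt :: "('c::field \<Rightarrow> real) \<Rightarrow> bool" where
  "complete_wrt v \<longleftrightarrow>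
     (\<forall>s. (\<forall>e>0. \<exists>N::nat. \<forall>m\<ge>N. \<forall>n\<ge>N. v (s m - s n) < e) \<longrightarrow>
        (\<exists>x. \<forall>e>0. \<exists>N. \<forall>n\<ge>N. v (s n - x) < e))"

text \<open>For a prime \<open>p\<close>: the field \<open>'c\<close> with the absolute value \<open>v\<close> is a completion of an
  algebraic closure of \<open>\<rat>\<^sub>p\<close>. This determines it up to isometric isomorphism. A non-archimedean
  absolute value on \<open>\<rat>\<close> is the \<open>p\<close>-adic one as soon as its value at \<open>p\<close> is \<open>1/p\<close>.\<close>

definition is_Cp :: "nat \<Rightarrow> ('c::field_char_0 \<Rightarrow> real) \<Rightarrow> bool" where
  "is_Cp p v \<longleftrightarrow> nonarch_abs_on UNIV v \<and> v (of_nat p) = 1 / real p \<and>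
     complete_wrt v \<and>
     (\<forall>q. coeffs_in (Qp_bar v) q \<and> degree q > 0 \<longrightarrow> (\<exists>x\<in>Qp_bar v. poly q x = 0)) \<and>
     (\<forall>x. \<forall>e>0. \<exists>y\<in>Qp_bar v. v (x - y) < e)"

end

theory Submission
  imports Defs "HOL-Analysis.L2_Norm" "HOL-Number_Theory.Residues"
begin

text \<open>Let \<open>w\<close> be the absolute value on \<open>\<rat>\<^sup>a\<^sup>l\<^sup>g\<close> that is induced by the embedding, and let \<open>t\<close> be a
  point with \<open>f\<^sup>m(a) = f\<^sup>n(b)\<close> at \<open>t\<close>. The height of \<open>t\<close> is bounded, for one of two reasons.

  If \<open>|m - n|\<close> is large, one of the two iterates has a much larger degree in \<open>t\<close> than the
  other. Its leading term dominates in the equation for \<open>t\<close>, at every place: a fixed multiple of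
  \<open>t\<close> is integral and all complex conjugates of \<open>t\<close> are bounded (\<open>fast_orbit_height\<close>).

  If \<open>|m - n|\<close> is bounded, upper and lower bounds of order \<open>d\<^sup>M\<close> with \<open>M = max m n\<close> are compared.
  The polynomial \<open>f\<^sup>m(a) - f\<^sup>n(b)\<close> is not \<open>0\<close>, since \<open>w a \<le> 1 < w b\<close> separates the two orbits at
  \<open>t = 0\<close>; its degree and the logarithm of its size are \<open>O(d\<^sup>M)\<close>. Therefore the height of \<open>t\<close> times
  the degree of \<open>\<rat>(t)\<close> is \<open>O(d\<^sup>M)\<close> (\<open>orbit_coincidence_height\<close>). So it suffices to show that the
  degree of \<open>\<rat>(t)\<close> is at least a constant times \<open>d\<^sup>M\<close>, if \<open>m\<close> is minimal
  (\<open>meeting_orbits_degree\<close>). This uses \<open>w\<close>. Here \<open>w t > 1\<close>, both orbits escape to infinity, and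
  before they meet they run through points \<open>x\<^sub>k \<noteq> y\<^sub>k\<close> with \<open>w x\<^sub>k = w y\<^sub>k\<close>. The ratios
  \<open>\<rho>\<^sub>k = x\<^sub>k / y\<^sub>k\<close> satisfy \<open>\<rho>\<^sub>k\<^sub>+\<^sub>1 \<approx> \<rho>\<^sub>k\<^sup>d\<close> with a rapidly decreasing error. They end at \<open>1\<close>, but the last
  ratio before that is not close to \<open>1\<close>. If \<open>d\<close> is a power of a prime \<open>q \<noteq> p\<close>, the residue class of
  \<open>\<rho>\<^sub>0\<close> thus has an order divisible by a high power of \<open>q\<close>, and the residue field must be large. If
  \<open>d\<close> is a power of \<open>p\<close>, then \<open>w (\<rho>\<^sub>k - 1)\<close> for a \<open>k\<close> of bounded size is smaller than \<open>1\<close> but so close to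
  \<open>1\<close> that its \<open>d\<^sup>J\<close>-th power exceeds \<open>1/p\<close>, where \<open>M - J\<close> is bounded, and the ramification must be large.

  The height enters through two estimates. The contribution of the finite places to the height of
  a root of an integer polynomial is at most the logarithm of the leading coefficient
  (\<open>prod_finite_places_le_lead_coeff\<close>). Instead of ideals, the proof counts elements that
  are pairwise incongruent modulo a given one: weak approximation provides many, and expansions
  in powers of the modulus show that there cannot be more. The contribution of the complex
  embeddings is bounded by Landau's inequality.\<close>

section \<open>Subfields and non-archimedean absolute values\<close>

lemma subfield_0: "is_subfield K \<Longrightarrow> 0 \<in> K"
  and subfield_1: "is_subfield K \<Longrightarrow> 1 \<in> K"
  and subfield_diff: "is_subfield K \<Longrightarrow> x \<in> K \<Longrightarrow> y \<in> K \<Longrightarrow> x - y \<in> K"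
  and subfield_mult: "is_subfield K \<Longrightarrow> x \<in> K \<Longrightarrow> y \<in> K \<Longrightarrow> x * y \<in> K"
  and subfield_inverse: "is_subfield K \<Longrightarrow> x \<in> K \<Longrightarrow> inverse x \<in> K"
  by (auto simp: is_subfield_def)

lemma subfield_uminus: "is_subfield K \<Longrightarrow> x \<in> K \<Longrightarrow> - x \<in> K"
  using subfield_diff[of K 0 x] subfield_0[of K] by simp

lemma subfield_add: "is_subfield K \<Longrightarrow> x \<in> K \<Longrightarrow> y \<in> K \<Longrightarrow> x + y \<in> K"
  using subfield_diff[of K x "-y"] subfield_uminus[of K y] by simp

lemma subfield_divide: "is_subfield K \<Longrightarrow> x \<in> K \<Longrightarrow> y \<in> K \<Longrightarrow> x / y \<in> K"
  by (simp add: divide_inverse subfield_mult subfield_inverse)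

lemma subfield_power: "is_subfield K \<Longrightarrow> x \<in> K \<Longrightarrow> x ^ n \<in> K"
  by (induction n) (auto simp: subfield_1 subfield_mult)

lemma subfield_sum: "is_subfield K \<Longrightarrow> (\<And>i. i \<in> I \<Longrightarrow> f i \<in> K) \<Longrightarrow> sum f I \<in> K"
  by (induction I rule: infinite_finite_induct) (auto simp: subfield_0 subfield_add)

lemma subfield_of_nat: "is_subfield K \<Longrightarrow> of_nat n \<in> K"
  by (induction n) (auto simp: subfield_0 subfield_1 subfield_add)

lemma subfield_of_int: "is_subfield K \<Longrightarrow> of_int n \<in> K"
  by (cases n) (auto simp: subfield_of_nat subfield_uminus subfield_diff subfield_1)

lemma subfield_of_rat: "is_subfield K \<Longrightarrow> of_rat r \<in> K"
  by (cases r) (auto simp: of_rat_rat subfield_divide subfield_of_int)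

lemma subfield_poly: "is_subfield K \<Longrightarrow> coeffs_in K q \<Longrightarrow> x \<in> K \<Longrightarrow> poly q x \<in> K"
  unfolding poly_altdef coeffs_in_def
  by (intro subfield_sum subfield_mult subfield_power) auto

lemma is_subfield_UNIV [simp]: "is_subfield UNIV"
  by (simp add: is_subfield_def)

lemmas subfield_closed = subfield_0 subfield_1 subfield_diff subfield_mult subfield_inverse
  subfield_uminus subfield_add subfield_divide subfield_power subfield_sum subfield_of_nat
  subfield_of_int

locale nonarch =
  fixes K :: "'a::field set" and v :: "'a \<Rightarrow> real"
  assumes K: "is_subfield K" and v: "nonarch_abs_on K v"
begin

lemma nonneg: "x \<in> K \<Longrightarrow> 0 \<le> v x"
  and eq_0_iff: "x \<in> K \<Longrightarrow> v x = 0 \<longleftrightarrow> x = 0"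
  and mult: "x \<in> K \<Longrightarrow> y \<in> K \<Longrightarrow> v (x * y) = v x * v y"
  and add_le: "x \<in> K \<Longrightarrow> y \<in> K \<Longrightarrow> v (x + y) \<le> max (v x) (v y)"
  using v by (auto simp: nonarch_abs_on_def)

lemma zero: "v 0 = 0"
  using eq_0_iff subfield_0[OF K] by blast

lemma pos: "x \<in> K \<Longrightarrow> x \<noteq> 0 \<Longrightarrow> 0 < v x"
  using nonneg[of x] eq_0_iff[of x] by linarith

lemma one: "v 1 = 1"
  using mult[of 1 1] eq_0_iff[of 1] subfield_1[OF K] by auto

lemma uminus: assumes "x \<in> K" shows "v (- x) = v x"
proof -
  have "v (-1) * v (-1) = 1"
    using mult[of "-1" "-1"] one subfield_uminus[OF K subfield_1[OF K]] by simp
  moreover have "v (-1) \<ge> 0"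
    using nonneg subfield_uminus[OF K subfield_1[OF K]] by blast
  ultimately have "v (-1) = 1"
    by (metis abs_of_nonneg power2_eq_square power2_eq_1_iff abs_1 abs_minus_cancel)
  then show ?thesis
    using mult[of "-1" x] assms subfield_uminus[OF K subfield_1[OF K]] by simp
qed

lemma diff_le: "x \<in> K \<Longrightarrow> y \<in> K \<Longrightarrow> v (x - y) \<le> max (v x) (v y)"
  using add_le[of x "-y"] uminus[of y] subfield_uminus[OF K, of y] by simp

lemma minus_commute: "x \<in> K \<Longrightarrow> y \<in> K \<Longrightarrow> v (x - y) = v (y - x)"
  using uminus[of "x - y"] subfield_diff[OF K, of x y] by simp

lemma add_eq_right: assumes "x \<in> K" "y \<in> K" "v x < v y" shows "v (x + y) = v y"
proof -
  have "v y \<le> max (v (x + y)) (v x)"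
    using diff_le[of "x + y" x] assms subfield_add[OF K, of x y] by simp
  with assms add_le[of x y] show ?thesis by linarith
qed

lemma add_eq_left: "x \<in> K \<Longrightarrow> y \<in> K \<Longrightarrow> v y < v x \<Longrightarrow> v (x + y) = v x"
  using add_eq_right[of y x] by (simp add: add.commute)

lemma eq_of_near: assumes "x \<in> K" "y \<in> K" "v (x - y) < v y" shows "v x = v y"
  using add_eq_right[of "x - y" y] assms subfield_diff[OF K, of x y] by simp

lemma power: "x \<in> K \<Longrightarrow> v (x ^ n) = v x ^ n"
  by (induction n) (auto simp: one mult subfield_power[OF K])

lemma inverse: assumes "x \<in> K" shows "v (inverse x) = inverse (v x)"
proof (cases "x = 0")
  case False
  then have "v x * v (inverse x) = 1"
    using mult[of x "inverse x"] one subfield_inverse[OF K assms] assms by simp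
  then show ?thesis
    by (metis inverse_unique)
qed (auto simp: zero)

lemma divide: "x \<in> K \<Longrightarrow> y \<in> K \<Longrightarrow> v (x / y) = v x / v y"
  by (simp add: divide_inverse mult inverse subfield_inverse[OF K])

lemma sum_le: assumes "\<And>i. i \<in> I \<Longrightarrow> f i \<in> K" "\<And>i. i \<in> I \<Longrightarrow> v (f i) \<le> B" "0 \<le> B"
  shows "v (sum f I) \<le> B"
  using assms
proof (induction I rule: infinite_finite_induct)
  case (insert i I)
  have "v (f i + sum f I) \<le> max (v (f i)) (v (sum f I))"
    by (intro add_le subfield_sum[OF K]) (use insert in auto)
  also have "\<dots> \<le> B" using insert by auto
  finally show ?case using insert by simp
qed (auto simp: zero)

lemma sum_less: assumes "\<And>i. i \<in> I \<Longrightarrow> f i \<in> K" "\<And>i. i \<in> I \<Longrightarrow> v (f i) < B" "0 < B"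
  shows "v (sum f I) < B"
  using assms
proof (induction I rule: infinite_finite_induct)
  case (insert i I)
  have "v (f i + sum f I) \<le> max (v (f i)) (v (sum f I))"
    by (intro add_le subfield_sum[OF K]) (use insert in auto)
  also have "\<dots> < B" using insert by auto
  finally show ?case using insert by simp
qed (auto simp: zero)

lemma of_nat_le: "v (of_nat n) \<le> 1"
proof (induction n)
  case (Suc n)
  have "v (1 + of_nat n) \<le> max (v 1) (v (of_nat n))"
    by (intro add_le subfield_closed[OF K])
  with Suc one show ?case by simp
qed (simp add: zero)

lemma of_int_le: "v (of_int n) \<le> 1"
  by (cases n rule: int_cases2) (auto simp: of_nat_le uminus subfield_of_nat[OF K])

lemma power_diff_le:
  assumes "x \<in> K" "y \<in> K" "v x \<le> B" "v y \<le> B" "1 \<le> B"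
  shows "v (x ^ n - y ^ n) \<le> v (x - y) * B ^ (n - 1)"
proof (cases n)
  case (Suc k)
  have xy: "x ^ n - y ^ n = (x - y) * (\<Sum>i<n. y ^ (n - Suc i) * x ^ i)"
    by (rule power_diff_sumr2)
  have "v (\<Sum>i<n. y ^ (n - Suc i) * x ^ i) \<le> B ^ (n - 1)"
  proof (rule sum_le)
    fix i assume i: "i \<in> {..<n}"
    have "v (y ^ (n - Suc i) * x ^ i) = v y ^ (n - Suc i) * v x ^ i"
      using assms by (simp add: mult power subfield_power[OF K])
    also have "\<dots> \<le> B ^ (n - Suc i) * B ^ i"
      by (intro mult_mono power_mono) (use assms nonneg in auto)
    also have "\<dots> = B ^ (n - 1)" using i by (simp flip: power_add)
    finally show "v (y ^ (n - Suc i) * x ^ i) \<le> B ^ (n - 1)" .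
  qed (use assms in \<open>auto intro!: subfield_mult[OF K] subfield_power[OF K]\<close>)
  then show ?thesis
    unfolding xy
    by (subst mult)
       (use assms nonneg subfield_diff[OF K] in \<open>auto intro!: subfield_sum[OF K] subfield_mult[OF K] subfield_power[OF K] mult_left_mono\<close>)
qed (use assms in \<open>simp add: zero nonneg subfield_diff[OF K]\<close>)

end

section \<open>Finite-dimensional extensions of the rationals\<close>

interpretation Q: vector_space "\<lambda>(r::rat) (x::'a::field_char_0). of_rat r * x"
  by unfold_locales (auto simp: algebra_simps of_rat_add of_rat_mult)

lemma common_denominator:
  assumes "finite I"
  obtains N :: nat where "N > 0" "\<And>i. i \<in> I \<Longrightarrow> of_nat N * (r i :: rat) \<in> \<int>"
proof -
  have "\<exists>N::nat. N > 0 \<and> (\<forall>i\<in>I. of_nat N * r i \<in> \<int>)"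
    using assms
  proof induction
    case (insert j I)
    then obtain N where N: "N > 0" "\<forall>i\<in>I. of_nat N * r i \<in> \<int>" by auto
    obtain a b where ab: "r j = of_int a / of_int b" "b > 0"
      by (metis Rats_cases' Rats_def UNIV_I of_rat_eq_id id_apply image_id rangeI)
    have "of_nat (N * nat b) * r i \<in> \<int>" if "i \<in> insert j I" for i
    proof (cases "i = j")
      case True
      have "of_nat (N * nat b) * r i = of_int (int N * a)"
        using ab True by simp
      then show ?thesis by (metis Ints_of_int)
    next
      case False
      have "of_nat (nat b) * (of_nat N * r i) \<in> \<int>"
        by (rule Ints_mult) (use N that False in auto)
      then show ?thesis by (simp add: mult_ac del: of_nat_nat)
    qed
    then show ?case using N ab by (intro exI[of _ "N * nat b"]) auto
  qed (auto intro: exI[of _ 1])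
  then show ?thesis using that by blast
qed

lemma integer_relation:
  fixes x :: "nat \<Rightarrow> 'a::field_char_0"
  assumes "finite E" "\<And>i. i \<le> m \<Longrightarrow> x i \<in> Q.span E" "card E \<le> m"
  obtains c :: "nat \<Rightarrow> int" where "\<exists>i\<le>m. c i \<noteq> 0" "(\<Sum>i\<le>m. of_int (c i) * x i) = 0"
proof -
  have "\<exists>r :: nat \<Rightarrow> rat. (\<exists>i\<le>m. r i \<noteq> 0) \<and> (\<Sum>i\<le>m. of_rat (r i) * x i) = 0"
  proof (cases "inj_on x {..m}")
    case False
    then obtain i j where ij: "i \<le> m" "j \<le> m" "i \<noteq> j" "x i = x j"
      by (auto simp: inj_on_def)
    let ?r = "\<lambda>k. if k = i then 1 else if k = j then -1 else (0::rat)"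
    have "(\<Sum>k\<le>m. of_rat (?r k) * x k) = (\<Sum>k\<in>{i, j}. of_rat (?r k) * x k)"
      by (rule sum.mono_neutral_right) (use ij in auto)
    also have "\<dots> = 0" using ij by simp
    finally show ?thesis using ij by (intro exI[of _ ?r]) auto
  next
    case True
    have "Q.dependent (x ` {..m})"
    proof (rule ccontr)
      assume "Q.independent (x ` {..m})"
      then have "card (x ` {..m}) \<le> card E"
        using Q.independent_span_bound[OF assms(1)] assms(2) by blast
      with True assms(3) show False by (simp add: card_image)
    qed
    then obtain u where u: "\<exists>z\<in>x ` {..m}. u z \<noteq> 0" "(\<Sum>z\<in>x ` {..m}. of_rat (u z) * z) = 0"
      using Q.dependent_finite[of "x ` {..m}"] by auto
    from u(2) have "(\<Sum>i\<le>m. of_rat (u (x i)) * x i) = 0"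
      by (simp add: sum.reindex[OF True])
    then show ?thesis using u(1) by (intro exI[of _ "u \<circ> x"]) auto
  qed
  then obtain r :: "nat \<Rightarrow> rat" where r: "\<exists>i\<le>m. r i \<noteq> 0" "(\<Sum>i\<le>m. of_rat (r i) * x i) = 0"
    by blast
  obtain N :: nat where N: "N > 0" "\<And>i. i \<in> {..m} \<Longrightarrow> of_nat N * r i \<in> \<int>"
    using common_denominator[of "{..m}" r] by auto
  define c where "c i = \<lfloor>of_nat N * r i\<rfloor>" for i
  have c: "of_nat N * r i = of_int (c i)" if "i \<le> m" for i
    using N(2)[of i] that by (auto simp: c_def elim: Ints_cases)
  have c': "of_int (c i) = (of_nat N * of_rat (r i) :: 'a)" if "i \<le> m" for i
    using arg_cong[OF c[OF that], of "of_rat :: rat \<Rightarrow> 'a"] by (simp add: of_rat_mult del: of_rat_eq_iff)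
  show ?thesis
  proof (rule that)
    show "\<exists>i\<le>m. c i \<noteq> 0"
    proof -
      from r(1) obtain i where i: "i \<le> m" "r i \<noteq> 0" by blast
      with c[of i] N(1) have "c i \<noteq> 0" by auto
      with i show ?thesis by blast
    qed
    have "(\<Sum>i\<le>m. of_int (c i) * x i) = of_nat N * (\<Sum>i\<le>m. of_rat (r i) * x i)"
      by (simp add: c' sum_distrib_left mult.assoc)
    then show "(\<Sum>i\<le>m. of_int (c i) * x i) = 0" using r(2) by simp
  qed
qed

text \<open>Dividing an integer relation by the largest power of \<open>p\<close> that divides all coefficients makes it
  nontrivial modulo \<open>p\<close>.\<close>

lemma primitive_relation:
  fixes x :: "nat \<Rightarrow> 'a::field_char_0"
  assumes "finite E" "\<And>i. i \<le> m \<Longrightarrow> x i \<in> Q.span E" "card E \<le> m" "prime (p::nat)"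
  obtains c :: "nat \<Rightarrow> int"
    where "\<exists>i\<le>m. \<not> int p dvd c i" "(\<Sum>i\<le>m. of_int (c i) * x i) = 0"
proof -
  obtain c where c: "\<exists>i\<le>m. c i \<noteq> 0" "(\<Sum>i\<le>m. of_int (c i) * x i) = 0"
    using integer_relation[of E m x, OF assms(1-3)] by blast
  define g where "g = Gcd (c ` {..m})"
  have g: "g \<noteq> 0" using c(1) by (auto simp: g_def)
  define c' where "c' i = c i div g" for i
  have cc': "c i = g * c' i" if "i \<le> m" for i
    using that by (simp add: c'_def g_def)
  have "\<exists>i\<le>m. \<not> int p dvd c' i"
  proof (rule ccontr)
    assume "\<not> ?thesis"
    then have "g * int p dvd c i" if "i \<le> m" for i
      using that cc'[OF that] by (auto intro: mult_dvd_mono)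
    then have "g * int p dvd g"
      unfolding g_def by (intro Gcd_greatest) auto
    then have "int p dvd 1" using g by (simp add: dvd_mult_cancel_left)
    then show False using \<open>prime p\<close> by (simp add: prime_gt_1_nat)
  qed
  moreover have "(\<Sum>i\<le>m. of_int (c' i) * x i) = 0"
  proof -
    have "of_int g * (\<Sum>i\<le>m. of_int (c' i) * x i) = (\<Sum>i\<le>m. of_int (c i) * x i)"
      by (simp add: cc' sum_distrib_left mult.assoc)
    then show ?thesis using c(2) g by simp
  qed
  ultimately show ?thesis using that by blast
qed

lemma of_rat_in_span: "1 \<in> Q.span E \<Longrightarrow> of_rat r \<in> Q.span E"
  using Q.span_scale[of 1 E r] by simp

lemma span_mult:
  assumes "x \<in> Q.span A" "y \<in> Q.span B"
  shows "x * y \<in> Q.span {a * b |a b. a \<in> A \<and> b \<in> B}"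
proof -
  let ?S = "Q.span {a * b |a b. a \<in> A \<and> b \<in> B}"
  have 1: "a * y \<in> ?S" if "a \<in> A" "y \<in> Q.span B" for a y
    using that(2)
  proof (induction rule: Q.span_induct)
    case base
    show ?case
    proof (rule Q.subspaceI)
      show "c \<in> {y. a * y \<in> ?S} \<Longrightarrow> of_rat r * c \<in> {y. a * y \<in> ?S}" for r c
        using Q.span_scale[of "a * c" _ r] by (simp add: mult.left_commute)
    qed (simp_all add: distrib_left Q.span_zero Q.span_add)
  next
    case (step b)
    then show ?case using that(1) by (intro Q.span_base) auto
  qed
  from assms(1) show ?thesis
  proof (induction rule: Q.span_induct)
    case base
    show ?case
    proof (rule Q.subspaceI)
      show "c \<in> {x. x * y \<in> ?S} \<Longrightarrow> of_rat r * c \<in> {x. x * y \<in> ?S}" for r c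
        using Q.span_scale[of "c * y" _ r] by (simp add: mult.assoc)
    qed (simp_all add: distrib_right Q.span_zero Q.span_add)
  next
    case (step a)
    then show ?case using assms(2) by (intro 1) auto
  qed
qed

lemma to_ac_eq_of_rat: "to_ac (r::rat) = of_rat r"
  proof (cases r)
  case (Fract a b)
  then have r: "r = of_int a / of_int b" by (simp add: Fract_of_int_quotient)
  show ?thesis unfolding r by (simp only: to_ac_divide to_ac_of_int of_rat_divide of_rat_of_int_eq)
qed

lemma qbar_root_of_int_poly:
  obtains P :: "int poly" where "P \<noteq> 0" "poly (map_poly of_int P) (x::qbar) = 0"
proof -
  obtain p :: "rat poly" where p: "p \<noteq> 0" "poly (map_poly to_ac p) x = 0"
    by (rule alg_closure_algebraic)
  have "algebraic x"
    unfolding algebraic_altdef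
    using p by (intro exI[of _ "map_poly to_ac p"]) (auto simp: coeff_map_poly to_ac_eq_of_rat map_poly_eq_0_iff)
  then show ?thesis using that by (elim algebraicE') auto
qed

text \<open>An algebraic number \<open>x \<noteq> 0\<close> satisfies an equation with nonzero constant term, which expresses
  \<open>1/x\<close> as a polynomial in \<open>x\<close>.\<close>

lemma subfield_of_subring:
  fixes V :: "qbar set"
  assumes diff: "\<And>x y. x \<in> V \<Longrightarrow> y \<in> V \<Longrightarrow> x - y \<in> V"
    and mult: "\<And>x y. x \<in> V \<Longrightarrow> y \<in> V \<Longrightarrow> x * y \<in> V"
    and rat: "\<And>r. of_rat r \<in> V"
  shows "is_subfield V"
proof -
  have 0: "0 \<in> V" "1 \<in> V" using rat[of 0] rat[of 1] by auto
  have um: "- x \<in> V" if "x \<in> V" for x using diff[OF 0(1) that] by simp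
  have add: "x + y \<in> V" if "x \<in> V" "y \<in> V" for x y using diff[OF that(1) um[OF that(2)]] by simp
  have int: "of_int k \<in> V" for k using rat[of "of_int k"] by simp
  have poly: "poly (map_poly of_int P) y \<in> V" if "y \<in> V" for P y
    by (induction P) (use that in \<open>auto simp: map_poly_pCons 0 int intro!: add mult\<close>)
  have inv: "inverse y \<in> V" if "y \<in> V" "y \<noteq> 0" "P \<noteq> 0" "poly (map_poly of_int P) y = 0" for y P
    using that(3,4)
  proof (induction P)
    case (pCons a P)
    show ?case
    proof (cases "a = 0")
      case True
      with pCons that(2) show ?thesis by (auto simp: map_poly_pCons)
    next
      case False
      from pCons.prems have *: "of_int a + y * poly (map_poly of_int P) y = 0"
        by (simp add: map_poly_pCons)
      have "inverse y = of_rat (- (1 / of_int a)) * poly (map_poly of_int P) y"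
        using * False that(2) by (simp add: field_simps of_rat_divide of_rat_minus add_eq_0_iff)
      then show ?thesis using rat mult poly[OF that(1)] by metis
    qed
  qed simp
  have "inverse y \<in> V" if "y \<in> V" for y
    by (cases "y = 0") (use 0 that inv qbar_root_of_int_poly in \<open>auto, metis\<close>)
  with 0 diff mult show ?thesis by (auto simp: is_subfield_def)
qed

text \<open>These are the number fields. Closure under inverses is automatic, and not requiring it
  makes fields of this kind easy to construct.\<close>

definition fin_dim_ring :: "qbar set \<Rightarrow> bool" where
  "fin_dim_ring V \<longleftrightarrow> 1 \<in> V \<and> (\<forall>x\<in>V. \<forall>y\<in>V. x * y \<in> V) \<and> (\<exists>E. finite E \<and> V = Q.span E)"

lemma fin_dim_ring_subfield: assumes "fin_dim_ring V" shows "is_subfield V"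
proof -
  from assms obtain E where E: "finite E" "V = Q.span E" by (auto simp: fin_dim_ring_def)
  show ?thesis
    by (rule subfield_of_subring)
       (use assms E of_rat_in_span in \<open>auto simp: fin_dim_ring_def intro: Q.span_diff\<close>)
qed

lemma subfield_subspace: "is_subfield K \<Longrightarrow> Q.subspace K"
  by (intro Q.subspaceI) (auto simp: subfield_closed subfield_of_rat)

lemma subfield_span: "is_subfield K \<Longrightarrow> E \<subseteq> K \<Longrightarrow> Q.span E \<subseteq> K"
  by (simp add: Q.span_minimal subfield_subspace)

lemma compositum_span:
  assumes "is_subfield K" "is_subfield L" "Q.span E = K" "Q.span F = L" "finite E" "finite F"
  shows "fin_dim_ring (Q.span {a * b |a b. a \<in> E \<and> b \<in> F})" (is "fin_dim_ring (Q.span ?G)")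
    and "K \<subseteq> Q.span {a * b |a b. a \<in> E \<and> b \<in> F}" and "L \<subseteq> Q.span {a * b |a b. a \<in> E \<and> b \<in> F}"
    and "finite {a * b |a b. a \<in> E \<and> b \<in> F}" 
    and "card {a * b |a b. a \<in> E \<and> b \<in> F} \<le> card E * card F"
proof -
  have G: "?G = (\<lambda>(a, b). a * b) ` (E \<times> F)" by auto
  show fin: "finite ?G" unfolding G using assms by auto
  show "card ?G \<le> card E * card F"
    unfolding G using card_image_le[of "E \<times> F"] assms by (metis card_cartesian_product finite_SigmaI)
  have 1: "1 \<in> Q.span E" "1 \<in> Q.span F" using assms subfield_1 by auto
  have KG: "x \<in> Q.span ?G" if "x \<in> K" for x using span_mult[OF _ 1(2), of x E] that assms by auto
  have LG: "x \<in> Q.span ?G" if "x \<in> L" for x using span_mult[OF 1(1), of x F] that assms by auto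
  show "K \<subseteq> Q.span ?G" "L \<subseteq> Q.span ?G" using KG LG by auto
  have "x * y \<in> Q.span ?G" if "x \<in> Q.span ?G" "y \<in> Q.span ?G" for x y
  proof -
    have "{a * b |a b. a \<in> ?G \<and> b \<in> ?G} \<subseteq> Q.span ?G"
    proof clarify
      fix a b a' b' assume *: "a \<in> E" "b \<in> F" "a' \<in> E" "b' \<in> F"
      have "a * a' \<in> Q.span E" "b * b' \<in> Q.span F"
        using * assms Q.span_base subfield_mult by (metis, metis)
      then have "(a * a') * (b * b') \<in> Q.span ?G" by (rule span_mult)
      then show "a * b * (a' * b') \<in> Q.span ?G" by (simp add: mult_ac)
    qed
    then have "Q.span {a * b |a b. a \<in> ?G \<and> b \<in> ?G} \<subseteq> Q.span ?G"
      by (simp add: Q.span_minimal)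
    then show ?thesis using span_mult[OF that] by blast
  qed
  then show "fin_dim_ring (Q.span ?G)"
    unfolding fin_dim_ring_def using fin KG subfield_1[OF assms(1)] by blast
qed

text \<open>Multiplying a relation of degree \<open>n\<close> by powers of \<open>x\<close> reduces all higher powers.\<close>

lemma powers_in_span:
  fixes x :: qbar
  obtains n where "\<And>k. x ^ k \<in> Q.span ((\<lambda>i. x ^ i) ` {..<n})"
proof -
  obtain P :: "int poly" where P: "P \<noteq> 0" "poly (map_poly of_int P) x = 0"
    by (rule qbar_root_of_int_poly)
  define n where "n = degree P"
  let ?S = "Q.span ((\<lambda>i. x ^ i) ` {..<n})"
  have "0 = (\<Sum>i\<le>n. of_int (coeff P i) * x ^ i)"
    using P(2) unfolding poly_altdef n_def by (simp add: degree_map_poly coeff_map_poly)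
  also have "\<dots> = of_int (coeff P n) * x ^ n + (\<Sum>i<n. of_int (coeff P i) * x ^ i)"
    by (simp add: lessThan_Suc_atMost[symmetric])
  finally have "of_int (coeff P n) * x ^ n = (\<Sum>i<n. of_int (- coeff P i) * x ^ i)"
    by (simp add: sum_negf add_eq_0_iff)
  moreover have nz: "of_int (coeff P n) \<noteq> (0::qbar)" using P by (simp add: n_def)
  ultimately have "x ^ n = (\<Sum>i<n. of_int (- coeff P i) * x ^ i) / of_int (coeff P n)"
    by (simp add: field_simps)
  then have xn: "x ^ n = (\<Sum>i<n. of_rat (- of_int (coeff P i) / of_int (coeff P n)) * x ^ i)"
    by (simp add: sum_divide_distrib of_rat_divide of_rat_minus)
  have "x ^ k \<in> ?S" for k
  proof (induction k rule: less_induct)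
    case (less k)
    show ?case
    proof (cases "k < n")
      case False
      then have "x ^ k = x ^ (k - n) * x ^ n" by (simp flip: power_add)
      also have "\<dots> = (\<Sum>i<n. of_rat (- of_int (coeff P i) / of_int (coeff P n)) * x ^ (k - n + i))"
        unfolding xn by (simp add: sum_distrib_left power_add mult_ac)
      also have "\<dots> \<in> ?S"
        by (intro Q.span_sum Q.span_scale less) (use False in auto)
      finally show ?thesis .
    qed (auto intro: Q.span_base)
  qed
  then show ?thesis using that by blast
qed

lemma fin_dim_ring_powers:
  fixes x :: qbar
  obtains n where "fin_dim_ring (Q.span ((\<lambda>i. x ^ i) ` {..<n}))" "x \<in> Q.span ((\<lambda>i. x ^ i) ` {..<n})"
proof -
  obtain n where n: "\<And>k. x ^ k \<in> Q.span ((\<lambda>i. x ^ i) ` {..<n})"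
    using powers_in_span by blast
  let ?E = "(\<lambda>i. x ^ i) ` {..<n}"
  have "{a * b |a b. a \<in> ?E \<and> b \<in> ?E} \<subseteq> Q.span ?E"
    using n by (auto simp flip: power_add)
  then have "Q.span {a * b |a b. a \<in> ?E \<and> b \<in> ?E} \<subseteq> Q.span ?E"
    by (simp add: Q.span_minimal)
  then have "fin_dim_ring (Q.span ?E)"
    unfolding fin_dim_ring_def using n[of 0] span_mult[of _ ?E _ ?E]
    by (intro conjI ballI exI[of _ ?E]) (simp, blast, auto)
  moreover have "x \<in> Q.span ?E" using n[of 1] by simp
  ultimately show ?thesis using that by blast
qed

lemma finite_subset_fin_dim_ring:
  assumes "finite Z"
  obtains V where "fin_dim_ring V" "Z \<subseteq> V"
proof -
  have "\<exists>V. fin_dim_ring V \<and> Z \<subseteq> V"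
    using assms
  proof induction
    case empty
    show ?case using fin_dim_ring_powers by blast
  next
    case (insert x Z)
    then obtain V E where V: "fin_dim_ring V" "Z \<subseteq> V" "finite E" "V = Q.span E"
      by (auto simp: fin_dim_ring_def)
    obtain n where n: "fin_dim_ring (Q.span ((\<lambda>i. x ^ i) ` {..<n}))" "x \<in> Q.span ((\<lambda>i. x ^ i) ` {..<n})"
      by (rule fin_dim_ring_powers)
    note C = compositum_span[OF fin_dim_ring_subfield[OF V(1)] fin_dim_ring_subfield[OF n(1)]
        V(4)[symmetric] refl V(3) finite_imageI[OF finite_lessThan]]
    show ?case using C(1-3) V(2) n(2) by blast
  qed
  then show ?thesis using that by blast
qed

lemma fin_dim_ring_basis:
  assumes "fin_dim_ring V" "A \<subseteq> V" "Q.independent A"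
  obtains B where "A \<subseteq> B" "finite B" "Q.independent B" "Q.span B = V"
proof -
  obtain E where E: "finite E" "V = Q.span E" using assms by (auto simp: fin_dim_ring_def)
  obtain B where B: "A \<subseteq> B" "B \<subseteq> V" "Q.independent B" "V \<subseteq> Q.span B"
    using Q.maximal_independent_subset_extend[OF assms(2,3)] by blast
  have "finite B" using Q.independent_span_bound[OF E(1) B(3)] B(2) E by auto
  moreover have "Q.span B = V"
    using B E by (metis Q.span_minimal Q.subspace_span subset_antisym)
  ultimately show ?thesis using that B by blast
qed

lemma of_int_poly_add: "map_poly of_int (p + q) = (map_poly of_int p + map_poly of_int q :: 'a::ring_1 poly)"
  by (rule poly_eqI) (simp add: coeff_map_poly)

lemma of_int_poly_smult: "map_poly of_int (smult c q) = (smult (of_int c) (map_poly of_int q) :: 'a::comm_ring_1 poly)"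
  by (rule poly_eqI) (simp add: coeff_map_poly)

section \<open>The field generated by one element\<close>

lemma field_gen_subfield [simp]: "is_subfield (field_gen x)"
  unfolding field_gen_def is_subfield_def by auto

lemma field_gen_mem [simp]: "x \<in> field_gen x"
  by (simp add: field_gen_def)

lemma field_gen_least: "is_subfield K \<Longrightarrow> x \<in> K \<Longrightarrow> field_gen x \<subseteq> K"
  by (auto simp: field_gen_def)

lemma field_gen_inverse: "field_gen (inverse x) = field_gen x"
  using field_gen_least[of "field_gen x" "inverse x"] field_gen_least[of "field_gen (inverse x)" x]
    subfield_inverse[of "field_gen x" x] subfield_inverse[of "field_gen (inverse x)" "inverse x"]
  by auto

lemma field_gen_span:
  obtains n where "field_gen x = Q.span ((\<lambda>i. x ^ i) ` {..<n})"
proof -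
  obtain n where n: "fin_dim_ring (Q.span ((\<lambda>i. x ^ i) ` {..<n}))" "x \<in> Q.span ((\<lambda>i. x ^ i) ` {..<n})"
    by (rule fin_dim_ring_powers)
  have "field_gen x = Q.span ((\<lambda>i. x ^ i) ` {..<n})"
    by (intro equalityI field_gen_least subfield_span)
       (auto simp: n fin_dim_ring_subfield intro!: subfield_power)
  then show ?thesis using that by blast
qed

lemma field_gen_basis:
  obtains B where "finite B" "Q.independent B" "Q.span B = field_gen x" "card B = field_degree (field_gen x)"
proof -
  obtain n where n: "field_gen x = Q.span ((\<lambda>i. x ^ i) ` {..<n})" by (rule field_gen_span)
  have "\<exists>E. finite E \<and> field_gen x = Q.span E"
    by (rule exI[of _ "(\<lambda>i. x ^ i) ` {..<n}"]) (simp add: n)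
  then have "fin_dim_ring (field_gen x)"
    unfolding fin_dim_ring_def using subfield_1[OF field_gen_subfield] subfield_mult[OF field_gen_subfield]
    by blast
  then obtain B where B: "finite B" "Q.independent B" "Q.span B = field_gen x"
    by (rule fin_dim_ring_basis[OF _ empty_subsetI Q.independent_empty])
  moreover have "card B = field_degree (field_gen x)"
    unfolding field_degree_def using B by (metis Q.dim_span_eq_card_independent)
  ultimately show ?thesis using that by blast
qed

lemma field_degree_pos: "field_degree (field_gen x) > 0"
proof -
  obtain B where B: "finite B" "Q.independent B" "Q.span B = field_gen x" "card B = field_degree (field_gen x)"
    by (rule field_gen_basis)
  have "B \<noteq> {}"
  proof
    assume "B = {}"
    then have "field_gen x = {0}" using B(3) by simp
    then show False using subfield_1[OF field_gen_subfield[of x]] by (metis singletonD zero_neq_one)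
  qed
  then show ?thesis using B by (metis card_gt_0_iff)
qed

lemma field_gen_as_poly:
  assumes "y \<in> field_gen x"
  obtains q :: nat and g :: "int poly" where "q > 0" "of_nat q * y = poly (map_poly of_int g) x"
proof -
  obtain n where n: "field_gen x = Q.span ((\<lambda>i. x ^ i) ` {..<n})" by (rule field_gen_span)
  have "\<exists>(q::nat) (g::int poly). q > 0 \<and> of_nat q * y = poly (map_poly of_int g) x"
    using assms unfolding n
  proof (induction rule: Q.span_induct_alt)
    case base
    show ?case by (rule exI[of _ 1], rule exI[of _ 0]) simp
  next
    case (step r z y)
    then obtain q g i where *: "q > 0" "of_nat q * y = poly (map_poly of_int g) x" "z = x ^ i" by auto
    obtain a b where ab: "r = of_int a / of_int b" "b > 0"
      by (metis Rats_cases' Rats_def UNIV_I of_rat_eq_id id_apply image_id rangeI)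
    let ?h = "monom (int q * a) i + smult b g"
    have h: "poly (map_poly of_int ?h) x = of_nat q * of_int a * x ^ i + of_int b * poly (map_poly of_int g) x"
      by (simp add: of_int_poly_add of_int_poly_smult map_poly_monom poly_monom)
    have "of_rat r = (of_int a / of_int b :: qbar)"
      unfolding ab by (simp only: of_rat_divide of_rat_of_int_eq)
    then have "of_nat (q * nat b) * (of_rat r * z + y) = poly (map_poly of_int ?h) x"
      unfolding h *(2)[symmetric] using ab(2) *(3) by (simp add: field_simps)
    then show ?case using * ab by (intro exI[of _ "q * nat b"] exI[of _ ?h]) auto
  qed
  then show ?thesis using that by blast
qed

section \<open>Finite places: weak approximation\<close>

lemma finite_place_nonarch: "is_subfield K \<Longrightarrow> v \<in> finite_places K \<Longrightarrow> nonarch K v"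
  by (simp add: nonarch_def finite_places_def)

lemma (in nonarch) powi: assumes "x \<in> K" shows "v (x powi k) = v x powi k"
  using assms by (cases "0 \<le> k") (auto simp: power_int_def power inverse subfield_power[OF K] subfield_inverse[OF K])

lemma subfield_powi: "is_subfield K \<Longrightarrow> x \<in> K \<Longrightarrow> x powi k \<in> K"
  by (auto simp: power_int_def subfield_power subfield_inverse)

lemma finite_place_value:
  assumes "v \<in> finite_places K" "x \<in> K" "x \<noteq> 0"
  obtains k :: int where "v x = real (residue_card K v) powi k"
proof -
  have "v x \<in> v ` (K - {0})" using assms by blast
  then show ?thesis using assms(1) that by (auto simp: finite_places_def)
qed

lemma finite_place_uniformizer:
  assumes "v \<in> finite_places K"
  obtains u where "u \<in> K" "u \<noteq> 0" "v u = 1 / real (residue_card K v)"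
proof -
  have "real (residue_card K v) powi (-1) \<in> v ` (K - {0})"
    using assms unfolding finite_places_def by blast
  then obtain u where "u \<in> K - {0}" "v u = real (residue_card K v) powi (-1)" by force
  then show ?thesis using that[of u] by (simp add: power_int_minus field_simps)
qed

lemma finite_place_card: "v \<in> finite_places K \<Longrightarrow> residue_card K v > 1"
  by (simp add: finite_places_def)

lemma powi_cancel: "(N::real) > 1 \<Longrightarrow> N powi a = N powi b \<longleftrightarrow> a = b"
  by (metis linorder_neq_iff power_int_strict_increasing)

lemma powi_less_one: "(N::real) > 1 \<Longrightarrow> N powi a < 1 \<longleftrightarrow> a < 0"
  using power_int_strict_increasing[of a 0 N] power_int_increasing[of 0 a N] by (cases "a < 0") (auto simp: not_less)

text \<open>Comparability of the two maximal ideals forces equality of the valuation rings; then the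
  normalization makes the absolute values equal, because it depends on the valuation ring only.\<close>

lemma finite_places_eqI:
  assumes K: "is_subfield K" and v1: "v\<^sub>1 \<in> finite_places K" and v2: "v\<^sub>2 \<in> finite_places K"
    and le: "\<And>x. x \<in> K \<Longrightarrow> v\<^sub>1 x < 1 \<Longrightarrow> v\<^sub>2 x < 1"
  shows "v\<^sub>1 = v\<^sub>2"
proof -
  interpret a: nonarch K v\<^sub>1 using finite_place_nonarch[OF K v1] .
  interpret b: nonarch K v\<^sub>2 using finite_place_nonarch[OF K v2] .
  define M N where "M = real (residue_card K v\<^sub>1)" and "N = real (residue_card K v\<^sub>2)"
  have MN: "M > 1" "N > 1" using finite_place_card v1 v2 by (auto simp: M_def N_def)
  obtain \<pi> where \<pi>: "\<pi> \<in> K" "\<pi> \<noteq> 0" "v\<^sub>1 \<pi> = 1 / M"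
    using finite_place_uniformizer[OF v1] by (auto simp: M_def)
  obtain \<pi>2 where \<pi>2: "\<pi>2 \<in> K" "\<pi>2 \<noteq> 0" "v\<^sub>2 \<pi>2 = 1 / N"
    using finite_place_uniformizer[OF v2] by (auto simp: N_def)
  \<comment> \<open>A unit at \<open>v\<^sub>1\<close> times the uniformizer stays in the first
    maximal ideal, however large the power.\<close>
  have unit_le: "v\<^sub>2 u \<le> 1" if "u \<in> K" "v\<^sub>1 u = 1" for u
  proof (rule ccontr)
    assume "\<not> v\<^sub>2 u \<le> 1"
    then obtain m where m: "1 / v\<^sub>2 \<pi> < v\<^sub>2 u ^ m"
      using real_arch_pow[of "v\<^sub>2 u"] by auto
    have "v\<^sub>1 (\<pi> * u ^ m) < 1"
      using that \<pi> MN by (simp add: a.mult a.power subfield_power[OF K])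
    then have "v\<^sub>2 (\<pi> * u ^ m) < 1" using le that \<pi> subfield_closed(4,9)[OF K] by metis
    then have "v\<^sub>2 \<pi> * v\<^sub>2 u ^ m < 1"
      using that \<pi> by (simp add: b.mult b.power subfield_power[OF K])
    then show False using m b.pos[OF \<pi>(1,2)] by (simp add: field_simps)
  qed
  have unit: "v\<^sub>2 u = 1" if "u \<in> K" "v\<^sub>1 u = 1" for u
  proof -
    have "v\<^sub>2 (inverse u) \<le> 1"
      using that unit_le[of "inverse u"] subfield_inverse[OF K, of u] by (simp add: a.inverse)
    then have "inverse (v\<^sub>2 u) \<le> 1" using that by (simp add: b.inverse)
    moreover have "u \<noteq> 0" using that a.zero by auto
    ultimately show ?thesis
      using unit_le[OF that] b.pos[OF that(1)] by (simp add: field_simps)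
  qed
  have val: "\<exists>k. v\<^sub>1 x = M powi k \<and> v\<^sub>2 x = v\<^sub>2 \<pi> powi (- k)" if x: "x \<in> K" "x \<noteq> 0" for x
  proof -
    obtain k where k: "v\<^sub>1 x = M powi k"
      using finite_place_value[OF v1 x] by (auto simp: M_def)
    have pk: "\<pi> powi k \<in> K" using \<pi> by (simp add: subfield_powi[OF K])
    have "v\<^sub>1 (x * \<pi> powi k) = 1"
      using x pk \<pi> MN by (simp add: a.mult a.powi k power_int_divide_distrib)
    then have "v\<^sub>2 (x * \<pi> powi k) = 1" using unit x pk subfield_mult[OF K] by blast
    then have "v\<^sub>2 x * v\<^sub>2 \<pi> powi k = 1" using x pk \<pi> by (simp add: b.mult b.powi)
    then have "v\<^sub>2 x = v\<^sub>2 \<pi> powi (- k)"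
      using b.pos[OF \<pi>(1,2)] by (simp add: power_int_minus field_simps)
    with k show ?thesis by blast
  qed
  obtain l where l: "v\<^sub>2 \<pi> = N powi l"
    using finite_place_value[OF v2 \<pi>(1,2)] by (auto simp: N_def)
  have "v\<^sub>2 \<pi> < 1" using le[OF \<pi>(1)] \<pi>(3) MN by simp
  then have "l < 0" using l powi_less_one[OF MN(2)] by simp
  obtain j where j: "v\<^sub>2 \<pi>2 = v\<^sub>2 \<pi> powi (- j)" using val[OF \<pi>2(1,2)] by blast
  \<comment> \<open>The value of \<open>v\<^sub>2\<close> at \<open>\<pi>\<close> generates the
    value group of \<open>v\<^sub>2\<close>, so it is \<open>1/N\<close>.\<close>
  have "N powi (-1) = N powi (l * (- j))"
    using j l \<pi>2(3) MN by (simp only: power_int_mult) (simp add: power_int_minus field_simps)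
  then have "l * (- j) = -1" using powi_cancel[OF MN(2)] by metis
  then have "l = -1" using \<open>l < 0\<close> by (metis mult_minus_right neg_equal_iff_equal zmult_eq_1_iff not_one_less_zero)
  then have val: "\<exists>k. v\<^sub>1 x = M powi k \<and> v\<^sub>2 x = N powi k" if x: "x \<in> K" "x \<noteq> 0" for x
    using val[OF x] l MN by (auto simp: power_int_minus power_int_inverse)
  have less: "v\<^sub>1 x < 1 \<longleftrightarrow> v\<^sub>2 x < 1" and le': "v\<^sub>1 x \<le> 1 \<longleftrightarrow> v\<^sub>2 x \<le> 1" if "x \<in> K" for x
  proof -
    show "v\<^sub>1 x < 1 \<longleftrightarrow> v\<^sub>2 x < 1"
      by (cases "x = 0") (use val[OF that] powi_less_one MN a.zero b.zero in auto)
    moreover have "v\<^sub>1 x = 1 \<longleftrightarrow> v\<^sub>2 x = 1"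
      by (cases "x = 0") (use val[OF that] powi_cancel[of M _ 0] powi_cancel[of N _ 0] MN a.zero b.zero in auto)
    ultimately show "v\<^sub>1 x \<le> 1 \<longleftrightarrow> v\<^sub>2 x \<le> 1" by auto
  qed
  have "residue_card K v\<^sub>1 = residue_card K v\<^sub>2"
  proof -
    have "{x \<in> K. v\<^sub>1 x \<le> 1} = {x \<in> K. v\<^sub>2 x \<le> 1}" using le' by auto
    moreover have "{(x, y). x \<in> K \<and> y \<in> K \<and> v\<^sub>1 x \<le> 1 \<and> v\<^sub>1 y \<le> 1 \<and> v\<^sub>1 (x - y) < 1} =
       {(x, y). x \<in> K \<and> y \<in> K \<and> v\<^sub>2 x \<le> 1 \<and> v\<^sub>2 y \<le> 1 \<and> v\<^sub>2 (x - y) < 1}"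
      using le' less subfield_diff[OF K] by auto
    ultimately show ?thesis unfolding residue_card_def by simp
  qed
  then have "M = N" by (simp add: M_def N_def)
  show ?thesis
  proof
    fix x
    show "v\<^sub>1 x = v\<^sub>2 x"
    proof (cases "x \<in> K")
      case True
      then show ?thesis by (cases "x = 0") (use val[OF True] \<open>M = N\<close> a.zero b.zero in auto)
    qed (use v1 v2 in \<open>auto simp: finite_places_def\<close>)
  qed
qed

text \<open>Applied to both orders of the two places, the preceding lemma gives an element of each maximal
  ideal outside the other; \<open>z\<close> is a quotient of such elements.\<close>

lemma finite_places_separate:
  assumes K: "is_subfield K" and v1: "v\<^sub>1 \<in> finite_places K" and v2: "v\<^sub>2 \<in> finite_places K" and "v\<^sub>1 \<noteq> v\<^sub>2"
  obtains z where "z \<in> K" "v\<^sub>1 z > 1" "v\<^sub>2 z < 1"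
proof -
  interpret a: nonarch K v\<^sub>1 using finite_place_nonarch[OF K v1] .
  interpret b: nonarch K v\<^sub>2 using finite_place_nonarch[OF K v2] .
  obtain x where x: "x \<in> K" "v\<^sub>1 x < 1" "v\<^sub>2 x \<ge> 1"
    using finite_places_eqI[OF K v1 v2] assms(4) not_le_imp_less by blast
  obtain y where y: "y \<in> K" "v\<^sub>2 y < 1" "v\<^sub>1 y \<ge> 1"
    using finite_places_eqI[OF K v2 v1] assms(4) not_le_imp_less by metis
  have "x \<noteq> 0" using x b.zero by auto
  then have "v\<^sub>1 (y / x) > 1" "v\<^sub>2 (y / x) < 1"
    using x y a.pos[OF x(1)] b.pos[OF x(1)] by (auto simp: a.divide b.divide field_simps)
  then show ?thesis using that subfield_divide[OF K y(1) x(1)] by blast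
qed

lemma power_small: assumes "0 \<le> (a::real)" "a < 1" "e > 0" 
  obtains M where "\<And>m. m \<ge> M \<Longrightarrow> a ^ m < e"
proof -
  obtain n where n: "a ^ n < e" using real_arch_pow_inv[OF assms(3,2)] by blast
  then have "a ^ m < e" if "m \<ge> n" for m using power_decreasing[OF that assms(1)] assms(2) by linarith
  then show ?thesis using that by blast
qed

lemma finite_places_eventually:
  assumes "finite J" "\<And>v. v \<in> J \<Longrightarrow> \<exists>M. \<forall>m\<ge>M. P v (m::nat)"
  obtains M where "\<And>m v. m \<ge> M \<Longrightarrow> v \<in> J \<Longrightarrow> P v m"
proof -
  obtain f where f: "\<And>v m. v \<in> J \<Longrightarrow> m \<ge> f v \<Longrightarrow> P v m" using assms(2) by metis
  have "P v m" if "m \<ge> Max (insert 0 (f ` J))" "v \<in> J" for m v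
    using f[OF that(2)] that assms(1) by (metis Max_ge finite_imageI finite_insert image_eqI insertCI order_trans)
  then show ?thesis using that by blast
qed

lemma (in nonarch) power_ratio_small:
  assumes "z \<in> K" "v z < 1" "m > 0" shows "v (z ^ m / (1 + z ^ m)) \<le> v z ^ m" "1 + z ^ m \<noteq> 0"
proof -
  have "v (z ^ m) < v 1" using assms nonneg[of z] by (simp add: power one power_less_one_iff)
  then have 1: "v (1 + z ^ m) = 1"
    using add_eq_left[of 1 "z ^ m"] assms by (simp add: subfield_closed[OF K] one)
  then show "1 + z ^ m \<noteq> 0" using zero by auto
  show "v (z ^ m / (1 + z ^ m)) \<le> v z ^ m"
    using assms 1 by (simp add: divide power subfield_closed[OF K])
qed

lemma (in nonarch) power_ratio_large:
  assumes "z \<in> K" "v z > 1" "m > 0"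
  shows "v (z ^ m / (1 + z ^ m) - 1) \<le> (1 / v z) ^ m" "v (z ^ m / (1 + z ^ m)) = 1" "1 + z ^ m \<noteq> 0"
proof -
  have "v (z ^ m) > v 1" using assms by (simp add: power one one_less_power)
  then have 1: "v (1 + z ^ m) = v z ^ m"
    using add_eq_right[of 1 "z ^ m"] assms by (simp add: subfield_closed[OF K] power)
  then show nz: "1 + z ^ m \<noteq> 0" using zero assms(2) by auto
  have "z ^ m / (1 + z ^ m) - 1 = - 1 / (1 + z ^ m)"
    using nz by (simp add: field_simps)
  then have "v (z ^ m / (1 + z ^ m) - 1) = v (- 1) / v z ^ m"
    using 1 assms by (simp add: divide subfield_closed[OF K] del: minus_divide_left[symmetric])
  then show "v (z ^ m / (1 + z ^ m) - 1) \<le> (1 / v z) ^ m"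
    using uminus[of 1] by (simp add: one subfield_1[OF K] power_one_over)
  show "v (z ^ m / (1 + z ^ m)) = 1"
    using assms 1 by (simp add: divide power subfield_closed[OF K])
qed

text \<open>Induction on the number of places to be made small. If the element found so far is large
  at the new place, multiplication by \<open>z\<^sup>m / (1 + z\<^sup>m)\<close> is harmless there and kills the others.\<close>

lemma finite_places_dominate:
  assumes K: "is_subfield K" and "finite J" "J \<subseteq> finite_places K" and v: "v \<in> finite_places K" "v \<notin> J"
  shows "\<exists>z\<in>K. v z > 1 \<and> (\<forall>u\<in>J. u z < 1)"
  using assms(2,3,5)
proof (induction J)
  case empty
  interpret v: nonarch K v using finite_place_nonarch[OF K v(1)] .
  obtain u where u: "u \<in> K" "u \<noteq> 0" "v u = 1 / real (residue_card K v)"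
    using finite_place_uniformizer[OF v(1)] .
  then have "v (inverse u) > 1" using finite_place_card[OF v(1)] by (simp add: v.inverse)
  then show ?case using subfield_inverse[OF K u(1)] by auto
next
  case (insert w J)
  then obtain z where z: "z \<in> K" "v z > 1" "\<forall>u\<in>J. u z < 1" by auto
  have w: "w \<in> finite_places K" using insert by auto
  obtain y where y: "y \<in> K" "v y > 1" "w y < 1"
    using finite_places_separate[OF K v(1) w] insert by auto
  interpret v: nonarch K v using finite_place_nonarch[OF K v(1)] .
  interpret w: nonarch K w using finite_place_nonarch[OF K w] .
  have na: "nonarch K u" if "u \<in> J" for u using finite_place_nonarch[OF K] that insert by auto
  have small: "\<exists>M. \<forall>m\<ge>M. u z ^ m < 1 / (u y + 1)" if "u \<in> J" for u
  proof -
    interpret u: nonarch K u using na[OF that] .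
    have "1 / (u y + 1) > 0" using u.nonneg[OF y(1)] by (simp add: add_nonneg_pos)
    then show ?thesis using power_small[of "u z" "1 / (u y + 1)"] z that u.nonneg[OF z(1)] by metis
  qed
  obtain M where M: "\<And>m u. m \<ge> M \<Longrightarrow> u \<in> J \<Longrightarrow> u z ^ m < 1 / (u y + 1)"
    using finite_places_eventually[OF insert(1), of "\<lambda>u m. u z ^ m < 1 / (u y + 1)"] small by blast
  have yz: "u z ^ m * u y < 1" if "u \<in> J" "m \<ge> M" for u m
  proof -
    interpret u: nonarch K u using na[OF that(1)] .
    have "u z ^ m * (u y + 1) < 1"
      using M[OF that(2,1)] u.nonneg[OF y(1)] by (simp add: field_simps)
    moreover have "u z ^ m \<ge> 0" using u.nonneg[OF z(1)] by simp
    ultimately show ?thesis by (simp add: algebra_simps)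
  qed
  consider "w z < 1" | "w z = 1" | "w z > 1" by linarith
  then show ?case
  proof cases
    case 1
    then show ?thesis using z by auto
  next
    case 2
    define m where "m = Suc M"
    have K': "z ^ m * y \<in> K" using z y by (simp add: subfield_closed[OF K])
    have "v z ^ m * v y > 1"
      using z y by (metis less_1_mult one_less_power zero_less_Suc m_def)
    then have "v (z ^ m * y) > 1"
      using z y by (simp add: v.mult v.power subfield_power[OF K])
    moreover have "w (z ^ m * y) < 1"
      using 2 y z by (simp add: w.mult w.power subfield_power[OF K])
    moreover have "u (z ^ m * y) < 1" if "u \<in> J" for u
    proof -
      interpret u: nonarch K u using na[OF that] .
      have "m \<ge> M" by (simp add: m_def)
      then show ?thesis using yz[OF that, of m] z y by (simp add: u.mult u.power subfield_power[OF K])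
    qed
    ultimately show ?thesis using K' by auto
  next
    case 3
    define m where "m = Suc M"
    have m: "m > 0" by (simp add: m_def)
    define e where "e = z ^ m / (1 + z ^ m)"
    have e: "e \<in> K" using z by (simp add: e_def subfield_closed[OF K])
    have K': "e * y \<in> K" using e y by (simp add: subfield_closed[OF K])
    have "v e = 1" "w e = 1"
      using v.power_ratio_large(2)[OF z(1,2) m] w.power_ratio_large(2)[OF z(1) 3 m] by (simp_all add: e_def)
    then have "v (e * y) > 1" "w (e * y) < 1"
      using y e by (simp_all add: v.mult w.mult)
    moreover have "u (e * y) < 1" if "u \<in> J" for u
    proof -
      interpret u: nonarch K u using na[OF that] .
      have "u e * u y \<le> u z ^ m * u y"
        using u.power_ratio_small[OF z(1) _ m] z(3) that u.nonneg[OF y(1)] by (auto simp: e_def intro: mult_right_mono)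
      then show ?thesis using yz[OF that, of m] e y by (simp add: u.mult m_def)
    qed
    ultimately show ?thesis using K' by auto
  qed
qed

text \<open>For the \<open>z\<close> of the preceding lemma, the quotient \<open>z\<^sup>m / (1 + z\<^sup>m)\<close> tends to \<open>1\<close> at \<open>v\<close> and to \<open>0\<close> at the
  places in \<open>J\<close>.\<close>

lemma finite_places_near_idempotent:
  assumes K: "is_subfield K" and J: "finite J" "J \<subseteq> finite_places K" and v: "v \<in> finite_places K" "v \<notin> J"
    and "\<epsilon> > 0"
  shows "\<exists>e\<in>K. v (e - 1) < \<epsilon> \<and> (\<forall>u\<in>J. u e < \<epsilon>)"
proof -
  obtain z where z: "z \<in> K" "v z > 1" "\<forall>u\<in>J. u z < 1"
    using finite_places_dominate[OF K J v] by blast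
  interpret v: nonarch K v using finite_place_nonarch[OF K v(1)] .
  have na: "nonarch K u" if "u \<in> J" for u using finite_place_nonarch[OF K] that J by auto
  have "\<exists>M. \<forall>m\<ge>M. u z ^ m < \<epsilon>" if "u \<in> J" for u
  proof -
    interpret u: nonarch K u using na[OF that] .
    show ?thesis using power_small[of "u z" \<epsilon>] z that u.nonneg[OF z(1)] assms by metis
  qed
  then obtain M where M: "\<And>m u. m \<ge> M \<Longrightarrow> u \<in> J \<Longrightarrow> u z ^ m < \<epsilon>"
    using finite_places_eventually[OF J(1), of "\<lambda>u m. u z ^ m < \<epsilon>"] by blast
  obtain M' where M': "\<And>m. m \<ge> M' \<Longrightarrow> (1 / v z) ^ m < \<epsilon>"
    using power_small[of "1 / v z" \<epsilon>] z assms by auto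
  define m where "m = Suc (max M M')"
  have m: "m > 0" "m \<ge> M" "m \<ge> M'" by (auto simp: m_def)
  have "z ^ m / (1 + z ^ m) \<in> K" using z by (simp add: subfield_closed[OF K])
  moreover have "v (z ^ m / (1 + z ^ m) - 1) < \<epsilon>"
    using v.power_ratio_large(1)[OF z(1,2) m(1)] M'[OF m(3)] by linarith
  moreover have "u (z ^ m / (1 + z ^ m)) < \<epsilon>" if "u \<in> J" for u
    using nonarch.power_ratio_small(1)[OF na[OF that] z(1) _ m(1)] z(3) that M[OF m(2) that] by fastforce
  ultimately show ?thesis by blast
qed

text \<open>The approximation is \<open>\<Sum>v\<in>J. e v * y v\<close> for near-idempotents \<open>e v\<close> that are close enough to \<open>1\<close> at \<open>v\<close>
  and to \<open>0\<close> at the other places to compensate for the size of the \<open>y v\<close>.\<close>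

theorem weak_approximation:
  assumes K: "is_subfield K" and J: "finite J" "J \<subseteq> finite_places K"
    and y: "\<And>v. v \<in> J \<Longrightarrow> y v \<in> K" and "\<epsilon> > 0"
  obtains x where "x \<in> K" "\<And>v. v \<in> J \<Longrightarrow> v (x - y v) < \<epsilon>"
proof -
  have na: "nonarch K u" if "u \<in> J" for u using finite_place_nonarch[OF K] that J by auto
  define M where "M = (\<Sum>u\<in>J. \<Sum>v\<in>J. u (y v)) + 1"
  have nn: "u (y v) \<ge> 0" if "u \<in> J" "v \<in> J" for u v using nonarch.nonneg[OF na] y that by blast
  have M: "u (y v) < M" if "u \<in> J" "v \<in> J" for u v
  proof -
    have "u (y v) \<le> (\<Sum>v\<in>J. u (y v))" by (rule member_le_sum) (use that nn J in auto)
    also have "\<dots> \<le> (\<Sum>u\<in>J. \<Sum>v\<in>J. u (y v))"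
      by (rule member_le_sum) (use that nn J in \<open>auto intro: sum_nonneg\<close>)
    finally show ?thesis by (simp add: M_def)
  qed
  have M0: "M > 0" unfolding M_def by (intro add_nonneg_pos sum_nonneg) (use nn in auto)
  have "\<exists>e\<in>K. v (e - 1) < \<epsilon> / M \<and> (\<forall>u\<in>J - {v}. u e < \<epsilon> / M)" if "v \<in> J" for v
    by (rule finite_places_near_idempotent[OF K]) (use J that assms(5) M0 in auto)
  then obtain e where e: "\<And>v. v \<in> J \<Longrightarrow> e v \<in> K" "\<And>v. v \<in> J \<Longrightarrow> v (e v - 1) < \<epsilon> / M"
    "\<And>v u. v \<in> J \<Longrightarrow> u \<in> J \<Longrightarrow> u \<noteq> v \<Longrightarrow> u (e v) < \<epsilon> / M"
    by (metis Diff_iff singletonD)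
  define x where "x = (\<Sum>v\<in>J. e v * y v)"
  have "x \<in> K" unfolding x_def by (intro subfield_sum[OF K] subfield_mult[OF K]) (use e y in auto)
  moreover have "v (x - y v) < \<epsilon>" if that: "v \<in> J" for v
  proof -
    interpret v: nonarch K v using na[OF that] .
    have "x - y v = (\<Sum>u\<in>J. (e u - (if u = v then 1 else 0)) * y u)"
    proof -
      have "(\<Sum>u\<in>J. (e u - (if u = v then 1 else 0)) * y u) = x - (\<Sum>u\<in>J. if u = v then y u else 0)"
        unfolding x_def sum_subtractf[symmetric] by (rule sum.cong) (auto simp: algebra_simps)
      then show ?thesis using that J by simp
    qed
    also have "v \<dots> < \<epsilon>"
    proof (rule v.sum_less)
      fix u assume u: "u \<in> J"
      let ?c = "e u - (if u = v then 1 else 0)"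
      have c: "?c \<in> K" using e(1)[OF u] by (auto simp: subfield_closed[OF K])
      then show "?c * y u \<in> K" using y[OF u] by (simp add: subfield_mult[OF K])
      have "v ?c < \<epsilon> / M" using e(2)[OF u] e(3)[OF u that] by auto
      then have "v ?c * v (y u) \<le> \<epsilon> / M * v (y u)"
        using nn[OF that u] by (intro mult_right_mono) auto
      also have "\<dots> < \<epsilon> / M * M"
        using M[OF that u] M0 assms(5) by (intro mult_strict_left_mono) auto
      finally show "v (?c * y u) < \<epsilon>"
        using M0 c y[OF u] by (simp add: v.mult)
    qed (use assms in auto)
    finally show ?thesis .
  qed
  ultimately show ?thesis using that by blast
qed

section \<open>Finite places: counting incongruent elements\<close>

text \<open>A finite set of places of a number field replaces the ring of integers and its ideals:
  congruence modulo \<open>z\<close> means \<open>v (y - y') \<le> v z\<close> for all \<open>v \<in> J\<close>.\<close>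

locale places =
  fixes K :: "qbar set" and J :: "(qbar \<Rightarrow> real) set"
  assumes K: "is_subfield K" and finite_J: "finite J" and J: "J \<subseteq> finite_places K"
begin

definition integers :: "qbar set" where
  "integers = {y \<in> K. \<forall>v\<in>J. v y \<le> 1}"

definition incongruent :: "qbar \<Rightarrow> qbar set \<Rightarrow> bool" where
  "incongruent z Y \<longleftrightarrow> (\<forall>y\<in>Y. \<forall>y'\<in>Y. y \<noteq> y' \<longrightarrow> (\<exists>v\<in>J. v z < v (y - y')))"

lemma nonarch_J: "v \<in> J \<Longrightarrow> nonarch K v"
  using finite_place_nonarch[OF K] J by blast

end

text \<open>One element is chosen from each class of the relation that defines \<open>residue_card\<close>.\<close>

lemma residue_representatives:
  assumes K: "is_subfield K" and v: "v \<in> finite_places K"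
  obtains E where "finite E" "card E = residue_card K v" "\<And>r. r \<in> E \<Longrightarrow> r \<in> K \<and> v r \<le> 1"
    "\<And>r r'. r \<in> E \<Longrightarrow> r' \<in> E \<Longrightarrow> r \<noteq> r' \<Longrightarrow> v (r - r') = 1"
proof -
  interpret v: nonarch K v using finite_place_nonarch[OF K v] .
  let ?A = "{x \<in> K. v x \<le> 1}"
  let ?r = "{(x, y). x \<in> K \<and> y \<in> K \<and> v x \<le> 1 \<and> v y \<le> 1 \<and> v (x - y) < 1}"
  have eq: "equiv ?A ?r"
  proof (rule equivI)
    show "?r \<subseteq> ?A \<times> ?A" by auto
    show "refl_on ?A ?r" by (auto simp: refl_on_def v.zero)
    show "sym ?r" by (auto simp: sym_def v.minus_commute)
    show "trans ?r"
    proof (rule transI)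
      fix x y z assume *: "(x, y) \<in> ?r" "(y, z) \<in> ?r"
      then have "v (x - y + (y - z)) \<le> max (v (x - y)) (v (y - z))"
        by (intro v.add_le) (auto simp: subfield_diff[OF K])
      with * show "(x, z) \<in> ?r" by auto
    qed
  qed
  have card: "card (?A // ?r) = residue_card K v" by (simp add: residue_card_def)
  then have fin: "finite (?A // ?r)" using finite_place_card[OF v] by (intro card_ge_0_finite) simp
  define rep where "rep C = (SOME x. x \<in> C)" for C :: "qbar set"
  have rep: "rep C \<in> C" if "C \<in> ?A // ?r" for C
    using in_quotient_imp_non_empty[OF eq that] unfolding rep_def by (metis ex_in_conv someI_ex)
  have sub: "C \<subseteq> ?A" if "C \<in> ?A // ?r" for C using in_quotient_imp_subset[OF eq that] .
  have diff: "v (rep C - rep D) = 1" if "C \<in> ?A // ?r" "D \<in> ?A // ?r" "C \<noteq> D" for C D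
  proof -
    have A: "rep C \<in> ?A" "rep D \<in> ?A" using rep sub that by blast+
    have "(rep C, rep D) \<notin> ?r"
      using quotient_eq_iff[OF eq that(1,2) rep[OF that(1)] rep[OF that(2)]] that(3) by blast
    then have "v (rep C - rep D) \<ge> 1" using A by auto
    moreover have "v (rep C - rep D) \<le> 1" using A v.diff_le[of "rep C" "rep D"] by auto
    ultimately show ?thesis by simp
  qed
  have inj: "inj_on rep (?A // ?r)"
  proof (rule inj_onI, rule ccontr)
    fix C D assume *: "C \<in> ?A // ?r" "D \<in> ?A // ?r" "rep C = rep D" "C \<noteq> D"
    from diff[OF *(1,2,4)] *(3) show False by (simp add: v.zero)
  qed
  show ?thesis
  proof (rule that[of "rep ` (?A // ?r)"])
    show "finite (rep ` (?A // ?r))" using fin by simp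
    show "card (rep ` (?A // ?r)) = residue_card K v" using card_image[OF inj] card by simp
    show "r \<in> K \<and> v r \<le> 1" if "r \<in> rep ` (?A // ?r)" for r
      using that rep sub by blast
    show "v (r - r') = 1" if "r \<in> rep ` (?A // ?r)" "r' \<in> rep ` (?A // ?r)" "r \<noteq> r'" for r r'
      using that diff by auto
  qed
qed

text \<open>The elements are the digit expansions of length \<open>k\<close> in a uniformizer, with representatives of the
  residue classes as digits.\<close>

lemma incongruent_at_place:
  assumes K: "is_subfield K" and v: "v \<in> finite_places K"
  shows "\<exists>Y. finite Y \<and> card Y = residue_card K v ^ k \<and> (\<forall>y\<in>Y. y \<in> K \<and> v y \<le> 1) \<and>
    (\<forall>y\<in>Y. \<forall>y'\<in>Y. y \<noteq> y' \<longrightarrow> 1 / real (residue_card K v) ^ k < v (y - y'))"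
proof (induction k)
  case 0
  interpret v: nonarch K v using finite_place_nonarch[OF K v] .
  show ?case by (rule exI[of _ "{0}"]) (simp add: v.zero subfield_0[OF K])
next
  case (Suc k)
  interpret v: nonarch K v using finite_place_nonarch[OF K v] .
  define N where "N = real (residue_card K v)"
  have N: "N > 1" using finite_place_card[OF v] by (simp add: N_def)
  obtain Y where Y: "finite Y" "card Y = residue_card K v ^ k" "\<And>y. y \<in> Y \<Longrightarrow> y \<in> K \<and> v y \<le> 1"
    "\<And>y y'. y \<in> Y \<Longrightarrow> y' \<in> Y \<Longrightarrow> y \<noteq> y' \<Longrightarrow> 1 / N ^ k < v (y - y')"
    using Suc by (auto simp: N_def)
  obtain E where E: "finite E" "card E = residue_card K v" "\<And>r. r \<in> E \<Longrightarrow> r \<in> K \<and> v r \<le> 1"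
    "\<And>r r'. r \<in> E \<Longrightarrow> r' \<in> E \<Longrightarrow> r \<noteq> r' \<Longrightarrow> v (r - r') = 1"
    using residue_representatives[OF K v] by blast
  obtain \<pi> where \<pi>: "\<pi> \<in> K" "\<pi> \<noteq> 0" "v \<pi> = 1 / N"
    using finite_place_uniformizer[OF v] by (auto simp: N_def)
  have pi1: "v \<pi> < 1" using \<pi> N by simp
  define h where "h = (\<lambda>(r, y). r + \<pi> * y)"
  have far: "1 / N ^ Suc k < v (h a - h b)" if "a \<in> E \<times> Y" "b \<in> E \<times> Y" "a \<noteq> b" for a b
  proof -
    obtain r y r' y' where ab: "a = (r, y)" "b = (r', y')" by (metis surj_pair)
    have in_K: "r \<in> K" "y \<in> K" "r' \<in> K" "y' \<in> K" "v y \<le> 1" "v y' \<le> 1"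
      using that ab E(3) Y(3) by auto
    have h: "h a - h b = (r - r') + \<pi> * (y - y')" by (simp add: h_def ab algebra_simps)
    have py: "v (\<pi> * (y - y')) = v (y - y') / N"
      using \<pi> in_K by (simp add: v.mult subfield_diff[OF K])
    show ?thesis
    proof (cases "r = r'")
      case True
      then have "1 / N ^ k < v (y - y')" using Y(4)[of y y'] that ab by auto
      then have "1 / N ^ k / N < v (y - y') / N" using N by (intro divide_strict_right_mono) auto
      then show ?thesis using h py True N by (simp add: mult.commute)
    next
      case False
      then have 1: "v (r - r') = 1" using E(4) that ab by auto
      have "v (y - y') \<le> 1" using v.diff_le[of y y'] in_K by simp
      then have "v (\<pi> * (y - y')) < 1" using py N by simp
      then have "v (h a - h b) = 1"
        unfolding h using v.add_eq_left[of "r - r'" "\<pi> * (y - y')"] 1 in_K \<pi> by (simp add: subfield_closed[OF K])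
      then show ?thesis using one_less_power[OF N, of "Suc k"] by simp
    qed
  qed
  have inj: "inj_on h (E \<times> Y)"
  proof (rule inj_onI, rule ccontr)
    fix a b assume *: "a \<in> E \<times> Y" "b \<in> E \<times> Y" "h a = h b" "a \<noteq> b"
    have "0 < 1 / N ^ Suc k" using N by simp
    with far[OF *(1,2,4)] *(3) show False by (simp add: v.zero)
  qed
  have "card (h ` (E \<times> Y)) = residue_card K v ^ Suc k"
    using card_image[OF inj] E(2) Y(2) by (simp add: card_cartesian_product)
  moreover have "y \<in> K \<and> v y \<le> 1" if y: "y \<in> h ` (E \<times> Y)" for y
  proof -
    obtain r z where rz: "r \<in> E" "z \<in> Y" "y = r + \<pi> * z" using y by (auto simp: h_def)
    then have in_K: "r \<in> K" "z \<in> K" "v r \<le> 1" "v z \<le> 1" using E(3) Y(3) by auto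
    have "v (\<pi> * z) \<le> 1" using mult_le_one[of "v \<pi>" "v z"] pi1 in_K \<pi>(1) v.nonneg[OF in_K(2)] by (simp add: v.mult)
    then show ?thesis using v.add_le[of r "\<pi> * z"] in_K \<pi> rz by (auto simp: subfield_closed[OF K])
  qed
  moreover have "1 / N ^ Suc k < v (y - y')" if "y \<in> h ` (E \<times> Y)" "y' \<in> h ` (E \<times> Y)" "y \<noteq> y'" for y y'
    using that far by auto
  ultimately show ?case using E(1) Y(1) unfolding N_def by (intro exI[of _ "h ` (E \<times> Y)"]) auto
qed

context places
begin

text \<open>The digit expansions at the single places are glued by weak approximation.\<close>

lemma many_incongruent:
  assumes z: "z \<in> K" "z \<noteq> 0" "\<And>v. v \<in> J \<Longrightarrow> v z \<le> 1"
  obtains Y where "finite Y" "Y \<subseteq> integers" "incongruent z Y" "real (card Y) = (\<Prod>v\<in>J. 1 / v z)"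
proof -
  have "\<exists>Y. finite Y \<and> real (card Y) = 1 / v z \<and> (\<forall>y\<in>Y. y \<in> K \<and> v y \<le> 1) \<and>
    (\<forall>y\<in>Y. \<forall>y'\<in>Y. y \<noteq> y' \<longrightarrow> v z < v (y - y'))" if v: "v \<in> J" for v
  proof -
    define N where "N = real (residue_card K v)"
    have N: "N > 1" using finite_place_card J v by (auto simp: N_def)
    obtain k where k: "v z = N powi k" using finite_place_value[of v K z] z J v by (auto simp: N_def)
    have "k \<le> 0"
      using z(3)[OF v] k power_int_strict_increasing[of 0 k N] N by (cases "k > 0") auto
    then have vz: "v z = 1 / N ^ nat (- k)" using k by (auto simp: power_int_def field_simps)
    show ?thesis
      using incongruent_at_place[OF K, of v "nat (- k)"] J v unfolding vz N_def by auto
  qed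
  then obtain Y where Y: "\<And>v. v \<in> J \<Longrightarrow> finite (Y v)" "\<And>v. v \<in> J \<Longrightarrow> real (card (Y v)) = 1 / v z"
    "\<And>v y. v \<in> J \<Longrightarrow> y \<in> Y v \<Longrightarrow> y \<in> K \<and> v y \<le> 1"
    "\<And>v y y'. v \<in> J \<Longrightarrow> y \<in> Y v \<Longrightarrow> y' \<in> Y v \<Longrightarrow> y \<noteq> y' \<Longrightarrow> v z < v (y - y')"
    by metis
  define \<delta> where "\<delta> = Min (insert 1 ((\<lambda>v. v z) ` J))"
  have \<delta>: "\<delta> > 0" "\<delta> \<le> 1" "\<And>v. v \<in> J \<Longrightarrow> \<delta> \<le> v z"
    unfolding \<delta>_def using finite_J nonarch.pos[OF nonarch_J z(1,2)] by auto
  let ?F = "PiE J Y"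
  have "\<exists>x\<in>K. \<forall>v\<in>J. v (x - f v) < \<delta>" if "f \<in> ?F" for f
    using weak_approximation[OF K finite_J J, of f \<delta>] Y(3) that \<delta>(1) by (metis PiE_mem)
  then obtain x where x: "\<And>f. f \<in> ?F \<Longrightarrow> x f \<in> K" "\<And>f v. f \<in> ?F \<Longrightarrow> v \<in> J \<Longrightarrow> v (x f - f v) < \<delta>"
    by metis
  have far: "\<exists>v\<in>J. v z < v (x f - x g)" if fg: "f \<in> ?F" "g \<in> ?F" "f \<noteq> g" for f g
  proof -
    obtain v where v: "v \<in> J" "f v \<noteq> g v" using fg by (meson PiE_ext)
    interpret v: nonarch K v using nonarch_J[OF v(1)] .
    have m: "f v \<in> Y v" "g v \<in> Y v" using fg v by auto
    then have K': "f v \<in> K" "g v \<in> K" using Y(3) v by auto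
    have "v z < v (f v - g v)" using Y(4)[OF v(1) m v(2)] .
    also have "f v - g v = (x g - g v) - (x f - f v) + (x f - x g)" by simp
    also have "v \<dots> \<le> max (max (v (x g - g v)) (v (x f - f v))) (v (x f - x g))"
      using x fg K' by (intro order_trans[OF v.add_le] max.mono v.diff_le) (auto simp: subfield_diff[OF K])
    finally have "v z < v (x f - x g)"
      using x(2)[OF fg(1) v(1)] x(2)[OF fg(2) v(1)] \<delta>(3)[OF v(1)] by auto
    then show ?thesis using v by blast
  qed
  have inj: "inj_on x ?F"
  proof (rule inj_onI, rule ccontr)
    fix f g assume *: "f \<in> ?F" "g \<in> ?F" "x f = x g" "f \<noteq> g"
    from far[OF *(1,2,4)] *(3) z nonarch.nonneg[OF nonarch_J z(1)] nonarch.zero[OF nonarch_J]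
    show False by (metis diff_self not_le)
  qed
  show ?thesis
  proof (rule that[of "x ` ?F"])
    show "finite (x ` ?F)" using finite_PiE[OF finite_J] Y(1) by blast
    show "real (card (x ` ?F)) = (\<Prod>v\<in>J. 1 / v z)"
      using card_image[OF inj] Y(2) by (simp add: card_PiE[OF finite_J])
    show "incongruent z (x ` ?F)"
      unfolding incongruent_def using far by auto
    show "x ` ?F \<subseteq> integers"
    proof
      fix y assume "y \<in> x ` ?F"
      then obtain f where f: "f \<in> ?F" "y = x f" by blast
      have "v (x f) \<le> 1" if v: "v \<in> J" for v
      proof -
        interpret v: nonarch K v using nonarch_J[OF v] .
        have "f v \<in> K \<and> v (f v) \<le> 1" using Y(3)[OF v] f v by auto
        then show ?thesis
          using v.add_le[of "x f - f v" "f v"] x(1)[OF f(1)] x(2)[OF f(1) v] \<delta>(2) by (auto simp: subfield_diff[OF K])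
      qed
      then show "y \<in> integers" using x(1) f by (auto simp: integers_def)
    qed
  qed
qed

lemma horner_in_integers:
  assumes "z \<in> integers" "set ys \<subseteq> integers"
  shows "horner_sum (\<lambda>a. a) z ys \<in> integers"
  using assms(2)
proof (induction ys)
  case Nil
  have "v 0 \<le> 1" if "v \<in> J" for v using nonarch.zero[OF nonarch_J[OF that]] by simp
  then show ?case using subfield_0[OF K] by (simp add: integers_def)
next
  case (Cons y ys)
  then have in_K: "z \<in> K" "y \<in> K" "horner_sum (\<lambda>a. a) z ys \<in> K" using assms(1) by (auto simp: integers_def)
  have "v (y + z * horner_sum (\<lambda>a. a) z ys) \<le> 1" if v: "v \<in> J" for v
  proof -
    interpret v: nonarch K v using nonarch_J[OF v] .
    have "v z * v (horner_sum (\<lambda>a. a) z ys) \<le> 1"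
      using Cons assms(1) v v.nonneg in_K by (auto simp: integers_def intro!: mult_le_one)
    then show ?thesis
      using v.add_le[of y "z * horner_sum (\<lambda>a. a) z ys"] in_K Cons v
      by (auto simp: v.mult subfield_mult[OF K] integers_def)
  qed
  then show ?case using in_K by (auto simp: integers_def subfield_closed[OF K])
qed

text \<open>Distinct digit strings over an incongruent set stay incongruent modulo a power of the base.
  Comparing the number of digit strings with a bound that grows like \<open>B\<^sup>M\<close> therefore shows that an
  incongruent set has at most \<open>B\<close> elements.\<close>

lemma horner_incongruent:
  assumes z: "z \<in> integers" "z \<noteq> 0" and Y: "Y \<subseteq> integers" "incongruent z Y"
    and "set ys \<subseteq> Y" "set zs \<subseteq> Y" "length ys = length zs" "ys \<noteq> zs"
  shows "\<exists>v\<in>J. v z ^ length ys < v (horner_sum (\<lambda>a. a) z ys - horner_sum (\<lambda>a. a) z zs)"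
  using assms(7,5,6,8)
proof (induction ys zs rule: list_induct2)
  case (Cons y ys y' zs)
  let ?d = "horner_sum (\<lambda>a. a) z ys - horner_sum (\<lambda>a. a) z zs"
  have int: "horner_sum (\<lambda>a. a) z ys \<in> integers" "horner_sum (\<lambda>a. a) z zs \<in> integers" "y \<in> integers" "y' \<in> integers"
    using Cons.prems Y(1) by (auto intro!: horner_in_integers[OF z(1)])
  then have in_K: "?d \<in> K" "z \<in> K" "y \<in> K" "y' \<in> K" "horner_sum (\<lambda>a. a) z ys \<in> K" "horner_sum (\<lambda>a. a) z zs \<in> K"
    using z by (auto simp: integers_def subfield_diff[OF K])
  have eq: "horner_sum (\<lambda>a. a) z (y # ys) - horner_sum (\<lambda>a. a) z (y' # zs) = (y - y') + z * ?d"
    by (simp add: algebra_simps)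
  show ?case
  proof (cases "y = y'")
    case True
    then obtain v where v: "v \<in> J" "v z ^ length ys < v ?d" using Cons by auto
    interpret v: nonarch K v using nonarch_J[OF v(1)] .
    have "v z > 0" using v.pos in_K z(2) by blast
    then have "v z ^ length (y # ys) < v (z * ?d)"
      using v(2) in_K by (simp add: v.mult)
    then show ?thesis using v(1) eq True by auto
  next
    case False
    obtain v where v: "v \<in> J" "v z < v (y - y')"
      using Y(2) Cons.prems(1,2) False unfolding incongruent_def by (metis list.set_intros(1) subsetD)
    interpret v: nonarch K v using nonarch_J[OF v(1)] .
    have "v (horner_sum (\<lambda>a. a) z ys) \<le> 1" "v (horner_sum (\<lambda>a. a) z zs) \<le> 1"
      using int v(1) by (auto simp: integers_def)
    then have "v ?d \<le> 1" using v.diff_le[OF in_K(5,6)] by linarith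
    then have "v (z * ?d) \<le> v z" using in_K v.nonneg by (simp add: v.mult mult_left_le)
    then have "v (y - y' + z * ?d) = v (y - y')"
      using v in_K by (intro v.add_eq_left) (auto simp: subfield_closed[OF K])
    moreover have "v z ^ length (y # ys) \<le> v z"
      using z v(1) v.nonneg[OF in_K(2)] by (auto simp: integers_def mult_left_le power_le_one)
    ultimately have "v z ^ length (y # ys) < v (horner_sum (\<lambda>a. a) z (y # ys) - horner_sum (\<lambda>a. a) z (y' # zs))"
      unfolding eq using v(2) by linarith
    then show ?thesis using v(1) by blast
  qed
qed simp

lemma card_le_of_digit_count:
  assumes z: "z \<in> integers" "z \<noteq> 0" and Y: "Y \<subseteq> integers" "incongruent z Y" "finite Y"
    and T: "\<And>M. finite (T M)" "\<And>M ys. set ys \<subseteq> Y \<Longrightarrow> length ys = M \<Longrightarrow> \<Phi> M ys \<in> T M"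
    and \<Phi>: "\<And>M ys zs v. set ys \<subseteq> Y \<Longrightarrow> set zs \<subseteq> Y \<Longrightarrow> length ys = M \<Longrightarrow> length zs = M \<Longrightarrow> v \<in> J \<Longrightarrow>
       \<Phi> M ys = \<Phi> M zs \<Longrightarrow> v (horner_sum (\<lambda>a. a) z ys - horner_sum (\<lambda>a. a) z zs) \<le> v z ^ M"
    and B: "\<And>M. real (card (T M)) \<le> C * B ^ M" "B > 0"
  shows "real (card Y) \<le> B"
proof (rule ccontr)
  assume "\<not> real (card Y) \<le> B"
  then have "real (card Y) / B > 1" using B by (simp add: field_simps)
  moreover have "(real (card Y) / B) ^ M \<le> C" for M
  proof -
    let ?L = "{ys. set ys \<subseteq> Y \<and> length ys = M}"
    have "inj_on (\<Phi> M) ?L"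
    proof (rule inj_onI, rule ccontr)
      fix ys zs assume *: "ys \<in> ?L" "zs \<in> ?L" "\<Phi> M ys = \<Phi> M zs" "ys \<noteq> zs"
      from * horner_incongruent[OF z Y(1,2), of ys zs]
      obtain v where "v \<in> J" "v z ^ M < v (horner_sum (\<lambda>a. a) z ys - horner_sum (\<lambda>a. a) z zs)" by auto
      with \<Phi>[of ys zs M v] * show False by auto
    qed
    then have "card ?L \<le> card (T M)"
      by (rule card_inj_on_le) (use T in auto)
    then have "real (card Y) ^ M \<le> C * B ^ M"
      using card_lists_length_eq[OF Y(3), of M] B(1)[of M] by (simp flip: of_nat_power)
    then show ?thesis using B(2) by (simp add: power_divide field_simps)
  qed
  ultimately show False using real_arch_pow[of "real (card Y) / B" C] by (meson not_le)
qed

lemma integers_in_K: "y \<in> integers \<Longrightarrow> y \<in> K"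
  and integers_le: "y \<in> integers \<Longrightarrow> v \<in> J \<Longrightarrow> v y \<le> 1"
  by (auto simp: integers_def)

lemma integers_add: assumes "x \<in> integers" "y \<in> integers" shows "x + y \<in> integers"
  using assms nonarch.add_le[OF nonarch_J, of _ x y] unfolding integers_def
  by (auto simp: subfield_add[OF K]) (meson le_max_iff_disj max.bounded_iff order_trans)

lemma integers_mult: assumes "x \<in> integers" "y \<in> integers" shows "x * y \<in> integers"
proof -
  have "v (x * y) \<le> 1" if "v \<in> J" for v
  proof -
    interpret v: nonarch K v using nonarch_J[OF that] .
    show ?thesis
      using assms that v.nonneg mult_le_one[of "v x" "v y"] by (simp add: integers_def v.mult)
  qed
  then show ?thesis using assms by (simp add: integers_def subfield_mult[OF K])
qed

lemma integers_of_int: "of_int n \<in> integers"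
  using nonarch.of_int_le[OF nonarch_J] by (auto simp: integers_def subfield_of_int[OF K])

lemma integers_poly: "w \<in> integers \<Longrightarrow> poly (map_poly of_int h) w \<in> integers"
proof (induction h)
  case 0
  show ?case using integers_of_int[of 0] by simp
qed (auto simp: map_poly_pCons intro!: integers_add integers_mult integers_of_int)

text \<open>For a rational integer as modulus, digit strings are counted by their coordinates with
  respect to a basis: these have a fixed denominator and grow like the modulus to the power \<open>M\<close>.\<close>

lemma card_incongruent_integer:
  assumes B: "finite B" "Q.independent B" "Q.span B = K" and L: "L > 0"
    and Y: "Y \<subseteq> integers" "incongruent (of_nat L) Y" "finite Y"
  shows "card Y \<le> L ^ card B"
proof (cases "L = 1")
  case True
  have "y = y'" if "y \<in> Y" "y' \<in> Y" for y y'
  proof (rule ccontr)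
    assume "y \<noteq> y'"
    then obtain v where v: "v \<in> J" "v 1 < v (y - y')"
      using Y(2)[unfolded incongruent_def, rule_format, OF \<open>y \<in> Y\<close> \<open>y' \<in> Y\<close> \<open>y \<noteq> y'\<close>] True by force
    interpret v: nonarch K v using nonarch_J[OF v(1)] .
    have "v (y - y') \<le> max (v y) (v y')"
      using that Y(1) by (intro v.diff_le integers_in_K) auto
    also have "\<dots> \<le> 1" using that Y(1) integers_le v(1) by auto
    finally show False using v(2) v.one by simp
  qed
  then have "card Y \<le> Suc 0" using card_le_Suc0_iff_eq[OF Y(3)] by blast
  then show ?thesis using True by simp
next
  case False
  then have L2: "L \<ge> 2" using L by simp
  let ?H = "horner_sum (\<lambda>a. a) (of_nat L :: qbar)"
  define r where "r = Q.representation B"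
  have "\<exists>q::nat. q > 0 \<and> (\<forall>i\<in>Y \<times> B. of_nat q * (case i of (y, b) \<Rightarrow> r y b) \<in> \<int>)"
    using common_denominator[OF finite_cartesian_product[OF Y(3) B(1)], of "\<lambda>(y, b). r y b"] by metis
  then obtain q :: nat where q: "q > 0" "\<And>y b. y \<in> Y \<Longrightarrow> b \<in> B \<Longrightarrow> of_nat q * r y b \<in> \<int>"
    by auto
  define G where "G = (\<Sum>y\<in>Y. \<Sum>b\<in>B. nat \<lceil>\<bar>of_nat q * r y b\<bar>\<rceil>)"
  have G: "\<bar>of_nat q * r y b\<bar> \<le> of_nat G" if "y \<in> Y" "b \<in> B" for y b
  proof -
    have "nat \<lceil>\<bar>of_nat q * r y b\<bar>\<rceil> \<le> (\<Sum>b\<in>B. nat \<lceil>\<bar>of_nat q * r y b\<bar>\<rceil>)"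
      by (rule member_le_sum) (use that B in auto)
    also have "\<dots> \<le> G" unfolding G_def by (rule member_le_sum) (use that Y in auto)
    finally have "rat_of_nat (nat \<lceil>\<bar>of_nat q * r y b\<bar>\<rceil>) \<le> of_nat G" by simp
    then show ?thesis using real_nat_ceiling_ge by (meson of_nat_ceiling order_trans)
  qed
  have in_K: "?H ys \<in> K" if "set ys \<subseteq> Y" for ys
    using horner_in_integers[of "of_nat L" ys] that Y(1) integers_in_K integers_of_int[of "int L"] by auto
  have coord: "of_nat q * r (?H ys) b \<in> \<int> \<and> \<bar>of_nat q * r (?H ys) b\<bar> \<le> of_nat G * (of_nat L ^ length ys - 1)"
    if "set ys \<subseteq> Y" "b \<in> B" for ys b
    using that
  proof (induction ys)
    case Nil
    then show ?case by (simp add: r_def Q.representation_zero)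
  next
    case (Cons y ys)
    have m: "y \<in> K" "?H ys \<in> K" "y \<in> Y" using Cons.prems in_K Y(1) integers_in_K by auto
    have rep: "r (?H (y # ys)) b = r y b + of_nat L * r (?H ys) b"
    proof -
      have s: "y \<in> Q.span B" "?H ys \<in> Q.span B" using m B(3) by auto
      have e: "?H (y # ys) = y + of_rat (of_nat L) * ?H ys" by simp
      have 1: "Q.representation B (y + of_rat (of_nat L) * ?H ys) =
          (\<lambda>b. Q.representation B y b + Q.representation B (of_rat (of_nat L) * ?H ys) b)"
        by (rule Q.representation_add[OF B(2) Q.span_scale[OF s(2)] s(1)])
      have 2: "Q.representation B (of_rat (of_nat L) * ?H ys) = (\<lambda>b. of_nat L * Q.representation B (?H ys) b)"
        by (rule Q.representation_scale[OF B(2) s(2)])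
      show ?thesis unfolding r_def by (simp only: e 1 2)
    qed
    have IH: "of_nat q * r (?H ys) b \<in> \<int>" "\<bar>of_nat q * r (?H ys) b\<bar> \<le> of_nat G * (of_nat L ^ length ys - 1)"
      using Cons by auto
    have eq: "of_nat q * r (?H (y # ys)) b = of_nat q * r y b + of_nat L * (of_nat q * r (?H ys) b)"
      unfolding rep by (simp add: algebra_simps)
    have "\<bar>of_nat q * r (?H (y # ys)) b\<bar> \<le> \<bar>of_nat q * r y b\<bar> + of_nat L * \<bar>of_nat q * r (?H ys) b\<bar>"
      unfolding eq by (metis abs_mult abs_of_nat abs_triangle_ineq)
    also have "\<dots> \<le> of_nat G + of_nat L * (of_nat G * (of_nat L ^ length ys - 1))"
      by (intro add_mono mult_left_mono IH G m Cons.prems) auto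
    also have "\<dots> = of_nat G * (of_nat L ^ length (y # ys) - (of_nat L - 1))"
      by (simp add: algebra_simps)
    also have "\<dots> \<le> of_nat G * (of_nat L ^ length (y # ys) - 1)"
      using L2 by (intro mult_left_mono) auto
    finally show ?case
      unfolding eq using q(2)[OF m(3) Cons.prems(2)] IH(1) by (auto intro!: Ints_add Ints_mult[OF Ints_of_nat])
  qed
  define \<Phi> where "\<Phi> M ys = restrict (\<lambda>b. \<lfloor>of_nat q * r (?H ys) b\<rfloor>) B" for M :: nat and ys
  define T where "T M = PiE B (\<lambda>_. {- int (G * L ^ M)..int (G * L ^ M)})" for M
  have "real (card Y) \<le> real (L ^ card B)"
  proof (rule card_le_of_digit_count[where z = "of_nat L" and T = T and \<Phi> = \<Phi> and C = "real ((2 * G + 1) ^ card B)"])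
    show "of_nat L \<in> integers" using integers_of_int[of "int L"] by simp
    show "finite (T M)" for M unfolding T_def using B(1) by (intro finite_PiE) auto
    show "\<Phi> M ys \<in> T M" if "set ys \<subseteq> Y" "length ys = M" for M ys
    proof -
      have "\<lfloor>of_nat q * r (?H ys) b\<rfloor> \<in> {- int (G * L ^ M)..int (G * L ^ M)}" if b: "b \<in> B" for b
      proof -
        obtain k :: int where k: "of_nat q * r (?H ys) b = of_int k"
          using coord[OF \<open>set ys \<subseteq> Y\<close> b] by (auto elim: Ints_cases)
        have "\<bar>of_int k :: rat\<bar> \<le> of_nat G * (of_nat L ^ length ys - 1)"
          using coord[OF \<open>set ys \<subseteq> Y\<close> b] unfolding k by blast
        also have "\<dots> \<le> of_nat G * of_nat L ^ length ys" by (intro mult_left_mono) auto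
        also have "\<dots> = of_int (int (G * L ^ M))" using \<open>length ys = M\<close> by simp
        finally have "\<bar>k\<bar> \<le> int (G * L ^ M)" by (metis of_int_abs of_int_le_iff)
        then show ?thesis unfolding k by auto
      qed
      then show ?thesis unfolding T_def \<Phi>_def by auto
    qed
    show "v (?H ys - ?H zs) \<le> v (of_nat L) ^ M"
      if "set ys \<subseteq> Y" "set zs \<subseteq> Y" "v \<in> J" "\<Phi> M ys = \<Phi> M zs" for M ys zs v
    proof -
      interpret v: nonarch K v using nonarch_J[OF that(3)] .
      have "r (?H ys) b = r (?H zs) b" if b: "b \<in> B" for b
      proof -
        have "\<lfloor>of_nat q * r (?H ys) b\<rfloor> = \<lfloor>of_nat q * r (?H zs) b\<rfloor>"
          using fun_cong[OF \<open>\<Phi> M ys = \<Phi> M zs\<close>, of b] b by (simp add: \<Phi>_def)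
        then have "of_nat q * r (?H ys) b = of_nat q * r (?H zs) b"
          using coord[OF \<open>set ys \<subseteq> Y\<close> b] coord[OF \<open>set zs \<subseteq> Y\<close> b] by (metis Ints_cases floor_of_int)
        then show ?thesis using q(1) by simp
      qed
      then have "(\<Sum>b\<in>B. of_rat (r (?H ys) b) * b) = (\<Sum>b\<in>B. of_rat (r (?H zs) b) * b)"
        by (intro sum.cong) auto
      moreover have "(\<Sum>b\<in>B. of_rat (r u b) * b) = u" if "u \<in> K" for u
        unfolding r_def by (rule Q.sum_representation_eq[OF B(2) _ B(1) subset_refl]) (simp add: that B(3))
      ultimately have "?H ys = ?H zs" using in_K[OF \<open>set ys \<subseteq> Y\<close>] in_K[OF \<open>set zs \<subseteq> Y\<close>] by simp
      then show ?thesis using v.zero v.nonneg[OF subfield_of_nat[OF K]] by simp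
    qed
    show "real (card (T M)) \<le> real ((2 * G + 1) ^ card B) * real (L ^ card B) ^ M" for M
    proof -
      have "card (T M) = (2 * (G * L ^ M) + 1) ^ card B"
      proof -
        have "card {- int k..int k} = 2 * k + 1" for k by simp
        then show ?thesis by (simp only: T_def card_PiE[OF B(1)] prod_constant)
      qed
      also have "\<dots> \<le> ((2 * G + 1) * L ^ M) ^ card B"
        using L by (intro power_mono) (auto simp: algebra_simps)
      also have "\<dots> = (2 * G + 1) ^ card B * (L ^ card B) ^ M"
        by (simp only: power_mult_distrib power_mult[symmetric] mult.commute[of M])
      finally have "real (card (T M)) \<le> real ((2 * G + 1) ^ card B * (L ^ card B) ^ M)" by (rule of_nat_mono)
      then show ?thesis by (simp only: of_nat_mult of_nat_power)
    qed
  qed (use L Y in auto)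
  then show ?thesis by (simp only: of_nat_le_iff)
qed

text \<open>An incongruent set of maximal size represents all congruence classes; the preceding bound shows
  that a maximal size exists.\<close>

lemma residue_system:
  assumes B: "finite B" "Q.independent B" "Q.span B = K" and L: "L > 0"
  obtains Y0 where "finite Y0" "\<And>y. y \<in> integers \<Longrightarrow> \<exists>y0\<in>Y0. \<forall>v\<in>J. v (y - y0) \<le> v (of_nat L)" "Y0 \<subseteq> integers"
proof -
  define P where "P n \<longleftrightarrow> (\<exists>Y. finite Y \<and> Y \<subseteq> integers \<and> incongruent (of_nat L) Y \<and> card Y = n)" for n
  have "P 0" unfolding P_def by (rule exI[of _ "{}"]) (auto simp: incongruent_def)
  moreover have "\<forall>n. P n \<longrightarrow> n \<le> L ^ card B"
    unfolding P_def using card_incongruent_integer[OF B L] by blast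
  ultimately obtain n where n: "P n" "\<And>m. P m \<Longrightarrow> m \<le> n"
    using Nat.ex_has_greatest_nat[of P 0 "L ^ card B"] by blast
  then obtain Y where Y: "finite Y" "Y \<subseteq> integers" "incongruent (of_nat L) Y" "card Y = n"
    unfolding P_def by blast
  have "\<exists>y0\<in>Y. \<forall>v\<in>J. v (y - y0) \<le> v (of_nat L)" if y: "y \<in> integers" for y
  proof (rule ccontr)
    assume "\<not> ?thesis"
    then have far: "\<exists>v\<in>J. v (of_nat L) < v (y - y0)" if "y0 \<in> Y" for y0 using that by (auto simp: not_le)
    have "\<exists>v\<in>J. v (of_nat L) < v (y0 - y)" if y0: "y0 \<in> Y" for y0
    proof -
      obtain v where v: "v \<in> J" "v (of_nat L) < v (y - y0)" using far[OF y0] by blast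
      then have "v (of_nat L) < v (y0 - y)"
        using nonarch.minus_commute[OF nonarch_J[OF v(1)] integers_in_K[OF y] integers_in_K[of y0]] y0 Y(2) by auto
      then show ?thesis using v(1) by blast
    qed
    with far Y(3) have inc: "incongruent (of_nat L) (insert y Y)" by (auto simp: incongruent_def)
    have "y \<notin> Y"
    proof
      assume "y \<in> Y"
      from far[OF this] obtain v where v: "v \<in> J" "v (of_nat L) < v 0" by auto
      interpret v: nonarch K v using nonarch_J[OF v(1)] .
      show False using v v.zero v.nonneg[OF subfield_of_nat[OF K], of L] by simp
    qed
    then have "P (Suc n)" unfolding P_def using Y y inc by (intro exI[of _ "insert y Y"]) auto
    then show False using n(2) by fastforce
  qed
  then show ?thesis using that Y by blast
qed

text \<open>Division with remainder of the constant coefficient by \<open>c\<close>; the equation for \<open>w\<close> turns the multiple of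
  \<open>c\<close> into a multiple of \<open>w\<close>.\<close>

lemma base_expansion:
  fixes w :: qbar and c :: int
  assumes "c \<noteq> 0" "of_int c + w * poly (map_poly of_int F) w = 0"
  shows "\<exists>ds h'. length ds = M \<and> set ds \<subseteq> {0..<\<bar>c\<bar>} \<and>
    poly (map_poly of_int h) w = horner_sum of_int w ds + w ^ M * poly (map_poly of_int h') w"
proof (induction M arbitrary: h)
  case 0
  show ?case by (rule exI[of _ "[]"], rule exI[of _ h]) simp
next
  case (Suc M)
  obtain a h1 where h: "h = pCons a h1" by (cases h) auto
  define e where "e = sgn c * (a div \<bar>c\<bar>)"
  have a: "a = a mod \<bar>c\<bar> + e * c" unfolding e_def
    by (metis abs_sgn mod_div_mult_eq mult.assoc mult.commute)
  obtain ds h' where ds: "length ds = M" "set ds \<subseteq> {0..<\<bar>c\<bar>}"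
    "poly (map_poly of_int (h1 + smult (- e) F)) w = horner_sum of_int w ds + w ^ M * poly (map_poly of_int h') w"
    using Suc by blast
  have "poly (map_poly of_int h) w = of_int (a mod \<bar>c\<bar>) + of_int e * of_int c + w * poly (map_poly of_int h1) w"
    unfolding h by (subst a) (simp add: map_poly_pCons)
  also have "of_int c = - (w * poly (map_poly of_int F) w)" using assms(2) by (simp add: add_eq_0_iff)
  also have "of_int (a mod \<bar>c\<bar>) + of_int e * - (w * poly (map_poly of_int F) w) + w * poly (map_poly of_int h1) w =
     of_int (a mod \<bar>c\<bar>) + w * poly (map_poly of_int (h1 + smult (- e) F)) w"
    unfolding of_int_poly_add of_int_poly_smult by (simp add: algebra_simps)
  also have "\<dots> = horner_sum of_int w (a mod \<bar>c\<bar> # ds) + w ^ Suc M * poly (map_poly of_int h') w"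
    unfolding ds(3) by (simp add: algebra_simps)
  finally show ?case
    using ds(1,2) assms(1) by (intro exI[of _ "a mod \<bar>c\<bar> # ds"] exI[of _ h']) auto
qed

text \<open>For a modulus \<open>w\<close> that generates the field, every element of \<open>\<int>[w]\<close> has a \<open>w\<close>-adic expansion
  with digits below the constant term of an integral equation for \<open>w\<close>; the denominators needed to
  get from \<open>\<int>[w]\<close> to arbitrary elements cost only a bounded factor.\<close>

lemma card_incongruent_generator:
  assumes gen: "K = field_gen w" and w: "w \<in> integers" "w \<noteq> 0"
    and c: "c \<noteq> 0" "of_int c + w * poly (map_poly of_int F) w = 0"
    and Y: "Y \<subseteq> integers" "incongruent w Y" "finite Y"
  shows "int (card Y) \<le> \<bar>c\<bar>"
proof -
  let ?H = "horner_sum (\<lambda>a. a) w"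
  have "\<exists>(q::nat) g. q > 0 \<and> (\<forall>y\<in>Y. of_nat q * y = poly (map_poly of_int (g y :: int poly)) w)"
    using Y(3,1)
  proof induction
    case (insert y Y)
    then obtain q g where q: "q > 0" "\<forall>y\<in>Y. of_nat q * y = poly (map_poly of_int (g y :: int poly)) w" by auto
    obtain q' h where h: "q' > 0" "of_nat q' * y = poly (map_poly of_int h) w"
      using field_gen_as_poly[of y w] insert.prems integers_in_K gen by blast
    define g' where "g' x = (if x = y then smult (int q) h else smult (int q') (g x))" for x
    have "of_nat (q * q') * x = poly (map_poly of_int (g' x)) w" if "x \<in> insert y Y" for x
      using that q(2) h(2)
      by (auto simp: g'_def of_int_poly_smult simp flip: h(2)) 
    then show ?case using q(1) h(1) by (intro exI[of _ "q * q'"] exI[of _ g']) auto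
  qed (auto intro: exI[of _ 1])
  then obtain q :: nat and g where q: "q > 0"
    and g: "\<And>y. y \<in> Y \<Longrightarrow> of_nat q * y = poly (map_poly of_int (g y :: int poly)) w" by blast
  define G where "G ys = foldr (\<lambda>y h. g y + pCons 0 h) ys 0" for ys
  have G: "of_nat q * ?H ys = poly (map_poly of_int (G ys)) w" if "set ys \<subseteq> Y" for ys
    using that
  proof (induction ys)
    case (Cons y ys)
    have "of_nat q * ?H (y # ys) = of_nat q * y + w * (of_nat q * ?H ys)" by (simp add: algebra_simps)
    then show ?case using Cons g[of y] by (simp add: G_def of_int_poly_add map_poly_pCons)
  qed (simp add: G_def)
  obtain B where B: "finite B" "Q.independent B" "Q.span B = K"
    using field_gen_basis[of w] gen by metis
  obtain Y0 where Y0: "finite Y0" "\<And>y. y \<in> integers \<Longrightarrow> \<exists>y0\<in>Y0. \<forall>v\<in>J. v (y - y0) \<le> v (of_nat q)" "Y0 \<subseteq> integers"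
    using residue_system[OF B q] by blast
  then obtain cls where cls: "\<And>y. y \<in> integers \<Longrightarrow> cls y \<in> Y0"
    "\<And>y v. y \<in> integers \<Longrightarrow> v \<in> J \<Longrightarrow> v (y - cls y) \<le> v (of_nat q)" by metis
  obtain ds h' where ds: "\<And>M h. length (ds M h) = M" "\<And>M h. set (ds M h) \<subseteq> {0..<\<bar>c\<bar>}"
    "\<And>M h. poly (map_poly of_int h) w = horner_sum of_int w (ds M h) + w ^ M * poly (map_poly of_int (h' M h)) w"
    using base_expansion[OF c] by metis
  \<comment> \<open>A digit string is determined modulo \<open>w\<^sup>M\<close> by the first
    \<open>M\<close> digits of \<open>q\<close> times its value and by the class modulo
    \<open>q\<close> of the rest.\<close>
  define \<Phi> where "\<Phi> M ys = (ds M (G ys), cls (poly (map_poly of_int (h' M (G ys))) w))" for M ys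
  define T where "T M = {ds. set ds \<subseteq> {0..<\<bar>c\<bar>} \<and> length ds = M} \<times> Y0" for M
  have "real (card Y) \<le> real_of_int \<bar>c\<bar>"
  proof (rule card_le_of_digit_count[where z = w and T = T and \<Phi> = \<Phi> and C = "real (card Y0)"])
    show "finite (T M)" for M unfolding T_def using Y0(1) by (simp add: finite_lists_length_eq)
    show "\<Phi> M ys \<in> T M" for M ys
      unfolding T_def \<Phi>_def using ds cls(1) integers_poly[OF w(1)] by auto
    show "v (?H ys - ?H zs) \<le> v w ^ M"
      if "set ys \<subseteq> Y" "set zs \<subseteq> Y" "v \<in> J" "\<Phi> M ys = \<Phi> M zs" for M ys zs v
    proof -
      interpret v: nonarch K v using nonarch_J[OF that(3)] .
      define a b where "a = poly (map_poly of_int (h' M (G ys))) w" and "b = poly (map_poly of_int (h' M (G zs))) w"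
      have ab: "a \<in> integers" "b \<in> integers" using integers_poly[OF w(1)] by (auto simp: a_def b_def)
      have H: "?H ys \<in> K" "?H zs \<in> K" using that Y(1) by (auto intro!: integers_in_K horner_in_integers[OF w(1)])
      have ca: "cls a = cls b" using that(4) by (simp add: \<Phi>_def a_def b_def)
      have "of_nat q * (?H ys - ?H zs) = w ^ M * (a - b)"
        using that(4) ds(3)[of "G ys" M] ds(3)[of "G zs" M] unfolding G[OF that(1), symmetric] G[OF that(2), symmetric]
        by (simp add: \<Phi>_def a_def b_def algebra_simps)
      then have "v (of_nat q) * v (?H ys - ?H zs) = v w ^ M * v (a - b)"
        using H ab w integers_in_K
        by (metis K subfield_closed(3,9) subfield_of_nat v.mult v.power)
      also have "v (a - b) \<le> max (v (a - cls a)) (v (b - cls b))"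
        using v.diff_le[of "a - cls a" "b - cls b"] ca ab cls(1) Y0(3) integers_in_K by (simp add: subfield_diff[OF K] subset_iff)
      then have "v w ^ M * v (a - b) \<le> v w ^ M * v (of_nat q)"
        using cls(2)[OF ab(1) that(3)] cls(2)[OF ab(2) that(3)] v.nonneg[OF integers_in_K[OF w(1)]]
        by (intro mult_left_mono) auto
      finally show ?thesis
        using v.pos[OF subfield_of_nat[OF K], of q] q by (simp add: mult.commute)
    qed
    show "real (card (T M)) \<le> real (card Y0) * real_of_int \<bar>c\<bar> ^ M" for M
      unfolding T_def by (simp add: card_cartesian_product card_lists_length_eq)
  qed (use w c Y in auto)
  then show ?thesis by linarith
qed

end

text \<open>The places with \<open>v x > 1\<close> are those with \<open>v w < 1\<close> for \<open>w = 1/x\<close>. By weak approximation there are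
  \<open>\<Prod>v. 1 / v w\<close> incongruent elements modulo \<open>w\<close>. The reversed polynomial has constant term
  \<open>lead_coeff F\<close> and the root \<open>w\<close>, so it bounds the number of such elements.\<close>

theorem prod_finite_places_le_lead_coeff:
  assumes J: "finite J" "J \<subseteq> finite_places (field_gen x)"
    and F: "F \<noteq> 0" "poly (map_poly of_int F) x = 0"
  shows "(\<Prod>v\<in>J. max 1 (v x)) \<le> real_of_int \<bar>lead_coeff F\<bar>"
proof (cases "x = 0")
  case True
  have "max 1 (v x) = 1" if "v \<in> J" for v
    using True nonarch.zero[OF finite_place_nonarch[OF field_gen_subfield], of v x] J that by auto
  then have "(\<Prod>v\<in>J. max 1 (v x)) = 1" by (intro prod.neutral) blast
  moreover have "\<bar>lead_coeff F\<bar> \<ge> 1" using F(1) by (simp add: Ints_nonzero_abs_ge1 int_one_le_iff_zero_less)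
  ultimately show ?thesis by (metis of_int_1 of_int_le_iff)
next
  case False
  define J' where "J' = {v \<in> J. v x > 1}"
  interpret places "field_gen x" J'
    by unfold_locales (use J in \<open>auto simp: J'_def\<close>)
  define w where "w = inverse x"
  have w: "w \<in> field_gen x" "w \<noteq> 0" using False by (auto simp: w_def subfield_inverse)
  have vw: "v w = 1 / v x" if "v \<in> J'" for v
    using nonarch.inverse[OF nonarch_J[OF that], of x] by (simp add: w_def inverse_eq_divide)
  have le: "v w \<le> 1" if "v \<in> J'" for v using vw[OF that] that by (simp add: J'_def)
  have "\<exists>Y. finite Y \<and> Y \<subseteq> integers \<and> incongruent w Y \<and> real (card Y) = (\<Prod>v\<in>J'. 1 / v w)"
  proof (rule many_incongruent[of w])
    show "v w \<le> 1" if "v \<in> J'" for v by (rule le[OF that])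
  qed (use w in auto)
  then obtain Y where Y: "finite Y" "Y \<subseteq> integers" "incongruent w Y" "real (card Y) = (\<Prod>v\<in>J'. 1 / v w)"
    by blast
  obtain F1 where F1: "reflect_poly F = pCons (lead_coeff F) F1"
    by (metis coeff_0_reflect_poly pCons_cases coeff_pCons_0)
  have "poly (map_poly of_int (reflect_poly F)) w = 0"
  proof -
    have "map_poly of_int (reflect_poly F) = reflect_poly (map_poly of_int F :: qbar poly)"
      by (rule poly_eqI) (simp add: coeff_map_poly coeff_reflect_poly degree_map_poly)
    then show ?thesis using F(2) False by (simp add: w_def poly_reflect_poly_nz)
  qed
  then have "of_int (lead_coeff F) + w * poly (map_poly of_int F1) w = 0"
    unfolding F1 by (simp add: map_poly_pCons)
  then have "int (card Y) \<le> \<bar>lead_coeff F\<bar>"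
    by (intro card_incongruent_generator) (use Y w le F in \<open>auto simp: w_def field_gen_inverse integers_def\<close>)
  then have "(\<Prod>v\<in>J'. 1 / v w) \<le> real_of_int \<bar>lead_coeff F\<bar>" using Y(4) by linarith
  moreover have "(\<Prod>v\<in>J. max 1 (v x)) = (\<Prod>v\<in>J'. max 1 (v x))"
    using assms(1) by (intro prod.mono_neutral_right) (auto simp: J'_def)
  moreover have "(\<Prod>v\<in>J'. max 1 (v x)) = (\<Prod>v\<in>J'. 1 / v w)"
    by (intro prod.cong) (auto simp: vw J'_def)
  ultimately show ?thesis by simp
qed

text \<open>One half of the product formula for a rational integer, again by counting.\<close>

theorem prod_finite_places_integer:
  assumes J: "finite J" "J \<subseteq> finite_places (field_gen x)" and L: "L > 0"
  shows "(\<Prod>v\<in>J. 1 / v (of_nat L)) \<le> real L ^ field_degree (field_gen x)"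
proof -
  interpret places "field_gen x" J by unfold_locales (use J in auto)
  obtain B where B: "finite B" "Q.independent B" "Q.span B = field_gen x" "card B = field_degree (field_gen x)"
    by (rule field_gen_basis)
  have "\<exists>Y. finite Y \<and> Y \<subseteq> integers \<and> incongruent (of_nat L) Y \<and> real (card Y) = (\<Prod>v\<in>J. 1 / v (of_nat L))"
  proof (rule many_incongruent[of "of_nat L"])
    show "v (of_nat L) \<le> 1" if "v \<in> J" for v by (rule nonarch.of_nat_le[OF nonarch_J[OF that]])
    show "of_nat L \<in> field_gen x" by (rule subfield_of_nat[OF field_gen_subfield])
    show "of_nat L \<noteq> (0::qbar)" using L by simp
  qed blast
  then obtain Y where Y: "finite Y" "Y \<subseteq> integers" "incongruent (of_nat L) Y"
    "real (card Y) = (\<Prod>v\<in>J. 1 / v (of_nat L))" by blast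
  have "card Y \<le> L ^ card B" by (rule card_incongruent_integer[OF B(1-3) L Y(2,3,1)])
  then have "real (card Y) \<le> real (L ^ card B)" by (rule of_nat_mono)
  then show ?thesis using Y(4) B(4) by simp
qed

section \<open>Field embeddings\<close>

locale embedding =
  fixes K :: "'a::field_char_0 set" and \<sigma> :: "'a \<Rightarrow> 'b::field_char_0"
  assumes K: "is_subfield K" and emb: "field_embedding_on K \<sigma>"
begin

lemma one: "\<sigma> 1 = 1"
  and add: "x \<in> K \<Longrightarrow> y \<in> K \<Longrightarrow> \<sigma> (x + y) = \<sigma> x + \<sigma> y"
  and mult: "x \<in> K \<Longrightarrow> y \<in> K \<Longrightarrow> \<sigma> (x * y) = \<sigma> x * \<sigma> y"
  using emb by (auto simp: field_embedding_on_def)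

lemma zero: "\<sigma> 0 = 0"
  using add[of 0 0] subfield_0[OF K] by simp

lemma diff: "x \<in> K \<Longrightarrow> y \<in> K \<Longrightarrow> \<sigma> (x - y) = \<sigma> x - \<sigma> y"
  using add[of "x - y" y] subfield_diff[OF K, of x y] by (simp add: algebra_simps)

lemma power: "x \<in> K \<Longrightarrow> \<sigma> (x ^ n) = \<sigma> x ^ n"
  by (induction n) (auto simp: one mult subfield_power[OF K])

lemma sum: "(\<And>i. i \<in> I \<Longrightarrow> f i \<in> K) \<Longrightarrow> \<sigma> (sum f I) = (\<Sum>i\<in>I. \<sigma> (f i))"
  by (induction I rule: infinite_finite_induct) (auto simp: zero add subfield_sum[OF K])

lemma eq_0_iff: assumes "x \<in> K" shows "\<sigma> x = 0 \<longleftrightarrow> x = 0"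
proof
  assume 0: "\<sigma> x = 0"
  show "x = 0"
  proof (rule ccontr)
    assume "x \<noteq> 0"
    then have "\<sigma> (x * inverse x) = 1" by (simp add: one)
    then show False using mult[OF assms subfield_inverse[OF K assms]] 0 by simp
  qed
qed (simp add: zero)

lemma inverse: assumes "x \<in> K" shows "\<sigma> (inverse x) = inverse (\<sigma> x)"
proof (cases "x = 0")
  case False
  then have "\<sigma> x * \<sigma> (inverse x) = 1"
    using mult[OF assms subfield_inverse[OF K assms]] one by simp
  then show ?thesis by (metis inverse_unique)
qed (simp add: zero)

lemma of_nat: "\<sigma> (of_nat n) = of_nat n"
  by (induction n) (auto simp: zero one add subfield_1[OF K] subfield_of_nat[OF K])

lemma of_int: "\<sigma> (of_int n) = of_int n"
proof (cases n rule: int_cases2)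
  case (nonpos m)
  then show ?thesis using diff[OF subfield_0[OF K] subfield_of_nat[OF K, of m]] by (simp add: zero of_nat)
qed (simp add: of_nat)

lemma poly_of_int: "y \<in> K \<Longrightarrow> \<sigma> (poly (map_poly of_int F) y) = poly (map_poly of_int F) (\<sigma> y)"
proof (induction F)
  case (pCons a F)
  have "poly (map_poly of_int F) y \<in> K"
    by (rule subfield_poly[OF K _ \<open>y \<in> K\<close>]) (simp add: coeffs_in_def coeff_map_poly subfield_of_int[OF K])
  with pCons show ?case
    by (simp add: map_poly_pCons add mult of_int subfield_of_int[OF K] subfield_mult[OF K])
qed (simp add: zero)

end

lemma complex_embedding: "\<sigma> \<in> complex_embeddings K \<Longrightarrow> is_subfield K \<Longrightarrow> embedding K \<sigma>"
  by (simp add: complex_embeddings_def embedding_def)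

text \<open>An embedding of \<open>\<rat>(x)\<close> is determined by the image of \<open>x\<close>.\<close>

lemma inj_embeddings: "inj_on (\<lambda>\<sigma>. \<sigma> x) (complex_embeddings (field_gen x))"
proof (rule inj_onI)
  fix \<sigma> \<tau> assume *: "\<sigma> \<in> complex_embeddings (field_gen x)" "\<tau> \<in> complex_embeddings (field_gen x)" "\<sigma> x = \<tau> x"
  interpret s: embedding "field_gen x" \<sigma> using complex_embedding[OF *(1)] by simp
  interpret t: embedding "field_gen x" \<tau> using complex_embedding[OF *(2)] by simp
  let ?E = "{y \<in> field_gen x. \<sigma> y = \<tau> y}"
  have "is_subfield ?E"
    unfolding is_subfield_def
    by (auto simp: s.zero t.zero s.one t.one s.diff t.diff s.mult t.mult s.inverse t.inverse subfield_closed[OF s.K])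
  then have "field_gen x \<subseteq> ?E" by (rule field_gen_least) (simp add: *)
  then have "\<sigma> y = \<tau> y" for y
    using *(1,2) by (cases "y \<in> field_gen x") (auto simp: complex_embeddings_def)
  then show "\<sigma> = \<tau>" by blast
qed

section \<open>Embeddings of a root of an integer polynomial: Landau's inequality\<close>

text \<open>Replacing the factor \<open>X - \<tau>\<close> by \<open>\<tau>\<^sup>* X - 1\<close> (the star denoting conjugation) does not change
  the sum of the squares of the coefficients, but multiplies the leading coefficient by \<open>\<bar>\<tau>\<bar>\<close>.\<close>

lemma l2_flip_root:
  fixes G :: "complex poly"
  assumes "degree G < N"
  shows "(\<Sum>i\<le>N. (cmod (coeff ([:-\<tau>, 1:] * G) i))\<^sup>2) = (\<Sum>i\<le>N. (cmod (coeff ([:-1, cnj \<tau>:] * G) i))\<^sup>2)"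
proof -
  define g where "g i = (if i = 0 then 0 else coeff G (i - 1))" for i
  have c: "coeff ([:-\<tau>, 1:] * G) i = g i - \<tau> * g (Suc i)" "coeff ([:-1, cnj \<tau>:] * G) i = cnj \<tau> * g i - g (Suc i)" for i
    by (auto simp: g_def coeff_pCons split: nat.splits)
  have id: "(cmod (a - \<tau> * b))\<^sup>2 - (cmod (cnj \<tau> * a - b))\<^sup>2 = (1 - (cmod \<tau>)\<^sup>2) * ((cmod a)\<^sup>2 - (cmod b)\<^sup>2)" for a b
    unfolding cmod_power2 by (simp add: power2_eq_square algebra_simps)
  have "(\<Sum>i\<le>N. (cmod (coeff ([:-\<tau>, 1:] * G) i))\<^sup>2) - (\<Sum>i\<le>N. (cmod (coeff ([:-1, cnj \<tau>:] * G) i))\<^sup>2) =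
     (\<Sum>i\<le>N. (1 - (cmod \<tau>)\<^sup>2) * ((cmod (g i))\<^sup>2 - (cmod (g (Suc i)))\<^sup>2))"
    unfolding c id[symmetric] by (rule sum_subtractf[symmetric])
  also have "\<dots> = (1 - (cmod \<tau>)\<^sup>2) * ((cmod (g 0))\<^sup>2 - (cmod (g (Suc N)))\<^sup>2)"
    using sum_telescope[of "\<lambda>i. (cmod (g i))\<^sup>2" N] by (simp add: sum_distrib_left[symmetric])
  also have "\<dots> = 0" using assms by (simp add: g_def coeff_eq_0)
  finally show ?thesis by simp
qed

text \<open>Induction on the set of roots: flipping the root \<open>\<tau>\<close> by the preceding lemma moves the factor
  \<open>|\<tau>|\<close> into the leading coefficient.\<close>

lemma landau_l2:
  fixes F :: "complex poly"
  assumes "finite T" "\<And>\<tau>. \<tau> \<in> T \<Longrightarrow> poly F \<tau> = 0 \<and> \<tau> \<noteq> 0" "degree F \<le> N"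
  shows "cmod (lead_coeff F) * (\<Prod>\<tau>\<in>T. cmod \<tau>) \<le> sqrt (\<Sum>i\<le>N. (cmod (coeff F i))\<^sup>2)"
  using assms
proof (induction T arbitrary: F rule: finite_induct)
  case empty
  have "(cmod (lead_coeff F))\<^sup>2 \<le> (\<Sum>i\<le>N. (cmod (coeff F i))\<^sup>2)"
    by (rule member_le_sum) (use empty in auto)
  then show ?case by (simp add: real_le_rsqrt)
next
  case (insert \<tau> T)
  show ?case
  proof (cases "F = 0")
    case True
    then show ?thesis by simp
  next
    case False
    obtain G where G: "F = [:-\<tau>, 1:] * G" using insert.prems(1)[of \<tau>] by (auto simp: poly_eq_0_iff_dvd dvd_def)
    have G0: "G \<noteq> 0" using False G by auto
    let ?F = "[:-1, cnj \<tau>:] * G"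
    have \<tau>: "\<tau> \<noteq> 0" using insert.prems(1) by auto
    have "degree F = Suc (degree G)" unfolding G using G0 by (subst degree_mult_eq) auto
    then have dG: "degree G < N" using insert.prems(2) by simp
    have dF: "degree ?F = Suc (degree G)" using G0 \<tau> by (subst degree_mult_eq) auto
    have lc: "lead_coeff F = lead_coeff G" "lead_coeff ?F = cnj \<tau> * lead_coeff G"
      unfolding G lead_coeff_mult using \<tau> by auto
    have "poly G t = 0" if "t \<in> T" for t
      using insert.prems(1)[of t] insert.hyps(2) that unfolding G by auto
    then have "cmod (lead_coeff ?F) * (\<Prod>\<tau>\<in>T. cmod \<tau>) \<le> sqrt (\<Sum>i\<le>N. (cmod (coeff ?F i))\<^sup>2)"
      using insert.prems(1) dF dG by (intro insert.IH) auto
    then show ?thesis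
      using insert.hyps unfolding lc l2_flip_root[OF dG, of \<tau>, symmetric] G[symmetric]
      by (simp add: norm_mult mult_ac)
  qed
qed

definition coeff_sum :: "int poly \<Rightarrow> real" where
  "coeff_sum F = (\<Sum>i\<le>degree F. real_of_int \<bar>coeff F i\<bar>)"

lemma coeff_sum_ge_1: assumes "F \<noteq> 0" shows "coeff_sum F \<ge> 1"
proof -
  have "1 \<le> \<bar>lead_coeff F\<bar>" using assms by (simp add: int_one_le_iff_zero_less)
  then have "1 \<le> real_of_int \<bar>lead_coeff F\<bar>" by linarith
  also have "\<dots> \<le> coeff_sum F" unfolding coeff_sum_def by (rule member_le_sum) auto
  finally show ?thesis .
qed

text \<open>The roots of absolute value at most \<open>1\<close> contribute \<open>1\<close> to the product and are dropped.\<close>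

lemma landau:
  fixes F :: "int poly"
  assumes "finite T" "\<And>\<tau>. \<tau> \<in> T \<Longrightarrow> poly (map_poly of_int F) \<tau> = (0::complex)"
  shows "real_of_int \<bar>lead_coeff F\<bar> * (\<Prod>\<tau>\<in>T. max 1 (cmod \<tau>)) \<le> coeff_sum F"
proof -
  let ?F = "map_poly of_int F :: complex poly"
  define T' where "T' = {\<tau> \<in> T. cmod \<tau> > 1}"
  have d: "degree ?F = degree F" by (simp add: degree_map_poly)
  have "(\<Prod>\<tau>\<in>T. max 1 (cmod \<tau>)) = (\<Prod>\<tau>\<in>T'. max 1 (cmod \<tau>))"
    using assms(1) by (intro prod.mono_neutral_right) (auto simp: T'_def)
  also have "\<dots> = (\<Prod>\<tau>\<in>T'. cmod \<tau>)" by (intro prod.cong) (auto simp: T'_def)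
  finally have "real_of_int \<bar>lead_coeff F\<bar> * (\<Prod>\<tau>\<in>T. max 1 (cmod \<tau>)) = cmod (lead_coeff ?F) * (\<Prod>\<tau>\<in>T'. cmod \<tau>)"
    by (simp add: d coeff_map_poly)
  also have "\<dots> \<le> sqrt (\<Sum>i\<le>degree F. (cmod (coeff ?F i))\<^sup>2)"
    by (rule landau_l2) (use assms d in \<open>auto simp: T'_def\<close>)
  also have "\<dots> \<le> (\<Sum>i\<le>degree F. cmod (coeff ?F i))"
    using L2_set_le_sum[of "{..degree F}" "\<lambda>i. cmod (coeff ?F i)"] by (simp add: L2_set_def)
  also have "\<dots> = coeff_sum F" by (simp add: coeff_sum_def coeff_map_poly)
  finally show ?thesis .
qed

lemma embedding_root:
  assumes "\<sigma> \<in> complex_embeddings (field_gen x)" "poly (map_poly of_int F) x = 0"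
  shows "poly (map_poly of_int F) (\<sigma> x) = 0"
proof -
  interpret embedding "field_gen x" \<sigma> using complex_embedding[OF assms(1)] by simp
  show ?thesis using poly_of_int[of x F] assms(2) zero by simp
qed

lemma embeddings_finite_card:
  shows "finite (complex_embeddings (field_gen x))"
    and "card (complex_embeddings (field_gen x)) \<le> field_degree (field_gen x)"
proof -
  obtain B where B: "finite B" "Q.independent B" "Q.span B = field_gen x" "card B = field_degree (field_gen x)"
    by (rule field_gen_basis)
  have "x ^ i \<in> Q.span B" for i using B(3) by (simp add: subfield_power)
  then obtain c where c: "\<exists>i\<le>card B. c i \<noteq> 0" "(\<Sum>i\<le>card B. of_int (c i) * x ^ i) = 0"
    using integer_relation[of B "card B" "\<lambda>i. x ^ i"] B(1) by blast
  define F where "F = (\<Sum>i\<le>card B. monom (c i) i)"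
  have coeff: "coeff F i = (if i \<le> card B then c i else 0)" for i
    by (simp add: F_def coeff_sum)
  have "F \<noteq> 0" using c(1) coeff by (metis coeff_0)
  have deg: "degree F \<le> card B" by (rule degree_le) (simp add: coeff)
  have "poly (map_poly of_int F) x = (\<Sum>i\<le>card B. of_int (coeff F i) * x ^ i)"
    unfolding poly_altdef using deg
    by (simp add: degree_map_poly coeff_map_poly) (intro sum.mono_neutral_left, auto simp: coeff_eq_0)
  then have root: "poly (map_poly of_int F) x = 0" using c(2) by (simp add: coeff)
  let ?R = "{z::complex. poly (map_poly of_int F) z = 0}"
  have F': "map_poly of_int F \<noteq> (0 :: complex poly)" using \<open>F \<noteq> 0\<close> by (simp add: map_poly_eq_0_iff)
  have sub: "(\<lambda>\<sigma>. \<sigma> x) ` complex_embeddings (field_gen x) \<subseteq> ?R" using embedding_root[OF _ root] by auto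
  then show fin: "finite (complex_embeddings (field_gen x))"
    using inj_embeddings poly_roots_finite[OF F'] by (meson finite_imageD finite_subset)
  have "card (complex_embeddings (field_gen x)) \<le> card ?R"
    using inj_embeddings sub poly_roots_finite[OF F'] by (metis card_inj_on_le)
  also have "\<dots> \<le> degree (map_poly of_int F :: complex poly)" using F' by (rule card_poly_roots_bound)
  also have "\<dots> \<le> card B" using deg by (simp add: degree_map_poly)
  finally show "card (complex_embeddings (field_gen x)) \<le> field_degree (field_gen x)" using B(4) by simp
qed

lemma prod_embeddings:
  assumes "poly (map_poly of_int F) x = 0"
  shows "real_of_int \<bar>lead_coeff F\<bar> * (\<Prod>\<sigma>\<in>complex_embeddings (field_gen x). max 1 (norm (\<sigma> x))) \<le> coeff_sum F"
proof -
  let ?C = "complex_embeddings (field_gen x)"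
  have "(\<Prod>\<sigma>\<in>?C. max 1 (norm (\<sigma> x))) = (\<Prod>\<tau>\<in>(\<lambda>\<sigma>. \<sigma> x) ` ?C. max 1 (cmod \<tau>))"
    by (simp add: prod.reindex[OF inj_embeddings])
  then show ?thesis
    using landau[of "(\<lambda>\<sigma>. \<sigma> x) ` ?C" F] embeddings_finite_card(1)[of x] embedding_root[OF _ assms] by auto
qed

section \<open>Two bounds for the Weil height\<close>

text \<open>If \<open>f\<close> is not summable, the sum is \<open>0\<close> by convention, which is covered by \<open>J = {}\<close>.\<close>

lemma infsum_le_bound:
  fixes f :: "'a \<Rightarrow> real"
  assumes "\<And>J. finite J \<Longrightarrow> J \<subseteq> A \<Longrightarrow> sum f J \<le> B"
  shows "infsum f A \<le> B"
proof (cases "f summable_on A")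
  case True
  then show ?thesis using assms by (rule infsum_le_finite_sums)
next
  case False
  then show ?thesis using assms[of "{}"] by (simp add: infsum_not_exists)
qed

text \<open>The finite places contribute at most \<open>ln |lead_coeff F|\<close>, and Landau's inequality bounds the sum of this
  and the contribution of the embeddings.\<close>

theorem weil_height_le_coeff_sum:
  assumes F: "F \<noteq> 0" "poly (map_poly of_int F) x = 0"
  shows "weil_height x * real (field_degree (field_gen x)) \<le> ln (coeff_sum F)"
proof -
  define n where "n = field_degree (field_gen x)"
  define c where "c = real_of_int \<bar>lead_coeff F\<bar>"
  have n: "n > 0" unfolding n_def by (rule field_degree_pos)
  have "1 \<le> \<bar>lead_coeff F\<bar>" using F by (simp add: int_one_le_iff_zero_less)
  then have c: "c \<ge> 1" unfolding c_def by linarith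
  have fin: "(\<Sum>\<^sub>\<infinity>v\<in>finite_places (field_gen x). ln (max 1 (v x))) \<le> ln c"
  proof (rule infsum_le_bound)
    fix J assume J: "finite J" "J \<subseteq> finite_places (field_gen x)"
    have "(\<Sum>v\<in>J. ln (max 1 (v x))) = ln (\<Prod>v\<in>J. max 1 (v x))"
      by (rule ln_prod[symmetric]) (use J in auto)
    also have "\<dots> \<le> ln c"
      unfolding c_def by (rule ln_mono[OF prod_finite_places_le_lead_coeff[OF J F]]) (auto intro!: prod_pos)
    finally show "(\<Sum>v\<in>J. ln (max 1 (v x))) \<le> ln c" .
  qed
  let ?C = "complex_embeddings (field_gen x)"
  have P: "(\<Prod>\<sigma>\<in>?C. max 1 (norm (\<sigma> x))) > 0" by (intro prod_pos) auto
  have "(\<Sum>\<sigma>\<in>?C. ln (max 1 (norm (\<sigma> x)))) = ln (\<Prod>\<sigma>\<in>?C. max 1 (norm (\<sigma> x)))"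
    by (rule ln_prod[symmetric]) (use embeddings_finite_card in auto)
  also have "\<dots> = ln (c * (\<Prod>\<sigma>\<in>?C. max 1 (norm (\<sigma> x)))) - ln c"
    using P c by (simp add: ln_mult)
  also have "ln (c * (\<Prod>\<sigma>\<in>?C. max 1 (norm (\<sigma> x)))) \<le> ln (coeff_sum F)"
  proof (rule ln_mono)
    show "c * (\<Prod>\<sigma>\<in>?C. max 1 (norm (\<sigma> x))) \<le> coeff_sum F"
      unfolding c_def by (rule prod_embeddings[OF F(2)])
  qed (use P c in simp)
  finally have "(\<Sum>\<sigma>\<in>?C. ln (max 1 (norm (\<sigma> x)))) \<le> ln (coeff_sum F) - ln c" by simp
  with fin show ?thesis
    using n unfolding weil_height_def Let_def n_def[symmetric] by simp
qed

text \<open>At a finite place, \<open>max 1 (v x) \<le> 1 / v L\<close>, and the product of these bounds is at most \<open>L\<close> to the power of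
  the degree.\<close>

theorem weil_height_le_local:
  assumes L: "L > 0" "\<And>v. v \<in> finite_places (field_gen x) \<Longrightarrow> v (of_nat L * x) \<le> 1"
    and C: "C \<ge> 1" "\<And>\<sigma>. \<sigma> \<in> complex_embeddings (field_gen x) \<Longrightarrow> norm (\<sigma> x) \<le> C"
  shows "weil_height x \<le> ln L + ln C"
proof -
  define n where "n = field_degree (field_gen x)"
  have n: "n > 0" unfolding n_def by (rule field_degree_pos)
  have fin: "(\<Sum>\<^sub>\<infinity>v\<in>finite_places (field_gen x). ln (max 1 (v x))) \<le> n * ln L"
  proof (rule infsum_le_bound)
    fix J assume J: "finite J" "J \<subseteq> finite_places (field_gen x)"
    have vL: "0 < v (of_nat L) \<and> max 1 (v x) \<le> 1 / v (of_nat L)" if v: "v \<in> J" for v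
    proof -
      interpret v: nonarch "field_gen x" v using finite_place_nonarch[OF field_gen_subfield] v J by blast
      have "v (of_nat L) > 0" using v.pos[OF subfield_of_nat[OF v.K]] L(1) by simp
      moreover have "v (of_nat L) * v x \<le> 1"
        using L(2)[of v] v J v.mult[OF subfield_of_nat[OF v.K] field_gen_mem, of L] by auto
      ultimately show ?thesis using v.of_nat_le[of L] by (simp add: pos_le_divide_eq mult.commute)
    qed
    have pos: "1 / v (of_nat L) > 0" if "v \<in> J" for v using vL[OF that] by simp
    have "(\<Sum>v\<in>J. ln (max 1 (v x))) \<le> (\<Sum>v\<in>J. ln (1 / v (of_nat L)))"
    proof (rule sum_mono)
      fix v assume "v \<in> J"
      from vL[OF this] show "ln (max 1 (v x)) \<le> ln (1 / v (of_nat L))" by (intro ln_mono) auto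
    qed
    also have "(\<Sum>v\<in>J. ln (1 / v (of_nat L))) = ln (\<Prod>v\<in>J. 1 / v (of_nat L))"
    proof (rule ln_prod[symmetric])
      show "1 / v (of_nat L) \<noteq> 0" if "v \<in> J" for v using pos[OF that] by simp
    qed (rule J(1))
    also have "\<dots> \<le> ln (real L ^ n)"
      unfolding n_def by (rule ln_mono[OF prod_finite_places_integer[OF J L(1)]]) (rule prod_pos, rule pos)
    also have "\<dots> = n * ln L" using L(1) by (simp add: ln_realpow)
    finally show "(\<Sum>v\<in>J. ln (max 1 (v x))) \<le> n * ln L" .
  qed
  let ?C = "complex_embeddings (field_gen x)"
  have "(\<Sum>\<sigma>\<in>?C. ln (max 1 (norm (\<sigma> x)))) \<le> (\<Sum>\<sigma>\<in>?C. ln C)"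
    by (intro sum_mono ln_mono) (use C in auto)
  also have "\<dots> \<le> n * ln C"
    using embeddings_finite_card(2)[of x] C(1) by (simp add: n_def mult_right_mono)
  finally have "(\<Sum>\<sigma>\<in>?C. ln (max 1 (norm (\<sigma> x)))) \<le> n * ln C" .
  with fin show ?thesis
    using n unfolding weil_height_def Let_def n_def[symmetric] by (simp add: field_simps)
qed

section \<open>Orbits of monic polynomials\<close>

text \<open>The iterates of \<open>z\<^sup>d + \<alpha>\<^sub>1 z\<^sup>d\<^sup>-\<^sup>1 + \<dots> + \<alpha>\<^sub>d\<close> at \<open>c\<close>, over any commutative ring: both in \<open>\<rat>\<^sup>a\<^sup>l\<^sup>g[t]\<close>
  and at a special value of \<open>t\<close>.\<close>

fun orbit :: "nat \<Rightarrow> (nat \<Rightarrow> 'a::comm_semiring_1) \<Rightarrow> 'a \<Rightarrow> nat \<Rightarrow> 'a" where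
  "orbit d \<alpha> c 0 = c"
| "orbit d \<alpha> c (Suc k) = orbit d \<alpha> c k ^ d + (\<Sum>i=1..d. \<alpha> i * orbit d \<alpha> c k ^ (d - i))"

lemma poly_orbit: "poly (orbit d A [:c:] k) t = orbit d (\<lambda>i. poly (A i) t) c k"
  by (induction k) (simp_all add: poly_sum)

section \<open>Integer polynomials that vanish where a given polynomial vanishes\<close>

text \<open>A number field in the coordinates of a basis \<open>B\<close> that contains \<open>1\<close>; \<open>q\<close> is a common denominator of
  the structure constants.\<close>

locale coordinates =
  fixes B :: "qbar set" and q :: nat
  assumes finite_B: "finite B" and indep_B: "Q.independent B" and one_B: "1 \<in> B"
    and span_mult_closed: "\<And>x y. x \<in> Q.span B \<Longrightarrow> y \<in> Q.span B \<Longrightarrow> x * y \<in> Q.span B"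
    and q_pos: "q > 0"
    and structure_constants: "\<And>b b' e. b \<in> B \<Longrightarrow> b' \<in> B \<Longrightarrow> e \<in> B \<Longrightarrow>
          of_nat q * Q.representation B (b * b') e \<in> \<int>"
begin

definition rep :: "qbar \<Rightarrow> qbar \<Rightarrow> rat" where "rep = Q.representation B"

definition nrm :: "qbar \<Rightarrow> real" where "nrm y = (\<Sum>b\<in>B. \<bar>real_of_rat (rep y b)\<bar>)"

text \<open>Makes \<open>nrm\<close> submultiplicative: \<open>nrm (x * y) \<le> C0 * nrm x * nrm y\<close>.\<close>

definition C0 :: real where "C0 = 1 + (\<Sum>b\<in>B. \<Sum>b'\<in>B. nrm (b * b'))"

definition int_pts :: "qbar set" where "int_pts = {y \<in> Q.span B. \<forall>b\<in>B. rep y b \<in> \<int>}"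

text \<open>The elements with integer coordinates need not form a ring, but the multiples of \<open>q\<close> among them
  are closed under multiplication and act on the elements with integer coordinates.\<close>

definition lat :: "qbar set" where "lat = (\<lambda>y. of_nat q * y) ` int_pts"

lemma rep_add: "x \<in> Q.span B \<Longrightarrow> y \<in> Q.span B \<Longrightarrow> rep (x + y) b = rep x b + rep y b"
  unfolding rep_def using Q.representation_add[OF indep_B, of y x] by (simp add: add.commute)

lemma rep_scale: "y \<in> Q.span B \<Longrightarrow> rep (of_rat r * y) b = r * rep y b"
  unfolding rep_def by (simp add: Q.representation_scale[OF indep_B])

lemma rep_zero: "rep 0 b = 0"
  unfolding rep_def by (simp add: Q.representation_zero)

lemma rep_sum: "(\<And>i. i \<in> I \<Longrightarrow> f i \<in> Q.span B) \<Longrightarrow> rep (sum f I) b = (\<Sum>i\<in>I. rep (f i) b)"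
  unfolding rep_def by (simp add: Q.representation_sum[OF indep_B])

lemma rep_basis: "b \<in> B \<Longrightarrow> rep b e = (if e = b then 1 else 0)"
  unfolding rep_def by (simp add: Q.representation_basis[OF indep_B])

lemma rep_expand: "y \<in> Q.span B \<Longrightarrow> y = (\<Sum>b\<in>B. of_rat (rep y b) * b)"
  unfolding rep_def by (rule Q.sum_representation_eq[OF indep_B _ finite_B subset_refl, symmetric])

lemma span_of_nat: "y \<in> Q.span B \<Longrightarrow> of_nat n * y \<in> Q.span B"
  using Q.span_scale[of y B "of_nat n"] by simp

lemma rep_of_nat: "y \<in> Q.span B \<Longrightarrow> rep (of_nat n * y) b = of_nat n * rep y b"
  using rep_scale[of y "of_nat n"] by simp

lemma nrm_nonneg [simp]: "nrm y \<ge> 0"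
  by (simp add: nrm_def sum_nonneg)

lemma C0_ge_1: "C0 \<ge> 1"
  by (simp add: C0_def sum_nonneg)

lemma nrm_zero [simp]: "nrm 0 = 0"
  by (simp add: nrm_def rep_zero)

lemma nrm_add: "x \<in> Q.span B \<Longrightarrow> y \<in> Q.span B \<Longrightarrow> nrm (x + y) \<le> nrm x + nrm y"
  unfolding nrm_def sum.distrib[symmetric]
  by (intro sum_mono) (simp only: rep_add of_rat_add abs_triangle_ineq)

lemma nrm_scale: "y \<in> Q.span B \<Longrightarrow> nrm (of_rat r * y) = \<bar>real_of_rat r\<bar> * nrm y"
  by (simp add: nrm_def rep_scale of_rat_mult abs_mult sum_distrib_left)

lemma nrm_sum: "(\<And>i. i \<in> I \<Longrightarrow> f i \<in> Q.span B) \<Longrightarrow> nrm (sum f I) \<le> (\<Sum>i\<in>I. nrm (f i))"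
proof (induction I rule: infinite_finite_induct)
  case (insert i I)
  then have "nrm (f i + sum f I) \<le> nrm (f i) + nrm (sum f I)"
    by (intro nrm_add Q.span_sum) auto
  with insert show ?case by simp
qed auto

lemma mult_expand:
  assumes "x \<in> Q.span B" "y \<in> Q.span B"
  shows "x * y = (\<Sum>b\<in>B. \<Sum>b'\<in>B. of_rat (rep x b * rep y b') * (b * b'))"
proof -
  have "x * y = (\<Sum>b\<in>B. of_rat (rep x b) * b) * (\<Sum>b\<in>B. of_rat (rep y b) * b)"
    using rep_expand[OF assms(1)] rep_expand[OF assms(2)] by simp
  then show ?thesis by (simp add: sum_product of_rat_mult mult_ac)
qed

lemma basis_products: "b \<in> B \<Longrightarrow> b' \<in> B \<Longrightarrow> b * b' \<in> Q.span B"
  by (intro span_mult_closed Q.span_base)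

lemma nrm_mult: assumes "x \<in> Q.span B" "y \<in> Q.span B" shows "nrm (x * y) \<le> C0 * nrm x * nrm y"
proof -
  have le: "nrm (b * b') \<le> C0" if "b \<in> B" "b' \<in> B" for b b'
  proof -
    have "nrm (b * b') \<le> (\<Sum>b'\<in>B. nrm (b * b'))" by (rule member_le_sum) (use that finite_B in auto)
    also have "\<dots> \<le> (\<Sum>b\<in>B. \<Sum>b'\<in>B. nrm (b * b'))"
      by (rule member_le_sum) (use that finite_B in \<open>auto intro: sum_nonneg\<close>)
    finally show ?thesis by (simp add: C0_def)
  qed
  have "nrm (x * y) \<le> (\<Sum>b\<in>B. nrm (\<Sum>b'\<in>B. of_rat (rep x b * rep y b') * (b * b')))"
    unfolding mult_expand[OF assms] by (intro nrm_sum Q.span_sum Q.span_scale basis_products)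
  also have "\<dots> \<le> (\<Sum>b\<in>B. \<Sum>b'\<in>B. nrm (of_rat (rep x b * rep y b') * (b * b')))"
    by (intro sum_mono nrm_sum Q.span_scale basis_products)
  also have "\<dots> \<le> (\<Sum>b\<in>B. \<Sum>b'\<in>B. \<bar>real_of_rat (rep x b * rep y b')\<bar> * C0)"
    using le by (intro sum_mono) (auto simp: nrm_scale basis_products intro: mult_left_mono)
  also have "\<dots> = (\<Sum>b\<in>B. \<Sum>b'\<in>B. C0 * (\<bar>real_of_rat (rep x b)\<bar> * \<bar>real_of_rat (rep y b')\<bar>))"
    by (simp add: of_rat_mult abs_mult mult_ac)
  also have "\<dots> = C0 * (nrm x * nrm y)"
    unfolding nrm_def sum_product by (simp add: sum_distrib_left)
  finally show ?thesis by (simp add: mult.assoc)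
qed

lemma int_pts_add: "x \<in> int_pts \<Longrightarrow> y \<in> int_pts \<Longrightarrow> x + y \<in> int_pts"
  by (auto simp: int_pts_def rep_add Q.span_add)

lemma int_pts_zero: "0 \<in> int_pts"
  by (auto simp: int_pts_def rep_zero Q.span_zero)

lemma int_pts_of_nat: "y \<in> int_pts \<Longrightarrow> of_nat n * y \<in> int_pts"
  by (auto simp: int_pts_def rep_of_nat span_of_nat)

lemma int_pts_minus: "y \<in> int_pts \<Longrightarrow> - y \<in> int_pts"
  using rep_scale[of y "-1"] by (auto simp: int_pts_def Q.span_neg)

lemma basis_int_pts: "b \<in> B \<Longrightarrow> b \<in> int_pts"
  by (auto simp: int_pts_def Q.span_base rep_basis)

lemma int_pts_mult: assumes "x \<in> int_pts" "y \<in> int_pts" shows "of_nat q * (x * y) \<in> int_pts"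
proof -
  have s: "x \<in> Q.span B" "y \<in> Q.span B" using assms by (auto simp: int_pts_def)
  have "rep (of_nat q * (x * y)) e \<in> \<int>" if e: "e \<in> B" for e
  proof -
    have "rep (of_nat q * (x * y)) e = (\<Sum>b\<in>B. \<Sum>b'\<in>B. (rep x b * rep y b') * (of_nat q * rep (b * b') e))"
    proof -
      have "rep (x * y) e = (\<Sum>b\<in>B. rep (\<Sum>b'\<in>B. of_rat (rep x b * rep y b') * (b * b')) e)"
        unfolding mult_expand[OF s] by (intro rep_sum Q.span_sum Q.span_scale basis_products)
      also have "\<dots> = (\<Sum>b\<in>B. \<Sum>b'\<in>B. rep x b * rep y b' * rep (b * b') e)"
      proof (rule sum.cong[OF refl])
        fix b assume b: "b \<in> B"
        have "rep (\<Sum>b'\<in>B. of_rat (rep x b * rep y b') * (b * b')) e = (\<Sum>b'\<in>B. rep (of_rat (rep x b * rep y b') * (b * b')) e)"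
          by (intro rep_sum Q.span_scale basis_products b)
        also have "\<dots> = (\<Sum>b'\<in>B. rep x b * rep y b' * rep (b * b') e)"
          by (intro sum.cong[OF refl] rep_scale basis_products b)
        finally show "rep (\<Sum>b'\<in>B. of_rat (rep x b * rep y b') * (b * b')) e = (\<Sum>b'\<in>B. rep x b * rep y b' * rep (b * b') e)" .
      qed
      finally show ?thesis
        unfolding rep_of_nat[OF span_mult_closed[OF s]] by (simp add: sum_distrib_left mult_ac)
    qed
    also have "\<dots> \<in> \<int>"
    proof (rule Ints_sum, rule Ints_sum)
      fix b b' assume b: "b \<in> B" "b' \<in> B"
      have "of_nat q * rep (b * b') e \<in> \<int>" unfolding rep_def by (rule structure_constants[OF b e])
      then show "(rep x b * rep y b') * (of_nat q * rep (b * b') e) \<in> \<int>"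
        using assms b by (intro Ints_mult[OF Ints_mult]) (auto simp: int_pts_def)
    qed
    finally show ?thesis .
  qed
  then show ?thesis using s by (auto simp: int_pts_def span_of_nat span_mult_closed)
qed

lemma lat_subset: "y \<in> lat \<Longrightarrow> y \<in> int_pts"
  by (auto simp: lat_def int_pts_of_nat)

lemma int_pts_span: "y \<in> int_pts \<Longrightarrow> y \<in> Q.span B"
  by (simp add: int_pts_def)

lemma lat_times_int_pts: "x \<in> lat \<Longrightarrow> y \<in> int_pts \<Longrightarrow> x * y \<in> int_pts"
  using int_pts_mult by (auto simp: lat_def mult.assoc)

lemma lat_zero: "0 \<in> lat"
  using int_pts_zero by (force simp: lat_def)

lemma lat_add: assumes "x \<in> lat" "y \<in> lat" shows "x + y \<in> lat"
proof -
  obtain x' y' where *: "x = of_nat q * x'" "y = of_nat q * y'" "x' \<in> int_pts" "y' \<in> int_pts"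
    using assms by (auto simp: lat_def)
  then have "x + y = of_nat q * (x' + y')" by (simp add: algebra_simps)
  then show ?thesis using * int_pts_add unfolding lat_def by blast
qed

lemma lat_of_nat: assumes "y \<in> lat" shows "of_nat n * y \<in> lat"
proof -
  obtain y' where *: "y = of_nat q * y'" "y' \<in> int_pts" using assms by (auto simp: lat_def)
  then have "of_nat n * y = of_nat q * (of_nat n * y')" by (simp add: algebra_simps)
  then show ?thesis using * int_pts_of_nat unfolding lat_def by blast
qed

lemma lat_minus: assumes "y \<in> lat" shows "- y \<in> lat"
proof -
  obtain y' where *: "y = of_nat q * y'" "y' \<in> int_pts" using assms by (auto simp: lat_def)
  then have "- y = of_nat q * (- y')" by simp
  then show ?thesis using * int_pts_minus unfolding lat_def by blast
qed

lemma lat_mult: assumes "x \<in> lat" "y \<in> lat" shows "x * y \<in> lat"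
proof -
  obtain y' where *: "y = of_nat q * y'" "y' \<in> int_pts" using assms by (auto simp: lat_def)
  then have "x * y = of_nat q * (x * y')" by (simp add: algebra_simps)
  then show ?thesis using * lat_times_int_pts[OF assms(1)] unfolding lat_def by blast
qed

lemma lat_sum: "(\<And>i. i \<in> I \<Longrightarrow> f i \<in> lat) \<Longrightarrow> sum f I \<in> lat"
  by (induction I rule: infinite_finite_induct) (auto simp: lat_zero lat_add)

lemma common_denominator_lat:
  assumes "finite Y" "Y \<subseteq> Q.span B"
  obtains L :: nat where "L > 0" "\<And>y. y \<in> Y \<Longrightarrow> of_nat L * y \<in> lat"
proof -
  have "\<exists>N::nat. N > 0 \<and> (\<forall>i\<in>Y \<times> B. of_nat N * (case i of (y, b) \<Rightarrow> rep y b) \<in> \<int>)"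
    using common_denominator[OF finite_cartesian_product[OF assms(1) finite_B], of "\<lambda>(y, b). rep y b"] by metis
  then obtain N :: nat where N: "N > 0" "\<And>y b. y \<in> Y \<Longrightarrow> b \<in> B \<Longrightarrow> of_nat N * rep y b \<in> \<int>"
    by auto
  have "of_nat (q * N) * y \<in> lat" if y: "y \<in> Y" for y
  proof -
    have "of_nat N * y \<in> int_pts" using N(2)[OF y] y assms(2) by (auto simp: int_pts_def rep_of_nat span_of_nat)
    then show ?thesis unfolding lat_def by (auto simp: mult.assoc)
  qed
  then show ?thesis using that[of "q * N"] N(1) q_pos by auto
qed

definition pn :: "qbar poly \<Rightarrow> real" where "pn R = (\<Sum>i\<le>degree R. nrm (coeff R i))"

definition over_span :: "qbar poly \<Rightarrow> bool" where "over_span R \<longleftrightarrow> (\<forall>i. coeff R i \<in> Q.span B)"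

definition over_lat :: "qbar poly \<Rightarrow> bool" where "over_lat R \<longleftrightarrow> (\<forall>i. coeff R i \<in> lat)"

lemma over_lat_span: "over_lat R \<Longrightarrow> over_span R"
  using lat_subset int_pts_span by (auto simp: over_lat_def over_span_def)

lemma over_span_add: "over_span R \<Longrightarrow> over_span S \<Longrightarrow> over_span (R + S)"
  by (simp add: over_span_def Q.span_add)

lemma over_span_mult: "over_span R \<Longrightarrow> over_span S \<Longrightarrow> over_span (R * S)"
  by (auto simp: over_span_def coeff_mult intro!: Q.span_sum span_mult_closed)

lemma over_span_one: "over_span 1"
  using Q.span_base[OF one_B] by (auto simp: over_span_def coeff_1 Q.span_zero)

lemma over_span_power: "over_span R \<Longrightarrow> over_span (R ^ n)"
  by (induction n) (auto simp: over_span_one over_span_mult)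

lemma over_span_sum: "(\<And>i. i \<in> I \<Longrightarrow> over_span (f i)) \<Longrightarrow> over_span (sum f I)"
  by (induction I rule: infinite_finite_induct) (auto simp: over_span_add, auto simp: over_span_def Q.span_zero)

lemma over_lat_add: "over_lat R \<Longrightarrow> over_lat S \<Longrightarrow> over_lat (R + S)"
  by (simp add: over_lat_def lat_add)

lemma over_lat_mult: "over_lat R \<Longrightarrow> over_lat S \<Longrightarrow> over_lat (R * S)"
  by (auto simp: over_lat_def coeff_mult intro!: lat_sum lat_mult)

lemma over_lat_power: "over_lat R \<Longrightarrow> n > 0 \<Longrightarrow> over_lat (R ^ n)"
proof (induction n)
  case (Suc n)
  then show ?case by (cases n) (auto intro!: over_lat_mult)
qed simp

lemma over_lat_of_nat: "over_lat R \<Longrightarrow> over_lat (smult (of_nat n) R)"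
  by (simp add: over_lat_def lat_of_nat)

lemma over_lat_sum: "(\<And>i. i \<in> I \<Longrightarrow> over_lat (f i)) \<Longrightarrow> over_lat (sum f I)"
  by (induction I rule: infinite_finite_induct) (auto simp: over_lat_add, auto simp: over_lat_def lat_zero)

lemma pn_eq: "degree R \<le> N \<Longrightarrow> pn R = (\<Sum>i\<le>N. nrm (coeff R i))"
  unfolding pn_def by (rule sum.mono_neutral_left) (auto simp: coeff_eq_0)

lemma pn_nonneg [simp]: "pn R \<ge> 0"
  by (simp add: pn_def sum_nonneg)

lemma nrm_coeff_le_pn: "nrm (coeff R i) \<le> pn R"
  by (cases "i \<le> degree R") (auto simp: pn_def coeff_eq_0 sum_nonneg intro: member_le_sum)

lemma pn_pCons: "pn (pCons a R) = nrm a + pn R"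
proof -
  have "pn (pCons a R) = (\<Sum>i\<le>Suc (degree R). nrm (coeff (pCons a R) i))"
    by (rule pn_eq) (simp add: degree_pCons_le)
  then show ?thesis by (simp only: sum.atMost_Suc_shift) (simp add: pn_def)
qed

lemma pn_zero: "pn 0 = 0"
  by (simp add: pn_def)

lemma pn_add: assumes "over_span R" "over_span S" shows "pn (R + S) \<le> pn R + pn S"
proof -
  let ?N = "max (degree R) (degree S)"
  have "pn (R + S) = (\<Sum>i\<le>?N. nrm (coeff R i + coeff S i))"
    using pn_eq[of "R + S" ?N] degree_add_le_max[of R S] by simp
  also have "\<dots> \<le> (\<Sum>i\<le>?N. nrm (coeff R i) + nrm (coeff S i))"
    using assms by (intro sum_mono nrm_add) (auto simp: over_span_def)
  also have "\<dots> = pn R + pn S" 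
    using pn_eq[of R ?N] pn_eq[of S ?N] by (simp add: sum.distrib)
  finally show ?thesis .
qed

lemma pn_sum: "(\<And>i. i \<in> I \<Longrightarrow> over_span (f i)) \<Longrightarrow> pn (sum f I) \<le> (\<Sum>i\<in>I. pn (f i))"
proof (induction I rule: infinite_finite_induct)
  case (insert i I)
  then have "pn (f i + sum f I) \<le> pn (f i) + pn (sum f I)"
    by (intro pn_add over_span_sum) auto
  with insert show ?case by simp
qed (auto simp: pn_zero)

lemma pn_smult_rat: assumes "over_span R" shows "pn (smult (of_rat r) R) = \<bar>real_of_rat r\<bar> * pn R"
proof -
  have "pn (smult (of_rat r) R) = (\<Sum>i\<le>degree R. nrm (of_rat r * coeff R i))"
    by (subst pn_eq[of _ "degree R"]) (auto simp: degree_smult_le)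
  then show ?thesis
    using assms by (simp add: nrm_scale over_span_def pn_def sum_distrib_left)
qed

lemma pn_smult: assumes "a \<in> Q.span B" "over_span S" shows "pn (smult a S) \<le> C0 * nrm a * pn S"
proof -
  have "pn (smult a S) = (\<Sum>i\<le>degree S. nrm (a * coeff S i))"
    by (subst pn_eq[of _ "degree S"]) (auto simp: degree_smult_le)
  also have "\<dots> \<le> (\<Sum>i\<le>degree S. C0 * nrm a * nrm (coeff S i))"
    using assms by (intro sum_mono nrm_mult) (auto simp: over_span_def)
  finally show ?thesis by (simp add: pn_def sum_distrib_left)
qed

lemma over_span_pCons: "over_span (pCons a R) \<longleftrightarrow> a \<in> Q.span B \<and> over_span R"
proof
  assume "over_span (pCons a R)"
  then have "coeff (pCons a R) i \<in> Q.span B" for i by (simp add: over_span_def)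
  from this[of 0] this[of "Suc _"] show "a \<in> Q.span B \<and> over_span R" by (simp add: over_span_def)
qed (auto simp: over_span_def coeff_pCons split: nat.split)

lemma pn_mult: "over_span R \<Longrightarrow> over_span S \<Longrightarrow> pn (R * S) \<le> C0 * pn R * pn S"
proof (induction R)
  case 0
  show ?case by (simp add: pn_zero)
next
  case (pCons a R)
  then have aR: "a \<in> Q.span B" "over_span R" by (auto simp: over_span_pCons)
  have "over_span (smult a S)" using aR pCons.prems by (auto simp: over_span_def span_mult_closed)
  moreover have "over_span (pCons 0 (R * S))" using aR pCons.prems by (simp add: over_span_pCons over_span_mult Q.span_zero)
  ultimately have "pn (pCons a R * S) \<le> pn (smult a S) + pn (pCons 0 (R * S))"
    by (simp only: mult_pCons_left pn_add)
  also have "\<dots> \<le> C0 * nrm a * pn S + C0 * pn R * pn S"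
    using pn_smult[OF aR(1) pCons.prems(2)] pCons.IH[OF aR(2) pCons.prems(2)] by (simp add: pn_pCons)
  finally show ?case by (simp add: pn_pCons algebra_simps)
qed

lemma pn_one: "pn 1 = 1"
  using finite_B one_B by (simp add: one_pCons pn_pCons pn_zero nrm_def rep_basis if_distrib[of real_of_rat] if_distrib[of abs] sum.delta' cong: if_cong)

lemma pn_power: assumes "over_span R" shows "pn (R ^ n) \<le> (C0 * max 1 (pn R)) ^ n"
proof (induction n)
  case (Suc n)
  have "pn (R ^ Suc n) \<le> C0 * pn R * pn (R ^ n)"
    using pn_mult[OF assms over_span_power[OF assms]] by simp
  also have "\<dots> \<le> (C0 * max 1 (pn R)) * (C0 * max 1 (pn R)) ^ n"
    using Suc C0_ge_1 by (intro mult_mono mult_left_mono) auto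
  finally show ?case by simp
qed (simp add: pn_one)

end

lemma coordinates_exist:
  assumes "fin_dim_ring V"
  obtains B q where "coordinates B q" "Q.span B = V"
proof -
  have "Q.independent {1::qbar}" by (simp add: Q.dependent_single)
  moreover have "{1} \<subseteq> V" using assms by (auto simp: fin_dim_ring_def)
  ultimately obtain B where B: "{1} \<subseteq> B" "finite B" "Q.independent B" "Q.span B = V"
    using fin_dim_ring_basis[OF assms] by metis
  obtain q :: nat where q: "q > 0"
    "\<And>i. i \<in> B \<times> B \<times> B \<Longrightarrow> of_nat q * (case i of (b, b', e) \<Rightarrow> Q.representation B (b * b') e) \<in> \<int>"
    using common_denominator[of "B \<times> B \<times> B" "\<lambda>(b, b', e). Q.representation B (b * b') e"] B(2) by auto
  have "coordinates B q"
  proof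
    show "of_nat q * Q.representation B (b * b') e \<in> \<int>" if "b \<in> B" "b' \<in> B" "e \<in> B" for b b' e
      using q(2)[of "(b, b', e)"] that by simp
  qed (use B q assms in \<open>auto simp: fin_dim_ring_def\<close>)
  then show ?thesis using that B(4) by blast
qed

lemma smult_sum_right: "smult c (sum f I) = (\<Sum>i\<in>I. smult c (f i :: 'a::comm_ring_1 poly))"
  by (rule poly_eqI) (simp add: coeff_sum sum_distrib_left)

context coordinates
begin

text \<open>Siegel's lemma: among the products of \<open>R\<close> with polynomials of larger degree and small integer
  coordinates, two agree in all coordinates other than the rational one. Their difference has
  rational integer coefficients.\<close>

lemma integer_multiple:
  assumes R: "over_lat R" "R \<noteq> 0" and \<delta>: "degree R \<le> \<delta>" "\<delta> \<ge> 1" and A: "pn R \<le> A" "A \<ge> 1"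
  shows "\<exists>F::int poly. F \<noteq> 0 \<and> (\<forall>t. poly R t = 0 \<longrightarrow> poly (map_poly of_int F) t = 0) \<and>
    coeff_sum F \<le> (4 * C0 * (card B + 1) ^ 3 * \<delta> * A) ^ ((card B)\<^sup>2 + 2)"
proof -
  define N where "N = card B"
  have N: "N \<ge> 1" unfolding N_def using finite_B one_B by (metis One_nat_def Suc_leI card_gt_0_iff empty_iff)
  \<comment> \<open>With coordinates of \<open>G\<close> in \<open>{0..H}\<close>, the coordinates
    of \<open>R * G\<close> are at most \<open>A2 * H\<close>. The choice
    \<open>H + 1 = u ^ N\<^sup>2\<close>, where \<open>u \<ge> 2 * A2\<close>, makes the
    pigeonhole count work with \<open>N * \<delta>\<close> coefficients of \<open>G\<close>.\<close>
  define A2 where "A2 = C0 * A * real (N\<^sup>2 * \<delta>)"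
  define A3 where "A3 = nat \<lceil>A2\<rceil>"
  have "1 \<le> C0 * A" using C0_ge_1 A(2) by (metis mult_mono' mult_1 zero_le_one)
  moreover have "1 \<le> real (N\<^sup>2 * \<delta>)" using N \<delta>(2) by (metis One_nat_def Suc_leI nat_0_less_mult_iff of_nat_1 of_nat_mono zero_less_power less_le_trans zero_less_one)
  ultimately have A2: "A2 \<ge> 1" unfolding A2_def by (metis mult_mono' mult_1 zero_le_one)
  have A3: "A2 \<le> real A3" "real A3 \<le> 2 * A2" "A3 \<ge> 1"
    using A2 unfolding A3_def by linarith+
  define u where "u = 2 * A3"
  have u: "u \<ge> 2" using A3 by (simp add: u_def)
  define H where "H = u ^ N\<^sup>2 - 1"
  have H: "Suc H = u ^ N\<^sup>2" unfolding H_def using u by simp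
  define I where "I = {..<N * \<delta>} \<times> B"
  define \<Gamma> where "\<Gamma> = PiE I (\<lambda>_. {0..H})"
  define G where "G \<gamma> = (\<Sum>k<N * \<delta>. monom (\<Sum>b\<in>B. of_nat (\<gamma> (k, b)) * b) k)" for \<gamma> :: "nat \<times> qbar \<Rightarrow> nat"
  have Gc: "coeff (G \<gamma>) k = (if k < N * \<delta> then \<Sum>b\<in>B. of_nat (\<gamma> (k, b)) * b else 0)" for \<gamma> k
    unfolding G_def coeff_sum by simp
  have G_int: "coeff (G \<gamma>) k \<in> int_pts" for \<gamma> k
  proof -
    have "sum f I \<in> int_pts" if "\<And>i. i \<in> I \<Longrightarrow> f i \<in> int_pts" for f :: "qbar \<Rightarrow> qbar" and I
      using that by (induction I rule: infinite_finite_induct) (auto simp: int_pts_zero int_pts_add)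
    moreover have "of_nat (\<gamma> (k, b)) * b \<in> int_pts" if "b \<in> B" for b
      by (rule int_pts_of_nat[OF basis_int_pts[OF that]])
    ultimately show ?thesis unfolding Gc by (simp add: int_pts_zero)
  qed
  have G_span: "over_span (G \<gamma>)" for \<gamma>
    using G_int int_pts_span by (auto simp: over_span_def)
  have G_deg: "degree (G \<gamma>) < N * \<delta>" for \<gamma>
  proof -
    have "degree (G \<gamma>) \<le> N * \<delta> - 1" by (rule degree_le) (simp add: Gc)
    moreover have "N * \<delta> > 0" using N \<delta>(2) by simp
    ultimately show ?thesis by linarith
  qed
  have G_rep: "rep (coeff (G \<gamma>) k) b = of_nat (\<gamma> (k, b))" if "k < N * \<delta>" "b \<in> B" for \<gamma> k b
  proof -
    have "rep (coeff (G \<gamma>) k) b = (\<Sum>b'\<in>B. rep (of_nat (\<gamma> (k, b')) * b') b)"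
      unfolding Gc using that by (simp add: rep_sum span_of_nat Q.span_base)
    also have "\<dots> = (\<Sum>b'\<in>B. if b' = b then of_nat (\<gamma> (k, b)) else 0)"
      using that by (intro sum.cong[OF refl]) (auto simp: rep_of_nat Q.span_base rep_basis)
    finally show ?thesis using that finite_B by simp
  qed
  have RG_int: "coeff (R * G \<gamma>) j \<in> int_pts" for \<gamma> j
  proof -
    have s: "sum f I \<in> int_pts" if "\<And>i. i \<in> I \<Longrightarrow> f i \<in> int_pts" for f :: "nat \<Rightarrow> qbar" and I
      using that by (induction I rule: infinite_finite_induct) (auto simp: int_pts_zero int_pts_add)
    have "coeff R i * coeff (G \<gamma>) (j - i) \<in> int_pts" for i
      using R(1) by (intro lat_times_int_pts G_int) (simp add: over_lat_def)
    then show ?thesis unfolding coeff_mult by (intro s)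
  qed
  have RG_deg: "coeff (R * G \<gamma>) j = 0" if "j \<ge> (N + 1) * \<delta>" for \<gamma> j
  proof (rule coeff_eq_0)
    have "degree (R * G \<gamma>) \<le> degree R + degree (G \<gamma>)" by (rule degree_mult_le)
    also have "\<dots> < \<delta> + N * \<delta>" using \<delta>(1) G_deg[of \<gamma>] by linarith
    also have "\<dots> \<le> j" using that by (simp add: algebra_simps)
    finally show "degree (R * G \<gamma>) < j" .
  qed
  have RG_bound: "\<bar>real_of_rat (rep (coeff (R * G \<gamma>) j) b)\<bar> \<le> real (A3 * H)" if "\<gamma> \<in> \<Gamma>" "b \<in> B" for \<gamma> j b
  proof -
    have "pn (G \<gamma>) = (\<Sum>k\<le>N * \<delta> - 1. nrm (coeff (G \<gamma>) k))"
      using G_deg[of \<gamma>] by (intro pn_eq) linarith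
    also have "\<dots> = (\<Sum>k<N * \<delta>. nrm (coeff (G \<gamma>) k))"
    proof -
      have "{..N * \<delta> - 1} = {..<N * \<delta>}" using G_deg[of \<gamma>] by (auto simp del: One_nat_def)
      then show ?thesis by simp
    qed
    also have "\<dots> \<le> (\<Sum>k<N * \<delta>. real N * real H)"
    proof (rule sum_mono)
      fix k assume k: "k \<in> {..<N * \<delta>}"
      have "nrm (coeff (G \<gamma>) k) = (\<Sum>b\<in>B. real (\<gamma> (k, b)))"
        unfolding nrm_def using k G_rep[of k] by (intro sum.cong) auto
      also have "\<dots> \<le> (\<Sum>b\<in>B. real H)"
        using that(1) k by (intro sum_mono) (auto simp: \<Gamma>_def I_def PiE_def Pi_def)
      finally show "nrm (coeff (G \<gamma>) k) \<le> real N * real H" by (simp add: N_def)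
    qed
    finally have pG: "pn (G \<gamma>) \<le> real (N\<^sup>2 * \<delta>) * real H" by (simp add: power2_eq_square mult_ac)
    have "\<bar>real_of_rat (rep (coeff (R * G \<gamma>) j) b)\<bar> \<le> nrm (coeff (R * G \<gamma>) j)"
      unfolding nrm_def by (rule member_le_sum) (use that finite_B in auto)
    also have "\<dots> \<le> pn (R * G \<gamma>)" by (rule nrm_coeff_le_pn)
    also have "\<dots> \<le> C0 * pn R * pn (G \<gamma>)" by (rule pn_mult[OF over_lat_span[OF R(1)] G_span])
    also have "\<dots> \<le> C0 * A * (real (N\<^sup>2 * \<delta>) * real H)"
      using A C0_ge_1 pG by (intro mult_mono mult_left_mono) auto
    also have "\<dots> = A2 * real H" by (simp add: A2_def)
    also have "\<dots> \<le> real (A3 * H)" using A3(1) by (simp add: mult_right_mono)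
    finally show ?thesis .
  qed
  \<comment> \<open>Only the coordinates with index other than \<open>1\<close> have to agree.\<close>
  define W where "W = {..<(N + 1) * \<delta>} \<times> (B - {1})"
  define \<Phi> where "\<Phi> \<gamma> = restrict (\<lambda>(j, b). \<lfloor>rep (coeff (R * G \<gamma>) j) b\<rfloor>) W" for \<gamma>
  define T where "T = PiE W (\<lambda>_. {- int (A3 * H)..int (A3 * H)})"
  have "\<Phi> ` \<Gamma> \<subseteq> T"
  proof clarify
    fix \<gamma> assume \<gamma>: "\<gamma> \<in> \<Gamma>"
    have "\<lfloor>rep (coeff (R * G \<gamma>) j) b\<rfloor> \<in> {- int (A3 * H)..int (A3 * H)}" if b: "b \<in> B" for j b
    proof -
      have "rep (coeff (R * G \<gamma>) j) b \<in> \<int>" using RG_int[of \<gamma> j] b by (simp add: int_pts_def)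
      then obtain z where z: "rep (coeff (R * G \<gamma>) j) b = of_int z" by (rule Ints_cases)
      have "\<bar>real_of_int z\<bar> \<le> real (A3 * H)" using RG_bound[OF \<gamma> b, of j] unfolding z by simp
      then have "\<bar>z\<bar> \<le> int (A3 * H)" by linarith
      then show ?thesis unfolding z by auto
    qed
    then show "\<Phi> \<gamma> \<in> T" by (auto simp: \<Phi>_def T_def W_def)
  qed
  moreover have "card T < card \<Gamma>"
  proof -
    have cW: "card W = (N\<^sup>2 - 1) * \<delta>"
    proof -
      have "card W = ((N + 1) * \<delta>) * (N - 1)"
        unfolding W_def N_def using one_B finite_B by (simp add: card_cartesian_product)
      also have "\<dots> = (N\<^sup>2 - 1) * \<delta>" by (cases N) (auto simp: power2_eq_square algebra_simps)
      finally show ?thesis .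
    qed
    have fW: "finite W" unfolding W_def using finite_B by simp
    have "card {- int k..int k} = 2 * k + 1" for k by simp
    then have "card T = (2 * (A3 * H) + 1) ^ ((N\<^sup>2 - 1) * \<delta>)"
      by (simp only: T_def card_PiE[OF fW] prod_constant cW)
    also have "\<dots> \<le> (u * u ^ N\<^sup>2) ^ ((N\<^sup>2 - 1) * \<delta>)"
    proof (rule power_mono)
      have "2 * (A3 * H) + 1 \<le> u * Suc H" using A3(3) by (simp add: u_def)
      then show "2 * (A3 * H) + 1 \<le> u * u ^ N\<^sup>2" by (simp only: H)
    qed simp
    also have "\<dots> = u ^ ((N\<^sup>2 + 1) * ((N\<^sup>2 - 1) * \<delta>))"
      by (simp only: power_Suc[symmetric] power_mult[symmetric] Suc_eq_plus1)
    also have "\<dots> < u ^ (N\<^sup>2 * (N\<^sup>2 * \<delta>))"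
    proof (rule power_strict_increasing)
      obtain k where k: "N\<^sup>2 = Suc k" using N by (metis One_nat_def Suc_le_D one_le_power)
      \<comment> \<open>This is \<open>N\<^sup>4 - 1 < N\<^sup>4\<close>: there are
        \<open>(N\<^sup>2 - 1) * \<delta>\<close> conditions with at most
        \<open>u ^ (N\<^sup>2 + 1)\<close> outcomes each, and
        \<open>N\<^sup>2 * \<delta>\<close> unknowns with \<open>u ^ N\<^sup>2\<close> values
        each.\<close>
      show "(N\<^sup>2 + 1) * ((N\<^sup>2 - 1) * \<delta>) < N\<^sup>2 * (N\<^sup>2 * \<delta>)"
        using \<delta>(2) unfolding k by (simp add: algebra_simps)
    qed (use u in simp)
    also have "\<dots> = card \<Gamma>"
    proof -
      have "card I = N\<^sup>2 * \<delta>" unfolding I_def by (simp add: N_def card_cartesian_product power2_eq_square mult_ac)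
      moreover have "finite I" unfolding I_def using finite_B by simp
      moreover have "card {0..H} = u ^ N\<^sup>2" using H by simp
      ultimately have "card \<Gamma> = (u ^ N\<^sup>2) ^ (N\<^sup>2 * \<delta>)" by (simp only: \<Gamma>_def card_PiE prod_constant)
      then show ?thesis by (simp only: power_mult[symmetric])
    qed
    finally show ?thesis .
  qed
  moreover have "finite T" unfolding T_def W_def using finite_B by (intro finite_PiE) auto
  ultimately have "\<not> inj_on \<Phi> \<Gamma>" by (metis card_inj_on_le not_le)
  then obtain \<gamma> \<gamma>' where \<gamma>: "\<gamma> \<in> \<Gamma>" "\<gamma>' \<in> \<Gamma>" "\<gamma> \<noteq> \<gamma>'" "\<Phi> \<gamma> = \<Phi> \<gamma>'" by (auto simp: inj_on_def)
  define D where "D = G \<gamma> - G \<gamma>'"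
  have "D \<noteq> 0"
  proof
    assume "D = 0"
    then have "G \<gamma> = G \<gamma>'" by (simp add: D_def)
    then have "of_nat (\<gamma> (k, b)) = (of_nat (\<gamma>' (k, b)) :: rat)" if "k < N * \<delta>" "b \<in> B" for k b
      using G_rep[OF that] by metis
    then have "\<gamma> = \<gamma>'" using \<gamma>(1,2) unfolding \<Gamma>_def I_def by (intro PiE_ext) auto
    then show False using \<gamma>(3) by simp
  qed
  have RD: "coeff (R * D) j = coeff (R * G \<gamma>) j + of_rat (-1) * coeff (R * G \<gamma>') j" for j
    by (simp add: D_def right_diff_distrib)
  have repRD: "rep (coeff (R * D) j) b = rep (coeff (R * G \<gamma>) j) b - rep (coeff (R * G \<gamma>') j) b" for j b
    unfolding RD using RG_int[of _ j] by (simp only: rep_add int_pts_span Q.span_scale rep_scale mult_minus_left mult_1 uminus_add_conv_diff diff_conv_add_uminus)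
  have span_RD: "coeff (R * D) j \<in> Q.span B" for j
    unfolding RD by (intro Q.span_add Q.span_scale int_pts_span RG_int)
  define F where "F = map_poly (\<lambda>y. \<lfloor>rep y 1\<rfloor>) (R * D)"
  have cF: "coeff F j = \<lfloor>rep (coeff (R * D) j) 1\<rfloor>" for j
    by (simp add: F_def coeff_map_poly rep_zero)
  have int1: "of_int (coeff F j) = rep (coeff (R * D) j) 1" for j
    unfolding cF repRD using RG_int[of _ j] one_B by (auto simp: int_pts_def elim!: Ints_cases dest!: spec)
  have eq: "coeff (R * D) j = of_int (coeff F j)" for j
  proof -
    have 0: "rep (coeff (R * D) j) b = 0" if b: "b \<in> B - {1}" for b
    proof (cases "j < (N + 1) * \<delta>")
      case True
      then have "\<lfloor>rep (coeff (R * G \<gamma>) j) b\<rfloor> = \<lfloor>rep (coeff (R * G \<gamma>') j) b\<rfloor>"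
        using fun_cong[OF \<gamma>(4), of "(j, b)"] b by (simp add: \<Phi>_def W_def)
      moreover have "rep (coeff (R * G \<gamma>) j) b \<in> \<int>" "rep (coeff (R * G \<gamma>') j) b \<in> \<int>"
        using RG_int b by (auto simp: int_pts_def)
      ultimately show ?thesis unfolding repRD by (auto elim!: Ints_cases)
    next
      case False
      then show ?thesis unfolding RD using RG_deg[of j] by (simp add: rep_zero)
    qed
    have "coeff (R * D) j = (\<Sum>b\<in>B. of_rat (rep (coeff (R * D) j) b) * b)"
      by (rule rep_expand[OF span_RD])
    also have "\<dots> = of_rat (rep (coeff (R * D) j) 1) * 1 + (\<Sum>b\<in>B - {1}. of_rat (rep (coeff (R * D) j) b) * b)"
      by (rule sum.remove[OF finite_B one_B])
    also have "(\<Sum>b\<in>B - {1}. of_rat (rep (coeff (R * D) j) b) * b) = 0"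
      by (rule sum.neutral) (simp add: 0)
    finally show ?thesis by (simp add: int1[symmetric])
  qed
  have F_eq: "map_poly of_int F = R * D"
    by (rule poly_eqI) (simp only: coeff_map_poly of_int_0 eq)
  have "F \<noteq> 0" using F_eq R(2) \<open>D \<noteq> 0\<close> by auto
  moreover have "poly (map_poly of_int F) t = 0" if "poly R t = 0" for t
    unfolding F_eq using that by simp
  moreover have "coeff_sum F \<le> (4 * C0 * (card B + 1) ^ 3 * \<delta> * A) ^ ((card B)\<^sup>2 + 2)"
  proof -
    have le: "real_of_int \<bar>coeff F j\<bar> \<le> real (u ^ (N\<^sup>2 + 1))" for j
    proof -
      have "real_of_int \<bar>coeff F j\<bar> = \<bar>real_of_rat (of_int (coeff F j))\<bar>" by simp
      also have "\<dots> \<le> \<bar>real_of_rat (rep (coeff (R * G \<gamma>) j) 1)\<bar> + \<bar>real_of_rat (rep (coeff (R * G \<gamma>') j) 1)\<bar>"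
        unfolding int1 repRD of_rat_diff by (rule abs_triangle_ineq4)
      also have "\<dots> \<le> real (A3 * H) + real (A3 * H)" using RG_bound \<gamma>(1,2) one_B by (intro add_mono)
      also have "\<dots> \<le> real (u * Suc H)" by (simp add: u_def)
      also have "\<dots> = real (u ^ (N\<^sup>2 + 1))" unfolding H by simp
      finally show ?thesis .
    qed
    have dF: "degree F < (N + 1) * \<delta>"
    proof -
      have "degree F \<le> (N + 1) * \<delta> - 1"
      proof (rule degree_le, intro allI impI)
        fix j assume "(N + 1) * \<delta> - 1 < j"
        then have "j \<ge> (N + 1) * \<delta>" by linarith
        then have "coeff (R * D) j = 0" unfolding RD using RG_deg by simp
        then show "coeff F j = 0" using eq[of j] by simp
      qed
      moreover have "(N + 1) * \<delta> > 0" using \<delta>(2) by simp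
      ultimately show ?thesis by linarith
    qed
    define z where "z = 4 * C0 * (real N + 1) ^ 3 * \<delta> * A"
    have z1: "real ((N + 1) * \<delta>) \<le> z" and z2: "real u \<le> z"
    proof -
      have n3: "(real N)\<^sup>2 \<le> (real N + 1) ^ 3" "real N + 1 \<le> (real N + 1) ^ 3"
        using power_increasing[of 1 3 "real N + 1"] power_increasing[of 2 3 "real N + 1"] 
          power_mono[of "real N" "real N + 1" 2] by (auto intro: order_trans[of _ "(real N + 1)\<^sup>2"])
      have CA: "1 \<le> C0 * A" by fact
      have "real u \<le> 4 * A2" using A3(2) by (simp add: u_def)
      also have "\<dots> = 4 * (C0 * A * real \<delta>) * (real N)\<^sup>2" by (simp add: A2_def)
      also have "\<dots> \<le> 4 * (C0 * A * real \<delta>) * (real N + 1) ^ 3"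
        using n3(1) CA by (intro mult_left_mono) auto
      also have "\<dots> = z" by (simp add: z_def)
      finally show "real u \<le> z" .
      have "real ((N + 1) * \<delta>) = 1 * ((real N + 1) * real \<delta>)" by (simp add: algebra_simps)
      also have "\<dots> \<le> (4 * (C0 * A)) * ((real N + 1) ^ 3 * real \<delta>)"
        using n3(2) CA by (intro mult_mono mult_right_mono) auto
      also have "\<dots> = z" by (simp add: z_def)
      finally show "real ((N + 1) * \<delta>) \<le> z" .
    qed
    have "coeff_sum F \<le> (\<Sum>j\<le>degree F. real (u ^ (N\<^sup>2 + 1)))"
      unfolding coeff_sum_def by (intro sum_mono le)
    also have "\<dots> = real (degree F + 1) * real u ^ (N\<^sup>2 + 1)" by simp
    also have "\<dots> \<le> z * z ^ (N\<^sup>2 + 1)"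
    proof (intro mult_mono power_mono z2)
      have "real (degree F + 1) \<le> real ((N + 1) * \<delta>)" using dF by linarith
      then show "real (degree F + 1) \<le> z" using z1 by linarith
      show "0 \<le> z" using z2 by linarith
    qed auto
    also have "\<dots> = z ^ (N\<^sup>2 + 2)" by simp
    finally show ?thesis unfolding z_def N_def by (simp add: add.commute)
  qed
  ultimately show ?thesis by blast
qed

section \<open>Height and degree of a coincidence of two orbits\<close>

text \<open>Both the size and the denominators of the coefficients of the \<open>k\<close>-th iterate are exponential
  in \<open>d\<^sup>k\<close> only.\<close>

lemma orbit_over_lat:
  assumes d: "d \<ge> 2" and L: "L > 0" "over_lat (smult (of_nat L) c)" "\<And>i. i \<in> {1..d} \<Longrightarrow> over_lat (smult (of_nat L) (A i))"
  shows "over_lat (smult (of_nat L ^ d ^ k) (orbit d A c k))"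
proof (induction k)
  case 0
  then show ?case using L by simp
next
  case (Suc k)
  let ?P = "orbit d A c k" and ?l = "of_nat L ^ d ^ k :: qbar"
  have "smult (?l ^ d) (A i * ?P ^ (d - i)) =
      smult (of_nat (L ^ (i * d ^ k - 1))) (smult (of_nat L) (A i) * smult ?l ?P ^ (d - i))" if i: "i \<in> {1..d}" for i
  proof -
    have "i * d ^ k \<ge> 1" using i d by simp
    have "?l ^ d = ?l ^ i * ?l ^ (d - i)" using i by (simp flip: power_add)
    also have "?l ^ i = of_nat L ^ (i * d ^ k)" by (simp flip: power_mult add: mult.commute)
    also have "\<dots> = of_nat (L ^ (i * d ^ k - 1)) * of_nat L" 
      using \<open>i * d ^ k \<ge> 1\<close> by (metis Suc_diff_le diff_Suc_1 of_nat_power plus_1_eq_Suc power_Suc2 le_add_diff_inverse)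
    finally show ?thesis by (simp add: smult_power mult_ac)
  qed
  moreover have "over_lat (smult (of_nat (L ^ (i * d ^ k - 1))) (smult (of_nat L) (A i) * smult ?l ?P ^ (d - i)))"
    if i: "i \<in> {1..d}" for i
  proof (cases "d - i = 0")
    case True
    then show ?thesis using L(3)[OF i] by (intro over_lat_of_nat) simp
  next
    case False
    then have "over_lat (smult ?l ?P ^ (d - i))" by (intro over_lat_power Suc) simp
    then show ?thesis by (rule over_lat_of_nat[OF over_lat_mult[OF L(3)[OF i]]])
  qed
  moreover have "over_lat (smult ?l ?P ^ d)" using d by (intro over_lat_power Suc) auto
  moreover have "smult (of_nat L ^ d ^ Suc k) (orbit d A c (Suc k)) =
     smult ?l ?P ^ d + (\<Sum>i=1..d. smult (?l ^ d) (A i * ?P ^ (d - i)))"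
  proof -
    have "of_nat L ^ d ^ Suc k = ?l ^ d" by (simp flip: power_mult add: mult.commute)
    then show ?thesis by (simp add: smult_add_right smult_power[symmetric] smult_sum_right)
  qed
  ultimately show ?case by (auto intro!: over_lat_add over_lat_sum)
qed

lemma orbit_over_span:
  assumes "over_span c" "\<And>i. i \<in> {1..d} \<Longrightarrow> over_span (A i)"
  shows "over_span (orbit d A c k)"
  using assms by (induction k) (auto intro!: over_span_add over_span_sum over_span_mult over_span_power)

lemma orbit_pn:
  assumes d: "d \<ge> 2" and c: "over_span c" "\<And>i. i \<in> {1..d} \<Longrightarrow> over_span (A i)"
  obtains H where "H \<ge> 1" "\<And>k. pn (orbit d A c k) \<le> H ^ d ^ k"
proof -
  define D where "D = 1 + (\<Sum>i=1..d. C0 * pn (A i))"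
  define E where "E = D * C0 ^ d"
  have D: "D \<ge> 1" unfolding D_def using C0_ge_1 by (simp add: sum_nonneg)
  have E: "E \<ge> 1" unfolding E_def using D C0_ge_1 by (metis mult_mono' mult_1 zero_le_one one_le_power)
  define s where "s k = max 1 (pn (orbit d A c k))" for k
  have step: "s (Suc k) \<le> E * s k ^ d" for k
  proof -
    let ?P = "orbit d A c k"
    have P: "over_span ?P" by (rule orbit_over_span[OF c])
    have Cs: "C0 * s k \<ge> 1" using C0_ge_1 by (simp add: s_def) (metis mult_mono' mult_1 zero_le_one max.cobounded1)
    have "pn (orbit d A c (Suc k)) \<le> pn (?P ^ d) + pn (\<Sum>i=1..d. A i * ?P ^ (d - i))"
      using c P by (auto intro!: pn_add over_span_power over_span_sum over_span_mult)
    also have "\<dots> \<le> (C0 * s k) ^ d + (\<Sum>i=1..d. pn (A i * ?P ^ (d - i)))"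
      unfolding s_def using c P by (intro add_mono pn_power pn_sum over_span_mult over_span_power) auto
    also have "\<dots> \<le> (C0 * s k) ^ d + (\<Sum>i=1..d. C0 * pn (A i) * (C0 * s k) ^ d)"
    proof (intro add_left_mono sum_mono)
      fix i assume i: "i \<in> {1..d}"
      have "pn (A i * ?P ^ (d - i)) \<le> C0 * pn (A i) * pn (?P ^ (d - i))"
        using c i P by (intro pn_mult over_span_power) auto
      also have "\<dots> \<le> C0 * pn (A i) * (C0 * s k) ^ (d - i)"
        unfolding s_def using C0_ge_1 by (intro mult_left_mono pn_power P) auto
      also have "\<dots> \<le> C0 * pn (A i) * (C0 * s k) ^ d"
        using C0_ge_1 Cs by (intro mult_left_mono power_increasing) auto
      finally show "pn (A i * ?P ^ (d - i)) \<le> C0 * pn (A i) * (C0 * s k) ^ d" .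
    qed
    also have "\<dots> = E * s k ^ d" by (simp add: E_def D_def power_mult_distrib algebra_simps sum_distrib_right sum_distrib_left)
    finally have "pn (orbit d A c (Suc k)) \<le> E * s k ^ d" .
    moreover have "1 \<le> E * s k ^ d"
      using E one_le_power[of "s k" d] by (metis s_def max.cobounded1 mult_mono' mult_1 zero_le_one)
    ultimately show ?thesis by (simp add: s_def)
  qed
  have inv: "E * s k \<le> (E * s 0) ^ d ^ k" for k
  proof (induction k)
    case (Suc k)
    have "E * s (Suc k) \<le> E * (E * s k ^ d)" using step E by (intro mult_left_mono) auto
    also have "\<dots> = E ^ 2 * s k ^ d" by (simp add: power2_eq_square)
    also have "\<dots> \<le> E ^ d * s k ^ d"
      using E d by (intro mult_right_mono power_increasing) (auto simp: s_def)
    also have "\<dots> = (E * s k) ^ d" by (simp add: power_mult_distrib)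
    also have "\<dots> \<le> ((E * s 0) ^ d ^ k) ^ d" using E by (intro power_mono Suc) (auto simp: s_def)
    finally show ?case by (simp flip: power_mult add: mult.commute)
  qed simp
  show ?thesis
  proof (rule that[of "E * s 0"])
    show "1 \<le> E * s 0" using E by (metis s_def max.cobounded1 mult_mono' mult_1 zero_le_one)
    have "s k \<le> E * s k" for k using E mult_right_mono[of 1 E "s k"] by (simp add: s_def)
    then show "pn (orbit d A c k) \<le> (E * s 0) ^ d ^ k" for k
      using inv[of k] by (metis s_def max.cobounded2 order_trans)
  qed
qed

end

lemma orbit_degree_le:
  assumes d: "d \<ge> 2" and A: "\<And>i. i \<in> {1..d} \<Longrightarrow> degree (A i) < i"
  shows "degree (orbit d A [:c:] k :: 'a::comm_ring_1 poly) \<le> d ^ k"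
proof (induction k)
  case (Suc k)
  let ?P = "orbit d A [:c:] k"
  have P: "degree (?P ^ j) \<le> j * d ^ k" for j
  proof -
    have "degree (?P ^ j) \<le> degree ?P * j" by (rule degree_power_le)
    also have "\<dots> \<le> d ^ k * j" using Suc by (rule mult_right_mono) simp
    finally show ?thesis by (simp add: mult.commute)
  qed
  have "degree (A i * ?P ^ (d - i)) \<le> d ^ Suc k" if i: "i \<in> {1..d}" for i
  proof -
    have "degree (A i * ?P ^ (d - i)) \<le> degree (A i) + degree (?P ^ (d - i))" by (rule degree_mult_le)
    also have "\<dots> \<le> i * d ^ k + (d - i) * d ^ k"
    proof (rule add_mono[OF _ P])
      have "degree (A i) \<le> i * 1" using A[OF i] by simp
      also have "\<dots> \<le> i * d ^ k" using d by (intro mult_left_mono) auto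
      finally show "degree (A i) \<le> i * d ^ k" .
    qed
    also have "\<dots> = d ^ Suc k" using i by (simp flip: add_mult_distrib)
    finally show ?thesis .
  qed
  then have "degree (\<Sum>i=1..d. A i * ?P ^ (d - i)) \<le> d ^ Suc k"
    by (intro degree_sum_le) auto
  then show ?case using P[of d] by (simp add: degree_add_le)
qed simp

text \<open>After clearing denominators, the difference of the two iterates divides a nonzero integer polynomial
  whose coefficients have size \<open>exp (O(d\<^sup>M))\<close>, where \<open>M = max m n\<close>.\<close>

theorem orbit_coincidence_height:
  assumes d: "d \<ge> 2" and A: "\<And>i. i \<in> {1..d} \<Longrightarrow> degree (A i) < i"
  obtains C where "C \<ge> 0" "\<And>m n t. orbit d A [:a:] m \<noteq> orbit d A [:b:] n \<Longrightarrow>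
     poly (orbit d A [:a:] m) t = poly (orbit d A [:b:] n) t \<Longrightarrow>
     weil_height t * real (field_degree (field_gen t)) \<le> C * real d ^ max m n"
proof -
  define Y where "Y = insert a (insert b (\<Union>i\<in>{1..d}. coeff (A i) ` {..degree (A i)}))"
  have "finite Y" by (auto simp: Y_def)
  then obtain V where V: "fin_dim_ring V" "Y \<subseteq> V" by (rule finite_subset_fin_dim_ring)
  obtain B q where B: "coordinates B q" "Q.span B = V" using coordinates_exist[OF V(1)] .
  interpret coordinates B q by fact
  obtain L :: nat where L: "L > 0" "\<And>y. y \<in> Y \<Longrightarrow> of_nat L * y \<in> lat"
    using common_denominator_lat[OF \<open>finite Y\<close>] V(2) B(2) by blast
  have ca: "over_lat (smult (of_nat L) [:c:])" "over_span [:c:]" if "c \<in> Y" for c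
    using L(2)[OF that] that V(2) B(2) lat_zero Q.span_zero
    by (auto simp: over_lat_def over_span_def coeff_pCons split: nat.splits)
  have cA: "over_lat (smult (of_nat L) (A i))" "over_span (A i)" if i: "i \<in> {1..d}" for i
  proof -
    have *: "coeff (A i) j = 0 \<or> coeff (A i) j \<in> Y" for j
      using i by (cases "j \<le> degree (A i)") (auto simp: Y_def coeff_eq_0)
    then have "of_nat L * coeff (A i) j \<in> lat" for j using L(2) lat_zero by (metis mult_zero_right)
    then show "over_lat (smult (of_nat L) (A i))" by (simp add: over_lat_def)
    have "coeff (A i) j \<in> Q.span B" for j using *[of j] V(2) B(2) Q.span_zero by auto
    then show "over_span (A i)" by (simp add: over_span_def)
  qed
  have ab: "a \<in> Y" "b \<in> Y" by (auto simp: Y_def)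
  obtain H1 where H1: "H1 \<ge> 1" "\<And>k. pn (orbit d A [:a:] k) \<le> H1 ^ d ^ k"
    using orbit_pn[where A = A, OF d ca(2)[OF ab(1)] cA(2)] by metis
  obtain H2 where H2: "H2 \<ge> 1" "\<And>k. pn (orbit d A [:b:] k) \<le> H2 ^ d ^ k"
    using orbit_pn[where A = A, OF d ca(2)[OF ab(2)] cA(2)] by metis
  define H where "H = max H1 H2"
  define e where "e = (card B)\<^sup>2 + 2"
  define z where "z = 4 * C0 * (card B + 1) ^ 3"
  define C where "C = e * (ln z + 1 + ln (2 * L * H))"
  have H: "H \<ge> 1" using H1 by (simp add: H_def)
  have "1 \<le> (real (card B) + 1) ^ 3" by (rule one_le_power) simp
  then have "1 \<le> C0 * (real (card B) + 1) ^ 3" using C0_ge_1 by (metis mult_mono' mult_1 zero_le_one)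
  then have z: "z \<ge> 1" by (simp add: z_def add.commute)
  have "1 * 1 \<le> real L * H" using L(1) H by (intro mult_mono) auto
  then have LH: "2 * L * H \<ge> 1" by simp
  have C: "C \<ge> 0" unfolding C_def using z LH by simp
  show ?thesis
  proof (rule that[OF C])
    fix m n t assume ne: "orbit d A [:a:] m \<noteq> orbit d A [:b:] n"
      and eq: "poly (orbit d A [:a:] m) t = poly (orbit d A [:b:] n) t"
    define M where "M = max m n"
    define D where "D = d ^ M"
    have D: "D \<ge> 1" using d by (simp add: D_def)
    let ?P = "orbit d A [:a:] m" and ?Q = "orbit d A [:b:] n"
    \<comment> \<open>The power \<open>L ^ D\<close> is a common denominator of both iterates.\<close>
    define R where "R = smult (of_nat (L ^ D)) (?P - ?Q)"
    have PQ: "over_lat (smult (of_nat (L ^ D)) ?P)" "over_lat (smult (of_nat (L ^ D)) ?Q)"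
    proof -
      have *: "over_lat (smult (of_nat (L ^ D)) (orbit d A [:c:] k))" if "k \<le> M" "c \<in> Y" for c k
      proof -
        have "d ^ k \<le> D" using that d by (simp add: D_def power_increasing)
        then have "L ^ D = L ^ (D - d ^ k) * L ^ d ^ k" by (simp flip: power_add)
        then have "smult (of_nat (L ^ D)) (orbit d A [:c:] k) =
           smult (of_nat (L ^ (D - d ^ k))) (smult (of_nat L ^ d ^ k) (orbit d A [:c:] k))" by simp
        then show ?thesis
          using orbit_over_lat[where A = A, OF d L(1) ca(1)[OF that(2)] cA(1)] by (simp only: over_lat_of_nat)
      qed
      show "over_lat (smult (of_nat (L ^ D)) ?P)" "over_lat (smult (of_nat (L ^ D)) ?Q)"
        using *[of m a] *[of n b] ab by (auto simp: M_def)
    qed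
    have R: "over_lat R"
    proof -
      have "R = smult (of_nat (L ^ D)) ?P + (- smult (of_nat (L ^ D)) ?Q)"
        by (simp add: R_def smult_diff_right)
      moreover have "over_lat (- smult (of_nat (L ^ D)) ?Q)" using PQ(2) lat_minus by (simp add: over_lat_def)
      ultimately show ?thesis using over_lat_add[OF PQ(1)] by metis
    qed
    have R0: "R \<noteq> 0" using ne L(1) by (simp add: R_def)
    have dR: "degree R \<le> D"
    proof -
      have "degree ?P \<le> D" "degree ?Q \<le> D"
      proof -
        have "d ^ m \<le> D" "d ^ n \<le> D" using d by (auto simp: D_def M_def intro!: power_increasing)
        then show "degree ?P \<le> D" "degree ?Q \<le> D"
          using orbit_degree_le[of d A a m, OF d A] orbit_degree_le[of d A b n, OF d A] by (meson order_trans)+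
      qed
      then have "degree (?P - ?Q) \<le> D" by (rule degree_diff_le)
      then show ?thesis using degree_smult_le[of _ "?P - ?Q"] by (simp add: R_def) 
    qed
    have pR: "pn R \<le> (2 * L * H) ^ D"
    proof -
      have sp: "over_span ?P" "over_span ?Q" using ca(2) cA(2) ab by (auto intro!: orbit_over_span)
      have k: "pn (orbit d A [:a:] m) \<le> H ^ D" "pn (orbit d A [:b:] n) \<le> H ^ D"
      proof -
        have "H1 ^ d ^ m \<le> H ^ d ^ m" "H2 ^ d ^ n \<le> H ^ d ^ n" using H1 H2 by (auto simp: H_def intro!: power_mono)
        moreover have "H ^ d ^ m \<le> H ^ D" "H ^ d ^ n \<le> H ^ D"
          using H d unfolding D_def M_def by (auto intro!: power_increasing)
        ultimately show "pn (orbit d A [:a:] m) \<le> H ^ D" "pn (orbit d A [:b:] n) \<le> H ^ D"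
          using H1(2)[of m] H2(2)[of n] by linarith+
      qed
      have "over_span (- ?Q)" using sp(2) by (simp add: over_span_def Q.span_neg)
      moreover have "pn (- ?Q) = pn ?Q" using pn_smult_rat[OF sp(2), of "-1"] by simp
      ultimately have "pn (?P - ?Q) \<le> H ^ D + H ^ D"
        using pn_add[of ?P "- ?Q"] sp k by simp
      moreover have "pn R = real L ^ D * pn (?P - ?Q)"
        unfolding R_def using pn_smult_rat[of "?P - ?Q" "of_nat (L ^ D)"] over_span_add[of ?P "- ?Q"] sp \<open>over_span (- ?Q)\<close>
        by (simp add: of_rat_power)
      ultimately have "pn R \<le> real L ^ D * (2 * H ^ D)" by (simp add: mult_left_mono)
      also have "\<dots> \<le> real L ^ D * (2 ^ D * H ^ D)"
        using H D power_increasing[of 1 D "2::real"] by (intro mult_left_mono mult_right_mono) auto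
      finally show ?thesis by (simp add: power_mult_distrib mult_ac)
    qed
    have "1 \<le> (2 * L * H) ^ D" using LH by (rule one_le_power)
    then obtain F :: "int poly" where F: "F \<noteq> 0" "\<And>t. poly R t = 0 \<Longrightarrow> poly (map_poly of_int F) t = 0"
      "coeff_sum F \<le> (z * D * (2 * L * H) ^ D) ^ e"
      using integer_multiple[OF R R0 dR D pR] unfolding z_def e_def by blast
    have "poly R t = 0" using eq by (simp add: R_def)
    then have "weil_height t * real (field_degree (field_gen t)) \<le> ln (coeff_sum F)"
      by (intro weil_height_le_coeff_sum F)
    also have "\<dots> \<le> ln ((z * D * (2 * L * H) ^ D) ^ e)"
      using F(3) coeff_sum_ge_1[OF F(1)] by (intro ln_mono) auto
    also have "\<dots> = e * (ln z + ln D + D * ln (2 * L * H))"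
    proof -
      have pos: "z > 0" "real D > 0" "2 * L * H > 0" using z D LH by linarith+
      then have "ln (z * D * (2 * L * H) ^ D) = ln (z * D) + ln ((2 * L * H) ^ D)"
        by (intro ln_mult_pos) (simp_all only: zero_less_power zero_less_mult_iff, auto)
      also have "\<dots> = ln z + ln D + D * ln (2 * L * H)"
        unfolding ln_mult_pos[OF pos(1,2)] using pos(3) by (simp only: ln_realpow)
      finally have "ln (z * D * (2 * L * H) ^ D) = ln z + ln D + D * ln (2 * L * H)" .
      moreover have "0 < z * D * (2 * L * H) ^ D" using pos by simp
      ultimately show ?thesis by (simp only: ln_realpow)
    qed
    also have "\<dots> \<le> e * (D * ln z + D * 1 + D * ln (2 * L * H))"
    proof (intro mult_left_mono add_mono)
      show "ln z \<le> D * ln z" using z D mult_right_mono[of 1 "real D" "ln z"] by simp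
      show "ln (real D) \<le> D * 1" using D ln_le_minus_one[of "real D"] by simp
    qed auto
    also have "\<dots> = C * D" by (simp add: C_def algebra_simps)
    finally show "weil_height t * real (field_degree (field_gen t)) \<le> C * real d ^ max m n"
      by (simp add: D_def M_def)
  qed
qed

section \<open>Algebraic integers\<close>

interpretation Zm: Modules.module "\<lambda>(n::int) (x::qbar). of_int n * x"
  by unfold_locales (auto simp: algebra_simps)

text \<open>The algebraic integers. With finitely generated modules instead of monic polynomials, closure
  under the ring operations needs no resultants or symmetric functions.\<close>

definition integral :: "qbar \<Rightarrow> bool" where
  "integral y \<longleftrightarrow> (\<exists>E. finite E \<and> 1 \<in> E \<and> (\<forall>e\<in>E. y * e \<in> Zm.span E))"

lemma zspan_mult:
  assumes "x \<in> Zm.span A" "y \<in> Zm.span B"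
  shows "x * y \<in> Zm.span {a * b |a b. a \<in> A \<and> b \<in> B}"
proof -
  let ?S = "Zm.span {a * b |a b. a \<in> A \<and> b \<in> B}"
  have 1: "a * y \<in> ?S" if "a \<in> A" "y \<in> Zm.span B" for a y
    using that(2)
  proof (induction rule: Zm.span_induct)
    case base
    show ?case
    proof (rule Zm.subspaceI)
      show "c \<in> {y. a * y \<in> ?S} \<Longrightarrow> of_int r * c \<in> {y. a * y \<in> ?S}" for r c
        using Zm.span_scale[of "a * c" _ r] by (simp add: mult.left_commute)
    qed (simp_all add: distrib_left Zm.span_zero Zm.span_add)
  next
    case (step b)
    then show ?case using that(1) by (intro Zm.span_base) auto
  qed
  from assms(1) show ?thesis
  proof (induction rule: Zm.span_induct)
    case base
    show ?case
    proof (rule Zm.subspaceI)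
      show "c \<in> {x. x * y \<in> ?S} \<Longrightarrow> of_int r * c \<in> {x. x * y \<in> ?S}" for r c
        using Zm.span_scale[of "c * y" _ r] by (simp add: mult.assoc)
    qed (simp_all add: distrib_right Zm.span_zero Zm.span_add)
  next
    case (step a)
    then show ?case using assms(2) by (intro 1) auto
  qed
qed

lemma zspan_stable:
  assumes "\<And>e. e \<in> E \<Longrightarrow> y * e \<in> Zm.span E" "z \<in> Zm.span E"
  shows "y * z \<in> Zm.span E"
  using assms(2)
proof (induction rule: Zm.span_induct)
  case base
  show ?case
  proof (rule Zm.subspaceI)
    show "c \<in> {z. y * z \<in> Zm.span E} \<Longrightarrow> of_int r * c \<in> {z. y * z \<in> Zm.span E}" for r c
      using Zm.span_scale[of "y * c" E r] by (simp add: mult.left_commute)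
  qed (simp_all add: distrib_left Zm.span_zero Zm.span_add)
qed (use assms(1) in auto)

text \<open>The products of the generators of two modules generate a module that both elements stabilize.\<close>

lemma integral_common:
  assumes "finite Y" "\<And>y. y \<in> Y \<Longrightarrow> integral y"
  shows "\<exists>E. finite E \<and> 1 \<in> E \<and> (\<forall>y\<in>Y. \<forall>e\<in>E. y * e \<in> Zm.span E)"
  using assms
proof (induction Y rule: finite_induct)
  case empty
  show ?case by (rule exI[of _ "{1}"]) auto
next
  case (insert y Y)
  then obtain E where E: "finite E" "1 \<in> E" "\<forall>y\<in>Y. \<forall>e\<in>E. y * e \<in> Zm.span E" by auto
  obtain F where F: "finite F" "1 \<in> F" "\<forall>e\<in>F. y * e \<in> Zm.span F"
    using insert.prems[of y] by (auto simp: integral_def)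
  let ?G = "{a * b |a b. a \<in> E \<and> b \<in> F}"
  have "?G = (\<lambda>(a, b). a * b) ` (E \<times> F)" by auto
  then have fin: "finite ?G" using E(1) F(1) by (metis finite_SigmaI finite_imageI)
  have one: "1 \<in> ?G" using E(2) F(2) mult_1 by (metis (mono_tags, lifting) mem_Collect_eq)
  have "z * g \<in> Zm.span ?G" if z: "z \<in> insert y Y" and g: "g \<in> ?G" for z g
  proof -
    obtain a b where ab: "a \<in> E" "b \<in> F" "g = a * b" using g by blast
    show ?thesis
    proof (cases "z = y")
      case True
      have "a * (y * b) \<in> Zm.span ?G" by (rule zspan_mult) (use ab F(3) Zm.span_base in auto)
      then show ?thesis using True ab by (simp add: mult.left_commute)
    next
      case False
      have "(z * a) * b \<in> Zm.span ?G" by (rule zspan_mult) (use ab E(3) False z Zm.span_base in auto)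
      then show ?thesis using ab by (simp add: mult.assoc)
    qed
  qed
  then show ?case using fin one by (intro exI[of _ ?G]) blast
qed

lemma integral_pair:
  assumes "integral x" "integral y"
  obtains E where "finite E" "1 \<in> E" "\<And>e. e \<in> E \<Longrightarrow> x * e \<in> Zm.span E" "\<And>e. e \<in> E \<Longrightarrow> y * e \<in> Zm.span E"
proof -
  have "\<exists>E. finite E \<and> 1 \<in> E \<and> (\<forall>z\<in>{x, y}. \<forall>e\<in>E. z * e \<in> Zm.span E)"
    by (rule integral_common) (use assms in auto)
  then obtain E where "finite E" "1 \<in> E" "\<forall>z\<in>{x, y}. \<forall>e\<in>E. z * e \<in> Zm.span E" by blast
  then show ?thesis by (intro that[of E]) auto
qed

lemma integral_add: assumes "integral x" "integral y" shows "integral (x + y)"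
proof -
  obtain E where "finite E" "1 \<in> E" "\<And>e. e \<in> E \<Longrightarrow> x * e \<in> Zm.span E" "\<And>e. e \<in> E \<Longrightarrow> y * e \<in> Zm.span E"
    using integral_pair[OF assms] by blast
  then show ?thesis unfolding integral_def
    by (intro exI[of _ E]) (auto simp: distrib_right Zm.span_add)
qed

lemma integral_mult: assumes "integral x" "integral y" shows "integral (x * y)"
proof -
  obtain E where E: "finite E" "1 \<in> E" "\<And>e. e \<in> E \<Longrightarrow> x * e \<in> Zm.span E" "\<And>e. e \<in> E \<Longrightarrow> y * e \<in> Zm.span E"
    using integral_pair[OF assms] by blast
  then have "x * (y * e) \<in> Zm.span E" if "e \<in> E" for e using zspan_stable[of E x] that by blast
  then show ?thesis unfolding integral_def using E(1,2)
    by (intro exI[of _ E]) (auto simp: mult.assoc)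
qed

lemma integral_of_int: "integral (of_int n)"
  unfolding integral_def
  by (rule exI[of _ "{1}"]) (use Zm.span_scale[of 1 "{1}" n] Zm.span_base[of 1 "{1}"] in auto)

lemma integral_of_nat: "integral (of_nat n)"
  using integral_of_int[of "int n"] by simp

lemma integral_0: "integral 0" and integral_1: "integral 1"
  using integral_of_int[of 0] integral_of_int[of 1] by simp_all

lemma integral_minus: "integral x \<Longrightarrow> integral (- x)"
  using integral_mult[OF integral_of_int[of "-1"]] by simp

lemma integral_power: "integral x \<Longrightarrow> integral (x ^ n)"
  by (induction n) (auto simp: integral_1 integral_mult)

lemma integral_sum: "(\<And>i. i \<in> I \<Longrightarrow> integral (f i)) \<Longrightarrow> integral (sum f I)"
  by (induction I rule: infinite_finite_induct) (auto simp: integral_0 integral_add)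

text \<open>The powers of \<open>s\<close> below \<open>\<delta>\<close> times the generators of a module for the coefficients generate a module
  that is stable under \<open>s\<close>.\<close>

lemma integral_root:
  assumes r: "\<And>k. k < \<delta> \<Longrightarrow> integral (r k)" and s: "s ^ \<delta> = (\<Sum>k<\<delta>. r k * s ^ k)"
  shows "integral s"
proof -
  have "\<delta> \<noteq> 0" using s by (intro notI) simp
  obtain E where E: "finite E" "1 \<in> E" "\<forall>y\<in>r ` {..<\<delta>}. \<forall>e\<in>E. y * e \<in> Zm.span E"
    using integral_common[of "r ` {..<\<delta>}"] r by auto
  let ?P = "(\<lambda>k. s ^ k) ` {..<\<delta>}"
  let ?G = "{a * b |a b. a \<in> E \<and> b \<in> ?P}"
  have "?G = (\<lambda>(a, b). a * b) ` (E \<times> ?P)" by auto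
  then have fin: "finite ?G" using E(1) by (metis finite_SigmaI finite_imageI finite_lessThan)
  have one: "1 \<in> ?G" using E(2) \<open>\<delta> \<noteq> 0\<close> by (auto intro!: exI[of _ 1] image_eqI[of _ _ 0])
  have "s * g \<in> Zm.span ?G" if g: "g \<in> ?G" for g
  proof -
    obtain e k where ek: "e \<in> E" "k < \<delta>" "g = e * s ^ k" using g by blast
    show ?thesis
    proof (cases "Suc k < \<delta>")
      case True
      then have "e * s ^ Suc k \<in> ?G" using ek(1) by blast
      then show ?thesis using Zm.span_base ek(3) by (simp add: mult_ac)
    next
      case False
      then have "Suc k = \<delta>" using ek(2) by simp
      then have "s * g = e * s ^ \<delta>" using ek(3) by (simp add: mult_ac flip: \<open>Suc k = \<delta>\<close>)
      also have "\<dots> = (\<Sum>k<\<delta>. (r k * e) * s ^ k)"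
        unfolding s by (simp add: sum_distrib_left mult_ac)
      also have "\<dots> \<in> Zm.span ?G"
        by (intro Zm.span_sum zspan_mult) (use E(3) ek(1) Zm.span_base in auto)
      finally show ?thesis .
    qed
  qed
  then show ?thesis unfolding integral_def using fin one by (intro exI[of _ ?G]) blast
qed

text \<open>A root of \<open>c y\<^sup>n + \<dots>\<close> becomes integral after multiplication by \<open>c\<close>; the sign of \<open>c\<close> is then removed.\<close>

lemma integral_multiple:
  obtains L :: nat where "L > 0" "integral (of_nat L * y)"
proof -
  obtain P :: "int poly" where P: "P \<noteq> 0" "poly (map_poly of_int P) y = 0"
    by (rule qbar_root_of_int_poly)
  define n where "n = degree P"
  define c :: qbar where "c = of_int (coeff P n)"
  have c: "c \<noteq> 0" "coeff P n \<noteq> 0" using P(1) by (auto simp: c_def n_def)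
  have n: "n > 0"
  proof (rule ccontr)
    assume "\<not> n > 0"
    then obtain a where a: "P = [:a:]" using degree_eq_zeroE by (auto simp: n_def)
    then show False using P by (auto simp: map_poly_pCons)
  qed
  have "0 = (\<Sum>i\<le>n. of_int (coeff P i) * y ^ i)"
    using P(2) unfolding poly_altdef n_def by (simp add: degree_map_poly coeff_map_poly)
  also have "\<dots> = c * y ^ n + (\<Sum>i<n. of_int (coeff P i) * y ^ i)"
    by (simp add: lessThan_Suc_atMost[symmetric] c_def)
  finally have *: "c * y ^ n = (\<Sum>i<n. - of_int (coeff P i) * y ^ i)"
    by (simp add: sum_negf add_eq_0_iff)
  have "(c * y) ^ n = c ^ (n - 1) * (c * y ^ n)"
    using n by (simp add: power_mult_distrib power_eq_if[of c n])
  also have "\<dots> = (\<Sum>i<n. - of_int (coeff P i) * c ^ (n - 1 - i) * (c * y) ^ i)"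
    unfolding * sum_distrib_left
  proof (rule sum.cong[OF refl])
    fix i assume "i \<in> {..<n}"
    then have "c ^ (n - 1) = c ^ (n - 1 - i) * c ^ i" by (simp flip: power_add)
    then show "c ^ (n - 1) * (- of_int (coeff P i) * y ^ i) = - of_int (coeff P i) * c ^ (n - 1 - i) * (c * y) ^ i"
      by (simp add: power_mult_distrib)
  qed
  finally have e: "(c * y) ^ n = (\<Sum>i<n. - of_int (coeff P i) * c ^ (n - 1 - i) * (c * y) ^ i)" .
  have "integral c" unfolding c_def by (rule integral_of_int)
  then have "integral (- of_int (coeff P i) * c ^ (n - 1 - i))" for i
    by (rule integral_mult[OF integral_minus[OF integral_of_int] integral_power])
  then have "integral (c * y)" by (rule integral_root[OF _ e])
  then have "integral (of_int (sgn (coeff P n)) * (c * y))" by (rule integral_mult[OF integral_of_int])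
  also have "of_int (sgn (coeff P n)) * (c * y) = of_nat (nat \<bar>coeff P n\<bar>) * y"
  proof -
    have "of_int (sgn (coeff P n)) * c = of_int (sgn (coeff P n) * coeff P n)" by (simp add: c_def)
    also have "sgn (coeff P n) * coeff P n = \<bar>coeff P n\<bar>" by (simp add: abs_sgn mult.commute)
    finally show ?thesis by (simp add: mult.assoc[symmetric])
  qed
  finally show ?thesis using that[of "nat \<bar>coeff P n\<bar>"] c(2) by simp
qed

lemma integral_multiple_finite:
  assumes "finite Y"
  obtains L :: nat where "L > 0" "\<And>y. y \<in> Y \<Longrightarrow> integral (of_nat L * y)"
proof -
  have "\<exists>L::nat. L > 0 \<and> (\<forall>y\<in>Y. integral (of_nat L * y))"
    using assms
  proof induction
    case (insert y Y)
    then obtain L where L: "L > 0" "\<forall>y\<in>Y. integral (of_nat L * y)" by auto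
    obtain M :: nat where M: "M > 0" "integral (of_nat M * y)" by (rule integral_multiple)
    have "integral (of_nat (L * M) * z)" if "z \<in> insert y Y" for z
    proof (cases "z = y")
      case True
      then show ?thesis using integral_mult[OF integral_of_nat[of L] M(2)] by (simp add: mult.assoc)
    next
      case False
      then have "integral (of_nat L * z)" using that L by blast
      then have "integral (of_nat M * (of_nat L * z))" by (rule integral_mult[OF integral_of_nat])
      then show ?thesis by (simp add: mult_ac)
    qed
    then show ?case using L M by (intro exI[of _ "L * M"]) auto
  qed (auto intro: exI[of _ 1])
  then show ?thesis using that by blast
qed

text \<open>A rational projection of \<open>\<rat>\<^sup>a\<^sup>l\<^sup>g\<close> onto the number field maps the finitely generated module
  that contains all powers of \<open>s\<close> to a finitely generated module in the number field. So the powers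
  are bounded at every finite place, without extending the place to a larger field.\<close>

lemma integral_finite_place:
  assumes s: "integral s" "s \<in> field_gen x" and v: "v \<in> finite_places (field_gen x)"
  shows "v s \<le> 1"
proof -
  interpret v: nonarch "field_gen x" v using finite_place_nonarch[OF field_gen_subfield v] .
  obtain E where E: "finite E" "1 \<in> E" "\<And>e. e \<in> E \<Longrightarrow> s * e \<in> Zm.span E"
    using s(1) by (auto simp: integral_def)
  have pw: "s ^ k \<in> Zm.span E" for k
  proof (induction k)
    case (Suc k)
    then show ?case using zspan_stable[OF E(3)] by simp
  qed (use E(2) Zm.span_base in auto)
  obtain B where B: "finite B" "Q.independent B" "Q.span B = field_gen x" by (rule field_gen_basis)
  interpret QQ: vector_space_pair "\<lambda>(r::rat) (x::qbar). of_rat r * x" "\<lambda>(r::rat) (x::qbar). of_rat r * x"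
    by unfold_locales
  define \<pi> where "\<pi> = QQ.construct B id"
  have lin: "Vector_Spaces.linear (\<lambda>(r::rat) (x::qbar). of_rat r * x) (\<lambda>(r::rat) (x::qbar). of_rat r * x) \<pi>"
    unfolding \<pi>_def by (rule QQ.linear_construct[OF B(2)])
  interpret L: Vector_Spaces.linear "\<lambda>(r::rat) (x::qbar). of_rat r * x" "\<lambda>(r::rat) (x::qbar). of_rat r * x" \<pi>
    by (rule lin)
  have range: "\<pi> y \<in> field_gen x" for y
    using QQ.construct_in_span[OF B(2), of id y] B(3) by (simp add: \<pi>_def)
  have id: "\<pi> y = y" if "y \<in> field_gen x" for y
  proof -
    have "\<pi> b = b" if "b \<in> B" for b unfolding \<pi>_def using QQ.construct_basis[OF B(2) that, of id] by simp
    note basis = this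
    have "y \<in> Q.span B" using that B(3) by simp
    then show ?thesis
    proof (induction rule: Q.span_induct)
      case base
      show ?case by (rule Q.subspaceI) (simp_all add: L.add L.scale L.zero)
    qed (rule basis)
  qed
  define M where "M = Max (insert 0 ((\<lambda>e. v (\<pi> e)) ` E))"
  have M: "v (\<pi> e) \<le> M" if "e \<in> E" for e using E(1) that by (auto simp: M_def)
  have M0: "0 \<le> M" using E(1) by (auto simp: M_def)
  have "v (\<pi> z) \<le> M" if "z \<in> Zm.span E" for z
    using that
  proof (induction rule: Zm.span_induct_alt)
    case base
    show ?case using M0 by (simp add: v.zero)
  next
    case (step n e z)
    have "\<pi> (of_int n * e + z) = of_int n * \<pi> e + \<pi> z"
      using L.scale[of "of_int n" e] by (simp add: L.add)
    moreover have "v (of_int n * \<pi> e) \<le> M"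
    proof -
      have "v (of_int n) * v (\<pi> e) \<le> 1 * M"
        by (intro mult_mono v.of_int_le M step v.nonneg range) auto
      then show ?thesis using range by (simp add: v.mult subfield_of_int)
    qed
    ultimately show ?case
      using v.add_le[of "of_int n * \<pi> e" "\<pi> z"] step range by (simp add: subfield_mult subfield_of_int)
  qed
  then have "v s ^ k \<le> M" for k
    using pw[of k] id[of "s ^ k"] s(2) by (metis field_gen_subfield subfield_power v.power)
  then show ?thesis using real_arch_pow[of "v s" M] by (meson not_le)
qed

section \<open>Extension of embeddings\<close>

lemma coeffs_in_add: "is_subfield K \<Longrightarrow> coeffs_in K p \<Longrightarrow> coeffs_in K q \<Longrightarrow> coeffs_in K (p + q)"
  and coeffs_in_diff: "is_subfield K \<Longrightarrow> coeffs_in K p \<Longrightarrow> coeffs_in K q \<Longrightarrow> coeffs_in K (p - q)"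
  and coeffs_in_mult: "is_subfield K \<Longrightarrow> coeffs_in K p \<Longrightarrow> coeffs_in K q \<Longrightarrow> coeffs_in K (p * q)"
  by (auto simp: coeffs_in_def subfield_add subfield_diff coeff_mult intro!: subfield_sum subfield_mult)

lemma (in embedding) map_poly_add:
  "coeffs_in K p \<Longrightarrow> coeffs_in K q \<Longrightarrow> map_poly \<sigma> (p + q) = map_poly \<sigma> p + map_poly \<sigma> q"
  by (rule poly_eqI) (simp add: coeff_map_poly zero add coeffs_in_def)

lemma (in embedding) map_poly_diff:
  "coeffs_in K p \<Longrightarrow> coeffs_in K q \<Longrightarrow> map_poly \<sigma> (p - q) = map_poly \<sigma> p - map_poly \<sigma> q"
  by (rule poly_eqI) (simp add: coeff_map_poly zero diff coeffs_in_def)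

lemma (in embedding) map_poly_mult:
  "coeffs_in K p \<Longrightarrow> coeffs_in K q \<Longrightarrow> map_poly \<sigma> (p * q) = map_poly \<sigma> p * map_poly \<sigma> q"
  by (rule poly_eqI) (simp add: coeff_map_poly zero coeff_mult sum mult coeffs_in_def subfield_mult[OF K])

text \<open>Let \<open>p\<close> be a polynomial over \<open>K\<close> of least degree that annihilates \<open>\<alpha>\<close>, and let \<open>\<tau>\<close> be a complex root of its
  image. All polynomials over \<open>K\<close> that annihilate \<open>\<alpha>\<close> are multiples of \<open>p\<close>, so \<open>\<alpha> \<mapsto> \<tau>\<close> is well defined
  on polynomials in \<open>\<alpha>\<close>.\<close>

lemma extend_embedding:
  fixes \<sigma> :: "qbar \<Rightarrow> complex"
  assumes "embedding K \<sigma>"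
  obtains K' \<sigma>' where "embedding K' \<sigma>'" "K \<subseteq> K'" "\<alpha> \<in> K'" "\<And>y. y \<in> K \<Longrightarrow> \<sigma>' y = \<sigma> y"
proof -
  interpret s: embedding K \<sigma> by fact
  have cc: "coeffs_in K [:y:]" if "y \<in> K" for y
    using that subfield_0[OF s.K] by (auto simp: coeffs_in_def coeff_pCons split: nat.splits)
  have cX: "coeffs_in K [:0, 1:]"
    using subfield_0[OF s.K] subfield_1[OF s.K] by (auto simp: coeffs_in_def coeff_pCons split: nat.splits)
  obtain P :: "int poly" where P: "P \<noteq> 0" "poly (map_poly of_int P) \<alpha> = 0" by (rule qbar_root_of_int_poly)
  define ann where "ann p \<longleftrightarrow> p \<noteq> 0 \<and> coeffs_in K p \<and> poly p \<alpha> = 0" for p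
  have "ann (map_poly of_int P)"
    using P by (auto simp: ann_def coeffs_in_def coeff_map_poly subfield_of_int[OF s.K] map_poly_eq_0_iff)
  then obtain p where p: "ann p" "\<And>r. ann r \<Longrightarrow> degree p \<le> degree r"
    using ex_has_least_nat[of ann _ degree] by blast
  have lc: "lead_coeff p \<noteq> 0" "lead_coeff p \<in> K" using p(1) by (auto simp: ann_def coeffs_in_def)
  have "degree (map_poly \<sigma> p) = degree p"
  proof (rule antisym)
    show "degree (map_poly \<sigma> p) \<le> degree p" by (rule degree_le) (simp add: coeff_map_poly coeff_eq_0 s.zero)
    show "degree p \<le> degree (map_poly \<sigma> p)"
      by (rule le_degree) (use lc s.eq_0_iff in \<open>simp add: coeff_map_poly s.zero\<close>)
  qed
  moreover have "degree p \<noteq> 0"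
  proof
    assume "degree p = 0"
    then obtain c where "p = [:c:]" by (rule degree_eq_zeroE)
    then show False using p(1) by (auto simp: ann_def)
  qed
  ultimately have "\<not> constant (poly (map_poly \<sigma> p))" by (simp add: constant_degree)
  then obtain \<tau> where \<tau>: "poly (map_poly \<sigma> p) \<tau> = 0" using fundamental_theorem_of_algebra by blast
  have kernel: "poly (map_poly \<sigma> r) \<tau> = 0" if "coeffs_in K r" "poly r \<alpha> = 0" for r
    using that
  proof (induction "degree r" arbitrary: r rule: less_induct)
    case less
    show ?case
    proof (cases "r = 0")
      case False
      then have le: "degree p \<le> degree r" using less.prems p(2) by (simp add: ann_def)
      define q where "q = monom (lead_coeff r / lead_coeff p) (degree r - degree p)"
      have q: "coeffs_in K q" unfolding coeffs_in_def q_def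
        using less.prems lc by (auto simp: coeffs_in_def subfield_divide[OF s.K] subfield_0[OF s.K])
      have pK: "coeffs_in K p" using p(1) by (simp add: ann_def)
      have qp: "coeffs_in K (q * p)" by (rule coeffs_in_mult[OF s.K q pK])
      have q0: "q \<noteq> 0" using False lc by (simp add: q_def)
      have deg: "degree (q * p) = degree r"
        using q0 p(1) le lc False by (subst degree_mult_eq) (auto simp: ann_def q_def degree_monom_eq)
      have "lead_coeff (q * p) = lead_coeff r"
        using lc by (simp only: lead_coeff_mult) (simp add: q_def degree_monom_eq False)
      then have c0: "coeff (r - q * p) (degree r) = 0" using deg by simp
      have zero: "poly (r - q * p) \<alpha> = 0" using less.prems p(1) by (simp add: ann_def)
      have rK: "coeffs_in K (r - q * p)" by (rule coeffs_in_diff[OF s.K less.prems(1) qp])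
      have "poly (map_poly \<sigma> (r - q * p)) \<tau> = 0"
      proof (cases "r - q * p = 0")
        case False
        have "degree (r - q * p) \<le> degree r" using deg by (intro degree_diff_le) auto
        moreover have "degree (r - q * p) \<noteq> degree r" using c0 False by (metis leading_coeff_0_iff)
        ultimately show ?thesis using less.hyps rK zero by simp
      qed simp
      moreover have "map_poly \<sigma> r = map_poly \<sigma> (r - q * p) + map_poly \<sigma> q * map_poly \<sigma> p"
        using s.map_poly_diff[OF less.prems(1) qp] s.map_poly_mult[OF q pK] by simp
      ultimately show ?thesis using \<tau> by simp
    qed simp
  qed
  define K' where "K' = (\<lambda>q. poly q \<alpha>) ` {q. coeffs_in K q}"
  define pol where "pol y = (SOME q. coeffs_in K q \<and> poly q \<alpha> = y)" for y
  have pol: "coeffs_in K (pol y)" "poly (pol y) \<alpha> = y" if "y \<in> K'" for y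
    using someI_ex[of "\<lambda>q. coeffs_in K q \<and> poly q \<alpha> = y"] that by (auto simp: pol_def K'_def)
  define \<sigma>' where "\<sigma>' y = poly (map_poly \<sigma> (pol y)) \<tau>" for y
  have \<sigma>': "\<sigma>' (poly q \<alpha>) = poly (map_poly \<sigma> q) \<tau>" if "coeffs_in K q" for q
  proof -
    have K': "poly q \<alpha> \<in> K'" using that by (auto simp: K'_def)
    have "poly (map_poly \<sigma> (pol (poly q \<alpha>) - q)) \<tau> = 0"
      by (rule kernel) (use pol[OF K'] that in \<open>auto intro: coeffs_in_diff[OF s.K]\<close>)
    then show ?thesis using s.map_poly_diff[OF pol(1)[OF K'] that] by (simp add: \<sigma>'_def)
  qed
  have memI: "poly q \<alpha> \<in> K'" if "coeffs_in K q" for q using that by (auto simp: K'_def)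
  have sub: "K \<subseteq> K'" using memI[OF cc] by auto
  have subfield: "is_subfield K'"
  proof (rule subfield_of_subring)
    fix x y assume xy: "x \<in> K'" "y \<in> K'"
    show "x - y \<in> K'" using memI[OF coeffs_in_diff[OF s.K pol(1)[OF xy(1)] pol(1)[OF xy(2)]]] pol(2) xy by simp
    show "x * y \<in> K'" using memI[OF coeffs_in_mult[OF s.K pol(1)[OF xy(1)] pol(1)[OF xy(2)]]] pol(2) xy by simp
  qed (use sub subfield_of_rat[OF s.K] in auto)
  have "field_embedding_on K' \<sigma>'"
    unfolding field_embedding_on_def
  proof (intro conjI ballI)
    show "\<sigma>' 1 = 1" using \<sigma>'[OF cc[OF subfield_1[OF s.K]]] by (simp add: map_poly_pCons s.one s.zero)
    fix x y assume xy: "x \<in> K'" "y \<in> K'"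
    note P = pol(1)[OF xy(1)] pol(1)[OF xy(2)]
    show "\<sigma>' (x + y) = \<sigma>' x + \<sigma>' y"
      using \<sigma>'[OF coeffs_in_add[OF s.K P]] s.map_poly_add[OF P] pol(2) xy by (simp add: \<sigma>'_def)
    show "\<sigma>' (x * y) = \<sigma>' x * \<sigma>' y"
      using \<sigma>'[OF coeffs_in_mult[OF s.K P]] s.map_poly_mult[OF P] pol(2) xy by (simp add: \<sigma>'_def)
  qed
  then have "embedding K' \<sigma>'" using subfield by (simp add: embedding_def)
  moreover have "\<alpha> \<in> K'" using memI[OF cX] by simp
  moreover have "\<sigma>' y = \<sigma> y" if "y \<in> K" for y
    using \<sigma>'[OF cc[OF that]] by (simp add: map_poly_pCons s.zero)
  ultimately show ?thesis using that sub by blast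
qed

lemma extend_embedding_finite:
  fixes \<sigma> :: "qbar \<Rightarrow> complex"
  assumes "embedding K \<sigma>" "finite Y"
  shows "\<exists>K' \<sigma>'. embedding K' \<sigma>' \<and> K \<subseteq> K' \<and> Y \<subseteq> K' \<and> (\<forall>y\<in>K. \<sigma>' y = \<sigma> y)"
  using assms(2)
proof induction
  case empty
  show ?case using assms(1) by blast
next
  case (insert y Y)
  then obtain K1 \<sigma>1 where 1: "embedding K1 \<sigma>1" "K \<subseteq> K1" "Y \<subseteq> K1" "\<forall>y\<in>K. \<sigma>1 y = \<sigma> y" by blast
  obtain K2 \<sigma>2 where 2: "embedding K2 \<sigma>2" "K1 \<subseteq> K2" "y \<in> K2" "\<And>y. y \<in> K1 \<Longrightarrow> \<sigma>2 y = \<sigma>1 y"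
    using extend_embedding[OF 1(1)] by metis
  have "\<forall>y\<in>K. \<sigma>2 y = \<sigma> y" using 1 2(4) by auto
  then show ?case using 1 2 by (intro exI[of _ K2] exI[of _ \<sigma>2]) auto
qed

text \<open>The images of \<open>y\<close> are roots of one integer polynomial, whichever the embedding.\<close>

lemma embedding_bounded:
  obtains M where "M \<ge> 1" "\<And>K (\<sigma> :: qbar \<Rightarrow> complex). embedding K \<sigma> \<Longrightarrow> y \<in> K \<Longrightarrow> norm (\<sigma> y) \<le> M"
proof -
  obtain P :: "int poly" where P: "P \<noteq> 0" "poly (map_poly of_int P) y = 0" by (rule qbar_root_of_int_poly)
  let ?R = "{z::complex. poly (map_poly of_int P) z = 0}"
  have "finite ?R" by (rule poly_roots_finite) (use P in \<open>simp add: map_poly_eq_0_iff\<close>)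
  then have le: "norm z \<le> Max (insert 1 (norm ` ?R))" if "z \<in> ?R" for z using that by auto
  show ?thesis
  proof (rule that[of "Max (insert 1 (norm ` ?R))"])
    show "1 \<le> Max (insert 1 (norm ` ?R))" using \<open>finite ?R\<close> by auto
    fix K \<sigma> assume "embedding K (\<sigma> :: qbar \<Rightarrow> complex)" "y \<in> K"
    then have "\<sigma> y \<in> ?R" using embedding.poly_of_int[of K \<sigma> y P] P(2) embedding.zero by fastforce
    then show "norm (\<sigma> y) \<le> Max (insert 1 (norm ` ?R))" by (rule le)
  qed
qed

lemma embedding_bounded_finite:
  assumes "finite Y"
  shows "\<exists>M\<ge>1. \<forall>K (\<sigma> :: qbar \<Rightarrow> complex). embedding K \<sigma> \<longrightarrow> (\<forall>y\<in>Y \<inter> K. norm (\<sigma> y) \<le> M)"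
  using assms
proof induction
  case (insert y Y)
  then obtain M where M: "M \<ge> 1" "\<forall>K (\<sigma> :: qbar \<Rightarrow> complex). embedding K \<sigma> \<longrightarrow> (\<forall>y\<in>Y \<inter> K. norm (\<sigma> y) \<le> M)" by blast
  obtain M' where M': "M' \<ge> 1" "\<And>K (\<sigma> :: qbar \<Rightarrow> complex). embedding K \<sigma> \<Longrightarrow> y \<in> K \<Longrightarrow> norm (\<sigma> y) \<le> M'"
    using embedding_bounded[of y thesis] by blast
  show ?case using M M' by (intro exI[of _ "max M M'"]) (auto simp: le_max_iff_disj)
qed auto

section \<open>Orbits that grow at different rates\<close>

lemma orbit_poly_step:
  fixes A :: "nat \<Rightarrow> 'a::field_char_0 poly"
  assumes d: "d \<ge> 2" and A: "\<And>i. i \<in> {1..d} \<Longrightarrow> degree (A i) < i" and k: "degree (orbit d A c k) \<ge> 1"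
  shows "degree (orbit d A c (Suc k)) = d * degree (orbit d A c k)"
    and "lead_coeff (orbit d A c (Suc k)) = lead_coeff (orbit d A c k) ^ d"
proof -
  let ?P = "orbit d A c k"
  let ?e = "degree ?P"
  have "degree (\<Sum>i=1..d. A i * ?P ^ (d - i)) \<le> d * ?e - 1"
  proof (rule degree_sum_le)
    fix i assume i: "i \<in> {1..d}"
    have "degree (A i * ?P ^ (d - i)) \<le> degree (A i) + degree (?P ^ (d - i))" by (rule degree_mult_le)
    also have "\<dots> \<le> (i * ?e - 1) + (d - i) * ?e"
    proof (rule add_mono)
      have "i * 1 \<le> i * ?e" using k by (intro mult_left_mono) auto
      then show "degree (A i) \<le> i * ?e - 1" using A[OF i] by linarith
      show "degree (?P ^ (d - i)) \<le> (d - i) * ?e" using degree_power_le[of ?P "d - i"] by (simp add: mult.commute)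
    qed
    also have "\<dots> = d * ?e - 1"
    proof -
      have "i * ?e \<ge> 1" using i k by (metis One_nat_def Suc_leI atLeastAtMost_iff less_le_trans nat_0_less_mult_iff zero_less_Suc)
      moreover have "i * ?e + (d - i) * ?e = d * ?e" using i by (simp flip: add_mult_distrib)
      ultimately show ?thesis by linarith
    qed
    finally show "degree (A i * ?P ^ (d - i)) \<le> d * ?e - 1" .
  qed simp
  moreover have "d * ?e \<ge> 1" using d k by (metis One_nat_def Suc_leI less_le_trans nat_0_less_mult_iff pos2 zero_less_Suc)
  moreover have deg: "degree (?P ^ d) = d * ?e" by (rule degree_power_eq) (use k in auto)
  ultimately have less: "degree (\<Sum>i=1..d. A i * ?P ^ (d - i)) < degree (?P ^ d)" by linarith
  show "degree (orbit d A c (Suc k)) = d * degree (orbit d A c k)"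
    using degree_add_eq_left[OF less] deg by simp
  show "lead_coeff (orbit d A c (Suc k)) = lead_coeff (orbit d A c k) ^ d"
    using lead_coeff_add_le[OF less] by (simp add: add.commute lead_coeff_power)
qed

lemma orbit_poly_degree:
  fixes A :: "nat \<Rightarrow> 'a::field_char_0 poly"
  assumes d: "d \<ge> 2" and A: "\<And>i. i \<in> {1..d} \<Longrightarrow> degree (A i) < i" and k: "degree (orbit d A c k) \<ge> 1"
  shows "degree (orbit d A c (k + j)) = d ^ j * degree (orbit d A c k) \<and>
    lead_coeff (orbit d A c (k + j)) = lead_coeff (orbit d A c k) ^ d ^ j"
proof (induction j)
  case (Suc j)
  have "degree (orbit d A c (k + j)) \<ge> 1" using Suc k d by simp
  note ge = this
  have s1: "degree (orbit d A c (Suc (k + j))) = d * degree (orbit d A c (k + j))"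
    by (rule orbit_poly_step(1)[where A = A, OF d _ ge]) (rule A)
  have s2: "lead_coeff (orbit d A c (Suc (k + j))) = lead_coeff (orbit d A c (k + j)) ^ d"
    by (rule orbit_poly_step(2)[where A = A, OF d _ ge]) (rule A)
  have "degree (orbit d A c (Suc (k + j))) = d ^ Suc j * degree (orbit d A c k)"
    unfolding s1 using Suc by simp
  moreover have "lead_coeff (orbit d A c (Suc (k + j))) = (lead_coeff (orbit d A c k) ^ d ^ j) ^ d"
    unfolding s2 using Suc by metis
  ultimately show ?case
    by (simp only: add_Suc_right power_mult[symmetric] power_Suc mult.commute[of "d ^ j" d] simp_thms)
qed simp

text \<open>Polynomials in \<open>\<Lambda>t\<close> with integral coefficients.\<close>

definition scaled_integral :: "nat \<Rightarrow> qbar poly \<Rightarrow> bool" where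
  "scaled_integral \<Lambda> q \<longleftrightarrow> (\<forall>k. \<exists>r. integral r \<and> coeff q k = of_nat \<Lambda> ^ k * r)"

lemma scaled_integral_add: "scaled_integral \<Lambda> p \<Longrightarrow> scaled_integral \<Lambda> q \<Longrightarrow> scaled_integral \<Lambda> (p + q)"
  unfolding scaled_integral_def by (metis coeff_add distrib_left integral_add)

lemma scaled_integral_minus: "scaled_integral \<Lambda> p \<Longrightarrow> scaled_integral \<Lambda> (- p)"
  unfolding scaled_integral_def by (metis coeff_minus mult_minus_right integral_minus)

lemma scaled_integral_0: "scaled_integral \<Lambda> 0"
  unfolding scaled_integral_def using integral_0 by (metis coeff_0 mult_zero_right)

lemma scaled_integral_smult: "integral c \<Longrightarrow> scaled_integral \<Lambda> p \<Longrightarrow> scaled_integral \<Lambda> (smult c p)"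
  unfolding scaled_integral_def by (metis coeff_smult mult.left_commute integral_mult)

lemma scaled_integral_sum: "(\<And>i. i \<in> I \<Longrightarrow> scaled_integral \<Lambda> (f i)) \<Longrightarrow> scaled_integral \<Lambda> (sum f I)"
  by (induction I rule: infinite_finite_induct) (auto simp: scaled_integral_0 scaled_integral_add)

lemma scaled_integral_mult:
  assumes "scaled_integral \<Lambda> p" "scaled_integral \<Lambda> q" shows "scaled_integral \<Lambda> (p * q)"
proof -
  obtain r s where r: "\<And>k. integral (r k)" "\<And>k. coeff p k = of_nat \<Lambda> ^ k * r k"
    and s: "\<And>k. integral (s k)" "\<And>k. coeff q k = of_nat \<Lambda> ^ k * s k"
    using assms unfolding scaled_integral_def by metis
  have "coeff (p * q) k = of_nat \<Lambda> ^ k * (\<Sum>i\<le>k. r i * s (k - i))" for k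
  proof -
    have "coeff (p * q) k = (\<Sum>i\<le>k. (of_nat \<Lambda> ^ i * of_nat \<Lambda> ^ (k - i)) * (r i * s (k - i)))"
      unfolding coeff_mult by (simp add: r s mult_ac)
    also have "\<dots> = (\<Sum>i\<le>k. of_nat \<Lambda> ^ k * (r i * s (k - i)))"
      by (intro sum.cong) (auto simp flip: power_add)
    finally show ?thesis by (simp add: sum_distrib_left)
  qed
  moreover have "integral (\<Sum>i\<le>k. r i * s (k - i))" for k
    by (intro integral_sum integral_mult r s)
  ultimately show ?thesis unfolding scaled_integral_def by blast
qed

lemma scaled_integral_1: "scaled_integral \<Lambda> 1"
proof -
  have "integral (if k = 0 then 1 else 0) \<and> coeff 1 k = of_nat \<Lambda> ^ k * (if k = 0 then 1 else 0)" for k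
    by (simp add: integral_0 integral_1 coeff_1)
  then show ?thesis unfolding scaled_integral_def by blast
qed

lemma scaled_integral_power: "scaled_integral \<Lambda> p \<Longrightarrow> scaled_integral \<Lambda> (p ^ n)"
  by (induction n) (auto simp: scaled_integral_1 scaled_integral_mult)

text \<open>Dividing the equation by \<open>\<Lambda>\<close> to the power of its degree makes it monic in \<open>\<Lambda>t\<close>.\<close>

lemma scaled_integral_root:
  assumes p: "scaled_integral \<Lambda> p" "degree p = \<delta>" "lead_coeff p = of_nat \<Lambda> ^ \<delta>" and \<Lambda>: "\<Lambda> > 0"
    and t: "poly p t = 0"
  shows "integral (of_nat \<Lambda> * t)"
proof -
  obtain r where r: "\<And>k. integral (r k)" "\<And>k. coeff p k = of_nat \<Lambda> ^ k * r k"
    using p(1) unfolding scaled_integral_def by metis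
  have "0 = (\<Sum>k\<le>\<delta>. coeff p k * t ^ k)" using t p(2) by (simp add: poly_altdef)
  also have "\<dots> = coeff p \<delta> * t ^ \<delta> + (\<Sum>k<\<delta>. coeff p k * t ^ k)"
    by (simp add: lessThan_Suc_atMost[symmetric])
  also have "coeff p \<delta> * t ^ \<delta> = (of_nat \<Lambda> * t) ^ \<delta>" using p(2,3) by (simp add: power_mult_distrib)
  also have "(\<Sum>k<\<delta>. coeff p k * t ^ k) = (\<Sum>k<\<delta>. r k * (of_nat \<Lambda> * t) ^ k)"
    by (intro sum.cong) (auto simp: r power_mult_distrib)
  finally have e: "(of_nat \<Lambda> * t) ^ \<delta> = (\<Sum>k<\<delta>. - r k * (of_nat \<Lambda> * t) ^ k)"
    by (simp add: sum_negf add_eq_0_iff)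
  have "integral (- r k)" for k by (rule integral_minus[OF r(1)])
  then show ?thesis using e by (rule integral_root)
qed

text \<open>The factor \<open>h ^ (D * i)\<close> of \<open>A i\<close> contains at least \<open>\<Lambda> ^ i\<close>. As \<open>degree (A i) < i\<close>, this suffices for the factor
  \<open>\<Lambda> ^ k\<close> of the \<open>k\<close>-th coefficient and for one more \<open>\<Lambda>\<close>, which clears its denominator.\<close>

lemma scaled_integral_orbit_step:
  assumes d: "d \<ge> 2" and A: "\<And>i. i \<in> {1..d} \<Longrightarrow> degree (A i) < i" and D: "D \<ge> 1" and E: "E \<ge> 2"
    and h: "h = of_nat \<Lambda> ^ (E - 1) * g" "integral g"
    and LA: "\<And>i k. i \<in> {1..d} \<Longrightarrow> integral (of_nat \<Lambda> * coeff (A i) k)"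
    and P: "scaled_integral \<Lambda> (smult (h ^ D) P)"
  shows "scaled_integral \<Lambda> (smult (h ^ (D * d)) (P ^ d + (\<Sum>i=1..d. A i * P ^ (d - i))))"
proof -
  have "scaled_integral \<Lambda> (smult (h ^ (D * i)) (A i))" if i: "i \<in> {1..d}" for i
    unfolding scaled_integral_def
  proof
    fix k
    show "\<exists>r. integral r \<and> coeff (smult (h ^ (D * i)) (A i)) k = of_nat \<Lambda> ^ k * r"
    proof (cases "k < i")
      case False
      then have "coeff (A i) k = 0" using A[OF i] by (intro coeff_eq_0) simp
      then show ?thesis using integral_0 by (metis coeff_smult mult_zero_right)
    next
      case True
      define e where "e = (E - 1) * (D * i)"
      have "i \<le> 1 * (1 * i)" by simp
      also have "\<dots> \<le> e" unfolding e_def using D E by (intro mult_mono) auto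
      finally have "e = k + (e - k - 1) + 1" using True by linarith
      then have "of_nat \<Lambda> ^ e = of_nat \<Lambda> ^ k * of_nat \<Lambda> ^ (e - k - 1) * (of_nat \<Lambda> :: qbar)"
        by (metis power_add power_one_right)
      moreover have "h ^ (D * i) = of_nat \<Lambda> ^ e * g ^ (D * i)"
        unfolding h e_def by (simp add: power_mult_distrib power_mult)
      ultimately have "coeff (smult (h ^ (D * i)) (A i)) k =
          of_nat \<Lambda> ^ k * (of_nat \<Lambda> ^ (e - k - 1) * g ^ (D * i) * (of_nat \<Lambda> * coeff (A i) k))"
        by (simp add: mult_ac)
      moreover have "integral (of_nat \<Lambda> ^ (e - k - 1) * g ^ (D * i) * (of_nat \<Lambda> * coeff (A i) k))"
        by (rule integral_mult[OF integral_mult[OF integral_power[OF integral_of_nat] integral_power[OF h(2)]] LA[OF i]])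
      ultimately show ?thesis by blast
    qed
  qed
  then have "scaled_integral \<Lambda> (smult (h ^ (D * i)) (A i) * smult (h ^ D) P ^ (d - i))" if "i \<in> {1..d}" for i
    using that by (intro scaled_integral_mult scaled_integral_power P)
  moreover have "smult (h ^ (D * i)) (A i) * smult (h ^ D) P ^ (d - i) = smult (h ^ (D * d)) (A i * P ^ (d - i))"
    if i: "i \<in> {1..d}" for i
  proof -
    have "h ^ (D * d) = h ^ (D * i) * (h ^ D) ^ (d - i)"
      using i by (simp flip: power_mult power_add add_mult_distrib2)
    then show ?thesis by (simp add: smult_power mult_ac)
  qed
  ultimately have "scaled_integral \<Lambda> (\<Sum>i=1..d. smult (h ^ (D * d)) (A i * P ^ (d - i)))"
    by (intro scaled_integral_sum) auto
  moreover have "scaled_integral \<Lambda> (smult (h ^ (D * d)) (P ^ d))"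
    using scaled_integral_power[OF P, of d] by (simp add: smult_power power_mult)
  ultimately show ?thesis
    using scaled_integral_add by (simp add: smult_add_right smult_sum_right)
qed

text \<open>Divide the faster orbit by the appropriate power of its leading coefficient. In the variable
  \<open>\<Lambda>t\<close> it becomes monic with integral coefficients, and the slower orbit becomes a polynomial of
  smaller degree with integral coefficients.\<close>

lemma fast_orbit_integral:
  fixes A :: "nat \<Rightarrow> qbar poly"
  assumes d: "d \<ge> 2" and A: "\<And>i. i \<in> {1..d} \<Longrightarrow> degree (A i) < i" and k: "degree (orbit d A [:c:] k) \<ge> 2"
  obtains \<Lambda> :: nat where "\<Lambda> > 0"
    "\<And>j l t. l \<le> j \<Longrightarrow> poly (orbit d A [:c:] (k + j)) t = poly (orbit d A [:c':] l) t \<Longrightarrow> integral (of_nat \<Lambda> * t)"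
proof -
  define G where "G = orbit d A [:c:] k"
  define E where "E = degree G"
  define \<beta> where "\<beta> = lead_coeff G"
  have E: "E \<ge> 2" using k by (simp add: E_def G_def)
  then have \<beta>: "\<beta> \<noteq> 0" by (auto simp: \<beta>_def E_def)
  define Y where "Y = insert c' (insert (inverse \<beta>) ((\<lambda>i. inverse \<beta> * coeff G i) ` {..E} \<union> (\<Union>i\<in>{1..d}. coeff (A i) ` {..degree (A i)})))"
  have "finite Y" by (auto simp: Y_def)
  then obtain \<Lambda> :: nat where \<Lambda>: "\<Lambda> > 0" "\<And>y. y \<in> Y \<Longrightarrow> integral (of_nat \<Lambda> * y)"
    using integral_multiple_finite by metis
  have LA: "integral (of_nat \<Lambda> * coeff (A i) j)" if "i \<in> {1..d}" for i j
  proof (cases "j \<le> degree (A i)")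
    case True
    then show ?thesis using that by (intro \<Lambda>) (auto simp: Y_def)
  qed (simp add: coeff_eq_0 integral_0)
  define g where "g = of_nat \<Lambda> * inverse \<beta>"
  define h where "h = of_nat \<Lambda> ^ (E - 1) * g"
  have g: "integral g" unfolding g_def by (rule \<Lambda>) (simp add: Y_def)
  have h: "integral h" unfolding h_def by (intro integral_mult integral_power integral_of_nat g)
  have h': "h = of_nat \<Lambda> ^ E * inverse \<beta>"
    unfolding h_def g_def using E by (simp add: power_eq_if[of _ E])
  have step: "scaled_integral \<Lambda> (smult (h ^ (D * d)) (P ^ d + (\<Sum>i=1..d. A i * P ^ (d - i))))"
    if "D \<ge> 1" "scaled_integral \<Lambda> (smult (h ^ D) P)" for D P
    by (rule scaled_integral_orbit_step[where E = E and g = g, OF d A that(1) E h_def g LA that(2)])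
  have fast: "scaled_integral \<Lambda> (smult (h ^ d ^ j) (orbit d A [:c:] (k + j)))" for j
  proof (induction j)
    case 0
    have "\<exists>r. integral r \<and> coeff (smult h G) i = of_nat \<Lambda> ^ i * r" for i
    proof -
      consider "i < E" | "i = E" | "i > E" by linarith
      then show ?thesis
      proof cases
        case 1
        then have "E = i + (E - i - 1) + 1" by linarith
        then have "of_nat \<Lambda> ^ E = of_nat \<Lambda> ^ i * of_nat \<Lambda> ^ (E - i - 1) * (of_nat \<Lambda> :: qbar)"
          by (metis power_add power_one_right)
        then have "coeff (smult h G) i = of_nat \<Lambda> ^ i * (of_nat \<Lambda> ^ (E - i - 1) * (of_nat \<Lambda> * (inverse \<beta> * coeff G i)))"
          by (simp add: h' mult_ac)
        moreover have "integral (of_nat \<Lambda> * (inverse \<beta> * coeff G i))" using 1 by (intro \<Lambda>) (auto simp: Y_def)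
        then have "integral (of_nat \<Lambda> ^ (E - i - 1) * (of_nat \<Lambda> * (inverse \<beta> * coeff G i)))"
          by (rule integral_mult[OF integral_power[OF integral_of_nat]])
        ultimately show ?thesis by blast
      next
        case 2
        then have "coeff (smult h G) i = of_nat \<Lambda> ^ i * 1" using \<beta> by (simp add: h' \<beta>_def E_def)
        then show ?thesis using integral_1 by blast
      next
        case 3
        then have "coeff (smult h G) i = of_nat \<Lambda> ^ i * 0" by (simp add: coeff_eq_0 E_def)
        then show ?thesis using integral_0 by blast
      qed
    qed
    then show ?case by (simp add: scaled_integral_def G_def)
  next
    case (Suc j)
    have "d ^ j \<ge> 1" using d by simp
    from step[OF this Suc] show ?case by (simp add: mult.commute)
  qed
  have slow: "scaled_integral \<Lambda> (smult (h ^ d ^ l) (orbit d A [:c':] l))" for l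
  proof (induction l)
    case 0
    have "\<exists>r. integral r \<and> coeff (smult h [:c':]) i = of_nat \<Lambda> ^ i * r" for i
    proof (cases "i = 0")
      case True
      have "of_nat \<Lambda> ^ (E - 1) = of_nat \<Lambda> ^ (E - 2) * (of_nat \<Lambda> :: qbar)"
      proof -
        obtain e where "E = 2 + e" using E le_Suc_ex by blast
        then show ?thesis by simp
      qed
      then have "coeff (smult h [:c':]) i = of_nat \<Lambda> ^ i * (of_nat \<Lambda> ^ (E - 2) * g * (of_nat \<Lambda> * c'))"
        using True by (simp add: h_def mult_ac)
      moreover have "integral (of_nat \<Lambda> * c')" by (rule \<Lambda>) (simp add: Y_def)
      then have "integral (of_nat \<Lambda> ^ (E - 2) * g * (of_nat \<Lambda> * c'))"
        by (rule integral_mult[OF integral_mult[OF integral_power[OF integral_of_nat] g]])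
      ultimately show ?thesis by blast
    next
      case False
      then have "coeff (smult h [:c':]) i = of_nat \<Lambda> ^ i * 0" by (simp add: coeff_pCons split: nat.splits)
      then show ?thesis using integral_0 by blast
    qed
    then show ?case by (simp add: scaled_integral_def)
  next
    case (Suc l)
    have "d ^ l \<ge> 1" using d by simp
    from step[OF this Suc] show ?case by (simp add: mult.commute)
  qed
  show ?thesis
  proof (rule that[OF \<Lambda>(1)])
    fix j l t assume lj: "l \<le> j" and eq: "poly (orbit d A [:c:] (k + j)) t = poly (orbit d A [:c':] l) t"
    let ?P = "orbit d A [:c:] (k + j)" and ?Q = "orbit d A [:c':] l"
    define R where "R = smult (h ^ d ^ j) ?P + - smult (h ^ d ^ j) ?Q"
    have dl: "d ^ l \<le> d ^ j" using d lj by (simp add: power_increasing)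
    then have "h ^ d ^ j = h ^ (d ^ j - d ^ l) * h ^ d ^ l" by (simp flip: power_add)
    then have "smult (h ^ d ^ j) ?Q = smult (h ^ (d ^ j - d ^ l)) (smult (h ^ d ^ l) ?Q)" by simp
    then have "scaled_integral \<Lambda> (smult (h ^ d ^ j) ?Q)"
      using slow[of l] by (simp only: scaled_integral_smult integral_power h)
    then have R: "scaled_integral \<Lambda> R" unfolding R_def by (intro scaled_integral_add fast scaled_integral_minus)
    have P: "degree ?P = d ^ j * E" "lead_coeff ?P = \<beta> ^ d ^ j"
      using orbit_poly_degree[where A = A, OF d A, of "[:c:]" k j] k by (auto simp: E_def G_def \<beta>_def)
    have hd: "h ^ d ^ j \<noteq> 0" using \<beta> \<Lambda>(1) by (simp add: h')
    have dP: "degree (smult (h ^ d ^ j) ?P) = d ^ j * E" using hd P(1) by simp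
    have "degree ?Q \<le> d ^ l" using orbit_degree_le[where A = A, OF d A] by blast
    then have "degree (- smult (h ^ d ^ j) ?Q) \<le> d ^ l" using degree_smult_le[of "h ^ d ^ j" ?Q] by simp
    also have "\<dots> < d ^ j * E" using dl E d by (metis One_nat_def Suc_1 Suc_le_lessD le_less_trans nat_mult_1_right nat_mult_less_cancel_disj pos2 zero_less_power less_le_trans)
    finally have less: "degree (- smult (h ^ d ^ j) ?Q) < degree (smult (h ^ d ^ j) ?P)" using dP by simp
    show "integral (of_nat \<Lambda> * t)"
    proof (rule scaled_integral_root[OF R _ _ \<Lambda>(1)])
      show "degree R = d ^ j * E" unfolding R_def using degree_add_eq_left[OF less] dP by simp
      have "lead_coeff R = lead_coeff (smult (h ^ d ^ j) ?P)"
        unfolding R_def using lead_coeff_add_le[OF less] by (simp only: add.commute)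
      also have "\<dots> = h ^ d ^ j * \<beta> ^ d ^ j" using P(2) by (simp only: lead_coeff_smult)
      also have "\<dots> = (h * \<beta>) ^ d ^ j" by (simp add: power_mult_distrib)
      also have "h * \<beta> = of_nat \<Lambda> ^ E" using \<beta> by (simp add: h')
      finally show "lead_coeff R = of_nat \<Lambda> ^ (d ^ j * E)" by (simp add: power_mult[symmetric] mult.commute)
      show "poly R t = 0" using eq by (simp add: R_def)
    qed
  qed
qed

text \<open>If \<open>Z \<ge> T\<close> bounds the point, the lower terms are at most \<open>Z ^ d / 2\<close>. Each step also raises the factors \<open>2\<close>
  and \<open>1/2\<close> in the bounds to the power \<open>d \<ge> 2\<close>, which absorbs this loss.\<close>

lemma complex_orbit_bounds:
  fixes \<alpha> :: "nat \<Rightarrow> complex"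
  assumes d: "d \<ge> 2" and T: "T \<ge> 2 * real d * C" "T \<ge> 2" "C \<ge> 1"
    and \<alpha>: "\<And>i. i \<in> {1..d} \<Longrightarrow> norm (\<alpha> i) \<le> C * T ^ (i - 1)"
  shows "norm z \<ge> 2 * T \<Longrightarrow> norm (orbit d \<alpha> z k) \<ge> 2 * (norm z / 2) ^ d ^ k"
    and "norm z \<le> T \<Longrightarrow> norm (orbit d \<alpha> z k) \<le> (2 * T) ^ d ^ k / 2"
proof -
  have tail: "norm (\<Sum>i=1..d. \<alpha> i * y ^ (d - i)) \<le> Z ^ d / 2" if "norm y \<le> Z" "T \<le> Z" for y Z
  proof -
    have "norm (\<Sum>i=1..d. \<alpha> i * y ^ (d - i)) \<le> (\<Sum>i=1..d. norm (\<alpha> i * y ^ (d - i)))" by (rule norm_sum)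
    also have "\<dots> \<le> (\<Sum>i=1..d. C * Z ^ (d - 1))"
    proof (rule sum_mono)
      fix i assume i: "i \<in> {1..d}"
      have "norm (\<alpha> i * y ^ (d - i)) = norm (\<alpha> i) * norm y ^ (d - i)" by (simp add: norm_mult norm_power)
      also have "\<dots> \<le> (C * T ^ (i - 1)) * Z ^ (d - i)"
        using \<alpha>[OF i] that T by (intro mult_mono power_mono) auto
      also have "\<dots> \<le> (C * Z ^ (i - 1)) * Z ^ (d - i)"
        using that T by (intro mult_right_mono mult_left_mono power_mono) auto
      also have "\<dots> = C * Z ^ (d - 1)" using i by (simp flip: power_add)
      finally show "norm (\<alpha> i * y ^ (d - i)) \<le> C * Z ^ (d - 1)" .
    qed
    also have "\<dots> = (real d * C) * Z ^ (d - 1)" by simp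
    also have "\<dots> \<le> (Z / 2) * Z ^ (d - 1)" using that T by (intro mult_right_mono) auto
    also have "\<dots> = Z ^ d / 2" using d by (simp add: power_eq_if[of Z d])
    finally show ?thesis .
  qed
  show "norm (orbit d \<alpha> z k) \<ge> 2 * (norm z / 2) ^ d ^ k" if z: "norm z \<ge> 2 * T"
  proof (induction k)
    case (Suc k)
    let ?y = "orbit d \<alpha> z k" and ?s = "(norm z / 2) ^ d ^ k"
    have s1: "norm z / 2 \<ge> 1" using z T by simp
    have "norm z / 2 = (norm z / 2) ^ 1" by simp
    also have "\<dots> \<le> ?s" using s1 d by (intro power_increasing) auto
    finally have s: "?s \<ge> T" using z by simp
    have y: "norm ?y \<ge> T" using s Suc T by linarith
    have "2 * ?s ^ d \<le> (2 * ?s) ^ d / 2"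
    proof -
      have "(2::real) ^ 2 \<le> 2 ^ d" using d by (intro power_increasing) auto
      then have "4 * ?s ^ d \<le> 2 ^ d * ?s ^ d" using s T by (intro mult_right_mono) auto
      then show ?thesis by (simp add: power_mult_distrib)
    qed
    also have "\<dots> \<le> norm ?y ^ d / 2" using Suc s T by (intro divide_right_mono power_mono) auto
    also have "\<dots> \<le> norm (?y ^ d) - norm (\<Sum>i=1..d. \<alpha> i * ?y ^ (d - i))"
      using tail[of ?y "norm ?y"] y by (simp add: norm_power)
    also have "\<dots> \<le> norm (orbit d \<alpha> z (Suc k))" by (simp add: norm_diff_ineq)
    finally show ?case by (simp flip: power_mult add: mult.commute)
  qed simp
  show "norm (orbit d \<alpha> z k) \<le> (2 * T) ^ d ^ k / 2" if z: "norm z \<le> T"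
  proof (induction k)
    case (Suc k)
    let ?y = "orbit d \<alpha> z k" and ?Z = "(2 * T) ^ d ^ k / 2"
    have "(2 * T) ^ 1 \<le> (2 * T) ^ d ^ k" using T d by (intro power_increasing) auto
    then have Z: "T \<le> ?Z" by simp
    have "norm (orbit d \<alpha> z (Suc k)) \<le> norm (?y ^ d) + norm (\<Sum>i=1..d. \<alpha> i * ?y ^ (d - i))"
      by (simp add: norm_triangle_ineq)
    also have "\<dots> \<le> ?Z ^ d + ?Z ^ d / 2"
      using tail[OF Suc Z] Suc by (intro add_mono) (auto simp: norm_power intro: power_mono)
    also have "\<dots> \<le> 2 * ?Z ^ d" using Z T by simp
    also have "\<dots> \<le> 2 ^ d * ?Z ^ d / 2"
    proof -
      have "(2::real) ^ 2 \<le> 2 ^ d" using d by (intro power_increasing) auto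
      then have "4 * ?Z ^ d \<le> 2 ^ d * ?Z ^ d" using Z T by (intro mult_right_mono) auto
      then show ?thesis by simp
    qed
    also have "\<dots> = (2 * ?Z) ^ d / 2" by (simp only: power_mult_distrib)
    also have "2 * ?Z = (2 * T) ^ d ^ k" by simp
    also have "((2 * T) ^ d ^ k) ^ d = (2 * T) ^ d ^ Suc k"
      by (simp only: power_mult[symmetric] power_Suc mult.commute[of "d ^ k" d])
    finally show ?case .
  qed (use z in simp)
qed

lemma (in embedding) poly_expand:
  assumes "coeffs_in K q" "y \<in> K"
  shows "\<sigma> (poly q y) = (\<Sum>j\<le>degree q. \<sigma> (coeff q j) * \<sigma> y ^ j)"
proof -
  have c: "coeff q j \<in> K" for j using assms(1) by (simp add: coeffs_in_def)
  have "\<sigma> (poly q y) = (\<Sum>j\<le>degree q. \<sigma> (coeff q j * y ^ j))"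
    unfolding poly_altdef by (rule sum) (intro subfield_mult[OF K] subfield_power[OF K] c assms)
  also have "\<dots> = (\<Sum>j\<le>degree q. \<sigma> (coeff q j) * \<sigma> y ^ j)"
    by (intro sum.cong refl) (simp add: mult power c assms subfield_power[OF K])
  finally show ?thesis .
qed

lemma (in embedding) orbit:
  assumes "\<And>i. i \<in> {1..d} \<Longrightarrow> \<alpha> i \<in> K" "c \<in> K"
  shows "\<sigma> (orbit d \<alpha> c k) = orbit d (\<lambda>i. \<sigma> (\<alpha> i)) (\<sigma> c) k \<and> orbit d \<alpha> c k \<in> K"
proof (induction k)
  case (Suc k)
  then have o: "orbit d \<alpha> c k \<in> K" by simp
  have t: "\<alpha> i * orbit d \<alpha> c k ^ (d - i) \<in> K" if "i \<in> {1..d}" for i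
    using that assms(1) o by (intro subfield_mult[OF K] subfield_power[OF K]) auto
  have "\<sigma> (\<Sum>i=1..d. \<alpha> i * orbit d \<alpha> c k ^ (d - i)) = (\<Sum>i=1..d. \<sigma> (\<alpha> i * orbit d \<alpha> c k ^ (d - i)))"
    by (rule sum) (rule t)
  also have "\<dots> = (\<Sum>i=1..d. \<sigma> (\<alpha> i) * \<sigma> (orbit d \<alpha> c k) ^ (d - i))"
    using assms(1) o by (intro sum.cong) (auto simp: mult power subfield_power[OF K])
  finally have "\<sigma> (\<Sum>i=1..d. \<alpha> i * orbit d \<alpha> c k ^ (d - i)) = (\<Sum>i=1..d. \<sigma> (\<alpha> i) * \<sigma> (orbit d \<alpha> c k) ^ (d - i))" .
  moreover have "(\<Sum>i=1..d. \<alpha> i * orbit d \<alpha> c k ^ (d - i)) \<in> K" by (rule subfield_sum[OF K]) (rule t)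
  ultimately show ?case
    using Suc o by (simp add: add power subfield_power[OF K] subfield_add[OF K])
qed (use assms in simp)

lemma orbit_add: "orbit d \<alpha> c (k + j) = orbit d \<alpha> (orbit d \<alpha> c k) j"
  by (induction j) simp_all

text \<open>If \<open>T = |\<sigma> t|\<close> is large, the \<open>k\<close>-th point of the fast orbit has size at least \<open>2 T\<^sup>2\<close>, since it is a
  polynomial of degree at least \<open>3\<close> in \<open>t\<close>, whereas the slow orbit starts at a bounded point. From then on
  both are raised to the power \<open>d\<close> in each step, so they cannot meet.\<close>

lemma fast_orbit_arch:
  fixes A :: "nat \<Rightarrow> qbar poly"
  assumes d: "d \<ge> 2" and A: "\<And>i. i \<in> {1..d} \<Longrightarrow> degree (A i) < i" and k: "degree (orbit d A [:c:] k) \<ge> 3"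
  obtains C where "C \<ge> 1"
    "\<And>j l t \<sigma>. l \<le> j \<Longrightarrow> poly (orbit d A [:c:] (k + j)) t = poly (orbit d A [:c':] l) t \<Longrightarrow>
       \<sigma> \<in> complex_embeddings (field_gen t) \<Longrightarrow> norm (\<sigma> t) \<le> C"
proof -
  define G where "G = orbit d A [:c:] k"
  define E where "E = degree G"
  define \<beta> where "\<beta> = lead_coeff G"
  have E: "E \<ge> 3" using k by (simp add: E_def G_def)
  then have \<beta>: "\<beta> \<noteq> 0" by (auto simp: \<beta>_def E_def)
  define Y where "Y = {0, c, c', inverse \<beta>} \<union> coeff G ` {..E} \<union> (\<Union>i\<in>{1..d}. coeff (A i) ` {..degree (A i)})"
  have "finite Y" by (auto simp: Y_def)
  then obtain M where M: "M \<ge> 1" "\<And>K (\<sigma> :: qbar \<Rightarrow> complex) y. embedding K \<sigma> \<Longrightarrow> y \<in> Y \<Longrightarrow> y \<in> K \<Longrightarrow> norm (\<sigma> y) \<le> M"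
    using embedding_bounded_finite[of Y] by auto
  have Y0: "0 \<in> Y" by (simp add: Y_def)
  have YA: "coeff (A i) j \<in> Y" if "i \<in> {1..d}" for i j
  proof (cases "j \<le> degree (A i)")
    case True
    then show ?thesis unfolding Y_def using that by blast
  next
    case False
    then show ?thesis using Y0 by (simp add: coeff_eq_0)
  qed
  have YG: "coeff G j \<in> Y" for j
  proof (cases "j \<le> E")
    case True
    then show ?thesis unfolding Y_def by blast
  next
    case False
    then show ?thesis using Y0 by (simp add: coeff_eq_0 E_def)
  qed
  define C where "C = real d * M"
  define T0 where "T0 = M * (E * M + 2) + 2 * real d * C + M + 2"
  have C: "C \<ge> 1" unfolding C_def using d M(1) by (metis (mono_tags) mult_mono' mult_1 of_nat_1 of_nat_mono one_le_numeral order_trans zero_le_one)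
  have T0: "T0 \<ge> M * (E * M + 2)" "T0 \<ge> 2 * real d * C" "T0 \<ge> M" "T0 \<ge> 2"
    using M(1) C unfolding T0_def by (auto intro!: add_nonneg_nonneg mult_nonneg_nonneg)
  show ?thesis
  proof (rule that[of T0])
    show "1 \<le> T0" using T0 by simp
    fix j l t \<sigma>
    assume lj: "l \<le> j" and eq: "poly (orbit d A [:c:] (k + j)) t = poly (orbit d A [:c':] l) t"
      and \<sigma>: "\<sigma> \<in> complex_embeddings (field_gen t)"
    show "norm (\<sigma> t) \<le> T0"
    proof (rule ccontr)
      assume neg: "\<not> norm (\<sigma> t) \<le> T0"
      \<comment> \<open>The coefficients need not lie in \<open>\<rat>(t)\<close>.\<close>
      obtain K s where s: "embedding K s" "field_gen t \<subseteq> K" "Y \<subseteq> K" "\<forall>y\<in>field_gen t. s y = \<sigma> y"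
        using extend_embedding_finite[OF complex_embedding[OF \<sigma> field_gen_subfield] \<open>finite Y\<close>] by blast
      interpret s: embedding K s by fact
      define T where "T = norm (s t)"
      have T: "T > T0" using neg s(4) by (simp add: T_def)
      have tK: "t \<in> K" using s(2) by auto
      define \<alpha> where "\<alpha> i = poly (A i) t" for i
      have AK: "coeffs_in K (A i)" if "i \<in> {1..d}" for i using YA[OF that] s(3) by (auto simp: coeffs_in_def)
      have \<alpha>K: "\<alpha> i \<in> K" if "i \<in> {1..d}" for i
        unfolding \<alpha>_def by (rule subfield_poly[OF s.K AK[OF that] tK])
      have \<alpha>: "norm (s (\<alpha> i)) \<le> C * T ^ (i - 1)" if i: "i \<in> {1..d}" for i
      proof -
        have "s (\<alpha> i) = (\<Sum>j\<le>degree (A i). s (coeff (A i) j) * s t ^ j)"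
          unfolding \<alpha>_def by (rule s.poly_expand[OF AK[OF i] tK])
        also have "norm \<dots> \<le> (\<Sum>j\<le>degree (A i). norm (s (coeff (A i) j) * s t ^ j))" by (rule norm_sum)
        also have "\<dots> \<le> (\<Sum>j\<le>degree (A i). M * T ^ (i - 1))"
        proof (rule sum_mono)
          fix j assume j: "j \<in> {..degree (A i)}"
          have "norm (s (coeff (A i) j)) \<le> M" using YA[OF i] s(3) by (intro M(2)[OF s(1)]) auto
          moreover have "T ^ j \<le> T ^ (i - 1)" using j A[OF i] T T0(4) by (intro power_increasing) auto
          ultimately show "norm (s (coeff (A i) j) * s t ^ j) \<le> M * T ^ (i - 1)"
            unfolding norm_mult norm_power T_def[symmetric] using M(1) T T0(4) by (intro mult_mono) auto
        qed
        also have "\<dots> = real (degree (A i) + 1) * (M * T ^ (i - 1))" by simp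
        also have "\<dots> \<le> real d * (M * T ^ (i - 1))"
          using A[OF i] i M(1) T T0(4) by (intro mult_right_mono) auto
        finally show ?thesis by (simp add: C_def mult.assoc)
      qed
      define z where "z = s (poly G t)"
      have z: "norm z \<ge> 2 * T ^ 2"
      proof -
        have z_eq: "z = (\<Sum>j<E. s (coeff G j) * s t ^ j) + s \<beta> * s t ^ E"
        proof -
          have "z = (\<Sum>j\<le>E. s (coeff G j) * s t ^ j)"
            unfolding z_def E_def by (rule s.poly_expand[OF _ tK]) (use YG s(3) in \<open>auto simp: coeffs_in_def\<close>)
          then show ?thesis by (simp add: lessThan_Suc_atMost[symmetric] \<beta>_def E_def)
        qed
        have low: "norm (\<Sum>j<E. s (coeff G j) * s t ^ j) \<le> E * M * T ^ (E - 1)"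
        proof -
          have "norm (\<Sum>j<E. s (coeff G j) * s t ^ j) \<le> (\<Sum>j<E. norm (s (coeff G j) * s t ^ j))" by (rule norm_sum)
          also have "\<dots> \<le> (\<Sum>j<E. M * T ^ (E - 1))"
          proof (rule sum_mono)
            fix j assume j: "j \<in> {..<E}"
            have "norm (s (coeff G j)) \<le> M" using YG s(3) by (intro M(2)[OF s(1)]) auto
            moreover have "T ^ j \<le> T ^ (E - 1)" using j T T0(4) by (intro power_increasing) auto
            ultimately show "norm (s (coeff G j) * s t ^ j) \<le> M * T ^ (E - 1)"
              unfolding norm_mult norm_power T_def[symmetric] using M(1) T T0(4) by (intro mult_mono) auto
          qed
          finally show ?thesis by simp
        qed
        have "\<beta> \<in> Y" using YG unfolding \<beta>_def by blast
        then have "\<beta> \<in> K" using s(3) by auto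
        have "norm (s (inverse \<beta>)) \<le> M" using s(3) by (intro M(2)[OF s(1)]) (auto simp: Y_def)
        then have "inverse (norm (s \<beta>)) \<le> M" by (simp only: s.inverse[OF \<open>\<beta> \<in> K\<close>] norm_inverse)
        moreover have "norm (s \<beta>) > 0" using s.eq_0_iff[OF \<open>\<beta> \<in> K\<close>] \<beta> by simp
        ultimately have "norm (s \<beta>) \<ge> 1 / M"
          using le_imp_inverse_le[of "inverse (norm (s \<beta>))" M] by (simp add: inverse_eq_divide)
        then have "T ^ E / M \<le> norm (s \<beta> * s t ^ E)"
          unfolding norm_mult norm_power T_def[symmetric] using mult_right_mono[of "1 / M" "norm (s \<beta>)" "T ^ E"] T T0(4) by simp
        moreover have "norm (s \<beta> * s t ^ E) - norm (\<Sum>j<E. s (coeff G j) * s t ^ j) \<le> norm z"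
          unfolding z_eq using norm_diff_ineq[of "s \<beta> * s t ^ E" "\<Sum>j<E. s (coeff G j) * s t ^ j"]
          by (simp only: add.commute)
        ultimately have "norm z \<ge> T ^ E / M - E * M * T ^ (E - 1)" using low by linarith
        also have "T ^ E / M - E * M * T ^ (E - 1) = T ^ (E - 1) * (T / M - E * M)"
          using E by (simp add: power_eq_if[of T E] algebra_simps)
        finally have "T ^ (E - 1) * (T / M - E * M) \<le> norm z" .
        moreover have "2 \<le> T / M - E * M"
          using T T0(1) M(1) by (simp add: field_simps)
        then have "T ^ (E - 1) * 2 \<le> T ^ (E - 1) * (T / M - E * M)" using T T0(4) by (intro mult_left_mono) auto
        moreover have "T ^ 2 \<le> T ^ (E - 1)" using E T T0(4) by (intro power_increasing) auto
        ultimately show ?thesis by linarith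
      qed
      have Tc: "T \<ge> 2 * real d * C" "T \<ge> 2" "C \<ge> 1" using T T0 C by auto
      have T1: "1 \<le> T ^ 2" "2 * T \<le> T ^ 2"
        using one_le_power[of T 2] mult_right_mono[of 2 T T] Tc by (auto simp: power2_eq_square)
      have "2 * T \<le> norm z" using z T1 Tc by linarith
      then have "2 * (norm z / 2) ^ d ^ j \<le> norm (orbit d (\<lambda>i. s (\<alpha> i)) z j)"
        by (rule complex_orbit_bounds(1)[OF d Tc, rotated]) (rule \<alpha>)
      moreover have "(T ^ 2) ^ d ^ j \<le> (norm z / 2) ^ d ^ j" using z T1 by (intro power_mono) auto
      ultimately have 1: "2 * (T ^ 2) ^ d ^ j \<le> norm (orbit d (\<lambda>i. s (\<alpha> i)) z j)" by linarith
      have c'Y: "c' \<in> Y" "c' \<in> K" using s(3) by (auto simp: Y_def)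
      then have "norm (s c') \<le> T" using M(2)[OF s(1) c'Y] T T0(3) by linarith
      then have 2: "norm (orbit d (\<lambda>i. s (\<alpha> i)) (s c') l) \<le> (2 * T) ^ d ^ l / 2"
        by (rule complex_orbit_bounds(2)[OF d Tc, rotated]) (rule \<alpha>)
      have "(2 * T) ^ d ^ l \<le> (T ^ 2) ^ d ^ l" using T1 Tc by (intro power_mono) auto
      also have "\<dots> \<le> (T ^ 2) ^ d ^ j" using T1 d lj by (intro power_increasing) auto
      finally have "(2 * T) ^ d ^ l \<le> (T ^ 2) ^ d ^ j" .
      moreover have "0 < (T ^ 2) ^ d ^ j" using Tc by simp
      ultimately have neq: "norm (orbit d (\<lambda>i. s (\<alpha> i)) (s c') l) < norm (orbit d (\<lambda>i. s (\<alpha> i)) z j)"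
        using 1 2 by linarith
      have cK: "c \<in> K" using s(3) by (auto simp: Y_def)
      have "orbit d \<alpha> c (k + j) = orbit d \<alpha> c' l" using eq unfolding poly_orbit \<alpha>_def .
      then have "s (orbit d \<alpha> (poly G t) j) = s (orbit d \<alpha> c' l)"
        unfolding orbit_add G_def poly_orbit \<alpha>_def by simp
      moreover have "poly G t \<in> K" using s.orbit[of d \<alpha> c k] \<alpha>K cK unfolding G_def poly_orbit \<alpha>_def by blast
      ultimately have "orbit d (\<lambda>i. s (\<alpha> i)) z j = orbit d (\<lambda>i. s (\<alpha> i)) (s c') l"
        using s.orbit[of d \<alpha> "poly G t" j] s.orbit[of d \<alpha> c' l] \<alpha>K c'Y(2) by (simp add: z_def)
      then show False using neq by simp
    qed
  qed
qed

theorem fast_orbit_height: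
  fixes A :: "nat \<Rightarrow> qbar poly"
  assumes d: "d \<ge> 2" and A: "\<And>i. i \<in> {1..d} \<Longrightarrow> degree (A i) < i" and k0: "degree (orbit d A [:c:] k\<^sub>0) \<ge> 1"
  obtains N B where "\<And>m n t. m \<ge> n + N \<Longrightarrow> poly (orbit d A [:c:] m) t = poly (orbit d A [:c':] n) t \<Longrightarrow>
     weil_height t \<le> B"
proof -
  \<comment> \<open>Two more steps raise the degree from \<open>1\<close> to at least
    \<open>4\<close>.\<close>
  define k where "k = k\<^sub>0 + 2"
  have "degree (orbit d A [:c:] k) = d ^ 2 * degree (orbit d A [:c:] k\<^sub>0)"
    unfolding k_def using orbit_poly_degree[where A = A, OF d A k0, of 2] by simp
  moreover have "2 ^ 2 \<le> d ^ 2" using d by (intro power_mono) auto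
  ultimately have k: "degree (orbit d A [:c:] k) \<ge> 4" using k0 mult_mono[of 4 "d ^ 2" 1 "degree (orbit d A [:c:] k\<^sub>0)"] by simp
  obtain \<Lambda> :: nat where \<Lambda>: "\<Lambda> > 0"
    "\<And>j l t. l \<le> j \<Longrightarrow> poly (orbit d A [:c:] (k + j)) t = poly (orbit d A [:c':] l) t \<Longrightarrow> integral (of_nat \<Lambda> * t)"
    by (rule fast_orbit_integral[where A = A and c = c and k = k and c' = c', OF d A]) (use k in auto)
  obtain C where C: "C \<ge> 1"
    "\<And>j l t \<sigma>. l \<le> j \<Longrightarrow> poly (orbit d A [:c:] (k + j)) t = poly (orbit d A [:c':] l) t \<Longrightarrow>
       \<sigma> \<in> complex_embeddings (field_gen t) \<Longrightarrow> norm (\<sigma> t) \<le> C"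
    by (rule fast_orbit_arch[where A = A and c = c and k = k and c' = c', OF d A]) (use k in auto)
  show ?thesis
  proof (rule that[of k "ln \<Lambda> + ln C"])
    fix m n t assume "m \<ge> n + k" and eq: "poly (orbit d A [:c:] m) t = poly (orbit d A [:c':] n) t"
    define j where "j = m - k"
    have j: "m = k + j" "n \<le> j" using \<open>m \<ge> n + k\<close> by (auto simp: j_def)
    note eq' = eq[unfolded j(1)]
    have t: "of_nat \<Lambda> * t \<in> field_gen t" by (rule subfield_mult) (simp_all add: subfield_of_nat)
    show "weil_height t \<le> ln \<Lambda> + ln C"
    proof (rule weil_height_le_local[OF \<Lambda>(1) _ C(1)])
      show "v (of_nat \<Lambda> * t) \<le> 1" if "v \<in> finite_places (field_gen t)" for v
        by (rule integral_finite_place[OF \<Lambda>(2)[OF j(2) eq'] t that])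
      show "norm (\<sigma> t) \<le> C" if "\<sigma> \<in> complex_embeddings (field_gen t)" for \<sigma>
        by (rule C(2)[OF j(2) eq' that])
    qed
  qed
qed

section \<open>Powers of a prime modulo powers of another prime\<close>

lemma power_one_plus_mod_square: "[(1 + q * z) ^ i = 1 + int i * (q * z)] (mod (q::int)\<^sup>2)"
proof (induction i)
  case (Suc i)
  have "(1 + q * z) ^ Suc i = (1 + q * z) * (1 + q * z) ^ i" by simp
  also have "[\<dots> = (1 + q * z) * (1 + int i * (q * z))] (mod q\<^sup>2)" using Suc by (rule cong_scalar_left)
  also have "(1 + q * z) * (1 + int i * (q * z)) = 1 + int (Suc i) * (q * z) + q\<^sup>2 * (int i * z * z)"
    by (simp add: algebra_simps power2_eq_square)
  also have "[\<dots> = 1 + int (Suc i) * (q * z)] (mod q\<^sup>2)" by (simp add: cong_iff_dvd_diff)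
  finally show ?case .
qed simp

text \<open>Modulo \<open>q\<^sup>2\<close>, the \<open>i\<close>-th term is \<open>1 + i (x - 1)\<close>, and the sum of all \<open>i < q\<close> is divisible by \<open>q\<close> if \<open>q\<close> is
  odd. For \<open>q = 2\<close> the condition modulo \<open>4\<close> takes over.\<close>

lemma geometric_sum_mod_square:
  assumes q: "prime (q::nat)" and x: "int q dvd x - 1" "q = 2 \<Longrightarrow> 4 dvd x - 1"
  obtains u where "(\<Sum>i<q. x ^ i) = int q * u" "\<not> int q dvd u"
proof -
  have "[(\<Sum>i<q. x ^ i) = int q] (mod (int q)\<^sup>2)"
  proof (cases "q = 2")
    case True
    have "4 dvd x - 1" using x(2) True by blast
    then have "[1 + x = 2] (mod 4)" by (simp add: cong_iff_dvd_diff)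
    then show ?thesis using True by (simp add: numeral_2_eq_2 lessThan_Suc add.commute)
  next
    case False
    then have "odd q" using q prime_odd_nat[OF q] prime_ge_2_nat[OF q] by simp
    then obtain m where m: "q = 2 * m + 1" by (elim oddE)
    obtain z where z: "x - 1 = int q * z" using x(1) by (elim dvdE)
    then have xz: "x = 1 + int q * z" by simp
    have "[(\<Sum>i<q. x ^ i) = (\<Sum>i<q. 1 + int i * (int q * z))] (mod (int q)\<^sup>2)"
      unfolding xz by (intro cong_sum power_one_plus_mod_square)
    also have "(\<Sum>i<q. 1 + int i * (int q * z)) = int q + (\<Sum>i<q. int i) * (int q * z)"
      by (simp add: sum.distrib sum_distrib_right)
    also have "(\<Sum>i<q. int i) = int q * int m"
    proof -
      have "2 * (\<Sum>i<n. int i) = int n * (int n - 1)" for n by (induction n) (auto simp: algebra_simps)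
      from this[of q] show ?thesis using m by (simp add: algebra_simps)
    qed
    also have "int q + int q * int m * (int q * z) = int q + (int q)\<^sup>2 * (int m * z)"
      by (simp add: power2_eq_square algebra_simps)
    also have "[\<dots> = int q] (mod (int q)\<^sup>2)" by (simp add: cong_iff_dvd_diff)
    finally show ?thesis .
  qed
  then have "(int q)\<^sup>2 dvd (\<Sum>i<q. x ^ i) - int q" by (simp add: cong_iff_dvd_diff)
  then obtain k where k: "(\<Sum>i<q. x ^ i) - int q = (int q)\<^sup>2 * k" by (elim dvdE)
  have "\<not> int q dvd 1 + int q * k"
  proof
    assume "int q dvd 1 + int q * k"
    then have "int q dvd 1" using dvd_add_left_iff[of "int q" "int q * k" 1] by simp
    then have "q dvd 1" using int_dvd_int_iff[of q 1] by simp
    then show False using prime_gt_1_nat[OF q] by simp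
  qed
  moreover have "(\<Sum>i<q. x ^ i) = int q * (1 + int q * k)"
    using k by (simp add: power2_eq_square algebra_simps)
  ultimately show ?thesis using that by blast
qed

lemma prime_power_dvd_mult_cancel:
  assumes "prime (q::nat)" "int q ^ s dvd m * u" "\<not> int q dvd u" shows "int q ^ s dvd m"
proof -
  have "coprime (int q) u" using assms by (intro prime_imp_coprime) auto
  then have "coprime (int q ^ s) u" by simp
  then show ?thesis using assms(2) by (simp add: coprime_dvd_mult_left_iff)
qed

text \<open>Lifting the exponent: if \<open>q\<close> divides \<open>f\<close>, the geometric sum for \<open>x\<^sup>f = (x\<^sup>f\<^sup>/\<^sup>q)\<^sup>q\<close> contributes exactly one
  factor \<open>q\<close>; otherwise it contributes none.\<close>

lemma prime_power_dvd_power_minus_one: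
  assumes q: "prime (q::nat)" and x: "int q dvd x - 1" "q = 2 \<Longrightarrow> 4 dvd x - 1"
    and a: "\<And>s. int q ^ s dvd x - 1 \<Longrightarrow> s \<le> a"
  shows "f \<ge> 1 \<Longrightarrow> int q ^ s dvd x ^ f - 1 \<Longrightarrow> int q ^ s dvd int q ^ a * int f"
proof (induction f arbitrary: s rule: less_induct)
  case (less f)
  show ?case
  proof (cases "q dvd f")
    case False
    have "[(\<Sum>i<f. x ^ i) = (\<Sum>i<f. 1 ^ i)] (mod int q)"
      using x(1) by (intro cong_sum cong_pow) (simp add: cong_iff_dvd_diff)
    then have "[(\<Sum>i<f. x ^ i) = int f] (mod int q)" by simp
    then have "\<not> int q dvd (\<Sum>i<f. x ^ i)" using False by (metis cong_dvd_iff int_dvd_int_iff)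
    moreover have "x ^ f - 1 = (x - 1) * (\<Sum>i<f. x ^ i)" by (rule power_diff_1_eq)
    ultimately have "int q ^ s dvd x - 1" using less.prems(2) prime_power_dvd_mult_cancel[OF q] by metis
    then have "int q ^ s dvd int q ^ a" using a by (simp add: le_imp_power_dvd)
    then show ?thesis by simp
  next
    case True
    then obtain f' where f: "f = q * f'" by (elim dvdE)
    have f': "f' \<ge> 1" using less.prems(1) f by (cases f') auto
    have "f' < f" using f f' prime_gt_1_nat[OF q] by simp
    have dvd: "x - 1 dvd x ^ f' - 1" unfolding power_diff_1_eq by simp
    then obtain u where u: "(\<Sum>i<q. (x ^ f') ^ i) = int q * u" "\<not> int q dvd u"
    proof -
      have 1: "int q dvd x ^ f' - 1" using x(1) dvd by (rule dvd_trans)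
      have 2: "4 dvd x ^ f' - 1" if "q = 2" using x(2)[OF that] dvd by (rule dvd_trans)
      show thesis by (rule geometric_sum_mod_square[OF q 1 2]) (assumption, rule that)
    qed
    have eq: "x ^ f - 1 = (x ^ f' - 1) * (int q * u)"
      unfolding f u(1)[symmetric] power_diff_1_eq[of "x ^ f'", symmetric]
      using power_diff_1_eq[of "x ^ f'" q] by (simp add: power_mult[symmetric] mult.commute)
    show ?thesis
    proof (cases s)
      case (Suc s')
      have "int q * int q ^ s' dvd int q * ((x ^ f' - 1) * u)"
        using less.prems(2) unfolding eq Suc by (simp add: mult_ac)
      then have "int q ^ s' dvd (x ^ f' - 1) * u" using q by (simp add: prime_gt_0_nat)
      then have "int q ^ s' dvd x ^ f' - 1" using prime_power_dvd_mult_cancel[OF q] u(2) by blast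
      then have "int q ^ s' dvd int q ^ a * int f'" using less.IH[OF \<open>f' < f\<close> f'] by blast
      then have "int q * int q ^ s' dvd int q * (int q ^ a * int f')" by (intro mult_dvd_mono) auto
      then show ?thesis by (simp add: Suc f mult_ac)
    qed simp
  qed
qed

text \<open>The order of \<open>p\<close> modulo \<open>q\<^sup>s\<close> grows like \<open>q\<^sup>s\<close>. Passing to \<open>x = p\<^sup>h\<close> with \<open>h = 2 (q - 1)\<close> makes
  the hypotheses of the preceding lemma hold.\<close>

lemma order_of_prime_mod_prime_power:
  assumes p: "prime (p::nat)" and q: "prime (q::nat)" and "p \<noteq> q"
  obtains C :: nat where "C \<ge> 1" "\<And>s f. f \<ge> 1 \<Longrightarrow> int q ^ s dvd int p ^ f - 1 \<Longrightarrow> q ^ s \<le> C * f"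
proof -
  define h where "h = 2 * (q - 1)"
  define x where "x = int p ^ h"
  have h: "h \<ge> 1" using prime_ge_2_nat[OF q] by (simp add: h_def)
  have cop: "\<not> q dvd p" using primes_dvd_imp_eq[OF q p] assms(3) by blast
  have "[p ^ (q - 1) = 1] (mod q)" using fermat_theorem[OF q cop] .
  then have "[(p ^ (q - 1)) ^ 2 = 1 ^ 2] (mod q)" by (rule cong_pow)
  then have "[p ^ h = 1] (mod q)" by (simp add: h_def power_mult[symmetric] mult.commute)
  then have "[int (p ^ h) = int 1] (mod int q)" by (simp only: cong_int_iff)
  then have x1: "int q dvd x - 1" by (simp add: x_def cong_iff_dvd_diff)
  have x2: "4 dvd x - 1" if "q = 2"
  proof -
    have "odd (int p)" using cop that by simp
    then obtain m where m: "int p = 2 * m + 1" by (elim oddE)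
    have "x - 1 = 4 * (m * m + m)" using that unfolding x_def h_def m by (simp add: power2_eq_square algebra_simps)
    then show ?thesis by simp
  qed
  have "x > 1" unfolding x_def using h prime_gt_1_nat[OF p] by (simp add: one_less_power)
  define a where "a = nat (x - 1)"
  have a: "s \<le> a" if "int q ^ s dvd x - 1" for s
  proof -
    have "int q ^ s \<le> x - 1" using that \<open>x > 1\<close> by (intro zdvd_imp_le) auto
    moreover have "s < q ^ s" using prime_gt_1_nat[OF q] by (intro power_gt_expt) simp
    then have "int s < int (q ^ s)" by (simp only: of_nat_less_iff)
    then have "int s < int q ^ s" by simp
    ultimately show ?thesis unfolding a_def by linarith
  qed
  show ?thesis
  proof (rule that[of "q ^ a"])
    show "q ^ a \<ge> 1" using prime_gt_0_nat[OF q] by simp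
    fix s f :: nat assume f: "f \<ge> 1" and dvd: "int q ^ s dvd int p ^ f - 1"
    have "int p ^ f - 1 dvd (int p ^ f) ^ h - 1" unfolding power_diff_1_eq[of "int p ^ f"] by simp
    also have "(int p ^ f) ^ h = x ^ f" by (simp add: x_def power_mult[symmetric] mult.commute)
    finally have "int q ^ s dvd x ^ f - 1" using dvd by (rule dvd_trans[rotated])
    then have "int q ^ s dvd int q ^ a * int f"
      by (intro prime_power_dvd_power_minus_one[OF q x1 x2 a f]) auto
    then have "int (q ^ s) dvd int (q ^ a * f)" by simp
    then have "q ^ s dvd q ^ a * f" by (simp only: int_dvd_int_iff)
    then show "q ^ s \<le> q ^ a * f" using f prime_gt_0_nat[OF q] by (intro dvd_imp_le) auto
  qed
qed

section \<open>A p-adic absolute value on the algebraic numbers\<close>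

locale padic_field = nonarch UNIV w for w :: "'a::field_char_0 \<Rightarrow> real" +
  fixes p :: nat
  assumes prime_p: "prime p" and w_p: "w (of_nat p) = 1 / real p"
begin

lemma w_p_less: "0 < w (of_nat p)" "w (of_nat p) < 1"
  using prime_gt_1_nat[OF prime_p] by (auto simp: w_p)

lemma w_int_unit: assumes "\<not> int p dvd c" shows "w (of_int c) = 1"
proof -
  have "coprime (int p) c" using prime_p assms by (intro prime_imp_coprime) auto
  then obtain u v where "u * int p + v * c = 1" using bezout_int[of "int p" c] by auto
  then have "of_int u * of_nat p + of_int v * of_int c = (1::'a)"
    by (metis of_int_1 of_int_add of_int_mult of_int_of_nat_eq)
  then have "1 \<le> max (w (of_int u * of_nat p)) (w (of_int v * of_int c))"
    using add_le[of "of_int u * of_nat p" "of_int v * of_int c"] one by simp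
  moreover have "w (of_int u * of_nat p) < 1"
    using mult_right_mono[OF of_int_le[of u], of "w (of_nat p)"] w_p_less unfolding mult[OF UNIV_I UNIV_I] by linarith
  moreover have "w (of_int v * of_int c) \<le> w (of_int c)"
    using mult_right_mono[OF of_int_le[of v], of "w (of_int c)"] nonneg by (simp add: mult)
  ultimately show ?thesis using of_int_le[of c] by auto
qed

lemma w_int_dvd: assumes "int p dvd c" shows "w (of_int c) \<le> w (of_nat p)"
proof -
  obtain k where "c = int p * k" using assms by (elim dvdE)
  then have "w (of_int c) = w (of_nat p) * w (of_int k)" by (simp add: mult)
  then show ?thesis using of_int_le[of k] w_p_less by simp
qed

lemma w_int_power: assumes "c \<noteq> 0" obtains a :: nat where "w (of_int c) = w (of_nat p) ^ a"
proof -
  have "\<not> is_unit (int p)" using prime_p by auto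
  then obtain c' where c': "c = int p ^ multiplicity (int p) c * c'" "\<not> int p dvd c'"
    using multiplicity_decompose'[OF assms] by metis
  have "w (of_int c) = w (of_nat p) ^ multiplicity (int p) c * w (of_int c')"
    by (subst c'(1)) (simp add: mult power)
  then show ?thesis using that w_int_unit[OF c'(2)] by simp
qed

end

locale padic = padic_field w p for w :: "qbar \<Rightarrow> real" and p
begin

lemma frobenius:
  assumes "w x \<le> 1" "w y \<le> 1" shows "w ((x + y) ^ p - (x ^ p + y ^ p)) \<le> w (of_nat p)"
proof -
  have p: "p > 0" using prime_gt_0_nat[OF prime_p] .
  have "(x + y) ^ p = (\<Sum>k\<le>p. of_nat (p choose k) * x ^ k * y ^ (p - k))" by (rule binomial_ring)
  also have "{..p} = insert 0 (insert p {1..<p})" using p by auto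
  also have "(\<Sum>k\<in>insert 0 (insert p {1..<p}). of_nat (p choose k) * x ^ k * y ^ (p - k)) =
     y ^ p + (x ^ p + (\<Sum>k=1..<p. of_nat (p choose k) * x ^ k * y ^ (p - k)))"
    using p by (subst sum.insert; (subst sum.insert)?) auto
  finally have "(x + y) ^ p - (x ^ p + y ^ p) = (\<Sum>k=1..<p. of_nat (p choose k) * x ^ k * y ^ (p - k))"
    by simp
  also have "w \<dots> \<le> w (of_nat p)"
  proof (rule sum_le)
    fix k assume k: "k \<in> {1..<p}"
    have "p dvd p choose k" using prime_p k by (intro dvd_choose_prime) auto
    then have c: "w (of_nat (p choose k)) \<le> w (of_nat p)" using w_int_dvd[of "int (p choose k)"] by simp
    have "w x ^ k * w y ^ (p - k) \<le> 1" using assms nonneg by (intro mult_le_one power_le_one) auto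
    then have "w (of_nat (p choose k)) * (w x ^ k * w y ^ (p - k)) \<le> w (of_nat (p choose k)) * 1"
      using nonneg by (intro mult_left_mono) auto
    then show "w (of_nat (p choose k) * x ^ k * y ^ (p - k)) \<le> w (of_nat p)"
      using c by (simp add: mult power mult.assoc)
  qed (use w_p_less in auto)
  finally show ?thesis .
qed

lemma power_le_1: "w x \<le> 1 \<Longrightarrow> w (x ^ n) \<le> 1"
  using nonneg[of x] by (simp add: power power_le_one)

lemma mult_le_1: "w x \<le> 1 \<Longrightarrow> w y \<le> 1 \<Longrightarrow> w (x * y) \<le> 1"
  using nonneg by (simp add: mult mult_le_one)

lemma add_le_1: "w x \<le> 1 \<Longrightarrow> w y \<le> 1 \<Longrightarrow> w (x + y) \<le> 1"
  using add_le[of x y] by simp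

lemma near_trans: "w (x - y) < e \<Longrightarrow> w (y - z) < e \<Longrightarrow> w (x - z) < e"
  using add_le[of "x - y" "y - z"] by simp

lemma frobenius_sum:
  assumes "finite I" "\<And>i. i \<in> I \<Longrightarrow> w (f i) \<le> 1"
  shows "w ((\<Sum>i\<in>I. f i) ^ p - (\<Sum>i\<in>I. f i ^ p)) < 1"
  using assms
proof (induction I)
  case empty
  then show ?case using prime_gt_0_nat[OF prime_p] by (simp add: zero power_0_left)
next
  case (insert i I)
  have "w (sum f I) \<le> 1" using insert by (intro sum_le) auto
  then have "w ((f i + sum f I) ^ p - (f i ^ p + sum f I ^ p)) < 1"
    using frobenius[of "f i" "sum f I"] insert w_p_less(2) by simp
  moreover have "w ((f i ^ p + sum f I ^ p) - (f i ^ p + (\<Sum>i\<in>I. f i ^ p))) < 1" using insert by simp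
  ultimately have "w ((f i + sum f I) ^ p - (f i ^ p + (\<Sum>i\<in>I. f i ^ p))) < 1" by (rule near_trans)
  then show ?case using insert by simp
qed

lemma fermat_mod: "w (of_nat n ^ p - of_nat n) < 1"
proof (induction n)
  case 0
  then show ?case using prime_gt_0_nat[OF prime_p] by (simp add: zero power_0_left)
next
  case (Suc n)
  have "w ((1 + of_nat n) ^ p - (1 ^ p + of_nat n ^ p)) < 1"
    using frobenius[of 1 "of_nat n"] of_nat_le[of n] one w_p_less(2) by simp
  moreover have "w ((1 ^ p + of_nat n ^ p) - (1 + of_nat n)) < 1" using Suc by simp
  ultimately have "w ((1 + of_nat n) ^ p - (1 + of_nat n)) < 1" by (rule near_trans)
  then show ?case by simp
qed

text \<open>Raising to the power \<open>p\<close> is additive modulo the maximal ideal and fixes the integers.\<close>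

lemma frobenius_root:
  assumes g: "w g \<le> 1" and root: "w (\<Sum>k\<le>n. of_nat (c k) * g ^ k) < 1"
  shows "w (\<Sum>k\<le>n. of_nat (c k) * (g ^ p) ^ k) < 1"
proof -
  have le: "w (of_nat (c k) * g ^ k) \<le> 1" for k by (intro mult_le_1 power_le_1 g of_nat_le)
  let ?s = "\<Sum>k\<le>n. of_nat (c k) * g ^ k"
  have "w (?s ^ p) < 1" using root nonneg[of ?s] prime_gt_0_nat[OF prime_p] by (simp add: power power_less_one_iff)
  moreover have "w (?s ^ p - (\<Sum>k\<le>n. (of_nat (c k) * g ^ k) ^ p)) < 1" by (rule frobenius_sum) (use le in auto)
  then have "w ((\<Sum>k\<le>n. (of_nat (c k) * g ^ k) ^ p) - ?s ^ p) < 1" by (simp add: minus_commute)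
  ultimately have 1: "w (\<Sum>k\<le>n. (of_nat (c k) * g ^ k) ^ p) < 1"
    using near_trans[of "\<Sum>k\<le>n. (of_nat (c k) * g ^ k) ^ p" "?s ^ p" 1 0] by simp
  have "w (\<Sum>k\<le>n. of_nat (c k) * (g ^ p) ^ k - (of_nat (c k) * g ^ k) ^ p) < 1"
  proof (rule sum_less)
    fix k
    have "of_nat (c k) * (g ^ p) ^ k - (of_nat (c k) * g ^ k) ^ p = - ((of_nat (c k) ^ p - of_nat (c k)) * (g ^ p) ^ k)"
      by (simp add: power_mult_distrib power_mult[symmetric] mult.commute algebra_simps)
    also have "w \<dots> = w (of_nat (c k) ^ p - of_nat (c k)) * w ((g ^ p) ^ k)" by (simp add: uminus mult)
    also have "\<dots> \<le> w (of_nat (c k) ^ p - of_nat (c k)) * 1"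
      using nonneg by (intro mult_left_mono power_le_1 g) auto
    also have "\<dots> < 1" using fermat_mod by simp
    finally show "w (of_nat (c k) * (g ^ p) ^ k - (of_nat (c k) * g ^ k) ^ p) < 1" .
  qed auto
  then have "w ((\<Sum>k\<le>n. of_nat (c k) * (g ^ p) ^ k) - (\<Sum>k\<le>n. (of_nat (c k) * g ^ k) ^ p)) < 1"
    by (simp add: sum_subtractf)
  then have "w ((\<Sum>k\<le>n. of_nat (c k) * (g ^ p) ^ k) - 0) < 1"
    by (rule near_trans) (use 1 in simp)
  then show ?thesis by simp
qed

lemma poly_le_1: assumes "\<And>i. w (coeff F i) \<le> 1" "w r \<le> 1" shows "w (poly F r) \<le> 1"
  unfolding poly_altdef using assms by (intro sum_le mult_le_1 power_le_1) auto

lemma synthetic_div_le_1: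
  assumes "\<And>i. w (coeff F i) \<le> 1" "w r \<le> 1" shows "w (coeff (synthetic_div F r) i) \<le> 1"
  using assms(1)
proof (induction F arbitrary: i)
  case (pCons a F)
  have F: "w (coeff F i) \<le> 1" for i using pCons.prems[of "Suc i"] by simp
  show ?case
    using pCons.IH[OF F] poly_le_1[OF F assms(2)] by (auto simp: coeff_pCons split: nat.splits)
qed (simp add: zero)

text \<open>A polynomial over the residue field has at most as many roots as its degree.\<close>

lemma many_roots_mod:
  assumes "degree F \<le> n" "\<And>i. w (coeff F i) \<le> 1" "finite R" "card R > n"
    "\<And>r. r \<in> R \<Longrightarrow> w r \<le> 1 \<and> w (poly F r) < 1" "\<And>r r'. r \<in> R \<Longrightarrow> r' \<in> R \<Longrightarrow> r \<noteq> r' \<Longrightarrow> w (r - r') = 1"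
  shows "w (coeff F i) < 1"
  using assms
proof (induction n arbitrary: F R i)
  case 0
  then obtain c where c: "F = [:c:]" by (metis degree_eq_zeroE le_zero_eq)
  obtain r where "r \<in> R" using 0 by fastforce
  then have "w c < 1" using 0(5) c by fastforce
  then show ?case using c by (auto simp: coeff_pCons zero split: nat.splits)
next
  case (Suc n)
  obtain r where r: "r \<in> R" using Suc.prems(4) by fastforce
  have r1: "w r \<le> 1" "w (poly F r) < 1" using Suc.prems(5)[OF r] by auto
  define G where "G = synthetic_div F r"
  have F: "F + smult r G = pCons (poly F r) G" unfolding G_def by (rule synthetic_div_correct)
  have G1: "w (coeff G i) \<le> 1" for i unfolding G_def by (rule synthetic_div_le_1[OF Suc.prems(2) r1(1)])
  have G: "w (coeff G i) < 1" for i
  proof (rule Suc.IH[of G "R - {r}"])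
    show "degree G \<le> n" using Suc.prems(1) by (simp add: G_def degree_synthetic_div)
    show "n < card (R - {r})" using Suc.prems(3,4) r by simp
    fix r' assume r': "r' \<in> R - {r}"
    then have "w r' \<le> 1" "w (poly F r') < 1" using Suc.prems(5) by auto
    have "poly F r' + r * poly G r' = poly F r + r' * poly G r'" using arg_cong[OF F, of "\<lambda>q. poly q r'"] by simp
    then have "poly F r' - poly F r = (r' - r) * poly G r'" by (simp add: algebra_simps)
    then have "w (r' - r) * w (poly G r') < 1"
      using diff_le[of "poly F r'" "poly F r"] r1 \<open>w (poly F r') < 1\<close> by (simp flip: mult)
    then show "w r' \<le> 1 \<and> w (poly G r') < 1" using Suc.prems(6)[of r' r] r r' \<open>w r' \<le> 1\<close> by simp
  qed (use Suc.prems G1 in auto)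
  have "coeff F i = coeff (pCons (poly F r) G) i - r * coeff G i" using arg_cong[OF F, of "\<lambda>q. coeff q i"] by (simp add: algebra_simps)
  moreover have "w (coeff (pCons (poly F r) G) i) < 1" using G r1 by (auto simp: coeff_pCons split: nat.splits)
  moreover have "w (r * coeff G i) < 1"
    using mult_right_mono[OF r1(1), of "w (coeff G i)"] G[of i] nonneg by (simp add: mult)
  ultimately show ?case using diff_le[of "coeff (pCons (poly F r) G) i" "r * coeff G i"] by simp
qed

text \<open>The Frobenius conjugates of the residue class of \<open>g\<close> are roots of one polynomial over the
  prime field whose degree is bounded by the degree of the field. So two of the first
  conjugates agree, which bounds the order of the class.\<close>

lemma residue_order:
  assumes V: "fin_dim_ring V" "V = Q.span E" "finite E" and g: "g \<in> V" "w g = 1" and q: "prime (q::nat)" "q \<noteq> p"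
    and big: "w (g ^ q ^ s - 1) < 1" and small: "\<not> w (g ^ q ^ s\<^sub>0 - 1) < 1"
  obtains f where "1 \<le> f" "f \<le> card E" "int q ^ s\<^sub>0 dvd int p ^ f - 1"
proof -
  define n where "n = card E"
  have gV: "g ^ k \<in> Q.span E" for k using subfield_power[OF fin_dim_ring_subfield[OF V(1)] g(1)] V(2) by simp
  obtain c where c: "\<exists>i\<le>n. \<not> int p dvd c i" "(\<Sum>i\<le>n. of_int (c i) * g ^ i) = 0"
    using primitive_relation[of E n "\<lambda>i. g ^ i", OF V(3) gV _ prime_p] by (auto simp: n_def)
  define b where "b i = nat (c i mod int p)" for i
  have p0: "int p > 0" using prime_gt_0_nat[OF prime_p] by simp
  have cb: "w (of_nat (b i) - of_int (c i)) < 1" for i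
  proof -
    have "(of_nat (b i) - of_int (c i) :: qbar) = of_int (c i mod int p - c i)"
      using p0 by (simp add: b_def)
    moreover have "int p dvd c i mod int p - c i" by (metis dvd_minus_mod dvd_minus_iff minus_diff_eq)
    ultimately show ?thesis using w_int_dvd w_p_less(2) by fastforce
  qed
  have b0: "w (\<Sum>i\<le>n. of_nat (b i) * g ^ i) < 1"
  proof -
    have "w (\<Sum>i\<le>n. (of_nat (b i) - of_int (c i)) * g ^ i) < 1"
      by (rule sum_less) (use cb g(2) in \<open>auto simp: mult power\<close>)
    then show ?thesis using c(2) by (simp add: left_diff_distrib sum_subtractf)
  qed
  define F where "F = (\<Sum>i\<le>n. monom (of_nat (b i) :: qbar) i)"
  have cF: "coeff F i = (if i \<le> n then of_nat (b i) else 0)" for i by (simp add: F_def coeff_sum)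
  have pF: "poly F x = (\<Sum>i\<le>n. of_nat (b i) * x ^ i)" for x by (simp add: F_def poly_sum poly_monom)
  have conj: "w (g ^ p ^ j) = 1 \<and> w (poly F (g ^ p ^ j)) < 1" for j
  proof (induction j)
    case (Suc j)
    then have "w (\<Sum>i\<le>n. of_nat (b i) * ((g ^ p ^ j) ^ p) ^ i) < 1" by (intro frobenius_root) (auto simp: pF)
    then show ?case using g(2) by (simp add: pF power power_mult[symmetric] mult.commute)
  qed (use b0 g in \<open>simp add: pF\<close>)
  have "\<exists>i j. i < j \<and> j \<le> n \<and> w (g ^ p ^ i - g ^ p ^ j) < 1"
  proof (rule ccontr)
    assume neg: "\<not> ?thesis"
    have far: "w (g ^ p ^ i - g ^ p ^ j) = 1" if ij: "i \<le> n" "j \<le> n" "i \<noteq> j" for i j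
    proof -
      have "\<not> w (g ^ p ^ i - g ^ p ^ j) < 1" "\<not> w (g ^ p ^ j - g ^ p ^ i) < 1"
        using neg ij minus_commute[of "g ^ p ^ i" "g ^ p ^ j"] by (metis UNIV_I linorder_neqE_nat)+
      moreover have "w (g ^ p ^ i - g ^ p ^ j) \<le> 1" using diff_le[of "g ^ p ^ i" "g ^ p ^ j"] conj by simp
      ultimately show ?thesis by simp
    qed
    have inj: "inj_on (\<lambda>j. g ^ p ^ j) {..n}"
    proof (rule inj_onI, rule ccontr)
      fix i j assume "i \<in> {..n}" "j \<in> {..n}" "g ^ p ^ i = g ^ p ^ j" "i \<noteq> j"
      with far[of i j] show False by (simp add: zero)
    qed
    have "w (coeff F i) < 1" for i
    proof (rule many_roots_mod[where n = n and R = "(\<lambda>j. g ^ p ^ j) ` {..n}"])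
      show "degree F \<le> n" by (rule degree_le) (simp add: cF)
      show "w (coeff F i) \<le> 1" for i using of_nat_le by (simp add: cF zero)
      show "n < card ((\<lambda>j. g ^ p ^ j) ` {..n})" using card_image[OF inj] by simp
      show "w r \<le> 1 \<and> w (poly F r) < 1" if "r \<in> (\<lambda>j. g ^ p ^ j) ` {..n}" for r using that conj by auto
      show "w (r - r') = 1" if "r \<in> (\<lambda>j. g ^ p ^ j) ` {..n}" "r' \<in> (\<lambda>j. g ^ p ^ j) ` {..n}" "r \<noteq> r'" for r r'
        using that far by auto
    qed simp
    then have "w (of_nat (b i)) < 1" if "i \<le> n" for i using that cF by metis
    moreover obtain i where i: "i \<le> n" "\<not> int p dvd c i" using c(1) by blast
    have "\<not> int p dvd int (b i)" using i(2) p0 by (simp add: b_def dvd_mod_iff)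
    then have "w (of_nat (b i)) = 1" using w_int_unit[of "int (b i)"] by simp
    ultimately show False using i(1) by fastforce
  qed
  then obtain i j where ij: "i < j" "j \<le> n" "w (g ^ p ^ i - g ^ p ^ j) < 1" by blast
  define f where "f = j - i"
  have f: "1 \<le> f" "f \<le> card E" "j = i + f" using ij by (auto simp: f_def n_def)
  \<comment> \<open>The exponents \<open>m\<close> with \<open>g ^ m \<equiv> 1\<close> are closed
    under common divisors, so the common divisor of \<open>q ^ s\<close> and
    \<open>p ^ i * (p ^ f - 1)\<close> is one.\<close>
  define Per where "Per m \<longleftrightarrow> w (g ^ m - 1) < 1" for m :: nat
  have per_mult: "Per (m * k)" if "Per m" for m k
  proof -
    have "w ((g ^ m) ^ k - 1 ^ k) \<le> w (g ^ m - 1) * 1 ^ (k - 1)"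
      by (rule power_diff_le) (use g(2) in \<open>auto simp: power one\<close>)
    then show ?thesis using that by (simp add: Per_def power_mult[symmetric])
  qed
  have per_diff: "Per m" if "Per (m + k)" "Per k" for m k
  proof -
    have e: "g ^ m - 1 = (g ^ (m + k) - 1) - g ^ m * (g ^ k - 1)" by (simp add: power_add algebra_simps)
    moreover have "w (g ^ m * (g ^ k - 1)) < 1" using that(2) g(2) by (simp add: Per_def mult power)
    ultimately show ?thesis using diff_le[of "g ^ (m + k) - 1" "g ^ m * (g ^ k - 1)"] that(1)
      unfolding Per_def e by simp
  qed
  have per_gcd: "Per (gcd m k)" if m: "Per m" and k: "Per k" for m k
  proof (cases "m = 0")
    case False
    then obtain x y where xy: "m * x = k * y + gcd m k" using bezout_nat[of m k] by blast
    then have "Per (gcd m k + k * y)" using per_mult[OF m, of x] by (simp add: add.commute)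
    then show ?thesis using per_diff per_mult[OF k] by blast
  qed (use k in simp)
  have "Per (p ^ i * (p ^ f - 1))"
  proof -
    have p1: "p ^ f \<ge> 1" using prime_gt_0_nat[OF prime_p] by simp
    have "p ^ j = p ^ i + p ^ i * (p ^ f - 1)" using p1 by (simp add: f(3) power_add algebra_simps diff_mult_distrib2)
    then have "g ^ p ^ j - g ^ p ^ i = g ^ p ^ i * (g ^ (p ^ i * (p ^ f - 1)) - 1)" by (simp add: power_add algebra_simps)
    then show ?thesis using ij(3) conj[of i] minus_commute[of "g ^ p ^ i" "g ^ p ^ j"] by (simp add: Per_def mult)
  qed
  moreover have "Per (q ^ s)" using big by (simp add: Per_def)
  ultimately have pg: "Per (gcd (p ^ i * (p ^ f - 1)) (q ^ s))" by (rule per_gcd)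
  have "gcd (p ^ i * (p ^ f - 1)) (q ^ s) dvd q ^ s" by simp
  then obtain s1 where s1: "s1 \<le> s" "gcd (p ^ i * (p ^ f - 1)) (q ^ s) = q ^ s1"
    using divides_primepow_nat[OF q(1)] by blast
  have "\<not> s1 \<le> s\<^sub>0"
  proof
    assume "s1 \<le> s\<^sub>0"
    then have "q ^ s\<^sub>0 = q ^ s1 * q ^ (s\<^sub>0 - s1)" by (simp flip: power_add)
    then have "Per (q ^ s\<^sub>0)" using per_mult pg s1(2) by metis
    then show False using small by (simp add: Per_def)
  qed
  then have "q ^ s\<^sub>0 dvd q ^ s1" by (simp add: le_imp_power_dvd)
  also have "q ^ s1 dvd p ^ i * (p ^ f - 1)" using s1(2) by (metis gcd_dvd1)
  finally have "q ^ s\<^sub>0 dvd p ^ i * (p ^ f - 1)" .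
  moreover have "coprime (q ^ s\<^sub>0) (p ^ i)" using primes_coprime[OF q(1) prime_p q(2)] by simp
  ultimately have "q ^ s\<^sub>0 dvd p ^ f - 1" by (simp add: coprime_dvd_mult_right_iff)
  then have "int (q ^ s\<^sub>0) dvd int (p ^ f - 1)" by (simp only: int_dvd_int_iff)
  then have "int q ^ s\<^sub>0 dvd int p ^ f - 1" using prime_gt_0_nat[OF prime_p] by (simp add: of_nat_diff)
  then show ?thesis using that f(1,2) by blast
qed

text \<open>Powers of \<open>u\<close> whose absolute values lie strictly between \<open>1/p\<close> and \<open>1\<close> are linearly independent
  over the rationals, because rational multiples have absolute values in \<open>p\<^sup>\<int>\<close>.\<close>

lemma ramified_dimension:
  assumes V: "fin_dim_ring V" "V = Q.span E" "finite E" and u: "u \<in> V" "w u < 1" "w (of_nat p) < w u ^ J" and u0: "u \<noteq> 0"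
  shows "J < card E"
proof (rule ccontr)
  assume "\<not> J < card E"
  then have "card E \<le> J" by simp
  moreover have uV: "u ^ k \<in> Q.span E" for k using subfield_power[OF fin_dim_ring_subfield[OF V(1)] u(1)] V(2) by simp
  ultimately obtain c where c: "\<exists>i\<le>J. c i \<noteq> 0" "(\<Sum>i\<le>J. of_int (c i) * u ^ i) = 0"
    using integer_relation[of E J "\<lambda>i. u ^ i", OF V(3) uV] by blast
  define h where "h i = w (of_int (c i) * u ^ i)" for i
  define I where "I = {i. i \<le> J \<and> c i \<noteq> 0}"
  have I: "finite I" "I \<noteq> {}" using c(1) by (auto simp: I_def)
  have wu: "w u > 0" using u0 pos by simp
  have hpos: "h i > 0" if "i \<in> I" for i using that u0 pos by (auto simp: h_def I_def)
  have distinct: "h i \<noteq> h j" if ij: "i \<in> I" "j \<in> I" "i < j" for i j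
  proof
    assume eq: "h i = h j"
    obtain a b where ab: "w (of_int (c i)) = w (of_nat p) ^ a" "w (of_int (c j)) = w (of_nat p) ^ b"
      using w_int_power ij by (metis (mono_tags, lifting) I_def mem_Collect_eq)
    have "w (of_nat p) ^ a * w u ^ i = w (of_nat p) ^ b * w u ^ j" using eq by (simp add: h_def mult power ab)
    also have "w u ^ j = w u ^ i * w u ^ (j - i)" using ij by (simp flip: power_add)
    finally have e: "w (of_nat p) ^ a = w (of_nat p) ^ b * w u ^ (j - i)" using wu by simp
    have "w u ^ (j - i) < 1" using wu u(2) ij by (simp add: power_less_one_iff)
    then have "w (of_nat p) ^ a < w (of_nat p) ^ b" using e w_p_less by simp
    then have "b < a" using w_p_less by (simp add: power_strict_decreasing_iff)
    then have "w (of_nat p) ^ a \<le> w (of_nat p) ^ Suc b" using w_p_less by (intro power_decreasing) auto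
    then have "w (of_nat p) ^ b * w u ^ (j - i) \<le> w (of_nat p) ^ b * w (of_nat p)" using e by (simp add: mult.commute)
    then have "w u ^ (j - i) \<le> w (of_nat p)" using w_p_less by simp
    moreover have "w u ^ J \<le> w u ^ (j - i)" using wu u(2) ij by (intro power_decreasing) (auto simp: I_def)
    ultimately show False using u(3) by linarith
  qed
  obtain i where i: "i \<in> I" "\<And>j. j \<in> I \<Longrightarrow> h j \<le> h i"
  proof -
    have "Max (h ` I) \<in> h ` I" using I by (intro Max_in) auto
    then obtain i where "i \<in> I" "h i = Max (h ` I)" by auto
    then show thesis using that[of i] I(1) by simp
  qed
  have "w (\<Sum>j\<in>I - {i}. of_int (c j) * u ^ j) < h i"
  proof (rule sum_less)
    fix j assume j: "j \<in> I - {i}"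
    then have "h j \<noteq> h i" using distinct[of i j] distinct[of j i] i(1) by (metis DiffE insertI1 linorder_neqE_nat)
    then show "w (of_int (c j) * u ^ j) < h i" using i(2)[of j] j by (simp add: h_def)
  qed (use hpos i in auto)
  then have "w (of_int (c i) * u ^ i + (\<Sum>j\<in>I - {i}. of_int (c j) * u ^ j)) = h i"
    by (subst add_eq_left) (auto simp: h_def)
  moreover have "of_int (c i) * u ^ i + (\<Sum>j\<in>I - {i}. of_int (c j) * u ^ j) = (\<Sum>j\<in>I. of_int (c j) * u ^ j)"
    using sum.remove[OF I(1) i(1), of "\<lambda>j. of_int (c j) * u ^ j"] by simp
  moreover have "(\<Sum>j\<in>I. of_int (c j) * u ^ j) = (\<Sum>j\<le>J. of_int (c j) * u ^ j)"
    by (rule sum.mono_neutral_left) (auto simp: I_def)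
  ultimately show False using c(2) hpos[OF i(1)] zero by simp
qed

end

section \<open>Orbits that meet over a p-adic field\<close>

lemma (in nonarch) ratio_minus_one: "x \<in> K \<Longrightarrow> y \<in> K \<Longrightarrow> y \<noteq> 0 \<Longrightarrow> v (x / y - 1) * v y = v (x - y)"
  using mult[of "x / y - 1" y] by (simp add: K subfield_closed subfield_divide subfield_diff subfield_1 left_diff_distrib)

lemma orbit_in_subfield:
  assumes "is_subfield V" "z \<in> V" "\<And>i. i \<in> {1..d} \<Longrightarrow> \<alpha> i \<in> V" shows "orbit d \<alpha> z k \<in> V"
  using assms by (induction k) (auto intro!: subfield_add subfield_sum subfield_mult subfield_power)

context padic
begin

text \<open>Modulo the maximal ideal, \<open>z\<^sup>p - 1\<close> is \<open>(z - 1)\<^sup>p\<close>.\<close>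

lemma frobenius_inj: "w z \<le> 1 \<Longrightarrow> w (z ^ p ^ r - 1) < 1 \<Longrightarrow> w (z - 1) < 1"
proof (induction r)
  case (Suc r)
  define y where "y = z ^ p ^ r"
  have y1: "w (y - 1) \<le> 1" using power_le_1[OF Suc.prems(1), of "p ^ r"] diff_le[of y 1] one by (simp add: y_def)
  have yp: "y ^ p = z ^ p ^ Suc r" by (simp add: y_def power_mult[symmetric] mult.commute)
  have "w ((y - 1 + 1) ^ p - ((y - 1) ^ p + 1 ^ p)) < 1"
    using frobenius[of "y - 1" 1] y1 one w_p_less by simp
  then have 1: "w (y ^ p - 1 - (y - 1) ^ p) < 1" by (simp add: algebra_simps)
  have "w (y ^ p - 1 - (y ^ p - 1 - (y - 1) ^ p)) < 1"
    using diff_le[of "y ^ p - 1" "y ^ p - 1 - (y - 1) ^ p"] Suc.prems(2) 1 unfolding yp by simp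
  then have "w ((y - 1) ^ p) < 1" by simp
  then have "w (y - 1) < 1"
    using prime_gt_0_nat[OF prime_p] nonneg[of "y - 1"] by (simp add: power power_less_one_iff)
  then show ?case using Suc by (simp add: y_def)
qed simp

text \<open>Near \<open>1\<close> the geometric sum for \<open>z\<^sup>p - 1\<close> is congruent to \<open>p\<close>.\<close>

lemma prime_power_contracts:
  assumes "w (z - 1) \<le> w (of_nat p)" shows "w (z ^ p ^ r - 1) \<le> w (of_nat p) ^ r * w (z - 1)"
proof (induction r)
  case (Suc r)
  define y where "y = z ^ p ^ r"
  have yp: "y ^ p = z ^ p ^ Suc r" by (simp add: y_def power_mult[symmetric] mult.commute)
  have "w (y - 1) \<le> w (of_nat p) ^ r * w (z - 1)" using Suc by (simp add: y_def)
  also have "\<dots> \<le> 1 * w (z - 1)"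
    using w_p_less nonneg by (intro mult_right_mono power_le_one) auto
  finally have yp1: "w (y - 1) \<le> w (of_nat p)" using assms by simp
  have y1: "w y \<le> 1" using add_le_1[of "y - 1" 1] yp1 w_p_less one by simp
  have "w (\<Sum>i<p. y ^ i - 1) \<le> w (of_nat p)"
  proof (rule sum_le)
    fix i
    have "w (y ^ i - 1 ^ i) \<le> w (y - 1) * 1 ^ (i - 1)" using y1 one by (intro power_diff_le) auto
    then show "w (y ^ i - 1) \<le> w (of_nat p)" using yp1 by simp
  qed (use w_p_less in auto)
  then have "w ((\<Sum>i<p. y ^ i) - of_nat p) \<le> w (of_nat p)" by (simp add: sum_subtractf)
  then have s: "w (\<Sum>i<p. y ^ i) \<le> w (of_nat p)"
    using add_le[of "(\<Sum>i<p. y ^ i) - of_nat p" "of_nat p"] by simp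
  have "w (y ^ p - 1) = w (y - 1) * w (\<Sum>i<p. y ^ i)"
    unfolding power_diff_1_eq[of y p] by (rule mult) auto
  also have "\<dots> \<le> (w (of_nat p) ^ r * w (z - 1)) * w (of_nat p)"
    using Suc s nonneg w_p_less by (intro mult_mono) (auto simp: y_def)
  finally show ?case unfolding yp by (simp add: mult_ac)
qed simp

text \<open>Each step replaces \<open>z - 1\<close> by its \<open>p\<close>-th power up to a multiple of \<open>p\<close>.\<close>

lemma prime_power_far:
  assumes "w (z - 1) \<le> 1" shows "w (z ^ p ^ r - 1) \<le> max (w (z - 1) ^ p ^ r) (w (of_nat p))"
proof (induction r)
  case (Suc r)
  define y where "y = z ^ p ^ r"
  have yp: "y ^ p = z ^ p ^ Suc r" by (simp add: y_def power_mult[symmetric] mult.commute)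
  have p: "p > 0" using prime_gt_0_nat[OF prime_p] .
  have le: "w (y - 1) \<le> max (w (z - 1) ^ p ^ r) (w (of_nat p))" using Suc by (simp add: y_def)
  moreover have "w (z - 1) ^ p ^ r \<le> 1" using assms nonneg by (intro power_le_one) auto
  ultimately have y1: "w (y - 1) \<le> 1" using w_p_less by simp
  have "w ((y - 1 + 1) ^ p - ((y - 1) ^ p + 1 ^ p)) \<le> w (of_nat p)"
    using frobenius[of "y - 1" 1] y1 one by simp
  then have 1: "w (y ^ p - 1 - (y - 1) ^ p) \<le> w (of_nat p)" by (simp add: algebra_simps)
  have "w (y ^ p - 1) \<le> max (w (y ^ p - 1 - (y - 1) ^ p)) (w ((y - 1) ^ p))"
    using add_le[of "y ^ p - 1 - (y - 1) ^ p" "(y - 1) ^ p"] by simp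
  also have "\<dots> \<le> max (w (of_nat p)) (w (y - 1) ^ p)" using 1 by (auto simp: power)
  also have "w (y - 1) ^ p \<le> max (w (z - 1) ^ p ^ Suc r) (w (of_nat p))"
  proof (cases "w (y - 1) \<le> w (of_nat p)")
    case True
    then have "w (y - 1) ^ p \<le> w (of_nat p) ^ p" using nonneg by (intro power_mono) auto
    also have "\<dots> \<le> w (of_nat p) ^ 1" using w_p_less p by (intro power_decreasing) auto
    finally show ?thesis by simp
  next
    case False
    then have "w (y - 1) \<le> w (z - 1) ^ p ^ r" using le by linarith
    then have "w (y - 1) ^ p \<le> (w (z - 1) ^ p ^ r) ^ p" using nonneg by (intro power_mono) auto
    then show ?thesis by (simp add: power_mult[symmetric] mult.commute)
  qed
  finally show ?case unfolding yp by (simp add: max.commute max.left_commute)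
qed (simp add: assms)

end

text \<open>The bounds for \<open>\<alpha>\<close> hold with \<open>T = max 1 (w t)\<close> if \<open>\<alpha> i\<close> is the value at \<open>t\<close> of a polynomial of degree less
  than \<open>i\<close> with integral coefficients.\<close>

locale padic_orbit = padic +
  fixes d :: nat and T :: real and \<alpha> :: "nat \<Rightarrow> qbar"
  assumes d: "d \<ge> 2" and T: "T \<ge> 1" and w_\<alpha>: "\<And>i. i \<in> {1..d} \<Longrightarrow> w (\<alpha> i) \<le> T ^ (i - 1)"
begin

lemma lower_terms_le:
  assumes "w z \<le> B" "T \<le> B" shows "w (\<Sum>i=1..d. \<alpha> i * z ^ (d - i)) \<le> B ^ (d - 1)"
proof (rule sum_le)
  fix i assume i: "i \<in> {1..d}"
  have "w (\<alpha> i * z ^ (d - i)) = w (\<alpha> i) * w z ^ (d - i)" by (simp add: mult power)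
  also have "\<dots> \<le> B ^ (i - 1) * B ^ (d - i)"
  proof (intro mult_mono power_mono)
    have "T ^ (i - 1) \<le> B ^ (i - 1)" using T assms by (intro power_mono) auto
    then show "w (\<alpha> i) \<le> B ^ (i - 1)" using w_\<alpha>[OF i] by simp
  qed (use assms T nonneg in auto)
  also have "\<dots> = B ^ (d - 1)" using i by (simp flip: power_add)
  finally show "w (\<alpha> i * z ^ (d - i)) \<le> B ^ (d - 1)" .
qed (use assms T in auto)

lemma orbit_abs:
  assumes "w z \<ge> T" "w z > 1" shows "w (orbit d \<alpha> z k) = w z ^ d ^ k"
proof (induction k)
  case (Suc k)
  let ?y = "orbit d \<alpha> z k"
  have M: "w ?y > 1" unfolding Suc using assms(2) d by (intro one_less_power) auto
  have "w z ^ 1 \<le> w z ^ d ^ k" using assms(2) d by (intro power_increasing) auto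
  then have "T \<le> w ?y" using assms(1) Suc by simp
  then have "w (\<Sum>i=1..d. \<alpha> i * ?y ^ (d - i)) \<le> w ?y ^ (d - 1)" by (intro lower_terms_le) auto
  also have "\<dots> < w ?y ^ d" using M d by (intro power_strict_increasing) auto
  also have "\<dots> = w (?y ^ d)" by (simp add: power)
  finally have "w (orbit d \<alpha> z (Suc k)) = w (?y ^ d)" unfolding orbit.simps by (intro add_eq_left) auto
  also have "\<dots> = w ?y ^ d" by (rule power) simp
  finally show ?case unfolding Suc by (simp add: power_mult[symmetric] mult.commute)
qed simp

lemma orbit_less:
  assumes "w z < B" "T \<le> B" "1 < B" shows "w (orbit d \<alpha> z k) < B ^ d ^ k"
proof (induction k)
  case (Suc k)
  let ?y = "orbit d \<alpha> z k" and ?B = "B ^ d ^ k"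
  have B: "?B > 1" using assms(3) d by (intro one_less_power) auto
  have "B ^ 1 \<le> ?B" using assms(3) d by (intro power_increasing) auto
  then have "w (\<Sum>i=1..d. \<alpha> i * ?y ^ (d - i)) \<le> ?B ^ (d - 1)"
    using assms(2) Suc by (intro lower_terms_le) auto
  also have "\<dots> < ?B ^ d" using B d by (intro power_strict_increasing) auto
  finally have 1: "w (\<Sum>i=1..d. \<alpha> i * ?y ^ (d - i)) < ?B ^ d" .
  have 2: "w (?y ^ d) < ?B ^ d" using Suc nonneg[of ?y] d by (simp add: power power_strict_mono)
  have "w (orbit d \<alpha> z (Suc k)) < ?B ^ d"
    unfolding orbit.simps using add_le[of "?y ^ d" "\<Sum>i=1..d. \<alpha> i * ?y ^ (d - i)"] 1 2 by simp
  then show ?case by (simp add: power_mult[symmetric] mult.commute)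
qed (use assms in simp)

lemma ratio_step:
  assumes M: "w x = M" "w y = M" "T \<le> M" "1 < M"
    and g: "gx = x ^ d + (\<Sum>i=1..d. \<alpha> i * x ^ (d - i))" "gy = y ^ d + (\<Sum>i=1..d. \<alpha> i * y ^ (d - i))"
    and gy: "w gy = M ^ d"
  shows "w (gx / gy - (x / y) ^ d) \<le> 1 / M"
proof -
  define ex ey where "ex = (\<Sum>i=1..d. \<alpha> i * x ^ (d - i))" and "ey = (\<Sum>i=1..d. \<alpha> i * y ^ (d - i))"
  have e: "w ex \<le> M ^ (d - 1)" "w ey \<le> M ^ (d - 1)"
    unfolding ex_def ey_def by (rule lower_terms_le; use M in simp)+
  have ne: "y \<noteq> 0" "gy \<noteq> 0" using M gy by (auto simp: zero)
  have "gx / gy - (x / y) ^ d = (ex * y ^ d - x ^ d * ey) / (y ^ d * gy)"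
    using ne unfolding g ex_def[symmetric] ey_def[symmetric] by (simp add: power_divide divide_simps) (simp add: algebra_simps)
  then have "w (gx / gy - (x / y) ^ d) = w (ex * y ^ d - x ^ d * ey) / (M ^ d * M ^ d)"
    by (simp add: divide mult power M gy)
  also have "\<dots> \<le> (M ^ (d - 1) * M ^ d) / (M ^ d * M ^ d)"
  proof (intro divide_right_mono)
    have "w (ex * y ^ d) \<le> M ^ (d - 1) * M ^ d" "w (x ^ d * ey) \<le> M ^ d * M ^ (d - 1)"
      using e M by (auto simp: mult power intro!: mult_left_mono mult_right_mono)
    then show "w (ex * y ^ d - x ^ d * ey) \<le> M ^ (d - 1) * M ^ d"
      using diff_le[of "ex * y ^ d" "x ^ d * ey"] by (simp add: mult.commute)
  qed (use M in auto)
  also have "\<dots> = M ^ (d - 1) / M ^ d" using M by simp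
  also have "M ^ d = M ^ (d - 1) * M" using d by (simp flip: power_Suc2)
  finally show ?thesis using M by simp
qed

text \<open>Two distinct points with the same image differ by a factor that is not close to \<open>1\<close>: near \<open>1\<close>
  the map \<open>\<rho> \<mapsto> \<rho>\<^sup>d - 1\<close> scales distances by \<open>|d|\<close>, and the other terms are too small to
  compensate.\<close>

lemma ratio_far_from_1:
  assumes M: "w x = M" "w y = M" "T \<le> M" "1 < M" and small: "1 / M < w (of_nat d)" and "x \<noteq> y"
    and eq: "x ^ d + (\<Sum>i=1..d. \<alpha> i * x ^ (d - i)) = y ^ d + (\<Sum>i=1..d. \<alpha> i * y ^ (d - i))"
  shows "w (of_nat d) \<le> w (x / y - 1)"
proof (rule ccontr)
  define \<rho> where "\<rho> = x / y"
  assume "\<not> ?thesis"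
  then have near: "w (\<rho> - 1) < w (of_nat d)" by (simp add: \<rho>_def)
  have y0: "y \<noteq> 0" using M by (auto simp: zero)
  have wd: "w (of_nat d) \<le> 1" by (rule of_nat_le)
  have w\<rho>: "w \<rho> = 1" using M by (simp add: \<rho>_def divide)
  have "w (\<Sum>i<d. \<rho> ^ i - 1) < w (of_nat d)"
  proof (rule sum_less)
    fix i
    have "w (\<rho> ^ i - 1 ^ i) \<le> w (\<rho> - 1) * 1 ^ (i - 1)" using w\<rho> one by (intro power_diff_le) auto
    then show "w (\<rho> ^ i - 1) < w (of_nat d)" using near by simp
  qed (use near nonneg[of "\<rho> - 1"] in auto)
  then have "w ((\<Sum>i<d. \<rho> ^ i) - of_nat d) < w (of_nat d)" by (simp add: sum_subtractf)
  then have s: "w (\<Sum>i<d. \<rho> ^ i) = w (of_nat d)" by (intro eq_of_near) auto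
  have "x ^ d - y ^ d = y ^ d * (\<rho> ^ d - 1)" using y0 by (simp add: \<rho>_def power_divide algebra_simps)
  also have "\<dots> = y ^ d * ((\<rho> - 1) * (\<Sum>i<d. \<rho> ^ i))" by (simp only: power_diff_1_eq)
  finally have L: "w (x ^ d - y ^ d) = M ^ d * (w (\<rho> - 1) * w (of_nat d))" by (simp add: mult power M s)
  have xy: "w (x - y) = w (\<rho> - 1) * M" using ratio_minus_one[of x y] y0 M by (simp add: \<rho>_def)
  have "x ^ d - y ^ d = - (\<Sum>i=1..d. \<alpha> i * (x ^ (d - i) - y ^ (d - i)))"
    using eq by (simp add: right_diff_distrib sum_subtractf algebra_simps)
  then have "w (x ^ d - y ^ d) = w (\<Sum>i=1..d. \<alpha> i * (x ^ (d - i) - y ^ (d - i)))" by (simp add: uminus)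
  also have "\<dots> \<le> M ^ (d - 1) * w (\<rho> - 1)"
  proof (rule sum_le)
    fix i assume i: "i \<in> {1..d}"
    show "w (\<alpha> i * (x ^ (d - i) - y ^ (d - i))) \<le> M ^ (d - 1) * w (\<rho> - 1)"
    proof (cases "i = d")
      case False
      have 1: "w (x ^ (d - i) - y ^ (d - i)) \<le> w (x - y) * M ^ (d - i - 1)"
        using M by (intro power_diff_le) auto
      have "T ^ (i - 1) \<le> M ^ (i - 1)" using T M by (intro power_mono) auto
      then have "w (\<alpha> i) \<le> M ^ (i - 1)" using w_\<alpha>[OF i] by simp
      then have "w (\<alpha> i) * w (x ^ (d - i) - y ^ (d - i)) \<le> M ^ (i - 1) * (w (x - y) * M ^ (d - i - 1))"
        using 1 M nonneg by (intro mult_mono) auto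
      also have "\<dots> = (M ^ (i - 1) * M * M ^ (d - i - 1)) * w (\<rho> - 1)" by (simp add: xy mult_ac)
      also have "M ^ (i - 1) * M * M ^ (d - i - 1) = M ^ (d - 1)"
        using i False by (simp flip: power_add power_Suc2)
      finally show ?thesis by (simp add: mult)
    qed (use M nonneg in \<open>simp add: zero\<close>)
  qed (use M nonneg in auto)
  finally have "M ^ (d - 1) * (M * (w (\<rho> - 1) * w (of_nat d))) \<le> M ^ (d - 1) * w (\<rho> - 1)"
    using d unfolding L by (simp add: mult.assoc[symmetric] flip: power_Suc2)
  then have "M * (w (\<rho> - 1) * w (of_nat d)) \<le> w (\<rho> - 1)" using M by simp
  then have "w (\<rho> - 1) * (M * w (of_nat d)) \<le> w (\<rho> - 1) * 1" by (simp add: mult_ac)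
  moreover have "w (\<rho> - 1) > 0" using pos[of "\<rho> - 1"] assms(6) y0 by (simp add: \<rho>_def)
  ultimately have "M * w (of_nat d) \<le> 1" by simp
  then show False using small M by (simp add: field_simps)
qed

end

text \<open>Two orbits of points of equal size above the threshold \<open>T\<close>, which meet at time \<open>Suc K\<close> and no
  earlier.\<close>

locale meeting_orbits = padic_orbit +
  fixes x\<^sub>0 y\<^sub>0 :: qbar and K :: nat and V E :: "qbar set" and M :: real
  assumes M: "w x\<^sub>0 = M" "w y\<^sub>0 = M" "T \<le> M" "1 < M"
    and V: "fin_dim_ring V" "V = Q.span E" "finite E"
    and in_V: "x\<^sub>0 \<in> V" "y\<^sub>0 \<in> V" "\<And>i. i \<in> {1..d} \<Longrightarrow> \<alpha> i \<in> V"
    and meet: "orbit d \<alpha> x\<^sub>0 (Suc K) = orbit d \<alpha> y\<^sub>0 (Suc K)" "orbit d \<alpha> x\<^sub>0 K \<noteq> orbit d \<alpha> y\<^sub>0 K"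
begin

definition ratio where "ratio k = orbit d \<alpha> x\<^sub>0 k / orbit d \<alpha> y\<^sub>0 k"

lemma abs_orbits: "w (orbit d \<alpha> x\<^sub>0 k) = M ^ d ^ k" "w (orbit d \<alpha> y\<^sub>0 k) = M ^ d ^ k"
  using orbit_abs M by auto

lemma M_power: "T \<le> M ^ d ^ k" "1 < M ^ d ^ k" "M \<le> M ^ d ^ k"
proof -
  show "M \<le> M ^ d ^ k" using M d power_increasing[of 1 "d ^ k" M] by simp
  then show "T \<le> M ^ d ^ k" "1 < M ^ d ^ k" using M by auto
qed

lemma abs_ratio: "w (ratio k) = 1"
  using M(4) by (simp add: ratio_def divide abs_orbits)

lemma ratio_last: "ratio (Suc K) = 1"
proof -
  have "orbit d \<alpha> y\<^sub>0 (Suc K) \<noteq> 0" using abs_orbits(2)[of "Suc K"] M(4) by (metis less_irrefl not_one_less_zero power_eq_0_iff zero)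
  then show ?thesis by (simp add: ratio_def meet(1) del: orbit.simps)
qed

lemma ratio_Suc: "w (ratio (Suc k) - ratio k ^ d) \<le> 1 / M ^ d ^ k"
  unfolding ratio_def
  by (rule ratio_step) (use abs_orbits M_power abs_orbits[of "Suc k"] in \<open>auto simp: power_mult[symmetric] mult.commute\<close>)

lemma ratio_Suc_less: "w (ratio (Suc k) - ratio k ^ d) < 1"
proof -
  have "1 / M ^ d ^ k < 1" using M_power(2)[of k] by simp
  then show ?thesis using ratio_Suc[of k] by simp
qed

lemma ratio_far: "1 / M ^ d ^ K < w (of_nat d) \<Longrightarrow> w (of_nat d) \<le> w (ratio K - 1)"
  unfolding ratio_def
  by (rule ratio_far_from_1) (use abs_orbits M_power meet in auto)

lemma ratio_in_V: "ratio k \<in> V"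
  unfolding ratio_def using fin_dim_ring_subfield[OF V(1)] in_V
  by (intro subfield_divide orbit_in_subfield) auto

lemma card_E_pos: "card E \<ge> 1"
proof -
  have "x\<^sub>0 \<noteq> 0" using M by (auto simp: zero)
  then have "E \<noteq> {}" using in_V(1) V(2) by auto
  then show ?thesis using V(3) by (simp add: Suc_le_eq card_gt_0_iff)
qed

text \<open>Modulo the maximal ideal the ratios are the powers \<open>\<rho>\<^sub>0 ^ d\<^sup>k\<close>. The last one is \<open>1\<close>, the one before is
  not, as \<open>d\<close> is a unit. So the order of \<open>\<rho>\<^sub>0\<close> is a power of \<open>q\<close> greater than \<open>d ^ K\<close>.\<close>

lemma degree_bound_unramified:
  assumes q: "prime q" "q \<noteq> p" "d = q ^ r"
    and C: "\<And>s f. f \<ge> 1 \<Longrightarrow> int q ^ s dvd int p ^ f - 1 \<Longrightarrow> q ^ s \<le> C * f"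
  shows "d ^ K \<le> C * card E"
proof -
  have "\<not> int p dvd int d"
  proof
    assume "int p dvd int d"
    then have "p dvd q" using prime_dvd_power[OF prime_p, of q r] unfolding q(3) by (simp only: int_dvd_int_iff)
    then show False using primes_dvd_imp_eq[OF prime_p q(1)] q(2) by simp
  qed
  then have wd: "w (of_nat d) = 1" using w_int_unit[of "int d"] by simp
  have dk: "d ^ k = q ^ (r * k)" for k by (simp add: q(3) power_mult)
  have near: "w (ratio k - ratio 0 ^ d ^ k) < 1" for k
  proof (induction k)
    case (Suc k)
    have "w (ratio k ^ d - (ratio 0 ^ d ^ k) ^ d) \<le> w (ratio k - ratio 0 ^ d ^ k) * 1 ^ (d - 1)"
      using abs_ratio by (intro power_diff_le) (auto simp: power)
    then have "w (ratio k ^ d - (ratio 0 ^ d ^ k) ^ d) < 1" using Suc by simp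
    with ratio_Suc_less have "w (ratio (Suc k) - (ratio 0 ^ d ^ k) ^ d) < 1" by (rule near_trans)
    then show ?case by (simp add: power_mult[symmetric] mult.commute)
  qed (simp add: zero)
  have big: "w (ratio 0 ^ q ^ (r * Suc K) - 1) < 1"
    using near[of "Suc K"] ratio_last dk[of "Suc K"] minus_commute[of 1 "ratio 0 ^ d ^ Suc K"] by simp
  have small: "\<not> w (ratio 0 ^ q ^ (r * K) - 1) < 1"
  proof
    assume "w (ratio 0 ^ q ^ (r * K) - 1) < 1"
    then have "w (ratio 0 ^ d ^ K - 1) < 1" by (simp add: dk)
    with near have "w (ratio K - 1) < 1" by (rule near_trans)
    moreover have "1 \<le> w (ratio K - 1)" using ratio_far M_power(2)[of K] by (simp add: wd)
    ultimately show False by simp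
  qed
  obtain f where f: "1 \<le> f" "f \<le> card E" "int q ^ (r * K) dvd int p ^ f - 1"
    by (rule residue_order[OF V ratio_in_V abs_ratio q(1,2) big small])
  have "d ^ K = q ^ (r * K)" by (rule dk)
  also have "\<dots> \<le> C * f" by (rule C[OF f(1,3)])
  also have "\<dots> \<le> C * card E" using f(2) by simp
  finally show ?thesis .
qed

text \<open>Here \<open>k\<^sub>0\<close> is an index from which on the error is smaller than \<open>|d|\<close>. All ratios are in the residue class
  of \<open>1\<close>. Between \<open>k\<^sub>0\<close> and \<open>K\<close> the distance to \<open>1\<close> cannot drop to \<open>1/p\<close>: it would contract further and
  stay below \<open>|d|\<close>, contradicting \<open>ratio_far\<close>. As long as it exceeds \<open>1/p\<close>, each distance is at
  most the \<open>d\<close>-th power of the preceding one. So a power of exponent \<open>d ^ (K - k\<^sub>0 - 1)\<close> of the distance at \<open>k\<^sub>0\<close>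
  exceeds \<open>1/p\<close>.\<close>

lemma degree_bound_ramified:
  assumes dp: "d = p ^ r" and k0: "1 / M ^ d ^ k\<^sub>0 < w (of_nat d)"
  shows "d ^ K \<le> d ^ (k\<^sub>0 + 1) * card E"
proof (cases "K \<le> k\<^sub>0")
  case True
  have "d ^ K \<le> d ^ (k\<^sub>0 + 1)" using True d by (intro power_increasing) auto
  also have "\<dots> \<le> d ^ (k\<^sub>0 + 1) * card E" using card_E_pos by simp
  finally show ?thesis .
next
  case False
  have r: "r \<ge> 1" using dp d by (cases r) auto
  have wd: "w (of_nat d) = w (of_nat p) ^ r" by (simp add: dp power)
  have "w (of_nat p) ^ r \<le> w (of_nat p) ^ 1" using w_p_less r by (intro power_decreasing) auto
  then have wdp: "w (of_nat d) \<le> w (of_nat p)" by (simp add: wd)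
  have err: "w (ratio (Suc k) - ratio k ^ d) < w (of_nat d)" if "k \<ge> k\<^sub>0" for k
  proof -
    have "M ^ d ^ k\<^sub>0 \<le> M ^ d ^ k" using M d that by (intro power_increasing) auto
    then have "1 / M ^ d ^ k \<le> 1 / M ^ d ^ k\<^sub>0" using M_power(2)[of k\<^sub>0] by (intro divide_left_mono) auto
    then show ?thesis using ratio_Suc[of k] k0 by linarith
  qed
  have near_1: "w (ratio (Suc K - j) - 1) < 1" for j
  proof (induction j)
    case 0
    then show ?case by (simp add: ratio_last zero)
  next
    case (Suc j)
    show ?case
    proof (cases "j \<le> K")
      case True
      define k where "k = K - j"
      have k: "Suc K - j = Suc k" "Suc K - Suc j = k" using True by (auto simp: k_def)
      have "w (ratio k ^ d - ratio (Suc k)) < 1"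
        using ratio_Suc_less[of k] minus_commute[of "ratio k ^ d" "ratio (Suc k)"] by simp
      moreover have "w (ratio (Suc k) - 1) < 1" using Suc unfolding k .
      ultimately have "w (ratio k ^ d - 1) < 1" by (rule near_trans)
      then show ?thesis unfolding k using frobenius_inj[of "ratio k" r] abs_ratio[of k] by (simp add: dp)
    next
      case False
      then show ?thesis using Suc by simp
    qed
  qed
  define dist1 where "dist1 k = w (ratio k - 1)" for k
  have dist1_less_1: "dist1 k < 1" if "k \<le> K" for k using near_1[of "Suc K - k"] that by (simp add: dist1_def)
  have last: "w (of_nat d) \<le> dist1 K" unfolding dist1_def
  proof (rule ratio_far)
    have "M ^ d ^ k\<^sub>0 \<le> M ^ d ^ K" using M d False by (intro power_increasing) auto
    then have "1 / M ^ d ^ K \<le> 1 / M ^ d ^ k\<^sub>0" using M_power(2)[of k\<^sub>0] by (intro divide_left_mono) auto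
    then show "1 / M ^ d ^ K < w (of_nat d)" using k0 by linarith
  qed
  have stays: "dist1 (Suc k) < w (of_nat d)" if "dist1 k \<le> w (of_nat p)" "k \<ge> k\<^sub>0" for k
  proof -
    have "w (ratio k ^ d - 1) \<le> w (of_nat d) * dist1 k"
      using prime_power_contracts[of "ratio k" r, folded dp wd] that(1) by (simp add: dist1_def)
    also have "\<dots> < w (of_nat d) * 1"
      using w_p_less that(1) by (intro mult_strict_left_mono) (auto simp: wd)
    finally have "w (ratio k ^ d - 1) < w (of_nat d)" by simp
    with err[OF that(2)] show ?thesis unfolding dist1_def by (rule near_trans)
  qed
  have stays': "dist1 (Suc (k + j)) < w (of_nat d)" if "dist1 k \<le> w (of_nat p)" "k \<ge> k\<^sub>0" for k j
  proof (induction j)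
    case (Suc j)
    then show ?case using stays[of "Suc (k + j)"] wdp that(2) by simp
  qed (use stays that in simp)
  have large: "dist1 k > w (of_nat p)" if "k \<ge> k\<^sub>0" "k < K" for k
  proof (rule ccontr)
    assume "\<not> ?thesis"
    then have "dist1 (Suc (k + (K - Suc k))) < w (of_nat d)" using that by (intro stays') auto
    then show False using last that by simp
  qed
  have decay: "k\<^sub>0 + j < K \<Longrightarrow> dist1 (k\<^sub>0 + j) \<le> dist1 k\<^sub>0 ^ d ^ j" for j
  proof (induction j)
    case (Suc j)
    let ?k = "k\<^sub>0 + j"
    have "dist1 (Suc ?k) \<le> max (w (ratio (Suc ?k) - ratio ?k ^ d)) (w (ratio ?k ^ d - 1))"
      using add_le[of "ratio (Suc ?k) - ratio ?k ^ d" "ratio ?k ^ d - 1"] by (simp add: dist1_def)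
    also have "\<dots> \<le> max (w (of_nat p)) (max (dist1 ?k ^ d) (w (of_nat p)))"
    proof (rule max.mono)
      show "w (ratio (Suc ?k) - ratio ?k ^ d) \<le> w (of_nat p)" using err[of ?k] wdp by simp
      show "w (ratio ?k ^ d - 1) \<le> max (dist1 ?k ^ d) (w (of_nat p))"
        using prime_power_far[of "ratio ?k" r] dist1_less_1[of ?k] Suc.prems by (simp add: dist1_def dp)
    qed
    finally have "dist1 (Suc ?k) \<le> dist1 ?k ^ d" using large[of "Suc ?k"] Suc.prems by auto
    also have "\<dots> \<le> (dist1 k\<^sub>0 ^ d ^ j) ^ d" using Suc nonneg by (intro power_mono) (auto simp: dist1_def)
    finally show ?case by (simp add: power_mult[symmetric] mult.commute)
  qed simp
  define J where "J = K - Suc k\<^sub>0"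
  have J: "k\<^sub>0 + J < K" "K = J + (k\<^sub>0 + 1)" using False by (auto simp: J_def)
  have "w (of_nat p) < dist1 k\<^sub>0 ^ d ^ J" using large[of "k\<^sub>0 + J"] decay[OF J(1)] J by simp
  moreover have "ratio k\<^sub>0 - 1 \<noteq> 0" using large[of k\<^sub>0] J w_p_less by (auto simp: dist1_def zero)
  moreover have "ratio k\<^sub>0 - 1 \<in> V"
    using fin_dim_ring_subfield[OF V(1)] ratio_in_V by (intro subfield_diff subfield_1) auto
  ultimately have "d ^ J < card E"
    using dist1_less_1[of k\<^sub>0] J by (intro ramified_dimension[OF V, of "ratio k\<^sub>0 - 1"]) (auto simp: dist1_def)
  then have "d ^ J * d ^ (k\<^sub>0 + 1) \<le> card E * d ^ (k\<^sub>0 + 1)" by (intro mult_right_mono) auto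
  then show ?thesis unfolding J(2) power_add[of d J] by (simp add: mult.commute)
qed

end

text \<open>If \<open>d\<close> is a power of \<open>q \<noteq> p\<close>, the first ratio has an order divisible by a high power of
  \<open>q\<close> in the residue field; if \<open>d\<close> is a power of \<open>p\<close>, some ratio of bounded index differs from
  \<open>1\<close> by an element whose absolute value is very close to \<open>1\<close>, so the field is highly ramified.\<close>

lemma (in padic) meeting_orbits_degree:
  assumes d: "primepow d" and M\<^sub>0: "M\<^sub>0 > 1"
  obtains C :: nat where "C \<ge> 1"
    "\<And>T \<alpha> x\<^sub>0 y\<^sub>0 K V E M. meeting_orbits w p d T \<alpha> x\<^sub>0 y\<^sub>0 K V E M \<Longrightarrow> M\<^sub>0 \<le> M \<Longrightarrow> d ^ K \<le> C * card E"
proof -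
  obtain q r where q: "prime q" "r > 0" "d = q ^ r" using d by (auto simp: primepow_def)
  show ?thesis
  proof (cases "q = p")
    case False
    obtain C :: nat where C: "C \<ge> 1" "\<And>s f. f \<ge> 1 \<Longrightarrow> int q ^ s dvd int p ^ f - 1 \<Longrightarrow> q ^ s \<le> C * f"
      using order_of_prime_mod_prime_power[OF prime_p q(1)] False by blast
    show ?thesis
    proof (rule that[OF C(1)])
      fix T \<alpha> x\<^sub>0 y\<^sub>0 K V E M assume "meeting_orbits w p d T \<alpha> x\<^sub>0 y\<^sub>0 K V E M"
      then show "d ^ K \<le> C * card E"
        by (rule meeting_orbits.degree_bound_unramified[OF _ q(1) False q(3) C(2)])
    qed
  next
    case True
    have wd: "w (of_nat d) > 0" using q w_p_less by (simp add: True power)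
    obtain n where n: "1 / w (of_nat d) < M\<^sub>0 ^ n" using real_arch_pow[OF M\<^sub>0] by blast
    have "2 \<le> q ^ r" using prime_ge_2_nat[OF q(1)] q(2) self_le_power[of q r] by linarith
    then have d2: "d \<ge> 2" using q(3) by simp
    show ?thesis
    proof (rule that[of "d ^ (n + 1)"])
      show "d ^ (n + 1) \<ge> 1" using d2 by simp
      fix T \<alpha> x\<^sub>0 y\<^sub>0 K V E M assume m: "meeting_orbits w p d T \<alpha> x\<^sub>0 y\<^sub>0 K V E M" and M: "M\<^sub>0 \<le> M"
      have "n < d ^ n" using d2 by (intro power_gt_expt) auto
      then have "M\<^sub>0 ^ n \<le> M\<^sub>0 ^ d ^ n" using M\<^sub>0 by (intro power_increasing) auto
      also have "\<dots> \<le> M ^ d ^ n" using M M\<^sub>0 by (intro power_mono) auto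
      finally have "1 / w (of_nat d) < M ^ d ^ n" using n by simp
      moreover have "M ^ d ^ n > 0" using M M\<^sub>0 by simp
      ultimately have "1 / M ^ d ^ n < w (of_nat d)" using wd by (simp add: field_simps)
      then show "d ^ K \<le> d ^ (n + 1) * card E"
        using q(3) True by (intro meeting_orbits.degree_bound_ramified[OF m]) auto
    qed
  qed
qed

section \<open>Integral elements over the p-adic integers\<close>

locale complete_padic = padic_field v p for v :: "'c::field_char_0 \<Rightarrow> real" and p +
  assumes complete_v: "complete_wrt v"
begin

lemma Qp_near: "x \<in> Qp v \<Longrightarrow> e > 0 \<Longrightarrow> \<exists>r::rat. v (x - of_rat r) < e"
  by (simp add: Qp_def)

lemma QpI: assumes *: "\<And>e. e > 0 \<Longrightarrow> \<exists>y\<in>Qp v. v (x - y) < e" shows "x \<in> Qp v"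
  unfolding Qp_def mem_Collect_eq
proof (intro allI impI)
  fix e :: real assume e: "e > 0"
  obtain y where y: "y \<in> Qp v" "v (x - y) < e" using *[OF e] by blast
  obtain r where r: "v (y - of_rat r) < e" using Qp_near[OF y(1) e] by blast
  show "\<exists>r. v (x - of_rat r) < e" using add_le[of "x - y" "y - of_rat r"] y r by (intro exI[of _ r]) auto
qed

lemma of_rat_in_Qp: "of_rat r \<in> Qp v"
  unfolding Qp_def using zero by (auto intro!: exI[of _ r])

lemma mult_near:
  assumes e: "e > 0" obtains \<delta> where "\<delta> > 0"
    "\<And>y z. v (x - y) < \<delta> \<Longrightarrow> v (x' - z) < \<delta> \<Longrightarrow> v (x * x' - y * z) < e"
proof -
  define M where "M = max 1 (max (v x) (v x'))"
  define \<delta> where "\<delta> = min 1 (e / M)"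
  have M: "M \<ge> 1" "v x \<le> M" "v x' \<le> M" by (auto simp: M_def)
  have \<delta>: "\<delta> > 0" "\<delta> \<le> 1" "\<delta> * M \<le> e" using M e by (auto simp: \<delta>_def min_def field_simps)
  show ?thesis
  proof (rule that[OF \<delta>(1)])
    fix y z assume y: "v (x - y) < \<delta>" and z: "v (x' - z) < \<delta>"
    have "v z \<le> M" using diff_le[of x' "x' - z"] M z \<delta>(2) by simp
    then have "v (x - y) * v z \<le> v (x - y) * M" using nonneg by (intro mult_left_mono) auto
    also have "\<dots> < \<delta> * M" using y M by simp
    finally have 1: "v ((x - y) * z) < e" using \<delta>(3) by (simp add: mult)
    have "v x * v (x' - z) \<le> M * v (x' - z)" using M nonneg by (intro mult_right_mono) auto
    also have "\<dots> < M * \<delta>" using z M by simp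
    finally have 2: "v (x * (x' - z)) < e" using \<delta>(3) by (simp add: mult mult.commute)
    have "x * x' - y * z = x * (x' - z) + (x - y) * z" by (simp add: algebra_simps)
    then show "v (x * x' - y * z) < e" using add_le[of "x * (x' - z)" "(x - y) * z"] 1 2 by simp
  qed
qed

lemma is_subfield_Qp: "is_subfield (Qp v)"
  unfolding is_subfield_def
proof (intro conjI ballI)
  show "0 \<in> Qp v" "1 \<in> Qp v" using of_rat_in_Qp[of 0] of_rat_in_Qp[of 1] by auto
next
  fix x y assume x: "x \<in> Qp v" and y: "y \<in> Qp v"
  show "x - y \<in> Qp v"
  proof (rule QpI)
    fix e :: real assume e: "e > 0"
    obtain r where r: "v (x - of_rat r) < e" using Qp_near[OF x e] by blast
    obtain s where s: "v (y - of_rat s) < e" using Qp_near[OF y e] by blast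
    have "(x - y) - of_rat (r - s) = (x - of_rat r) - (y - of_rat s)" by (simp add: of_rat_diff)
    then have "v ((x - y) - of_rat (r - s)) < e"
      using diff_le[of "x - of_rat r" "y - of_rat s"] r s by (simp only:) simp
    then show "\<exists>z\<in>Qp v. v ((x - y) - z) < e" using of_rat_in_Qp by blast
  qed
  show "x * y \<in> Qp v"
  proof (rule QpI)
    fix e :: real assume e: "e > 0"
    obtain \<delta> where \<delta>: "\<delta> > 0" "\<And>r s. v (x - r) < \<delta> \<Longrightarrow> v (y - s) < \<delta> \<Longrightarrow> v (x * y - r * s) < e"
      using mult_near[OF e, of x y] by blast
    obtain r where r: "v (x - of_rat r) < \<delta>" using Qp_near[OF x \<delta>(1)] by blast
    obtain s where s: "v (y - of_rat s) < \<delta>" using Qp_near[OF y \<delta>(1)] by blast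
    have "v (x * y - of_rat (r * s)) < e" using \<delta>(2)[OF r s] by (simp add: of_rat_mult)
    then show "\<exists>z\<in>Qp v. v (x * y - z) < e" using of_rat_in_Qp by blast
  qed
next
  fix x assume x: "x \<in> Qp v"
  show "inverse x \<in> Qp v"
  proof (cases "x = 0")
    case False
    then have vx: "v x > 0" using pos by simp
    show ?thesis
    proof (rule QpI)
      fix e :: real assume e: "e > 0"
      obtain r where r: "v (x - of_rat r) < min (v x) (e * v x * v x)"
        using Qp_near[OF x, of "min (v x) (e * v x * v x)"] e vx by auto
      have vr: "v (of_rat r) = v x"
        using r eq_of_near[of "of_rat r" x] minus_commute[of x "of_rat r"] by simp
      then have r0: "of_rat r \<noteq> (0::'c)" using vx by (auto simp: zero simp del: of_rat_eq_0_iff)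
      have "(inverse x - inverse (of_rat r)) * (x * of_rat r) = of_rat r - x"
        using False r0 by (simp add: field_simps)
      then have "v (inverse x - inverse (of_rat r)) * (v x * v x) = v (x - of_rat r)"
        using mult[of "inverse x - inverse (of_rat r)" "x * of_rat r"] mult[of x "of_rat r"] minus_commute[of x "of_rat r"] vr
        by simp
      then have "v (inverse x - inverse (of_rat r)) * (v x * v x) < e * (v x * v x)" using r by (simp add: mult.assoc)
      then have "v (inverse x - inverse (of_rat r)) < e" using vx by simp
      then have "v (inverse x - of_rat (inverse r)) < e" by (simp add: of_rat_inverse)
      then show "\<exists>z\<in>Qp v. v (inverse x - z) < e" using of_rat_in_Qp by blast
    qed
  qed (use of_rat_in_Qp[of 0] in simp)
qed

text \<open>A vector close to the origin in a finite-dimensional space over the complete field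
  \<open>\<rat>\<^sub>p\<close> has small coordinates.\<close>

lemma coordinates_bounded:
  fixes e :: "nat \<Rightarrow> 'c"
  assumes "\<And>c. (\<And>i. c i \<in> Qp v) \<Longrightarrow> (\<Sum>i<n. c i * e i) = 0 \<Longrightarrow> \<forall>i<n. c i = 0"
  shows "\<exists>C\<ge>0. \<forall>c. (\<forall>i. c i \<in> Qp v) \<longrightarrow> (\<forall>i<n. v (c i) \<le> C * v (\<Sum>i<n. c i * e i))"
  using assms
proof (induction n)
  case 0
  show ?case by (intro exI[of _ 0]) auto
next
  case (Suc n)
  note Q = subfield_closed[OF is_subfield_Qp]
  have "\<exists>C\<ge>0. \<forall>c. (\<forall>i. c i \<in> Qp v) \<longrightarrow> (\<forall>i<n. v (c i) \<le> C * v (\<Sum>i<n. c i * e i))"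
  proof (rule Suc.IH)
    fix c assume c: "\<And>i. c i \<in> Qp v" and eq: "(\<Sum>i<n. c i * e i) = 0"
    have "\<forall>i<Suc n. (c(n := 0)) i = 0"
    proof (rule Suc.prems)
      show "(c(n := 0)) i \<in> Qp v" for i using c Q(1) by simp
      have "(\<Sum>i<n. (c(n := 0)) i * e i) = (\<Sum>i<n. c i * e i)" by (intro sum.cong) auto
      then show "(\<Sum>i<Suc n. (c(n := 0)) i * e i) = 0" using eq by simp
    qed
    then show "\<forall>i<n. c i = 0" by (metis fun_upd_other less_SucI nat_neq_iff)
  qed
  then obtain C where C: "C \<ge> 0" "\<And>c i. (\<And>i. c i \<in> Qp v) \<Longrightarrow> i < n \<Longrightarrow> v (c i) \<le> C * v (\<Sum>i<n. c i * e i)"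
    by blast
  \<comment> \<open>The vector \<open>e n\<close> has positive distance from the span of the
    others: otherwise it is a limit of elements of the span, whose coordinates converge by the
    induction hypothesis and completeness, and \<open>e n\<close> would be in the span.\<close>
  have "\<exists>\<delta>>0. \<forall>c. (\<forall>i. c i \<in> Qp v) \<longrightarrow> \<delta> \<le> v (e n + (\<Sum>i<n. c i * e i))"
  proof (rule ccontr)
    assume "\<not> ?thesis"
    then have "\<exists>c. (\<forall>i. c i \<in> Qp v) \<and> v (e n + (\<Sum>i<n. c i * e i)) < \<delta>" if "\<delta> > 0" for \<delta>
      using that by (meson not_le)
    then have "\<forall>k. \<exists>c. (\<forall>i. c i \<in> Qp v) \<and> v (e n + (\<Sum>i<n. c i * e i)) < 1 / real (Suc k)"
      by simp
    then obtain c where c: "\<And>k i. c k i \<in> Qp v" "\<And>k. v (e n + (\<Sum>i<n. c k i * e i)) < 1 / real (Suc k)"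
      by metis
    define s where "s k = (\<Sum>i<n. c k i * e i)" for k
    have small: "\<exists>N. \<forall>k\<ge>N. v (e n + s k) < \<epsilon>" if "\<epsilon> > 0" for \<epsilon> :: real
    proof -
      obtain N where N: "1 / real (Suc N) < \<epsilon>" using nat_approx_posE[OF \<open>\<epsilon> > 0\<close>] by blast
      have "v (e n + s k) < \<epsilon>" if "k \<ge> N" for k
      proof -
        have "1 / real (Suc k) \<le> 1 / real (Suc N)" using that by (intro divide_left_mono) auto
        then show ?thesis using c(2)[of k] N by (simp add: s_def)
      qed
      then show ?thesis by blast
    qed
    have "\<exists>x. \<forall>\<epsilon>>0. \<exists>N. \<forall>k\<ge>N. v (c k i - x) < \<epsilon>" if i: "i < n" for i
    proof -
      have "\<exists>N. \<forall>k\<ge>N. \<forall>l\<ge>N. v (c k i - c l i) < \<epsilon>" if \<epsilon>: "\<epsilon> > 0" for \<epsilon> :: real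
      proof -
        have "\<epsilon> / (C + 1) > 0" using C(1) \<epsilon> by simp
        from small[OF this] obtain N where N: "\<And>k. k \<ge> N \<Longrightarrow> v (e n + s k) < \<epsilon> / (C + 1)" by blast
        have "v (c k i - c l i) < \<epsilon>" if kl: "k \<ge> N" "l \<ge> N" for k l
        proof -
          have "v (s k - s l) < \<epsilon> / (C + 1)"
            using diff_le[of "e n + s k" "e n + s l"] N[OF kl(1)] N[OF kl(2)] by simp
          moreover have "v (c k i - c l i) \<le> C * v (s k - s l)"
            using C(2)[of "\<lambda>i. c k i - c l i" i] c(1) Q(3) i by (simp add: s_def sum_subtractf left_diff_distrib)
          moreover have "C * v (s k - s l) \<le> (C + 1) * v (s k - s l)" using nonneg by (intro mult_right_mono) auto
          ultimately show ?thesis using C(1) by (simp add: field_simps)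
        qed
        then show ?thesis by blast
      qed
      then show ?thesis using complete_v[unfolded complete_wrt_def, THEN spec, of "\<lambda>k. c k i"] by simp
    qed
    then have "\<forall>i. \<exists>x. i < n \<longrightarrow> (\<forall>\<epsilon>>0. \<exists>N. \<forall>k\<ge>N. v (c k i - x) < \<epsilon>)" by simp
    from choice[OF this] obtain x where "\<forall>i. i < n \<longrightarrow> (\<forall>\<epsilon>>0. \<exists>N. \<forall>k\<ge>N. v (c k i - x i) < \<epsilon>)" ..
    then have x: "\<exists>N. \<forall>k\<ge>N. v (c k i - x i) < \<epsilon>" if "i < n" "\<epsilon> > 0" for i \<epsilon> using that by simp
    have xQ: "x i \<in> Qp v" if i: "i < n" for i
    proof (rule QpI)
      fix \<epsilon> :: real assume "\<epsilon> > 0"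
      then obtain N where "v (c N i - x i) < \<epsilon>" using x[OF i] by blast
      then show "\<exists>y\<in>Qp v. v (x i - y) < \<epsilon>" using c(1)[of N i] minus_commute[of "x i" "c N i"] by (intro bexI[of _ "c N i"]) auto
    qed
    define L where "L = e n + (\<Sum>i<n. x i * e i)"
    have "v L < \<epsilon>" if \<epsilon>: "\<epsilon> > 0" for \<epsilon>
    proof -
      obtain N0 where N0: "\<And>k. k \<ge> N0 \<Longrightarrow> v (e n + s k) < \<epsilon>" using small[OF \<epsilon>] by blast
      have "\<exists>N. \<forall>k\<ge>N. v (c k i - x i) < \<epsilon> / (1 + v (e i))" if "i < n" for i
        using x[OF that, of "\<epsilon> / (1 + v (e i))"] \<epsilon> nonneg[of "e i"] by simp
      then have "\<forall>i. \<exists>N. i < n \<longrightarrow> (\<forall>k\<ge>N. v (c k i - x i) < \<epsilon> / (1 + v (e i)))" by simp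
      from choice[OF this] obtain N where "\<forall>i. i < n \<longrightarrow> (\<forall>k\<ge>N i. v (c k i - x i) < \<epsilon> / (1 + v (e i)))" ..
      then have N: "v (c k i - x i) < \<epsilon> / (1 + v (e i))" if "i < n" "k \<ge> N i" for i k using that by simp
      define k where "k = N0 + (\<Sum>i<n. N i)"
      have k: "k \<ge> N0" "\<And>i. i < n \<Longrightarrow> k \<ge> N i"
        unfolding k_def by (auto intro: trans_le_add2 member_le_sum)
      have "v (\<Sum>i<n. (c k i - x i) * e i) < \<epsilon>"
      proof (rule sum_less)
        fix i assume "i \<in> {..<n}"
        then have "v (c k i - x i) < \<epsilon> / (1 + v (e i))" using N k by simp
        then have "v (c k i - x i) * (1 + v (e i)) < \<epsilon>" using nonneg[of "e i"] by (simp add: field_simps)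
        then show "v ((c k i - x i) * e i) < \<epsilon>" using nonneg[of "c k i - x i"] unfolding mult[OF UNIV_I UNIV_I] by (simp add: distrib_left)
      qed (use \<epsilon> in auto)
      then have "v (s k - (\<Sum>i<n. x i * e i)) < \<epsilon>" by (simp add: s_def sum_subtractf left_diff_distrib)
      moreover have "L = (e n + s k) - (s k - (\<Sum>i<n. x i * e i))" by (simp add: L_def)
      ultimately show ?thesis using diff_le[of "e n + s k" "s k - (\<Sum>i<n. x i * e i)"] N0[OF k(1)] by simp
    qed
    then have "L = 0" using pos[of L] by (cases "L = 0") auto
    define c' where "c' i = (if i < n then x i else 1)" for i
    have "(\<Sum>i<n. c' i * e i) = (\<Sum>i<n. x i * e i)" by (intro sum.cong) (auto simp: c'_def)
    then have "(\<Sum>i<Suc n. c' i * e i) = 0" using \<open>L = 0\<close> by (simp add: L_def c'_def add.commute)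
    moreover have "c' i \<in> Qp v" for i using xQ Q(2) by (simp add: c'_def)
    ultimately have "c' n = 0" using Suc.prems[of c'] by blast
    then show False by (simp add: c'_def)
  qed
  then obtain \<delta> where \<delta>: "\<delta> > 0" "\<And>c. (\<And>i. c i \<in> Qp v) \<Longrightarrow> \<delta> \<le> v (e n + (\<Sum>i<n. c i * e i))" by blast
  define C' where "C' = max (1 / \<delta>) (C * (1 + v (e n) / \<delta>))"
  have "v (c i) \<le> C' * v (\<Sum>i<Suc n. c i * e i)" if c: "\<And>i. c i \<in> Qp v" and i: "i < Suc n" for c i
  proof -
    define S where "S = (\<Sum>i<n. c i * e i)"
    define T where "T = S + c n * e n"
    have T: "T = (\<Sum>i<Suc n. c i * e i)" by (simp add: T_def S_def)
    have top: "v (c n) \<le> v T / \<delta>"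
    proof (cases "c n = 0")
      case False
      have "\<delta> \<le> v (e n + (\<Sum>i<n. c i / c n * e i))" using c by (intro \<delta>(2)) (simp add: Q)
      also have "e n + (\<Sum>i<n. c i / c n * e i) = T / c n"
        using False by (simp add: T_def S_def add_divide_distrib sum_divide_distrib add.commute)
      finally show ?thesis using False \<delta>(1) pos[of "c n"] by (simp add: divide field_simps)
    qed (use \<delta>(1) nonneg in \<open>simp add: zero\<close>)
    have "v S \<le> max (v T) (v (c n * e n))" using diff_le[of T "c n * e n"] by (simp add: T_def)
    also have "\<dots> \<le> v T + v (c n) * v (e n)" using nonneg by (simp add: mult)
    also have "\<dots> \<le> v T + v T / \<delta> * v (e n)" using top nonneg by (intro add_left_mono mult_right_mono) auto
    finally have S: "v S \<le> (1 + v (e n) / \<delta>) * v T" by (simp add: algebra_simps)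
    show ?thesis
    proof (cases "i < n")
      case True
      have "v (c i) \<le> C * v S" unfolding S_def by (rule C(2)[OF c True])
      also have "\<dots> \<le> C * ((1 + v (e n) / \<delta>) * v T)" using S C(1) by (intro mult_left_mono)
      also have "\<dots> \<le> C' * v T" unfolding mult.assoc[symmetric] C'_def using nonneg by (intro mult_right_mono) auto
      finally show ?thesis by (simp only: T)
    next
      case False
      then have "v (c i) \<le> 1 / \<delta> * v T" using i top by (simp add: less_Suc_eq)
      also have "\<dots> \<le> C' * v T" unfolding C'_def using nonneg by (intro mult_right_mono) auto
      finally show ?thesis by (simp only: T)
    qed
  qed
  moreover have "C' \<ge> 0" using \<delta>(1) by (simp add: C'_def le_max_iff_disj)
  ultimately show ?case by blast
qed

text \<open>The quotient \<open>p\<^sup>-\<^sup>N\<int>\<^sub>p / \<int>\<^sub>p\<close> is finite and represented by fractions.\<close>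

lemma Qp_near_fraction:
  assumes c: "c \<in> Qp v" "v c \<le> real p ^ N"
  obtains j where "j < p ^ N" "v (c - of_nat j / of_nat p ^ N) \<le> 1"
proof -
  note Q = subfield_closed[OF is_subfield_Qp]
  have p: "p > 0" using prime_gt_0_nat[OF prime_p] .
  have vpN: "v (of_nat p ^ N) = 1 / real p ^ N" by (simp add: power w_p power_one_over)
  define c' where "c' = c * of_nat p ^ N"
  have c': "c' \<in> Qp v" "v c' \<le> 1" using c p by (auto simp: c'_def Q mult vpN field_simps)
  obtain r where r: "v (c' - of_rat r) < 1 / real p ^ N" using Qp_near[OF c'(1), of "1 / real p ^ N"] p by auto
  have N1: "1 / real p ^ N \<le> 1" using p by simp
  have vr: "v (of_rat r) \<le> 1" using diff_le[of c' "c' - of_rat r"] c' r N1 by simp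
  obtain a b where ab: "quotient_of r = (a, b)" by force
  have b0: "b > 0" using quotient_of_denom_pos[OF ab] .
  have rab: "(of_rat r :: 'c) = of_int a / of_int b"
    using quotient_of_div[OF ab] by (simp add: of_rat_divide)
  have "\<not> int p dvd b"
  proof
    assume pb: "int p dvd b"
    have "\<not> int p dvd a"
    proof
      assume "int p dvd a"
      then have "int p dvd 1" using pb quotient_of_coprime[OF ab] by (metis coprime_common_divisor)
      then show False using prime_gt_1_nat[OF prime_p] by simp
    qed
    then have "v (of_int a) = 1" by (rule w_int_unit)
    moreover have "v (of_int b) < 1" using w_int_dvd[OF pb] w_p_less by simp
    moreover have "v (of_int b) > 0" using b0 pos by simp
    ultimately show False using vr by (simp add: rab divide field_simps)
  qed
  then have "coprime (int p) b" using prime_p by (intro prime_imp_coprime) auto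
  then have "coprime (int p ^ N) b" by simp
  then obtain t u where tu: "t * int p ^ N + u * b = 1" using bezout_int[of "int p ^ N" b] by auto
  define j where "j = nat ((a * u) mod int p ^ N)"
  have j: "int j = (a * u) mod int p ^ N" "j < p ^ N" using p by (auto simp: j_def nat_less_iff)
  have "int p ^ N dvd a - b * int j"
  proof -
    have "int p ^ N dvd a * u - int j" by (simp add: j(1))
    then have "int p ^ N dvd a * (t * int p ^ N) + b * (a * u - int j)" by simp
    also have "a * (t * int p ^ N) + b * (a * u - int j) = a * (t * int p ^ N + u * b) - b * int j"
      by (simp add: algebra_simps)
    finally show ?thesis by (simp add: tu)
  qed
  then obtain m where m: "a - b * int j = int p ^ N * m" by (elim dvdE)
  have "(of_int (a - b * int j) :: 'c) = of_int (int p ^ N * m)" by (simp only: m)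
  then have "of_int a - of_int b * of_nat j = (of_nat p ^ N * of_int m :: 'c)" by simp
  then have "of_rat r - of_nat j = (of_nat p ^ N * of_int m / of_int b :: 'c)"
    using b0 by (simp add: rab field_simps)
  then have "v (of_rat r - of_nat j) = 1 / real p ^ N * v (of_int m)"
    using w_int_unit[OF \<open>\<not> int p dvd b\<close>] by (simp add: divide mult vpN)
  also have "\<dots> \<le> 1 / real p ^ N" using of_int_le[of m] p by (simp add: field_simps)
  finally have "v (c' - of_nat j) \<le> 1 / real p ^ N" using add_le[of "c' - of_rat r" "of_rat r - of_nat j"] r by simp
  moreover have "c - of_nat j / of_nat p ^ N = (c' - of_nat j) / of_nat p ^ N" using p by (simp add: c'_def field_simps)
  ultimately have "v (c - of_nat j / of_nat p ^ N) \<le> 1" using p by (simp add: divide vpN field_simps)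
  with j(2) show ?thesis by (rule that)
qed

text \<open>The powers of \<open>x\<close> have bounded coordinates, so two large powers of \<open>x\<close> agree modulo the lattice
  that is spanned over \<open>\<int>\<^sub>p\<close> by the small ones.\<close>

lemma Zp_bar_if_le_1:
  assumes x: "x \<in> Qp_bar v" "v x \<le> 1" shows "x \<in> Zp_bar v"
proof -
  note Q = subfield_closed[OF is_subfield_Qp]
  define rel where "rel n \<longleftrightarrow> (\<exists>c. (\<forall>i. c i \<in> Qp v) \<and> c n \<noteq> 0 \<and> (\<Sum>i\<le>n. c i * x ^ i) = 0)" for n
  obtain q where q: "q \<noteq> 0" "coeffs_in (Qp v) q" "poly q x = 0" using x(1) by (auto simp: Qp_bar_def)
  have "rel (degree q)" unfolding rel_def
    using q by (intro exI[of _ "coeff q"]) (auto simp: coeffs_in_def poly_altdef)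
  \<comment> \<open>The powers below the least degree of a relation are a basis of
    \<open>\<rat>\<^sub>p(x)\<close>.\<close>
  define n where "n = (LEAST n. rel n)"
  have n: "rel n" "\<And>k. k < n \<Longrightarrow> \<not> rel k" unfolding n_def using LeastI \<open>rel (degree q)\<close> not_less_Least by blast+
  have indep: "\<forall>i<n. c i = 0" if c: "\<And>i. c i \<in> Qp v" "(\<Sum>i<n. c i * x ^ i) = 0" for c
  proof (rule ccontr)
    assume "\<not> ?thesis"
    then have ne: "{i. i < n \<and> c i \<noteq> 0} \<noteq> {}" by auto
    define k where "k = Max {i. i < n \<and> c i \<noteq> 0}"
    have fin: "finite {i. i < n \<and> c i \<noteq> 0}" by simp
    have k: "k < n" "c k \<noteq> 0" using Max_in[OF fin ne] by (auto simp: k_def)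
    have "(\<Sum>i\<le>k. c i * x ^ i) = (\<Sum>i<n. c i * x ^ i)"
    proof (rule sum.mono_neutral_left)
      show "\<forall>i\<in>{..<n} - {..k}. c i * x ^ i = 0"
      proof
        fix i assume "i \<in> {..<n} - {..k}"
        then show "c i * x ^ i = 0" using Max_ge[OF fin, of i] by (auto simp: k_def)
      qed
    qed (use k in auto)
    then have "rel k" unfolding rel_def using c k by auto
    then show False using n(2)[OF k(1)] by blast
  qed
  obtain C where C: "C \<ge> 0" "\<And>c i. (\<And>i. c i \<in> Qp v) \<Longrightarrow> i < n \<Longrightarrow> v (c i) \<le> C * v (\<Sum>i<n. c i * x ^ i)"
    using coordinates_bounded[where n = n and e = "\<lambda>i. x ^ i", OF indep] by blast
  obtain r where r: "\<And>i. r i \<in> Qp v" "r n \<noteq> 0" "(\<Sum>i\<le>n. r i * x ^ i) = 0" using n(1) unfolding rel_def by blast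
  have xn: "x ^ n = (\<Sum>i<n. - r i / r n * x ^ i)"
  proof -
    have "(\<Sum>i<n. r i * x ^ i) + r n * x ^ n = 0" using r(3) by (simp add: lessThan_Suc_atMost[symmetric])
    then have "r n * x ^ n = - (\<Sum>i<n. r i * x ^ i)" by (simp add: add_eq_0_iff)
    then have "x ^ n = - (\<Sum>i<n. r i * x ^ i) / r n" using r(2) by (simp add: field_simps)
    then show ?thesis by (simp add: sum_divide_distrib sum_negf)
  qed
  have n0: "n > 0" using xn by (cases n) auto
  have "\<exists>c. (\<forall>i. c i \<in> Qp v) \<and> x ^ k = (\<Sum>i<n. c i * x ^ i)" for k
  proof (induction k)
    case 0
    have "(\<Sum>i<n. (if i = 0 then 1 else 0) * x ^ i) = (\<Sum>i<n. if i = 0 then 1 else 0)" by (intro sum.cong) auto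
    also have "\<dots> = 1" using n0 by simp
    finally show ?case using Q(1,2) by (intro exI[of _ "\<lambda>i. if i = 0 then 1 else 0"]) auto
  next
    case (Suc k)
    then obtain c where c: "\<And>i. c i \<in> Qp v" "x ^ k = (\<Sum>i<n. c i * x ^ i)" by blast
    obtain n' where n': "n = Suc n'" using n0 by (cases n) auto
    define c' where "c' i = (case i of 0 \<Rightarrow> 0 | Suc j \<Rightarrow> c j) + c n' * (- r i / r n)" for i
    have "x ^ Suc k = (\<Sum>i<n. c i * x ^ Suc i)" by (simp add: c(2) sum_distrib_left mult_ac)
    also have "\<dots> = (\<Sum>i<n'. c i * x ^ Suc i) + c n' * x ^ n" by (simp add: n')
    also have "(\<Sum>i<n'. c i * x ^ Suc i) = (\<Sum>i<n. (case i of 0 \<Rightarrow> 0 | Suc j \<Rightarrow> c j) * x ^ i)"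
      unfolding n' sum.lessThan_Suc_shift by simp
    also have "c n' * x ^ n = (\<Sum>i<n. c n' * (- r i / r n) * x ^ i)"
      by (subst xn) (simp only: sum_distrib_left mult.assoc)
    also have "(\<Sum>i<n. (case i of 0 \<Rightarrow> 0 | Suc j \<Rightarrow> c j) * x ^ i) + \<dots> = (\<Sum>i<n. c' i * x ^ i)"
      by (simp only: c'_def distrib_right sum.distrib)
    finally have "x ^ Suc k = (\<Sum>i<n. c' i * x ^ i)" .
    moreover have "c' i \<in> Qp v" for i
      unfolding c'_def using c(1) r(1) Q(1) by (intro Q) (auto intro!: Q split: nat.split)
    ultimately show ?case by blast
  qed
  then obtain c where c: "\<And>k i. c k i \<in> Qp v" "\<And>k. x ^ k = (\<Sum>i<n. c k i * x ^ i)" by metis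
  have "real p > 1" using prime_gt_1_nat[OF prime_p] by simp
  then obtain N where N: "C < real p ^ N" using real_arch_pow by blast
  have cN: "v (c k i) \<le> real p ^ N" if i: "i < n" for k i
  proof -
    have "v (c k i) \<le> C * v (x ^ k)" using C(2)[of "c k" i, OF c(1) i] unfolding c(2)[of k, symmetric] .
    also have "\<dots> \<le> C * 1" using C(1) x(2) nonneg[of x] by (intro mult_left_mono) (auto simp: power power_le_one)
    finally show ?thesis using N by simp
  qed
  define j where "j k i = (SOME j. j < p ^ N \<and> v (c k i - of_nat j / of_nat p ^ N) \<le> 1)" for k i
  have "j k i < p ^ N \<and> v (c k i - of_nat (j k i) / of_nat p ^ N) \<le> 1" if "i < n" for k i
    unfolding j_def by (rule someI_ex) (rule Qp_near_fraction[OF c(1) cN[OF that]], blast)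
  then have j: "\<And>k i. i < n \<Longrightarrow> j k i < p ^ N"
      "\<And>k i. i < n \<Longrightarrow> v (c k i - of_nat (j k i) / of_nat p ^ N) \<le> 1" by simp_all
  define J where "J k = restrict (j k) {..<n}" for k
  have "J k \<in> PiE {..<n} (\<lambda>_. {..<p ^ N})" for k using j(1) unfolding J_def restrict_PiE_iff by simp
  then have "J ` UNIV \<subseteq> PiE {..<n} (\<lambda>_. {..<p ^ N})" by blast
  then have "finite (J ` UNIV)" by (rule finite_subset) (intro finite_PiE, auto)
  then obtain k\<^sub>0 where "infinite {k \<in> UNIV. J k = J k\<^sub>0}" using pigeonhole_infinite[of UNIV J] by auto
  then have "\<forall>m. \<exists>k>m. J k = J k\<^sub>0" by (simp add: infinite_nat_iff_unbounded)
  \<comment> \<open>Taking \<open>k > n\<close> makes the relation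
    \<open>x ^ k - x ^ k\<^sub>0 - \<dots> = 0\<close> monic.\<close>
  then obtain k where k: "k > max k\<^sub>0 n" "J k = J k\<^sub>0" by blast
  define z where "z i = (if i < n then c k i - c k\<^sub>0 i else 0)" for i
  have z: "z i \<in> Zp v" for i
  proof (cases "i < n")
    case True
    have "j k i = j k\<^sub>0 i" using fun_cong[OF k(2), of i] True by (simp add: J_def)
    then have "z i = (c k i - of_nat (j k i) / of_nat p ^ N) - (c k\<^sub>0 i - of_nat (j k\<^sub>0 i) / of_nat p ^ N)"
      using True by (simp add: z_def)
    then have "v (z i) \<le> 1"
      using diff_le[of "c k i - of_nat (j k i) / of_nat p ^ N" "c k\<^sub>0 i - of_nat (j k\<^sub>0 i) / of_nat p ^ N"]
        j(2)[OF True, of k] j(2)[OF True, of k\<^sub>0] by simp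
    then show ?thesis using True c(1) Q(3) by (simp add: Zp_def z_def)
  qed (simp add: z_def Zp_def zero Q)
  define P where "P = monom 1 k - monom 1 k\<^sub>0 - (\<Sum>i<n. monom (z i) i)"
  have cP: "coeff P i = (if i = k then 1 else 0) - (if i = k\<^sub>0 then 1 else 0) - z i" for i
  proof -
    have "(\<Sum>j<n. coeff (monom (z j) j) i) = (\<Sum>j<n. if i = j then z i else 0)" by (intro sum.cong) auto
    also have "\<dots> = z i" by (simp add: z_def)
    finally show ?thesis by (auto simp: P_def coeff_sum)
  qed
  have "degree P = k"
  proof (rule antisym)
    show "degree P \<le> k" by (rule degree_le) (use k in \<open>auto simp: cP z_def\<close>)
    show "k \<le> degree P" by (rule le_degree) (use k in \<open>auto simp: cP z_def\<close>)
  qed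
  then have "lead_coeff P = 1" using k by (simp add: cP z_def)
  moreover have "coeffs_in (Zp v) P" unfolding coeffs_in_def
  proof
    fix i
    have zp: "s - t \<in> Zp v" if "s \<in> Zp v" "t \<in> Zp v" for s t
      using that Q(3) diff_le[of s t] by (auto simp: Zp_def)
    have "0 \<in> Zp v" "1 \<in> Zp v" using Q zero one by (auto simp: Zp_def)
    then show "coeff P i \<in> Zp v" unfolding cP by (intro zp z) auto
  qed
  moreover have "poly P x = 0"
  proof -
    have "(\<Sum>i<n. z i * x ^ i) = x ^ k - x ^ k\<^sub>0"
      unfolding c(2)[of k] c(2)[of k\<^sub>0] sum_subtractf[symmetric]
      by (intro sum.cong) (auto simp: z_def left_diff_distrib)
    then show ?thesis by (simp add: P_def poly_sum poly_monom)
  qed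
  ultimately show ?thesis using x(1) by (auto simp: Zp_bar_def)
qed

text \<open>If \<open>v x > 1\<close>, the leading term of a monic integral equation would dominate.\<close>

lemma Zp_bar_le_1: assumes "x \<in> Zp_bar v" shows "v x \<le> 1"
proof (rule ccontr)
  assume "\<not> ?thesis"
  then have x1: "v x > 1" by simp
  obtain q where q: "lead_coeff q = 1" "coeffs_in (Zp v) q" "poly q x = 0" using assms by (auto simp: Zp_bar_def)
  define n where "n = degree q"
  have "n > 0"
  proof (rule ccontr)
    assume "\<not> n > 0"
    then obtain c where "q = [:c:]" using degree_eq_zeroE unfolding n_def by blast
    then show False using q by simp
  qed
  have "0 = (\<Sum>i<n. coeff q i * x ^ i) + x ^ n"
    using q(1,3) by (simp add: poly_altdef n_def lessThan_Suc_atMost[symmetric])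
  then have "x ^ n = - (\<Sum>i<n. coeff q i * x ^ i)" by (simp add: eq_neg_iff_add_eq_0 add.commute)
  then have "v (x ^ n) = v (\<Sum>i<n. coeff q i * x ^ i)" by (simp add: uminus)
  also have "\<dots> \<le> v x ^ (n - 1)"
  proof (rule sum_le)
    fix i assume "i \<in> {..<n}"
    then have "v x ^ i \<le> v x ^ (n - 1)" using x1 by (intro power_increasing) auto
    moreover have "v (coeff q i) \<le> 1" using q(2) by (auto simp: coeffs_in_def Zp_def)
    ultimately have "v (coeff q i) * v x ^ i \<le> 1 * v x ^ (n - 1)" using nonneg by (intro mult_mono) auto
    then show "v (coeff q i * x ^ i) \<le> v x ^ (n - 1)" by (simp add: mult power)
  qed (use x1 in auto)
  also have "\<dots> < v x ^ n" using x1 \<open>n > 0\<close> by (intro power_strict_increasing) auto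
  finally show False by (simp add: power)
qed

end

section \<open>Bounded height of the coincidences\<close>

lemma iterate_at_eq_orbit:
  fixes A :: "nat \<Rightarrow> 'a::comm_ring_1 poly"
  assumes "f = monom 1 d + (\<Sum>i=1..d. monom (A i) (d - i))"
  shows "iterate_at f m a = orbit d A [:a:] m"
proof (induction m)
  case (Suc m)
  have "iterate_at f (Suc m) a = poly f (orbit d A [:a:] m)"
    using Suc by (simp add: iterate_at_def poly_pcompose)
  then show ?case by (simp add: assms poly_sum poly_monom)
qed (simp add: iterate_at_def)

lemma iterate_specialize_eq_orbit:
  fixes A :: "nat \<Rightarrow> 'a::comm_ring_1 poly"
  assumes f: "f = monom 1 d + (\<Sum>i=1..d. monom (A i) (d - i))"
  shows "poly (poly_iterate (specialize f t) m) a = orbit d (\<lambda>i. poly (A i) t) a m"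
proof -
  have "coeff (specialize f t) j = coeff (monom 1 d + (\<Sum>i=1..d. monom (poly (A i) t) (d - i))) j" for j
  proof -
    have "coeff (specialize f t) j = poly (coeff f j) t" by (simp add: specialize_def coeff_map_poly)
    also have "\<dots> = (if d = j then 1 else 0) + (\<Sum>i=1..d. if d - i = j then poly (A i) t else 0)"
      unfolding f by (simp add: coeff_sum poly_sum if_distrib[of "\<lambda>q. poly q t"] cong: if_cong)
    finally show ?thesis by (simp add: coeff_sum)
  qed
  then have s: "specialize f t = monom 1 d + (\<Sum>i=1..d. monom (poly (A i) t) (d - i))" by (rule poly_eqI)
  show ?thesis
  proof (induction m)
    case (Suc m)
    have "poly (poly_iterate (specialize f t) (Suc m)) a = poly (specialize f t) (orbit d (\<lambda>i. poly (A i) t) a m)"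
      using Suc by (simp add: poly_pcompose)
    then show ?case by (simp add: s poly_sum poly_monom)
  qed simp
qed

lemma orbit_constant:
  fixes A :: "nat \<Rightarrow> 'a::comm_ring_1 poly"
  assumes "\<And>i. i \<in> {1..d} \<Longrightarrow> degree (A i) = 0" shows "degree (orbit d A [:c:] k) = 0"
proof -
  have "\<exists>e. orbit d A [:c:] k = [:e:]"
  proof (induction k)
    case (Suc k)
    then obtain e where e: "orbit d A [:c:] k = [:e:]" by blast
    have "A i * [:e:] ^ (d - i) = [:coeff (A i) 0 * e ^ (d - i):]" if i: "i \<in> {1..d}" for i
    proof -
      obtain u where "A i = [:u:]" using assms[OF i] by (rule degree_eq_zeroE)
      then show ?thesis by (simp add: poly_const_pow mult.commute)
    qed
    then have "(\<Sum>i=1..d. A i * [:e:] ^ (d - i)) = [:\<Sum>i=1..d. coeff (A i) 0 * e ^ (d - i):]"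
      by (simp add: sum_to_poly)
    then show ?case unfolding orbit.simps e by (simp add: poly_const_pow)
  qed simp
  then show ?thesis by auto
qed

context padic
begin

lemma poly_le_power:
  assumes "\<And>j. w (coeff q j) \<le> 1" "degree q \<le> n" shows "w (poly q t) \<le> max 1 (w t) ^ n"
  unfolding poly_altdef
proof (rule sum_le)
  fix j assume j: "j \<in> {..degree q}"
  have "w (coeff q j) * w t ^ j \<le> 1 * max 1 (w t) ^ j"
    using assms(1) nonneg by (intro mult_mono power_mono) auto
  also have "\<dots> \<le> max 1 (w t) ^ n" using j assms(2) by (simp add: power_increasing)
  finally show "w (coeff q j * t ^ j) \<le> max 1 (w t) ^ n" by (simp add: mult power)
qed auto

lemma poly_abs:
  assumes q: "\<And>j. w (coeff q j) \<le> 1" "w (lead_coeff q) = 1" and t: "w t > 1"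
  shows "w (poly q t) = w t ^ degree q"
proof (cases "degree q = 0")
  case True
  then obtain c where "q = [:c:]" by (rule degree_eq_zeroE)
  then show ?thesis using q(2) by simp
next
  case False
  have "w (\<Sum>j<degree q. coeff q j * t ^ j) \<le> w t ^ (degree q - 1)"
  proof (rule sum_le)
    fix j assume j: "j \<in> {..<degree q}"
    have "w (coeff q j) * w t ^ j \<le> 1 * w t ^ (degree q - 1)"
      using q(1) j t by (intro mult_mono power_increasing) auto
    then show "w (coeff q j * t ^ j) \<le> w t ^ (degree q - 1)" by (simp add: mult power)
  qed (use t in auto)
  also have "\<dots> < w t ^ degree q" using False t by (intro power_strict_increasing) auto
  also have "\<dots> = w (lead_coeff q * t ^ degree q)" by (simp add: mult power q(2))
  finally have "w ((\<Sum>j<degree q. coeff q j * t ^ j) + lead_coeff q * t ^ degree q) = w (lead_coeff q * t ^ degree q)"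
    by (intro add_eq_right) auto
  then show ?thesis by (simp add: poly_altdef lessThan_Suc_atMost[symmetric] mult power q(2))
qed

lemma padic_orbit_poly:
  assumes d: "d \<ge> 2" and A: "\<And>i. i \<in> {1..d} \<Longrightarrow> degree (A i) < i"
    and integral: "\<And>i j. i \<in> {1..d} \<Longrightarrow> w (coeff (A i) j) \<le> 1"
  shows "padic_orbit w p d (max 1 (w t)) (\<lambda>i. poly (A i) t)"
proof (unfold_locales)
  fix i assume i: "i \<in> {1..d}"
  show "w (poly (A i) t) \<le> max 1 (w t) ^ (i - 1)"
    using A[OF i] integral[OF i] by (intro poly_le_power) auto
qed (use d in auto)

text \<open>If all iterates of \<open>b\<close> were constant, infinitely many numbers would be mapped to constants,
  so \<open>f\<close> itself would not depend on \<open>t\<close>.\<close>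

lemma orbit_nonconstant:
  assumes d: "d \<ge> 2" and A: "\<And>i. i \<in> {1..d} \<Longrightarrow> degree (A i) < i"
    and integral: "\<And>i j. i \<in> {1..d} \<Longrightarrow> w (coeff (A i) j) \<le> 1" and b: "w b > 1"
    and i: "i \<in> {1..d}" "degree (A i) \<noteq> 0"
  obtains k where "degree (orbit d A [:b:] k) \<ge> 1"
proof (rule ccontr)
  assume "\<not> thesis"
  then have deg: "degree (orbit d A [:b:] k) = 0" for k using that[of k] by (cases "degree (orbit d A [:b:] k)") auto
  define c where "c k = coeff (orbit d A [:b:] k) 0" for k
  have c: "orbit d A [:b:] k = [:c k:]" for k
    using degree_eq_zeroE[OF deg[of k]] unfolding c_def by (metis coeff_pCons_0)
  interpret padic_orbit w p d "max 1 (w 0)" "\<lambda>i. poly (A i) 0" using d A integral by (rule padic_orbit_poly)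
  have "poly [:c k:] 0 = orbit d (\<lambda>i. poly (A i) 0) b k" for k unfolding c[symmetric] by (rule poly_orbit)
  then have "w (c k) = w b ^ d ^ k" for k using orbit_abs[of b k] b by (simp add: zero)
  moreover have "w b ^ d ^ k < w b ^ d ^ l" if "k < l" for k l
    using b d that by (intro power_strict_increasing) auto
  ultimately have "c k \<noteq> c l" if "k < l" for k l using that by (metis less_irrefl)
  then have inj: "inj c" by (metis injI linorder_neqE_nat)
  define j where "j = degree (A i)"
  define F where "F = (\<Sum>i=1..d. monom (coeff (A i) j) (d - i))"
  have root: "poly F (c k) = 0" for k
  proof -
    have e: "[:c (Suc k):] = [:c k:] ^ d + (\<Sum>i=1..d. A i * [:c k:] ^ (d - i))"
      using c[of "Suc k"] c[of k] by simp
    have "coeff [:c (Suc k):] j = 0" "coeff ([:c k:] ^ d) j = 0"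
      using i by (auto simp: j_def coeff_pCons poly_const_pow split: nat.splits)
    then have "(\<Sum>i=1..d. coeff (A i * [:c k:] ^ (d - i)) j) = 0"
      using arg_cong[OF e, of "\<lambda>q. coeff q j"] by (simp add: coeff_sum)
    then show ?thesis by (simp add: F_def poly_sum poly_monom poly_const_pow mult.commute)
  qed
  have "F = 0"
  proof (rule ccontr)
    assume "F \<noteq> 0"
    then have "finite {x. poly F x = 0}" by (rule poly_roots_finite)
    then have "finite (range c)" by (rule finite_subset[rotated]) (use root in auto)
    then show False using finite_imageD[OF _ inj] by simp
  qed
  then have "0 = coeff F (d - i)" by simp
  also have "\<dots> = (\<Sum>i'=1..d. if i' = i then coeff (A i') j else 0)"
    unfolding F_def coeff_sum using i by (intro sum.cong) auto
  also have "\<dots> = coeff (A i) j" using i by simp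
  finally have "A i = 0" by (simp add: j_def)
  then show False using i by simp
qed

text \<open>If \<open>f\<^sup>m(a) = f\<^sup>n(b)\<close> at \<open>t\<close>, then \<open>w t > 1\<close>, so the orbit of \<open>a\<close> escapes from the time
  \<open>m\<^sub>0\<close> on. Hence the orbits of \<open>f\<^sup>m\<^sup>-\<^sup>k(a)\<close> and \<open>f\<^sup>n\<^sup>-\<^sup>k(b)\<close>, where \<open>k = min n (m - m\<^sub>0)\<close>, meet and start
  at points of equal absolute value.\<close>

lemma coincidence_degree:
  assumes d: "primepow d" and A: "\<And>i. i \<in> {1..d} \<Longrightarrow> degree (A i) < i"
    and integral: "\<And>i j. i \<in> {1..d} \<Longrightarrow> w (coeff (A i) j) \<le> 1"
    and a: "w a \<le> 1" and b: "w b > 1"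
    and m\<^sub>0: "degree (orbit d A [:a:] m\<^sub>0) \<ge> 1" "w (lead_coeff (orbit d A [:a:] m\<^sub>0)) = 1"
      "\<And>j. w (coeff (orbit d A [:a:] m\<^sub>0) j) \<le> 1"
  obtains C :: nat where "C \<ge> 1"
    "\<And>t m n. poly (orbit d A [:a:] m) t = poly (orbit d A [:b:] n) t \<Longrightarrow>
       (\<And>m' n'. m' < m \<Longrightarrow> poly (orbit d A [:a:] m') t \<noteq> poly (orbit d A [:b:] n') t) \<Longrightarrow>
       d ^ min n (m - m\<^sub>0) \<le> C * field_degree (field_gen t)"
proof -
  have d2: "d \<ge> 2" using primepow_gt_Suc_0[OF d] by simp
  obtain C :: nat where C: "C \<ge> 1" "\<And>T \<alpha> x\<^sub>0 y\<^sub>0 K V E M. meeting_orbits w p d T \<alpha> x\<^sub>0 y\<^sub>0 K V E M \<Longrightarrow> w b \<le> M \<Longrightarrow>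
     d ^ K \<le> C * card E" using meeting_orbits_degree[OF d b] by blast
  define Z where "Z = insert a (insert b (\<Union>i\<in>{1..d}. set (coeffs (A i))))"
  have "finite Z" by (auto simp: Z_def)
  then obtain V\<^sub>0 where V\<^sub>0: "fin_dim_ring V\<^sub>0" "Z \<subseteq> V\<^sub>0" by (rule finite_subset_fin_dim_ring)
  then obtain E\<^sub>0 where E\<^sub>0: "finite E\<^sub>0" "V\<^sub>0 = Q.span E\<^sub>0" by (auto simp: fin_dim_ring_def)
  have A_V\<^sub>0: "coeffs_in V\<^sub>0 (A i)" if "i \<in> {1..d}" for i
  proof -
    have "coeff (A i) j \<in> V\<^sub>0" for j
    proof (cases "coeff (A i) j = 0")
      case True
      then show ?thesis using subfield_0[OF fin_dim_ring_subfield[OF V\<^sub>0(1)]] by simp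
    next
      case False
      then have "coeff (A i) j \<in> set (coeffs (A i))" using coeff_in_coeffs[of "A i" j] le_degree[OF False] by fastforce
      then have "coeff (A i) j \<in> Z" using that unfolding Z_def by blast
      then show ?thesis using V\<^sub>0(2) by blast
    qed
    then show ?thesis by (simp add: coeffs_in_def)
  qed
  show ?thesis
  proof (rule that[of "C * (card E\<^sub>0 + 1) * d"])
    show "C * (card E\<^sub>0 + 1) * d \<ge> 1" using C d2 by simp
    fix t m n
    assume "poly (orbit d A [:a:] m) t = poly (orbit d A [:b:] n) t"
      and "\<And>m' n'. m' < m \<Longrightarrow> poly (orbit d A [:a:] m') t \<noteq> poly (orbit d A [:b:] n') t"
    moreover define \<alpha> where "\<alpha> = (\<lambda>i. poly (A i) t)"
    ultimately have eq: "orbit d \<alpha> a m = orbit d \<alpha> b n"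
      and minimal: "\<And>m' n'. m' < m \<Longrightarrow> orbit d \<alpha> a m' \<noteq> orbit d \<alpha> b n'" by (auto simp: poly_orbit)
    define T where "T = max 1 (w t)"
    interpret padic_orbit w p d T \<alpha> unfolding \<alpha>_def T_def using d2 A integral by (rule padic_orbit_poly)
    have t: "w t > 1"
    proof (rule ccontr)
      assume "\<not> ?thesis"
      then have T1: "T = 1" by (simp add: T_def)
      have "w (orbit d \<alpha> a m) \<le> 1"
      proof (induction m)
        case (Suc m)
        have "w (\<alpha> i) \<le> 1" if "i \<in> {1..d}" for i using w_\<alpha>[OF that] by (simp add: T1)
        then show ?case unfolding orbit.simps using Suc by (intro add_le_1 sum_le mult_le_1 power_le_1) auto
      qed (simp add: a)
      moreover have "w (orbit d \<alpha> b n) > 1" using orbit_abs[of b n] b d2 by (simp add: T1 one_less_power)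
      ultimately show False using eq by simp
    qed
    then have T: "T = w t" "T > 1" by (auto simp: T_def)
    define K where "K = min n (m - m\<^sub>0)"
    obtain B where B: "finite B" "Q.independent B" "Q.span B = field_gen t" "card B = field_degree (field_gen t)"
      by (rule field_gen_basis)
    define E where "E = {x * y |x y. x \<in> E\<^sub>0 \<and> y \<in> B}"
    define V where "V = Q.span E"
    note comp = compositum_span[OF fin_dim_ring_subfield[OF V\<^sub>0(1)] field_gen_subfield E\<^sub>0(2)[symmetric] B(3) E\<^sub>0(1) B(1),
      folded E_def]
    have V: "fin_dim_ring V" "V = Q.span E" "finite E" "V\<^sub>0 \<subseteq> V" "t \<in> V"
      using comp(1,2,4) subsetD[OF comp(3) field_gen_mem] by (auto simp: V_def)
    have cardE: "card E \<le> card E\<^sub>0 * field_degree (field_gen t)" using comp(5) B(4) by simp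
    note V_subfield = fin_dim_ring_subfield[OF V(1)]
    have \<alpha>_V: "\<alpha> i \<in> V" if "i \<in> {1..d}" for i
      unfolding \<alpha>_def using A_V\<^sub>0[OF that] V(4,5) by (intro subfield_poly[OF V_subfield]) (auto simp: coeffs_in_def)
    have ab_V: "a \<in> V" "b \<in> V" using V\<^sub>0(2) V(4) by (auto simp: Z_def)
    show "d ^ min n (m - m\<^sub>0) \<le> C * (card E\<^sub>0 + 1) * d * field_degree (field_gen t)"
    proof (cases K)
      case 0
      then have "d ^ min n (m - m\<^sub>0) = 1" by (simp add: K_def)
      also have "1 \<le> C * (card E\<^sub>0 + 1) * d * field_degree (field_gen t)"
        using C(1) d2 field_degree_pos[of t] by (simp add: Suc_le_eq)
      finally show ?thesis .
    next
      case (Suc K')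
      define x\<^sub>0 y\<^sub>0 where "x\<^sub>0 = orbit d \<alpha> a (m - K)" and "y\<^sub>0 = orbit d \<alpha> b (n - K)"
      have K: "K \<le> n" "K \<le> m - m\<^sub>0" "m - K \<ge> m\<^sub>0" "K \<le> m" using Suc by (auto simp: K_def)
      have orb: "orbit d \<alpha> x\<^sub>0 k = orbit d \<alpha> a (m - K + k)" "orbit d \<alpha> y\<^sub>0 k = orbit d \<alpha> b (n - K + k)" for k
        by (simp_all add: x\<^sub>0_def y\<^sub>0_def orbit_add)
      have am\<^sub>0: "w (orbit d \<alpha> a m\<^sub>0) = w t ^ degree (orbit d A [:a:] m\<^sub>0)"
        using poly_abs[OF m\<^sub>0(3,2) t] by (simp add: poly_orbit \<alpha>_def)
      have "w t ^ 1 \<le> w (orbit d \<alpha> a m\<^sub>0)" unfolding am\<^sub>0 using t m\<^sub>0(1) by (intro power_increasing) auto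
      then have am\<^sub>0': "T \<le> w (orbit d \<alpha> a m\<^sub>0)" "1 < w (orbit d \<alpha> a m\<^sub>0)" using T by auto
      have "w x\<^sub>0 = w (orbit d \<alpha> a m\<^sub>0) ^ d ^ (m - K - m\<^sub>0)"
        unfolding x\<^sub>0_def using orbit_abs[OF am\<^sub>0', of "m - K - m\<^sub>0"] K(3)
        by (metis le_add_diff_inverse orbit_add)
      moreover have "w (orbit d \<alpha> a m\<^sub>0) ^ 1 \<le> w (orbit d \<alpha> a m\<^sub>0) ^ d ^ (m - K - m\<^sub>0)"
        using am\<^sub>0' d2 by (intro power_increasing) auto
      ultimately have x\<^sub>0: "T \<le> w x\<^sub>0" "1 < w x\<^sub>0" using am\<^sub>0' by auto
      have meet: "orbit d \<alpha> x\<^sub>0 K = orbit d \<alpha> y\<^sub>0 K" using eq K by (simp add: orb)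
      have dK: "d ^ K > 0" using d2 by simp
      have y\<^sub>0: "w y\<^sub>0 = w x\<^sub>0"
      proof (rule ccontr)
        assume "w y\<^sub>0 \<noteq> w x\<^sub>0"
        then consider "w y\<^sub>0 < w x\<^sub>0" | "w x\<^sub>0 < w y\<^sub>0" by linarith
        then show False
        proof cases
          case 1
          then have "w (orbit d \<alpha> y\<^sub>0 K) < w x\<^sub>0 ^ d ^ K" using x\<^sub>0 by (intro orbit_less) auto
          then show False using orbit_abs[OF x\<^sub>0, of K] meet by simp
        next
          case 2
          then have "w (orbit d \<alpha> y\<^sub>0 K) = w y\<^sub>0 ^ d ^ K" using x\<^sub>0 by (intro orbit_abs) auto
          moreover have "w x\<^sub>0 ^ d ^ K < w y\<^sub>0 ^ d ^ K" using 2 dK nonneg[of x\<^sub>0] by (intro power_strict_mono) auto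
          ultimately show False using orbit_abs[OF x\<^sub>0, of K] meet by simp
        qed
      qed
      have "w b \<le> w x\<^sub>0"
      proof (cases "w b \<le> T")
        case False
        then have "w y\<^sub>0 = w b ^ d ^ (n - K)" unfolding y\<^sub>0_def using b by (intro orbit_abs) auto
        moreover have "w b ^ 1 \<le> w b ^ d ^ (n - K)" using b d2 by (intro power_increasing) auto
        ultimately show ?thesis using y\<^sub>0 by simp
      qed (use x\<^sub>0 in simp)
      moreover have "meeting_orbits w p d T \<alpha> x\<^sub>0 y\<^sub>0 K' V E (w x\<^sub>0)"
      proof (unfold_locales)
        show "w x\<^sub>0 = w x\<^sub>0" "w y\<^sub>0 = w x\<^sub>0" "T \<le> w x\<^sub>0" "1 < w x\<^sub>0" by (rule refl y\<^sub>0 x\<^sub>0)+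
        show "fin_dim_ring V" "V = Q.span E" "finite E" by (rule V)+
        show "x\<^sub>0 \<in> V" "y\<^sub>0 \<in> V"
          unfolding x\<^sub>0_def y\<^sub>0_def using V_subfield ab_V \<alpha>_V by (auto intro!: orbit_in_subfield)
        show "\<alpha> i \<in> V" if "i \<in> {1..d}" for i using that by (rule \<alpha>_V)
        show "orbit d \<alpha> x\<^sub>0 (Suc K') = orbit d \<alpha> y\<^sub>0 (Suc K')" using meet unfolding Suc .
        show "orbit d \<alpha> x\<^sub>0 K' \<noteq> orbit d \<alpha> y\<^sub>0 K'" unfolding orb using Suc K by (intro minimal) auto
      qed
      ultimately have "d ^ K' \<le> C * card E" using C(2) by blast
      also have "\<dots> \<le> C * ((card E\<^sub>0 + 1) * field_degree (field_gen t))" using cardE by (intro mult_left_mono) auto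
      finally have "d * d ^ K' \<le> d * (C * ((card E\<^sub>0 + 1) * field_degree (field_gen t)))" by (intro mult_left_mono) auto
      moreover have "d ^ min n (m - m\<^sub>0) = d * d ^ K'" using Suc by (simp add: K_def)
      moreover have "d * (C * ((card E\<^sub>0 + 1) * field_degree (field_gen t))) =
          C * (card E\<^sub>0 + 1) * d * field_degree (field_gen t)" by (simp only: mult_ac)
      ultimately show ?thesis by (simp only:)
    qed
  qed
qed

text \<open>The coincidence with the least \<open>m\<close> has bounded height by \<open>fast_orbit_height\<close>, applied to either orbit as
  the faster one, or else \<open>m\<close> and \<open>n\<close> differ by a bounded amount and the upper and lower bounds of order
  \<open>d ^ max m n\<close> can be compared.\<close>

theorem coincidences_bounded_height:
  assumes d: "primepow d" and A: "\<And>i. i \<in> {1..d} \<Longrightarrow> degree (A i) < i"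
    and integral: "\<And>i j. i \<in> {1..d} \<Longrightarrow> w (coeff (A i) j) \<le> 1"
    and a: "w a \<le> 1" and b: "w b > 1"
    and m\<^sub>0: "degree (orbit d A [:a:] m\<^sub>0) \<ge> 1" "w (lead_coeff (orbit d A [:a:] m\<^sub>0)) = 1"
      "\<And>j. w (coeff (orbit d A [:a:] m\<^sub>0) j) \<le> 1"
  shows "bounded_height {t. \<exists>m n. poly (orbit d A [:a:] m) t = poly (orbit d A [:b:] n) t}"
proof -
  have d2: "d \<ge> 2" using primepow_gt_Suc_0[OF d] by simp
  have "\<exists>i\<in>{1..d}. degree (A i) \<noteq> 0"
  proof (rule ccontr)
    assume "\<not> ?thesis"
    then have "degree (orbit d A [:a:] m\<^sub>0) = 0" by (intro orbit_constant) auto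
    then show False using m\<^sub>0(1) by simp
  qed
  then obtain k\<^sub>0 where k\<^sub>0: "degree (orbit d A [:b:] k\<^sub>0) \<ge> 1"
    using orbit_nonconstant[where A = A, OF d2 _ _ b] A integral by metis
  obtain N\<^sub>1 B\<^sub>1 where fast_a: "\<And>m n t. m \<ge> n + N\<^sub>1 \<Longrightarrow> poly (orbit d A [:a:] m) t = poly (orbit d A [:b:] n) t \<Longrightarrow>
     weil_height t \<le> B\<^sub>1" using fast_orbit_height[where A = A and c = a and c' = b, OF d2 A m\<^sub>0(1)] by blast
  obtain N\<^sub>2 B\<^sub>2 where fast_b: "\<And>m n t. m \<ge> n + N\<^sub>2 \<Longrightarrow> poly (orbit d A [:b:] m) t = poly (orbit d A [:a:] n) t \<Longrightarrow>
     weil_height t \<le> B\<^sub>2" using fast_orbit_height[where A = A and c = b and c' = a, OF d2 A k\<^sub>0] by blast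
  obtain C\<^sub>1 where C\<^sub>1: "C\<^sub>1 \<ge> 0" "\<And>m n t. orbit d A [:a:] m \<noteq> orbit d A [:b:] n \<Longrightarrow>
     poly (orbit d A [:a:] m) t = poly (orbit d A [:b:] n) t \<Longrightarrow>
     weil_height t * real (field_degree (field_gen t)) \<le> C\<^sub>1 * real d ^ max m n"
    using orbit_coincidence_height[where A = A and a = a and b = b, OF d2 A] by blast
  obtain C\<^sub>2 :: nat where C\<^sub>2: "C\<^sub>2 \<ge> 1"
    "\<And>t m n. poly (orbit d A [:a:] m) t = poly (orbit d A [:b:] n) t \<Longrightarrow>
       (\<And>m' n'. m' < m \<Longrightarrow> poly (orbit d A [:a:] m') t \<noteq> poly (orbit d A [:b:] n') t) \<Longrightarrow>
       d ^ min n (m - m\<^sub>0) \<le> C\<^sub>2 * field_degree (field_gen t)"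
    using coincidence_degree[where A = A and a = a and b = b, OF d A integral a b m\<^sub>0] by blast
  \<comment> \<open>At \<open>t = 0\<close> the orbit of \<open>a\<close> is integral and that of
    \<open>b\<close> is not.\<close>
  have ne: "orbit d A [:a:] m \<noteq> orbit d A [:b:] n" for m n
  proof
    interpret padic_orbit w p d "max 1 (w 0)" "\<lambda>i. poly (A i) 0" using d2 A integral by (rule padic_orbit_poly)
    assume "orbit d A [:a:] m = orbit d A [:b:] n"
    then have e: "orbit d (\<lambda>i. poly (A i) 0) a m = orbit d (\<lambda>i. poly (A i) 0) b n" by (simp only: poly_orbit[symmetric])
    have "w (orbit d (\<lambda>i. poly (A i) 0) a m) \<le> 1"
    proof (induction m)
      case (Suc m)
      have "w (poly (A i) 0) \<le> 1" if "i \<in> {1..d}" for i using integral[OF that] zero by (intro poly_le_1) auto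
      then show ?case unfolding orbit.simps using Suc by (intro add_le_1 sum_le mult_le_1 power_le_1) auto
    qed (simp add: a)
    moreover have "w (orbit d (\<lambda>i. poly (A i) 0) b n) > 1" using orbit_abs[of b n] b d2 by (simp add: zero one_less_power)
    ultimately show False using e by simp
  qed
  define N where "N = N\<^sub>1 + N\<^sub>2"
  define B where "B = max B\<^sub>1 (max B\<^sub>2 (C\<^sub>1 * real d ^ (m\<^sub>0 + N) * real C\<^sub>2))"
  have "weil_height t \<le> B" if "poly (orbit d A [:a:] m\<^sub>1) t = poly (orbit d A [:b:] n\<^sub>1) t" for t m\<^sub>1 n\<^sub>1
  proof -
    define m where "m = (LEAST m. \<exists>n. poly (orbit d A [:a:] m) t = poly (orbit d A [:b:] n) t)"
    have "\<exists>n. poly (orbit d A [:a:] m) t = poly (orbit d A [:b:] n) t"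
      unfolding m_def by (rule LeastI[of _ m\<^sub>1]) (use that in blast)
    then obtain n where eq: "poly (orbit d A [:a:] m) t = poly (orbit d A [:b:] n) t" by blast
    have minimal: "poly (orbit d A [:a:] m') t \<noteq> poly (orbit d A [:b:] n') t" if "m' < m" for m' n'
      using not_less_Least[OF that[unfolded m_def]] by blast
    consider "m \<ge> n + N\<^sub>1" | "n \<ge> m + N\<^sub>2" | "m < n + N\<^sub>1" "n < m + N\<^sub>2" by linarith
    then show ?thesis
    proof cases
      case 1
      then show ?thesis using fast_a[OF _ eq] by (simp add: B_def)
    next
      case 2
      then show ?thesis using fast_b[OF _ eq[symmetric]] by (simp add: B_def)
    next
      case 3
      let ?D = "real (field_degree (field_gen t))"
      have D: "?D > 0" using field_degree_pos[of t] by simp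
      have "max m n \<le> min n (m - m\<^sub>0) + (m\<^sub>0 + N)" using 3 by (auto simp: N_def)
      then have "real d ^ max m n \<le> real d ^ (min n (m - m\<^sub>0) + (m\<^sub>0 + N))" using d2 by (intro power_increasing) auto
      also have "\<dots> = real d ^ (m\<^sub>0 + N) * real (d ^ min n (m - m\<^sub>0))" by (simp add: power_add)
      also have "\<dots> \<le> real d ^ (m\<^sub>0 + N) * real (C\<^sub>2 * field_degree (field_gen t))"
        using C\<^sub>2(2)[OF eq minimal] by (intro mult_left_mono) (auto simp del: of_nat_mult of_nat_power)
      finally have "C\<^sub>1 * real d ^ max m n \<le> C\<^sub>1 * (real d ^ (m\<^sub>0 + N) * real (C\<^sub>2 * field_degree (field_gen t)))"
        using C\<^sub>1(1) by (intro mult_left_mono)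
      then have "weil_height t * ?D \<le> (C\<^sub>1 * real d ^ (m\<^sub>0 + N) * real C\<^sub>2) * ?D"
        using C\<^sub>1(2)[OF ne eq] by (simp add: mult_ac)
      then have "weil_height t \<le> C\<^sub>1 * real d ^ (m\<^sub>0 + N) * real C\<^sub>2" using D by simp
      then show ?thesis by (simp add: B_def)
    qed
  qed
  then show ?thesis unfolding bounded_height_def by blast
qed

end

lemma embedding_of_nat:
  fixes \<iota> :: "'a::field \<Rightarrow> 'b::field"
  shows "field_embedding_on UNIV \<iota> \<Longrightarrow> \<iota> (of_nat n) = of_nat n"
proof (induction n)
  case 0
  then have "\<iota> (0 + 0) = \<iota> 0 + \<iota> 0" unfolding field_embedding_on_def by blast
  then have "\<iota> 0 + \<iota> 0 = \<iota> 0 + 0" by (simp only: add_0_right)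
  then have "\<iota> 0 = 0" by (rule add_left_imp_eq)
  then show ?case by simp
next
  case (Suc n)
  then show ?case by (simp add: field_embedding_on_def)
qed

theorem theorem7p1:
  fixes d :: nat and A :: "nat \<Rightarrow> qbar poly" and f g :: "qbar poly poly" and a b :: qbar
    and p :: nat and v :: "'c::field_char_0 \<Rightarrow> real" and \<iota> :: "qbar \<Rightarrow> 'c"
    and S :: "qbar set"
  assumes "d \<ge> 2"
    and "f = monom 1 d + (\<Sum>i=1..d. monom (A i) (d - i))"
    and "g = f"
    and "primepow d"
    and "prime p" and "is_Cp p v" and "field_embedding_on UNIV \<iota>"
    and "\<forall>i\<in>{1..d}. coeffs_in (Zp_bar v) (map_poly \<iota> (A i)) \<and> degree (A i) < i"
    and "\<iota> a \<in> Zp_bar v" and "\<iota> b \<notin> Zp_bar v"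
    and "\<exists>m\<ge>1. coeffs_in (Zp_bar v) (map_poly \<iota> (iterate_at f m a)) \<and>
           degree (iterate_at f m a) > 0 \<and>
           (\<exists>u\<in>Zp_bar v. \<iota> (lead_coeff (iterate_at f m a)) * u = 1)"
    and "S = {t\<^sub>0. \<exists>m n. poly (poly_iterate (specialize f t\<^sub>0) m) a =
                        poly (poly_iterate (specialize g t\<^sub>0) n) b}"
  shows "(isotrivial (ratfun_of_poly f) (Affine (const_t a)) \<or>
          isotrivial (ratfun_of_poly g) (Affine (const_t b))) \<or>
         (\<exists>m n. iterate_at f m a = iterate_at g n b) \<or>
         bounded_height S"
proof -
  have v: "nonarch_abs_on UNIV v" "v (of_nat p) = 1 / real p" "complete_wrt v"
    using assms(6) by (auto simp: is_Cp_def)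
  interpret v: complete_padic v p by unfold_locales (use v assms(5) in auto)
  have \<iota>: "\<iota> 1 = 1" "\<iota> (x + y) = \<iota> x + \<iota> y" "\<iota> (x * y) = \<iota> x * \<iota> y" for x y
    using assms(7) by (auto simp: field_embedding_on_def)
  have \<iota>0: "\<iota> 0 = 0" using embedding_of_nat[OF assms(7), of 0] by simp
  have \<iota>_eq_0: "\<iota> x = 0 \<longleftrightarrow> x = 0" for x
  proof
    assume "\<iota> x = 0"
    then have "\<iota> (x * inverse x) = 0" by (simp add: \<iota>)
    then show "x = 0" using \<iota>(1) by (cases "x = 0") auto
  qed (simp add: \<iota>0)
  define w where "w x = v (\<iota> x)" for x
  interpret w: padic w p
  proof (unfold_locales)
    show "nonarch_abs_on UNIV w" unfolding nonarch_abs_on_def w_def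
      using v.nonneg v.eq_0_iff v.mult v.add_le by (simp add: \<iota> \<iota>_eq_0)
    show "w (of_nat p) = 1 / real p" by (simp add: w_def embedding_of_nat[OF assms(7)] v)
  qed (use assms(5) in auto)
  have coeffs: "w (coeff q j) \<le> 1" if "coeffs_in (Zp_bar v) (map_poly \<iota> q)" for q j
    using that v.Zp_bar_le_1 by (auto simp: coeffs_in_def coeff_map_poly \<iota>0 w_def)
  have a: "w a \<le> 1" using v.Zp_bar_le_1[OF assms(9)] by (simp add: w_def)
  \<comment> \<open>\<open>\<iota> b\<close> is algebraic, so it would be integral over
    \<open>\<int>\<^sub>p\<close> if its absolute value were at most \<open>1\<close>.\<close>
  have b: "w b > 1"
  proof (rule ccontr)
    assume "\<not> ?thesis"
    then have "v (\<iota> b) \<le> 1" by (simp add: w_def)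
    moreover have "\<iota> b \<in> Qp_bar v"
    proof -
      obtain P :: "int poly" where P: "P \<noteq> 0" "poly (map_poly of_int P) b = 0" by (rule qbar_root_of_int_poly)
      have "\<iota> (of_int n) = of_int n" for n
      proof -
        have "\<iota> (of_int n) + \<iota> (of_nat k) = of_int n + of_nat k" if "n + int k = int l" for k l
          using arg_cong[OF that, of "\<lambda>z. \<iota> (of_int z)"] arg_cong[OF that, of "\<lambda>z. of_int z :: 'c"]
          by (simp add: \<iota> embedding_of_nat[OF assms(7)])
        from this[of "nat (- n)" "nat n"] show ?thesis by (simp add: embedding_of_nat[OF assms(7)])
      qed
      then have "\<iota> (poly (map_poly of_int q) b) = poly (map_poly of_int q) (\<iota> b)" for q
        by (induction q) (simp_all add: \<iota> \<iota>0 map_poly_pCons)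
      then have "poly (map_poly of_int P) (\<iota> b) = 0" using P(2) \<iota>0 by metis
      moreover have "map_poly of_int P \<noteq> (0 :: 'c poly)" using P(1) by (simp add: map_poly_eq_0_iff)
      moreover have "coeffs_in (Qp v) (map_poly of_int P)"
        using v.of_rat_in_Qp[of "of_int _"] by (auto simp: coeffs_in_def coeff_map_poly)
      ultimately show ?thesis by (auto simp: Qp_bar_def)
    qed
    ultimately show False using v.Zp_bar_if_le_1 assms(10) by blast
  qed
  note orbits = iterate_at_eq_orbit[OF assms(2)] iterate_specialize_eq_orbit[OF assms(2)]
  obtain m\<^sub>0 where m\<^sub>0: "coeffs_in (Zp_bar v) (map_poly \<iota> (orbit d A [:a:] m\<^sub>0))"
      "degree (orbit d A [:a:] m\<^sub>0) > 0" "\<exists>u\<in>Zp_bar v. \<iota> (lead_coeff (orbit d A [:a:] m\<^sub>0)) * u = 1"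
    using assms(11) unfolding orbits by blast
  have unit: "w (lead_coeff (orbit d A [:a:] m\<^sub>0)) = 1"
  proof -
    let ?l = "lead_coeff (orbit d A [:a:] m\<^sub>0)"
    obtain u where u: "u \<in> Zp_bar v" "\<iota> ?l * u = 1" using m\<^sub>0(3) by blast
    have "w ?l * v u = 1" using v.mult[of "\<iota> ?l" u] u(2) v.one by (simp add: w_def)
    moreover have "w ?l * v u \<le> w ?l * 1" using v.Zp_bar_le_1[OF u(1)] w.nonneg by (intro mult_left_mono) auto
    ultimately show ?thesis using coeffs[OF m\<^sub>0(1), of "degree (orbit d A [:a:] m\<^sub>0)"] by simp
  qed
  have "bounded_height {t. \<exists>m n. poly (orbit d A [:a:] m) t = poly (orbit d A [:b:] n) t}"
    using assms(4,8) a b m\<^sub>0(2) unit coeffs coeffs[OF m\<^sub>0(1)]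
    by (intro w.coincidences_bounded_height[where m\<^sub>0 = m\<^sub>0]) (auto simp: Suc_le_eq)
  then have "bounded_height S" unfolding assms(12,3) orbits poly_orbit .
  then show ?thesis by blast
qed

end
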